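(* Let $n\ge3$ and let $g_0$ be the round metric on $S^n$. Consider the compact smooth metric measure space $(S^n,g_0,1^{1/2}d\mathrm{vol})$, i.e. $m=\tfrac12$ and $v\equiv1$ (so $\phi=0$). Then there is no positive $w\in C^\infty(S^n)$ with $\mathcal{Q}[g_0,1^{1/2}d\mathrm{vol}](w)=\Lambda[g_0,1^{1/2}d\mathrm{vol}]$.
   Context: For a compact Riemannian manifold $(M^n,g)$, $m\in[0,\infty)$ and positive $v\in C^\infty(M)$, write $\phi=-m\log v$; integrals are with respect to $v^m d\mathrm{vol}_g$. Let $\Delta_\phi w=\Delta w-\langle\nabla\phi,\nabla w\rangle$, $R^m_\phi=R+2\Delta\phi-\frac{m+1}{m}|\nabla\phi|^2$, $L^m_\phi=-\Delta_\phi+\frac{m+n-2}{4(m+n-1)}R^m_\phi$, $(L^m_\phi w,w)=\int wL^m_\phi w$. The weighted Yamabe quotient is \[ \mathcal{Q}[g,v^m d\mathrm{vol}](w)=\frac{(L^m_\phi w,w)\left(\int |w|^{\frac{2(m+n-1)}{m+n-2}}v^{-1}\right)^{\frac{2m}{n}}}{\left(\int |w|^{\frac{2(m+n)}{m+n-2}}\right)^{\frac{2m+n-2}{n}}}, \] and $\Lambda[g,v^m d\mathrm{vol}]=\inf\{\mathcal{Q}(w):0\ne w\in W^{1,2}(M)\}$. *)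

theory Defs
  imports "HOL-Analysis.Analysis"
begin

text \<open>Concrete model of the round sphere S^n inside R^(n+1) = 'a, where
  n = DIM('a) - 1.  A function on S^n is a function w :: 'a => real of which only
  the values on sphere 0 1 matter.\<close>

definition hext :: "('a::euclidean_space \<Rightarrow> real) \<Rightarrow> 'a \<Rightarrow> real" where
  "hext w x = w (x /\<^sub>R norm x)"

text \<open>Integral over S^n with respect to the Riemannian volume of the round metric,
  via the cone formula: the integral of f(x/|x|) over the unit ball equals
  (1/(n+1)) times the integral of f over S^n.\<close>
definition sph_int :: "('a::euclidean_space \<Rightarrow> real) \<Rightarrow> real" where
  "sph_int f = real DIM('a) * (LINT x:ball 0 1|lborel. f (x /\<^sub>R norm x))"

primrec Ck_on :: "nat \<Rightarrow> ('a::euclidean_space \<Rightarrow> real) \<Rightarrow> 'a set \<Rightarrow> bool" where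
  "Ck_on 0 f U = continuous_on U f"
| "Ck_on (Suc k) f U = (continuous_on U f \<and> (\<forall>x\<in>U. f differentiable (at x)) \<and>
      (\<forall>v. Ck_on k (\<lambda>x. frechet_derivative f (at x) v) U))"

definition smooth_on :: "('a::euclidean_space \<Rightarrow> real) \<Rightarrow> 'a set \<Rightarrow> bool" where
  "smooth_on f U = (\<forall>k. Ck_on k f U)"

definition sph_smooth :: "('a::euclidean_space \<Rightarrow> real) \<Rightarrow> bool" where
  "sph_smooth w = smooth_on (hext w) (UNIV - {0})"

definition test_fun :: "('a::euclidean_space \<Rightarrow> real) \<Rightarrow> 'a set \<Rightarrow> bool" where
  "test_fun \<phi> U = (smooth_on \<phi> UNIV \<and> compact (closure {x. \<phi> x \<noteq> 0})
                     \<and> closure {x. \<phi> x \<noteq> 0} \<subseteq> U)"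

definition weak_grad_L2 :: "'a set \<Rightarrow> ('a::euclidean_space \<Rightarrow> real) \<Rightarrow> ('a \<Rightarrow> 'a) \<Rightarrow> bool" where
  "weak_grad_L2 U F G = (
     set_borel_measurable lborel U F \<and> set_integrable lborel U (\<lambda>x. (F x)\<^sup>2) \<and>
     set_borel_measurable lborel U G \<and> set_integrable lborel U (\<lambda>x. (norm (G x))\<^sup>2) \<and>
     (\<forall>\<phi>. test_fun \<phi> U \<longrightarrow> (\<forall>i\<in>Basis.
        (LINT x:U|lborel. F x * frechet_derivative \<phi> (at x) i)
          = - (LINT x:U|lborel. (G x \<bullet> i) * \<phi> x))))"

definition punct_ball :: "'a::euclidean_space set" where
  "punct_ball = ball 0 1 - {0}"

text \<open>Sobolev space W^{1,2}(S^n): the 0-homogeneous extension lies in W^{1,2} of the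
  punctured unit ball (equivalent to the intrinsic definition for n >= 2).\<close>
definition sph_W12 :: "('a::euclidean_space \<Rightarrow> real) \<Rightarrow> bool" where
  "sph_W12 w = (\<exists>G. weak_grad_L2 punct_ball (hext w) G)"

text \<open>Dirichlet energy (integral of |grad_g w|^2 over S^n).  If W = hext w, then
  integral over the ball of |grad W|^2 = (1/(n-1)) * integral over S^n of |grad_g w|^2.\<close>
definition sph_dirichlet :: "('a::euclidean_space \<Rightarrow> real) \<Rightarrow> real" where
  "sph_dirichlet w = (let G = (SOME G. weak_grad_L2 punct_ball (hext w) G) in
      (real DIM('a) - 2) * (LINT x:punct_ball|lborel. (norm (G x))\<^sup>2))"

definition round_scal :: "'a::euclidean_space itself \<Rightarrow> real" where
  "round_scal _ = (real DIM('a) - 1) * (real DIM('a) - 2)"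

text \<open>Weighted Yamabe quotient on (S^n, g_0, 1^m dvol): v = 1, phi = 0, so
  R^m_phi = R and (L^m_phi w, w) = int |grad w|^2 + c R int w^2.\<close>
definition sph_Q :: "real \<Rightarrow> ('a::euclidean_space \<Rightarrow> real) \<Rightarrow> real" where
  "sph_Q m w = (let n = real DIM('a) - 1;
                    c = (m + n - 2) / (4 * (m + n - 1));
                    E = sph_dirichlet w + c * round_scal TYPE('a) * sph_int (\<lambda>x. (w x)\<^sup>2)
                in E * (sph_int (\<lambda>x. \<bar>w x\<bar> powr (2 * (m + n - 1) / (m + n - 2)) * 1 powr (-1)))
                        powr (2 * m / n)
                   / (sph_int (\<lambda>x. \<bar>w x\<bar> powr (2 * (m + n) / (m + n - 2))))
                        powr ((2 * m + n - 2) / n))"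

definition sph_Lambda :: "real \<Rightarrow> 'a::euclidean_space itself \<Rightarrow> real" where
  "sph_Lambda m _ = Inf {sph_Q m w | w :: 'a \<Rightarrow> real.
       sph_W12 w \<and> \<not> (AE x in lborel. x \<in> ball 0 1 \<longrightarrow> hext w x = 0)}"

end

theory Submission
  imports Defs
begin

text \<open>
  With \<open>m = 1/2\<close> the weight contributes \<open>2m = 1\<close> extra dimension.  A positive function on the
  sphere, raised to the power \<open>-2/(m + n - 2)\<close> and scaled, gives a function \<open>a\<close>, and the power
  \<open>-(n - 1)/2\<close> of \<open>a x + y\<^sup>2\<close> is a test function on the cylinder \<open>S^n \<times> \<real>\<close>, which is
  conformal to \<open>\<real>^(n+1) - {0}\<close>.  After integrating out \<open>y\<close> and optimising over the scale, the sharp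
  Sobolev inequality in dimension \<open>n + 1\<close> bounds the weighted Yamabe quotient from below by a
  constant.  The test function decays only polynomially in \<open>y\<close>; making it decay exponentially beyond
  \<open>\<bar>y\<bar> = T\<close> saves more energy than it costs, so the bound is strict.  On the other hand, choosing
  for \<open>a\<close> bubbles that concentrate at a point of the sphere shows that the constant is the infimum, which is
  therefore not attained.  The sharp Sobolev inequality itself follows from the
  Borell-Brascamp-Lieb inequality by inf-convolution with a paraboloid.
\<close>

section \<open>Borell-Brascamp-Lieb inequality\<close>

text \<open>With \<open>N = DIM('a) = n + 1\<close>, a Sobolev function \<open>u\<close> in
  dimension \<open>N\<close> is represented by \<open>g = u powr (- 2 / (N - 2))\<close>: mass and
  energy are then the integrals of \<open>1 / g ^ N\<close> and, up to a constant,
  \<open>(norm dg)\<^sup>2 / g ^ N\<close>, and the extremals are paraboloids. In coordinates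
  \<open>z = exp y *\<^sub>R x\<close> with \<open>g = exp y * G\<close> and \<open>G\<close> even
  in \<open>y\<close>, the energy density is the sum of the squares of \<open>G\<close>, its
  \<open>y\<close>-derivative and its tangential gradient, over \<open>G ^ N\<close>. The extremals
  used here read \<open>G = bub e p x + 2 * cosh y - 2\<close>, while the lift of a function on the
  sphere is \<open>G = \<alpha> x + y\<^sup>2\<close>. The two profiles differ, but agree to second
  order at \<open>y = 0\<close>, where a concentrating bubble has almost all of its energy; this is
  how the constant is approached. The obstacle is that
  \<open>exp y * (\<alpha> x + y\<^sup>2)\<close> vanishes at the origin and grows more slowly than
  \<open>(norm z)\<^sup>2\<close>, whereas the inf-convolution argument works with \<open>g\<close>
  above a multiple of \<open>1 + (norm z)\<^sup>2\<close>. The truncation thus provides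
  admissibility as well as strictness.\<close>

lemma compact_inner_approx:
  fixes A :: "real set"
  assumes A: "A \<in> sets borel" and ne: "A \<noteq> {}" and r: "r < emeasure lborel A"
  obtains K where "compact K" "K \<noteq> {}" "K \<subseteq> A" "r < emeasure lborel K"
proof -
  have fin: "r \<noteq> top" using r by auto
  then obtain r0 where r0: "r = ennreal r0" "r0 \<ge> 0" by (metis ennreal_cases)
  obtain e where e: "e > 0" "ennreal (r0 + e) < emeasure lborel A"
  proof (cases "emeasure lborel A")
    case (real q)
    have "r0 < q" using r r0 real by (simp add: ennreal_less_iff)
    then show ?thesis using that[of "(q - r0)/2"] real r0 by (auto simp: ennreal_less_iff field_simps)
  qed (use that[of 1] in auto)
  have Al: "A \<in> sets lebesgue" using A by simp
  obtain T where T: "closed T" "T \<subseteq> A" "emeasure lebesgue (A - T) < ennreal e"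
    using sets_lebesgue_inner_closed[OF Al e(1)] by metis
  have Tb: "T \<in> sets borel" using T by auto
  have "emeasure lborel (A - T) < ennreal e" using T A Tb by (simp add: emeasure_completion)
  moreover have "emeasure lborel A \<le> emeasure lborel T + emeasure lborel (A - T)"
  proof -
    have "A = T \<union> (A - T)" using T by auto
    then show ?thesis using emeasure_subadditive[of T lborel "A - T"] A Tb by auto
  qed
  ultimately have "ennreal (r0 + e) < emeasure lborel T + ennreal e"
    using e by (metis add_left_mono leD less_le_trans nle_le order_less_imp_le)
  then have rT: "r < emeasure lborel T"
    using r0 e by (metis add_right_mono ennreal_plus leD not_le_imp_less order_less_imp_le)
  define Tn where "Tn n = T \<inter> {- real n .. real n}" for n :: nat
  have "(\<lambda>n. emeasure lborel (Tn n)) \<longlonglongrightarrow> emeasure lborel (\<Union>n. Tn n)"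
    by (rule Lim_emeasure_incseq) (auto simp: Tn_def incseq_def Tb)
  moreover have "(\<Union>n. Tn n) = T"
  proof -
    have "\<exists>n. x \<in> {- real n .. real n}" for x :: real
    proof -
      obtain n where "\<bar>x\<bar> \<le> real n" using real_arch_simple by blast
      then show ?thesis by (intro exI[of _ n]) auto
    qed
    then show ?thesis by (auto simp: Tn_def)
  qed
  ultimately have "\<forall>\<^sub>F n in sequentially. r < emeasure lborel (Tn n)"
    using rT by (simp add: order_tendstoD)
  then obtain n where n: "r < emeasure lborel (Tn n)" by (auto simp: eventually_sequentially)
  show ?thesis
  proof
    show "compact (Tn n)" unfolding Tn_def using T(1) by (intro closed_Int_compact) auto
    show "Tn n \<noteq> {}" using n by auto
    show "Tn n \<subseteq> A" using T by (auto simp: Tn_def)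
  qed (fact n)
qed

lemma emeasure_lborel_affine_image:
  fixes K :: "real set"
  assumes "compact K"
  shows "emeasure lborel ((\<lambda>x. c * x + d) ` K) = ennreal \<bar>c\<bar> * emeasure lborel K"
proof -
  have "compact ((\<lambda>x. c * x + d) ` K)"
    by (intro compact_continuous_image assms continuous_intros)
  then have "(\<lambda>x. c * x + d) ` K \<in> sets borel" "K \<in> sets borel" using assms by (auto intro: borel_compact)
  then show ?thesis
    using emeasure_lebesgue_affine[of c d K] by (simp add: emeasure_completion)
qed

text \<open>With \<open>m\<close> the maximum of \<open>K\<close> and \<open>l\<close> the minimum
  of \<open>L\<close>, the translates \<open>K + t * l\<close> and \<open>m + t * L\<close> both lie
  in \<open>C\<close> and meet only in the point \<open>m + t * l\<close>, so their measures add up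
  inside \<open>C\<close>.\<close>

lemma Brunn_Minkowski_real_compact:
  fixes K L C :: "real set"
  assumes "compact K" "compact L" "K \<noteq> {}" "L \<noteq> {}" "C \<in> sets borel" "t \<ge> 0"
    and sub: "\<And>x y. x \<in> K \<Longrightarrow> y \<in> L \<Longrightarrow> x + t * y \<in> C"
  shows "emeasure lborel K + ennreal t * emeasure lborel L \<le> emeasure lborel C"
proof -
  obtain m where m: "m \<in> K" "\<And>x. x \<in> K \<Longrightarrow> x \<le> m" using compact_attains_sup[of K] assms by auto
  obtain l where l: "l \<in> L" "\<And>x. x \<in> L \<Longrightarrow> l \<le> x" using compact_attains_inf[of L] assms by auto
  define S1 where "S1 = (\<lambda>x. 1 * x + t * l) ` K"
  define S2 where "S2 = (\<lambda>y. t * y + m) ` L"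
  have c: "compact S1" "compact S2"
    unfolding S1_def S2_def by (intro compact_continuous_image assms continuous_intros)+
  have b: "S1 \<in> sets lborel" "S2 \<in> sets lborel" using c by (auto intro: borel_compact)
  have "S1 \<inter> S2 \<subseteq> {m + t * l}"
  proof
    fix z assume "z \<in> S1 \<inter> S2"
    then obtain x y where xy: "x \<in> K" "y \<in> L" "z = x + t * l" "z = t * y + m"
      by (auto simp: S1_def S2_def)
    have "t * l \<le> t * y" using l xy assms by (simp add: mult_left_mono)
    with xy m(2)[of x] show "z \<in> {m + t * l}" by auto
  qed
  then have "emeasure lborel (S1 \<inter> S2) \<le> emeasure lborel {m + t * l}"
    by (intro emeasure_mono) auto
  then have z: "emeasure lborel (S1 \<inter> S2) = 0" by simp
  have "emeasure lborel S2 = emeasure lborel (S2 - S1)"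
    using emeasure_Diff_null_set[of "S1 \<inter> S2" lborel S2] b z by (simp add: null_sets_def Diff_Int Diff_cancel Int_commute)
  then have "emeasure lborel S1 + emeasure lborel S2 = emeasure lborel (S1 \<union> (S2 - S1))"
    using b by (subst plus_emeasure[symmetric]) auto
  also have "\<dots> \<le> emeasure lborel C"
  proof (rule emeasure_mono)
    show "S1 \<union> (S2 - S1) \<subseteq> C"
      using sub m l by (auto simp: S1_def S2_def add.commute)
  qed (use assms in auto)
  finally have "emeasure lborel S1 + emeasure lborel S2 \<le> emeasure lborel C" .
  moreover have "emeasure lborel S1 = emeasure lborel K" "emeasure lborel S2 = ennreal t * emeasure lborel L"
    unfolding S1_def S2_def
    using emeasure_lborel_affine_image[OF assms(1), of 1 "t * l"] emeasure_lborel_affine_image[OF assms(2), of t m] assms(6)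
    by (simp_all add: abs_of_nonneg)
  ultimately show ?thesis by simp
qed

text \<open>Inner regularity reduces this to compact sets, in \<open>B\<close> first and then in
  \<open>A\<close>. The set \<open>C\<close> stands in for the sum set, which need not be
  Borel.\<close>

lemma Brunn_Minkowski_real:
  fixes A B C :: "real set"
  assumes "A \<in> sets borel" "B \<in> sets borel" "A \<noteq> {}" "B \<noteq> {}" "C \<in> sets borel" "t \<ge> 0"
    and sub: "\<And>x y. x \<in> A \<Longrightarrow> y \<in> B \<Longrightarrow> x + t * y \<in> C"
  shows "emeasure lborel A + ennreal t * emeasure lborel B \<le> emeasure lborel C"
proof -
  \<comment> \<open>The compact case wants nonempty sets; a singleton serves when \<open>r\<close>
    is not below the measure of \<open>S\<close>.\<close>
  have cpt: "\<exists>K. compact K \<and> K \<noteq> {} \<and> K \<subseteq> S \<and> (r < emeasure lborel S \<longrightarrow> r < emeasure lborel K)"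
    if "S \<in> sets borel" "S \<noteq> {}" for S :: "real set" and r
  proof (cases "r < emeasure lborel S")
    case True then show ?thesis using compact_inner_approx[OF that] by metis
  next
    case False
    obtain s where "s \<in> S" using \<open>S \<noteq> {}\<close> by blast
    with False show ?thesis by (intro exI[of _ "{s}"]) auto
  qed
  have 1: "emeasure lborel K + ennreal t * emeasure lborel B \<le> emeasure lborel C"
    if K: "compact K" "K \<noteq> {}" "K \<subseteq> A" for K
  proof -
    have "emeasure lborel B = (SUP L\<in>{L. compact L \<and> L \<noteq> {} \<and> L \<subseteq> B}. emeasure lborel L)" (is "_ = ?S")
    proof (rule antisym)
      show "emeasure lborel B \<le> ?S"
      proof (rule ccontr)
        assume "\<not> emeasure lborel B \<le> ?S"
        then have "?S < emeasure lborel B" by simp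
        then obtain L where "compact L" "L \<noteq> {}" "L \<subseteq> B" "?S < emeasure lborel L"
          using cpt[of B ?S] assms by blast
        then show False using SUP_upper[of L "{L. compact L \<and> L \<noteq> {} \<and> L \<subseteq> B}" "emeasure lborel"]
          by (auto simp: leD)
      qed
      show "?S \<le> emeasure lborel B" by (rule SUP_least) (use assms in \<open>auto intro!: emeasure_mono\<close>)
    qed
    also have "ennreal t * \<dots> = (SUP L\<in>{L. compact L \<and> L \<noteq> {} \<and> L \<subseteq> B}. ennreal t * emeasure lborel L)"
      by (rule SUP_mult_left_ennreal)
    also have "emeasure lborel K + \<dots> = (SUP L\<in>{L. compact L \<and> L \<noteq> {} \<and> L \<subseteq> B}. emeasure lborel K + ennreal t * emeasure lborel L)"
      using cpt[of B 0] assms by (intro ennreal_SUP_add_right) auto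
    also have "\<dots> \<le> emeasure lborel C"
      using K assms by (intro SUP_least Brunn_Minkowski_real_compact) auto
    finally show ?thesis .
  qed
  show ?thesis
  proof (rule ccontr)
    assume "\<not> ?thesis"
    then have lt: "emeasure lborel C < emeasure lborel A + ennreal t * emeasure lborel B" by simp
    define b where "b = ennreal t * emeasure lborel B"
    \<comment> \<open>A one-point \<open>K\<close> already shows
      \<open>b \<le> emeasure lborel C\<close>. Hence \<open>b\<close> is finite, and
      \<open>emeasure lborel C - b\<close> below is a genuine difference.\<close>
    obtain s where "s \<in> A" using assms by auto
    then have bC: "b \<le> emeasure lborel C" using 1[of "{s}"] by (auto simp: b_def)
    have bfin: "b \<noteq> top" "emeasure lborel C \<noteq> top" using lt bC by (auto simp: b_def top_unique)
    have "emeasure lborel C - b < emeasure lborel A"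
      using lt bC bfin unfolding b_def[symmetric]
      by (metis add.commute diff_add_cancel_ennreal add_left_mono leD not_le_imp_less)
    then obtain K where K: "compact K" "K \<noteq> {}" "K \<subseteq> A" "emeasure lborel C - b < emeasure lborel K"
      using cpt[of A "emeasure lborel C - b"] assms by blast
    then have "emeasure lborel C < emeasure lborel K + b"
      using bfin bC by (metis 1 add.commute b_def diff_add_cancel_ennreal ennreal_add_left_cancel_less less_le not_less_iff_gr_or_eq leD top.not_eq_extremum)
    with 1[OF K(1-3)] show False by (simp add: b_def)
  qed
qed

section \<open>Level sets and the one-dimensional Prekopa-Leindler inequality\<close>

lemma nn_integral_layer_cake:
  fixes f :: "real \<Rightarrow> ennreal"
  assumes [measurable]: "f \<in> borel_measurable borel"
  shows "(\<integral>\<^sup>+x. f x \<partial>lborel) = (\<integral>\<^sup>+l. emeasure lborel {x. ennreal l < f x} * indicator {0..} l \<partial>lborel)"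
proof -
  have *: "f x = (\<integral>\<^sup>+l. indicator {0..} l * indicator {l. ennreal l < f x} l \<partial>lborel)" for x
  proof -
    have "(\<integral>\<^sup>+l. indicator {0..} l * indicator {l. ennreal l < f x} l \<partial>lborel)
      = emeasure lborel ({0..} \<inter> {l. ennreal l < f x})"
      by (subst nn_integral_indicator[symmetric])
        (auto simp: indicator_inter_arith[abs_def] indicator_def intro!: nn_integral_cong simp del: nn_integral_indicator)
    also have "\<dots> = f x"
    proof (cases "f x")
      case (real q)
      then have "{0..} \<inter> {l. ennreal l < f x} = {0..<q}" by (auto simp: ennreal_less_iff)
      then show ?thesis using real by simp
    next
      case top
      then have "{0..} \<inter> {l. ennreal l < f x} = {0::real..}" by auto
      moreover have "emeasure lborel {0::real..} = top"
      proof (rule ccontr)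
        assume "emeasure lborel {0::real..} \<noteq> top"
        then obtain q where q: "emeasure lborel {0::real..} = ennreal q" "q \<ge> 0" by (metis ennreal_cases)
        have "ennreal (q + 1) = emeasure lborel {0..q+1}" using q by simp
        also have "\<dots> \<le> emeasure lborel {0::real..}" by (rule emeasure_mono) auto
        finally show False using q by (simp add: ennreal_le_iff)
      qed
      ultimately show ?thesis using top by simp
    qed
    finally show ?thesis by simp
  qed
  have "(\<integral>\<^sup>+x. f x \<partial>lborel) = (\<integral>\<^sup>+x. \<integral>\<^sup>+l. indicator {0..} l * indicator {l. ennreal l < f x} l \<partial>lborel \<partial>lborel)"
    by (subst *) simp
  also have "\<dots> = (\<integral>\<^sup>+l. \<integral>\<^sup>+x. indicator {0..} l * indicator {x. ennreal l < f x} x \<partial>lborel \<partial>lborel)"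
    by (subst lborel_pair.Fubini') (auto simp: indicator_def intro!: nn_integral_cong)
  also have "\<dots> = (\<integral>\<^sup>+l. emeasure lborel {x. ennreal l < f x} * indicator {0..} l \<partial>lborel)"
    by (intro nn_integral_cong, subst nn_integral_cmult) (auto simp: mult.commute)
  finally show ?thesis .
qed

text \<open>Only the level sets matter here; the equality of the suprema is what allows a sum
  on the right-hand side instead of a minimum.\<close>

lemma Prekopa_Leindler_min_real:
  fixes f g h :: "real \<Rightarrow> ennreal"
  assumes [measurable]: "f \<in> borel_measurable borel" "g \<in> borel_measurable borel" "h \<in> borel_measurable borel"
    and t: "t \<ge> 0"
    and sup: "\<And>l. (\<exists>x. l < f x) \<longleftrightarrow> (\<exists>y. l < g y)"
    and le: "\<And>x y. min (f x) (g y) \<le> h (x + t * y)"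
  shows "(\<integral>\<^sup>+x. f x \<partial>lborel) + ennreal t * (\<integral>\<^sup>+x. g x \<partial>lborel) \<le> (\<integral>\<^sup>+x. h x \<partial>lborel)"
proof -
  have "(\<integral>\<^sup>+x. f x \<partial>lborel) + ennreal t * (\<integral>\<^sup>+x. g x \<partial>lborel)
    = (\<integral>\<^sup>+l. emeasure lborel {x. ennreal l < f x} * indicator {0..} l
        + ennreal t * (emeasure lborel {x. ennreal l < g x} * indicator {0..} l) \<partial>lborel)"
    unfolding nn_integral_layer_cake[OF assms(1)] nn_integral_layer_cake[OF assms(2)]
    by (subst nn_integral_add) (auto simp: nn_integral_cmult)
  also have "\<dots> \<le> (\<integral>\<^sup>+l. emeasure lborel {x. ennreal l < h x} * indicator {0..} l \<partial>lborel)"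
  proof (intro nn_integral_mono)
    fix l :: real
    have "emeasure lborel {x. ennreal l < f x} + ennreal t * emeasure lborel {x. ennreal l < g x}
      \<le> emeasure lborel {x. ennreal l < h x}"
    proof (cases "\<exists>x. ennreal l < f x")
      case True
      then have "\<exists>x. ennreal l < g x" using sup by auto
      with True show ?thesis
        using t by (intro Brunn_Minkowski_real) (auto intro!: less_le_trans[OF _ le])
    next
      case False
      then have "{x. ennreal l < f x} = {}" "{x. ennreal l < g x} = {}" using sup[of "ennreal l"] by auto
      then show ?thesis by simp
    qed
    then show "emeasure lborel {x. ennreal l < f x} * indicator {0..} l
        + ennreal t * (emeasure lborel {x. ennreal l < g x} * indicator {0..} l)
        \<le> emeasure lborel {x. ennreal l < h x} * indicator {0..} l"
      by (cases "l \<ge> 0") auto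
  qed
  also have "\<dots> = (\<integral>\<^sup>+x. h x \<partial>lborel)" by (rule nn_integral_layer_cake[symmetric]) simp
  finally show ?thesis .
qed

section \<open>Borell-Brascamp-Lieb inequality by induction on coordinates\<close>

text \<open>The function \<open>a * (m / a) ^ Suc j\<close> is the perspective of a convex power,
  hence convex and homogeneous of degree one, hence subadditive in the pair
  \<open>(m, a)\<close>.\<close>

lemma power_ratio_convex:
  fixes a b m n t :: real
  assumes "a > 0" "b > 0" "m \<ge> 0" "n \<ge> 0" "t \<ge> 0"
  shows "(m + t * n) ^ Suc j / (a + t * b) ^ j \<le> m ^ Suc j / a ^ j + t * (n ^ Suc j / b ^ j)"
proof -
  have s: "a + t * b > 0" using assms by (simp add: add_pos_nonneg)
  define w where "w = t * b / (a + t * b)"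
  have w: "0 \<le> w" "w \<le> 1" using assms s by (auto simp: w_def)
  have w1: "1 - w = a / (a + t * b)" using s by (simp add: w_def field_simps)
  have "convex_on {0..} (\<lambda>x::real. x ^ Suc j)" 
    using convex_power_odd[of "Suc j"] convex_on_subset[OF convex_power_even[of "Suc j"], of "{0..}"]
    by (cases "even (Suc j)") auto
  then have "((1 - w) *\<^sub>R (m/a) + w *\<^sub>R (n/b)) ^ Suc j \<le> (1 - w) * (m/a) ^ Suc j + w * (n/b) ^ Suc j"
    using w assms by (intro convex_onD) auto
  moreover have "(1 - w) *\<^sub>R (m/a) + w *\<^sub>R (n/b) = (m + t * n) / (a + t * b)"
    unfolding w1 using assms s by (simp add: w_def add_divide_distrib)
  moreover have "(1 - w) * (m/a) ^ Suc j = m ^ Suc j / a ^ j / (a + t * b)"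
    unfolding w1 using assms s by (simp add: power_divide)
  moreover have "w * (n/b) ^ Suc j = t * (n ^ Suc j / b ^ j) / (a + t * b)"
    unfolding w_def using assms s by (simp add: power_divide)
  ultimately have "((m + t * n) / (a + t * b)) ^ Suc j \<le> (m ^ Suc j / a ^ j + t * (n ^ Suc j / b ^ j)) / (a + t * b)"
    by (simp add: add_divide_distrib)
  then have "((m + t * n) / (a + t * b)) ^ Suc j * (a + t * b) \<le> m ^ Suc j / a ^ j + t * (n ^ Suc j / b ^ j)"
    using s by (simp add: pos_le_divide_eq del: power_Suc)
  moreover have "((m + t * n) / (a + t * b)) ^ Suc j * (a + t * b) = (m + t * n) ^ Suc j / (a + t * b) ^ j"
    using s by (simp add: power_divide)
  ultimately show ?thesis by simp
qed

text \<open>The condition on \<open>a\<close>, \<open>b\<close>, \<open>c\<close> encodes that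
  \<open>h (x + t * y)\<close> is at least the mean of order \<open>-1 / (j + 1)\<close> of
  \<open>f x\<close> and \<open>g y\<close> with weights 1 and \<open>t\<close>; the conclusion has
  the same shape with \<open>j + 1\<close> lowered to \<open>j\<close>. Boundedness allows both
  suprema to be normalised to 1, which is what \<open>Prekopa_Leindler_min_real\<close> asks for,
  and \<open>power_ratio_convex\<close> undoes the normalisation.\<close>

lemma Borell_Brascamp_Lieb_real_bounded:
  fixes f g h :: "real \<Rightarrow> ennreal"
  assumes [measurable]: "f \<in> borel_measurable borel" "g \<in> borel_measurable borel" "h \<in> borel_measurable borel"
    and t: "t \<ge> 0"
    and fb: "(SUP x. f x) < top" and gb: "(SUP x. g x) < top"
    and le: "\<And>x y a b c. a > 0 \<Longrightarrow> b > 0 \<Longrightarrow> c > 0 \<Longrightarrow> ennreal (c / a ^ Suc j) \<le> f x \<Longrightarrow>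
      ennreal (c / b ^ Suc j) \<le> g y \<Longrightarrow> ennreal (c / (a + t * b) ^ Suc j) \<le> h (x + t * y)"
    and abc: "a > 0" "b > 0" "c > 0"
    and F: "ennreal (c / a ^ j) \<le> (\<integral>\<^sup>+x. f x \<partial>lborel)"
    and G: "ennreal (c / b ^ j) \<le> (\<integral>\<^sup>+x. g x \<partial>lborel)"
  shows "ennreal (c / (a + t * b) ^ j) \<le> (\<integral>\<^sup>+x. h x \<partial>lborel)"
proof -
  \<comment> \<open>The normalising factor is written as a power \<open>m ^ Suc j\<close> because
    \<open>m\<close> will take the place of \<open>a\<close> in the assumption
    \<open>le\<close>.\<close>
  have sup: "\<exists>m>0. (SUP x. ennreal (m ^ Suc j) * k x) = 1"
    if k: "ennreal r \<le> (\<integral>\<^sup>+x. k x \<partial>lborel)" "r > 0" "(SUP x. k x) < top" for k :: "real \<Rightarrow> ennreal" and r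
  proof -
    obtain s where s: "(SUP x. k x) = ennreal s" "s \<ge> 0" using k(3) by (metis ennreal_cases less_irrefl)
    have "s \<noteq> 0"
    proof
      assume "s = 0"
      then have "k x = 0" for x using s(1) SUP_upper[of x UNIV k] by simp
      then show False using k by simp
    qed
    with s have s0: "s > 0" by simp
    define m where "m = root (Suc j) (1 / s)"
    have m: "m > 0" "m ^ Suc j = 1 / s" using s0 by (auto simp: m_def simp del: power_Suc)
    have "(SUP x. ennreal (m ^ Suc j) * k x) = ennreal (1/s) * ennreal s"
      by (simp only: SUP_mult_left_ennreal[symmetric] s m)
    also have "\<dots> = 1" using s0 by (simp add: ennreal_mult[symmetric])
    finally show ?thesis using m by auto
  qed
  obtain m where m: "m > 0" "(SUP x. ennreal (m ^ Suc j) * f x) = 1"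
    using sup[OF F _ fb] abc by auto
  obtain n where n: "n > 0" "(SUP x. ennreal (n ^ Suc j) * g x) = 1"
    using sup[OF G _ gb] abc by auto
  define s where "s = m + t * n"
  have s: "s > 0" using m n t by (simp add: s_def add_pos_nonneg)
  \<comment> \<open>For the normalised functions the bound by the minimum \<open>q\<close> is
    \<open>le\<close> with \<open>a = m\<close>, \<open>b = n\<close> and \<open>c\<close> the real
    value of \<open>q\<close>.\<close>
  have key: "(\<integral>\<^sup>+x. ennreal (m ^ Suc j) * f x \<partial>lborel) + ennreal t * (\<integral>\<^sup>+x. ennreal (n ^ Suc j) * g x \<partial>lborel)
     \<le> (\<integral>\<^sup>+x. ennreal (s ^ Suc j) * h x \<partial>lborel)"
  proof (rule Prekopa_Leindler_min_real)
    fix l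
    show "(\<exists>x. l < ennreal (m ^ Suc j) * f x) \<longleftrightarrow> (\<exists>y. l < ennreal (n ^ Suc j) * g y)"
      using less_SUP_iff[of l "\<lambda>x. ennreal (m ^ Suc j) * f x" UNIV] less_SUP_iff[of l "\<lambda>x. ennreal (n ^ Suc j) * g x" UNIV]
        m n by simp
  next
    fix x y
    define q where "q = min (ennreal (m ^ Suc j) * f x) (ennreal (n ^ Suc j) * g y)"
    have "ennreal (m ^ Suc j) * f x \<le> 1"
      using m SUP_upper[of x UNIV "\<lambda>x. ennreal (m ^ Suc j) * f x"] by simp
    then have "q \<le> 1" by (simp add: q_def min.coboundedI1)
    then obtain q0 where q0: "q = ennreal q0" "q0 \<ge> 0" by (metis ennreal_cases ennreal_one_less_top leD)
    show "min (ennreal (m ^ Suc j) * f x) (ennreal (n ^ Suc j) * g y) \<le> ennreal (s ^ Suc j) * h (x + t * y)"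
      unfolding q_def[symmetric]
    proof (cases "q0 = 0")
      case False
      have div: "ennreal (q0 / m ^ Suc j) \<le> u" if "q \<le> ennreal (m ^ Suc j) * u" "m > 0" for u m
      proof -
        have "ennreal (1 / m ^ Suc j) * q \<le> ennreal (1 / m ^ Suc j) * (ennreal (m ^ Suc j) * u)"
          using that by (intro mult_left_mono) auto
        also have "\<dots> = u" using that(2) by (simp add: mult.assoc[symmetric] ennreal_mult[symmetric] del: power_Suc)
        finally show ?thesis using q0 that(2) by (simp add: ennreal_mult[symmetric] del: power_Suc)
      qed
      have "ennreal (q0 / s ^ Suc j) \<le> h (x + t * y)"
        unfolding s_def
      proof (rule le)
        show "ennreal (q0 / m ^ Suc j) \<le> f x" "ennreal (q0 / n ^ Suc j) \<le> g y"
          by (rule div; use m n in \<open>simp add: q_def del: power_Suc\<close>)+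
      qed (use m n False q0 in auto)
      then have "ennreal (s ^ Suc j) * ennreal (q0 / s ^ Suc j) \<le> ennreal (s ^ Suc j) * h (x + t * y)"
        by (intro mult_left_mono) auto
      then show "q \<le> ennreal (s ^ Suc j) * h (x + t * y)"
        using q0 s by (simp add: ennreal_mult[symmetric] del: power_Suc)
    qed (use q0 in simp)
  qed (use t in auto)
  have "s ^ Suc j * (c / (a + t * b) ^ j) = c * (s ^ Suc j / (a + t * b) ^ j)" by simp
  also have "\<dots> \<le> c * (m ^ Suc j / a ^ j + t * (n ^ Suc j / b ^ j))"
    unfolding s_def using abc m n t by (intro mult_left_mono power_ratio_convex) auto
  also have "\<dots> = m ^ Suc j * (c / a ^ j) + t * (n ^ Suc j * (c / b ^ j))" by (simp add: algebra_simps)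
  finally have "ennreal (s ^ Suc j * (c / (a + t * b) ^ j)) \<le> ennreal (m ^ Suc j * (c / a ^ j) + t * (n ^ Suc j * (c / b ^ j)))"
    by (rule ennreal_leI)
  also have "\<dots> = ennreal (m ^ Suc j) * ennreal (c / a ^ j) + ennreal t * (ennreal (n ^ Suc j) * ennreal (c / b ^ j))"
    using m n t abc by (subst ennreal_plus) (auto simp: ennreal_mult'[symmetric] mult.assoc simp del: power_Suc)
  also have "\<dots> \<le> ennreal (m ^ Suc j) * (\<integral>\<^sup>+x. f x \<partial>lborel) + ennreal t * (ennreal (n ^ Suc j) * (\<integral>\<^sup>+x. g x \<partial>lborel))"
    by (intro add_mono mult_left_mono F G) auto
  also have "\<dots> \<le> ennreal (s ^ Suc j) * (\<integral>\<^sup>+x. h x \<partial>lborel)"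
    using key by (simp add: nn_integral_cmult del: power_Suc)
  finally have "ennreal (1 / s ^ Suc j) * ennreal (s ^ Suc j * (c / (a + t * b) ^ j))
     \<le> ennreal (1 / s ^ Suc j) * (ennreal (s ^ Suc j) * (\<integral>\<^sup>+x. h x \<partial>lborel))"
    by (intro mult_left_mono) auto
  moreover have "ennreal (1 / s ^ Suc j) * (ennreal (s ^ Suc j) * H) = H" for H
    using s by (simp add: mult.assoc[symmetric] ennreal_mult[symmetric] del: power_Suc)
  moreover have "ennreal (1 / s ^ Suc j) * ennreal (s ^ Suc j * (c / (a + t * b) ^ j)) = ennreal (c / (a + t * b) ^ j)"
    using s abc t by (subst ennreal_mult[symmetric]) (auto simp del: power_Suc)
  ultimately show ?thesis by simp
qed

text \<open>Truncation at height \<open>n\<close> restores boundedness and keeps the assumption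
  \<open>le\<close>, since a level below \<open>min (f x) (of_nat n)\<close> is also below
  \<open>f x\<close>. For large \<open>n\<close> the truncated integrals still exceed the required
  values once \<open>c\<close> is decreased slightly.\<close>

lemma Borell_Brascamp_Lieb_real:
  fixes f g h :: "real \<Rightarrow> ennreal"
  assumes [measurable]: "f \<in> borel_measurable borel" "g \<in> borel_measurable borel" "h \<in> borel_measurable borel"
    and t: "t \<ge> 0"
    and le: "\<And>x y a b c. a > 0 \<Longrightarrow> b > 0 \<Longrightarrow> c > 0 \<Longrightarrow> ennreal (c / a ^ Suc j) \<le> f x \<Longrightarrow>
      ennreal (c / b ^ Suc j) \<le> g y \<Longrightarrow> ennreal (c / (a + t * b) ^ Suc j) \<le> h (x + t * y)"
    and abc: "a > 0" "b > 0" "c > 0"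
    and F: "ennreal (c / a ^ j) \<le> (\<integral>\<^sup>+x. f x \<partial>lborel)"
    and G: "ennreal (c / b ^ j) \<le> (\<integral>\<^sup>+x. g x \<partial>lborel)"
  shows "ennreal (c / (a + t * b) ^ j) \<le> (\<integral>\<^sup>+x. h x \<partial>lborel)"
proof (rule dense_le)
  fix w assume w: "w < ennreal (c / (a + t * b) ^ j)"
  have s: "a + t * b > 0" using abc t by (simp add: add_pos_nonneg)
  obtain w0 where w0: "w = ennreal w0" "w0 \<ge> 0" using w by (metis ennreal_cases not_less_iff_gr_or_eq top.extremum_strict)
  show "w \<le> (\<integral>\<^sup>+x. h x \<partial>lborel)"
  proof (cases "w0 = 0")
    case False
    \<comment> \<open>With \<open>c'\<close> in place of \<open>c\<close> the conclusion reads
      exactly \<open>w\<close>. Since \<open>c' < c\<close>, the truncated integrals eventually pass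
      the levels belonging to \<open>c'\<close>.\<close>
    define c' where "c' = w0 * (a + t * b) ^ j"
    have c': "c' > 0" "c' < c"
      using w w0 False s abc by (auto simp: c'_def ennreal_less_iff field_simps)
    have trunc: "(\<lambda>n. \<integral>\<^sup>+x. min (k x) (of_nat n) \<partial>lborel) \<longlonglongrightarrow> (\<integral>\<^sup>+x. k x \<partial>lborel)"
      if [measurable]: "k \<in> borel_measurable borel" for k :: "real \<Rightarrow> ennreal"
    proof (rule nn_integral_LIMSEQ)
      show "incseq (\<lambda>n x. min (k x) (of_nat n))"
        by (auto simp: incseq_def le_fun_def intro: min.coboundedI1 min.coboundedI2)
      show "(\<lambda>n. min (k x) (of_nat n)) \<longlonglongrightarrow> k x" for x
      proof (cases "k x")
        case (real r)
        obtain N where "r \<le> real N" using real_arch_simple by blast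
        then have "min (k x) (of_nat n) = k x" if "n \<ge> N" for n
          using that real by (auto simp: min_def ennreal_of_nat_eq_real_of_nat ennreal_less_iff)
        then show ?thesis by (intro tendsto_eventually) (auto simp: eventually_sequentially)
      next
        case top
        have "incseq (of_nat :: nat \<Rightarrow> ennreal)" by (auto simp: incseq_def)
        then have "(of_nat :: nat \<Rightarrow> ennreal) \<longlonglongrightarrow> top"
          using LIMSEQ_SUP[of "of_nat :: nat \<Rightarrow> ennreal"] by (simp add: ennreal_SUP_of_nat_eq_top)
        then show ?thesis using top by simp
      qed
    qed auto
    have ev: "\<forall>\<^sub>F n in sequentially. ennreal (c' / d ^ j) \<le> (\<integral>\<^sup>+x. min (k x) (of_nat n) \<partial>lborel)"
      if [measurable]: "k \<in> borel_measurable borel" and k: "ennreal (c / d ^ j) \<le> (\<integral>\<^sup>+x. k x \<partial>lborel)" "d > 0"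
      for k :: "real \<Rightarrow> ennreal" and d
    proof -
      have "ennreal (c' / d ^ j) < ennreal (c / d ^ j)" using c' k(2) by (intro ennreal_lessI) (auto simp: divide_strict_right_mono)
      also note k(1)
      finally have "\<forall>\<^sub>F n in sequentially. ennreal (c' / d ^ j) < (\<integral>\<^sup>+x. min (k x) (of_nat n) \<partial>lborel)"
        by (rule order_tendstoD(1)[OF trunc[OF that(1)]])
      then show ?thesis by (rule eventually_mono) simp
    qed
    have "\<forall>\<^sub>F n in sequentially. ennreal (c' / a ^ j) \<le> (\<integral>\<^sup>+x. min (f x) (of_nat n) \<partial>lborel) \<and>
       ennreal (c' / b ^ j) \<le> (\<integral>\<^sup>+x. min (g x) (of_nat n) \<partial>lborel)"
      using F G abc by (intro eventually_conj ev) auto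
    then obtain n where n: "ennreal (c' / a ^ j) \<le> (\<integral>\<^sup>+x. min (f x) (of_nat n) \<partial>lborel)"
       "ennreal (c' / b ^ j) \<le> (\<integral>\<^sup>+x. min (g x) (of_nat n) \<partial>lborel)" by (auto simp: eventually_sequentially)
    have bd: "(SUP x. min (k x) (of_nat n)) < (top :: ennreal)" for k :: "real \<Rightarrow> ennreal"
    proof -
      have "(SUP x. min (k x) (of_nat n)) \<le> (of_nat n :: ennreal)" by (rule SUP_least) auto
      also have "\<dots> < top" by (simp add: ennreal_of_nat_eq_real_of_nat)
      finally show ?thesis .
    qed
    have "ennreal (c' / (a + t * b) ^ j) \<le> (\<integral>\<^sup>+x. h x \<partial>lborel)"
    proof (rule Borell_Brascamp_Lieb_real_bounded[OF _ _ _ t bd bd _ abc(1,2) c'(1) n])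
      fix x y a b c :: real
      assume "a > 0" "b > 0" "c > 0" "ennreal (c / a ^ Suc j) \<le> min (f x) (of_nat n)"
        "ennreal (c / b ^ Suc j) \<le> min (g y) (of_nat n)"
      then show "ennreal (c / (a + t * b) ^ Suc j) \<le> h (x + t * y)"
        by (intro le) auto
    qed auto
    then show ?thesis using w0 s by (simp add: c'_def)
  qed (use w0 in simp)
qed

text \<open>Each integration over a coordinate lowers the exponent by one, so \<open>card I\<close>
  of them bring \<open>j + card I\<close> down to \<open>j\<close>. In the induction step, the
  condition on the inner integrals is the conclusion of the one-dimensional inequality at
  \<open>j + card I\<close>.\<close>

lemma Borell_Brascamp_Lieb_PiM:
  fixes f g h :: "('i \<Rightarrow> real) \<Rightarrow> ennreal"
  assumes "finite I" and t: "t \<ge> 0"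
    and "f \<in> borel_measurable (PiM I (\<lambda>_. lborel))" "g \<in> borel_measurable (PiM I (\<lambda>_. lborel))"
      "h \<in> borel_measurable (PiM I (\<lambda>_. lborel))"
    and "\<And>x y a b c. x \<in> extensional I \<Longrightarrow> y \<in> extensional I \<Longrightarrow> a > 0 \<Longrightarrow> b > 0 \<Longrightarrow> c > 0 \<Longrightarrow>
      ennreal (c / a ^ (j + card I)) \<le> f x \<Longrightarrow> ennreal (c / b ^ (j + card I)) \<le> g y \<Longrightarrow>
      ennreal (c / (a + t * b) ^ (j + card I)) \<le> h (\<lambda>i\<in>I. x i + t * y i)"
    and "a > 0" "b > 0" "c > 0"
    and "ennreal (c / a ^ j) \<le> (\<integral>\<^sup>+x. f x \<partial>PiM I (\<lambda>_. lborel))"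
    and "ennreal (c / b ^ j) \<le> (\<integral>\<^sup>+x. g x \<partial>PiM I (\<lambda>_. lborel))"
  shows "ennreal (c / (a + t * b) ^ j) \<le> (\<integral>\<^sup>+x. h x \<partial>PiM I (\<lambda>_. lborel))"
  using assms(1,3-)
proof (induction I arbitrary: f g h a b c rule: finite_induct)
  case empty
  interpret product_sigma_finite "\<lambda>_. lborel :: real measure" ..
  show ?case using empty.prems(4)[of "\<lambda>_. undefined" "\<lambda>_. undefined" a b c] empty.prems(5-)
    by (simp add: nn_integral_empty)
next
  case (insert i I)
  interpret product_sigma_finite "\<lambda>_. lborel :: real measure" ..
  note [measurable] = insert.prems(1-3)
  have upd: "(\<lambda>u. k (x(i := u))) \<in> borel_measurable borel"
    if [measurable]: "k \<in> borel_measurable (PiM (insert i I) (\<lambda>_. lborel))" and "x \<in> extensional I"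
    for k :: "('i \<Rightarrow> real) \<Rightarrow> ennreal" and x
  proof -
    have "x \<in> space (PiM I (\<lambda>_. lborel :: real measure))" using that by (auto simp: space_PiM PiE_def)
    then have "(\<lambda>u. x(i := u)) \<in> measurable lborel (PiM (insert i I) (\<lambda>_. lborel))"
      using measurable_component_update[of x I "\<lambda>_. lborel" i] insert.hyps by auto
    then have "(\<lambda>u. k (x(i := u))) \<in> borel_measurable lborel" by (rule measurable_compose) fact
    then show ?thesis by simp
  qed
  have int: "(\<lambda>x. \<integral>\<^sup>+u. k (x(i := u)) \<partial>lborel) \<in> borel_measurable (PiM I (\<lambda>_. lborel))"
    if "k \<in> borel_measurable (PiM (insert i I) (\<lambda>_. lborel))" for k :: "('i \<Rightarrow> real) \<Rightarrow> ennreal"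
  proof (rule lborel.borel_measurable_nn_integral)
    show "(\<lambda>(x, u). k (x(i := u))) \<in> borel_measurable (PiM I (\<lambda>_. lborel) \<Otimes>\<^sub>M lborel)"
      using measurable_compose[OF measurable_add_dim[of i I "\<lambda>_. lborel"] that] by (simp add: case_prod_beta')
  qed
  have rw: "(\<integral>\<^sup>+x. k x \<partial>PiM (insert i I) (\<lambda>_. lborel)) = (\<integral>\<^sup>+x. \<integral>\<^sup>+u. k (x(i := u)) \<partial>lborel \<partial>PiM I (\<lambda>_. lborel))"
    if "k \<in> borel_measurable (PiM (insert i I) (\<lambda>_. lborel))" for k :: "('i \<Rightarrow> real) \<Rightarrow> ennreal"
    by (rule product_nn_integral_insert) (use insert.hyps that in auto)
  show ?case unfolding rw[OF insert.prems(3)]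
  proof (rule insert.IH[OF int int int, OF insert.prems(1-3)])
    fix x y :: "'i \<Rightarrow> real" and a b c :: real
    assume x: "x \<in> extensional I" and y: "y \<in> extensional I" and abc: "a > 0" "b > 0" "c > 0"
      and F: "ennreal (c / a ^ (j + card I)) \<le> (\<integral>\<^sup>+u. f (x(i := u)) \<partial>lborel)"
      and G: "ennreal (c / b ^ (j + card I)) \<le> (\<integral>\<^sup>+u. g (y(i := u)) \<partial>lborel)"
    let ?z = "\<lambda>k\<in>I. x k + t * y k"
    show "ennreal (c / (a + t * b) ^ (j + card I)) \<le> (\<integral>\<^sup>+u. h (?z(i := u)) \<partial>lborel)"
    proof (rule Borell_Brascamp_Lieb_real[OF upd upd upd t _ abc F G])
      fix u v a b c :: real
      assume *: "a > 0" "b > 0" "c > 0" "ennreal (c / a ^ Suc (j + card I)) \<le> f (x(i := u))"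
        "ennreal (c / b ^ Suc (j + card I)) \<le> g (y(i := v))"
      have "ennreal (c / (a + t * b) ^ (j + card (insert i I))) \<le> h (\<lambda>k\<in>insert i I. (x(i := u)) k + t * (y(i := v)) k)"
      proof (rule insert.prems(4))
        show "x(i := u) \<in> extensional (insert i I)" "y(i := v) \<in> extensional (insert i I)"
          using x y by (auto simp: extensional_def)
      qed (use * insert.hyps in \<open>simp_all add: fun_upd_def\<close>)
      moreover have "(\<lambda>k\<in>insert i I. (x(i := u)) k + t * (y(i := v)) k) = ?z(i := u + t * v)"
        using insert.hyps by (auto simp: fun_eq_iff restrict_def)
      ultimately show "ennreal (c / (a + t * b) ^ Suc (j + card I)) \<le> h (?z(i := u + t * v))"
        using insert.hyps by simp
    qed (use x y in \<open>auto simp: extensional_def\<close>)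
  qed (use insert.prems(5-) in \<open>auto simp: rw insert.prems fun_upd_def\<close>)
qed

text \<open>All \<open>DIM('a)\<close> coordinates bring the exponent down to 0. There the
  conclusion no longer depends on \<open>a\<close> and \<open>b\<close> and says that every
  \<open>c\<close> below both integrals is below the integral of \<open>h\<close>.\<close>

theorem Borell_Brascamp_Lieb_min:
  fixes f g h :: "'a::euclidean_space \<Rightarrow> ennreal"
  assumes f: "f \<in> borel_measurable borel" and g: "g \<in> borel_measurable borel" and h: "h \<in> borel_measurable borel"
    and t: "t \<ge> 0"
    and le: "\<And>x y a b c. a > 0 \<Longrightarrow> b > 0 \<Longrightarrow> c > 0 \<Longrightarrow> ennreal (c / a ^ DIM('a)) \<le> f x \<Longrightarrow>
      ennreal (c / b ^ DIM('a)) \<le> g y \<Longrightarrow> ennreal (c / (a + t * b) ^ DIM('a)) \<le> h (x + t *\<^sub>R y)"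
  shows "min (\<integral>\<^sup>+x. f x \<partial>lborel) (\<integral>\<^sup>+x. g x \<partial>lborel) \<le> (\<integral>\<^sup>+x. h x \<partial>lborel)"
proof (rule dense_le)
  fix w assume w: "w < min (\<integral>\<^sup>+x. f x \<partial>lborel) (\<integral>\<^sup>+x. g x \<partial>lborel)"
  then obtain c where c: "w = ennreal c" "c \<ge> 0" by (metis ennreal_cases not_less_iff_gr_or_eq top.extremum_strict)
  show "w \<le> (\<integral>\<^sup>+x. h x \<partial>lborel)"
  proof (cases "c = 0")
    case False
    let ?P = "PiM (Basis :: 'a set) (\<lambda>_. lborel :: real measure)"
    let ?e = "\<lambda>f. \<Sum>b\<in>(Basis :: 'a set). f b *\<^sub>R b"
    have L: "lborel = distr ?P borel ?e" unfolding lborel_eq_real by (subst lborel_def) simp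
    have e: "?e \<in> measurable ?P borel" by measurable
    have rw: "(\<integral>\<^sup>+x. k x \<partial>lborel) = (\<integral>\<^sup>+x. k (?e x) \<partial>?P)" if "k \<in> borel_measurable borel" for k
      using that e by (subst L, subst nn_integral_distr) auto
    have "ennreal (c / (1 + t * 1) ^ 0) \<le> (\<integral>\<^sup>+x. h (?e x) \<partial>?P)"
    proof (rule Borell_Brascamp_Lieb_PiM[where f = "\<lambda>x. f (?e x)" and g = "\<lambda>x. g (?e x)" and a = 1 and b = 1])
      fix x y :: "'a \<Rightarrow> real" and a b c :: real
      assume *: "a > 0" "b > 0" "c > 0" "ennreal (c / a ^ (0 + card (Basis :: 'a set))) \<le> f (?e x)"
        "ennreal (c / b ^ (0 + card (Basis :: 'a set))) \<le> g (?e y)"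
      have "?e (\<lambda>i\<in>Basis. x i + t * y i) = ?e x + t *\<^sub>R ?e y"
        by (simp add: scaleR_add_left sum.distrib scaleR_sum_right cong: sum.cong)
      then show "ennreal (c / (a + t * b) ^ (0 + card (Basis :: 'a set))) \<le> h (?e (\<lambda>i\<in>Basis. x i + t * y i))"
        using le * by simp
    qed (use t False c w f g h e rw in \<open>auto intro: measurable_compose[OF e]\<close>)
    then show ?thesis using c rw[OF h] by simp
  qed (use c in simp)
qed

section \<open>Sharp Sobolev inequality\<close>

lemma nn_integral_lborel_scale:
  fixes f :: "'a::euclidean_space \<Rightarrow> ennreal"
  assumes [measurable]: "f \<in> borel_measurable borel" and c: "c > 0"
  shows "(\<integral>\<^sup>+x. f (d + c *\<^sub>R x) \<partial>lborel) = ennreal (1 / c ^ DIM('a)) * (\<integral>\<^sup>+x. f x \<partial>lborel)"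
proof -
  have "(\<integral>\<^sup>+x. f x \<partial>lborel) = ennreal (c ^ DIM('a)) * (\<integral>\<^sup>+x. f (d + c *\<^sub>R x) \<partial>lborel)"
    using c by (subst lborel_affine[of c d]) (auto simp: nn_integral_density nn_integral_distr nn_integral_cmult)
  then show ?thesis using c by (simp add: mult.assoc[symmetric] ennreal_mult[symmetric])
qed

lemma nn_integral_inverse_power_shift:
  fixes \<alpha> :: real
  assumes "\<alpha> > 0" "n \<ge> 1"
  shows "(\<integral>\<^sup>+r. ennreal (1 / (\<alpha> + r) ^ Suc n) * indicator {0..} r \<partial>lborel) = ennreal (1 / (real n * \<alpha> ^ n))"
proof -
  let ?F = "\<lambda>r. - 1 / (real n * (\<alpha> + r) ^ n)"
  have "(\<integral>\<^sup>+r. ennreal (1 / (\<alpha> + r) ^ Suc n) * indicator {0..} r \<partial>lborel) = ennreal (0 - ?F 0)"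
  proof (rule nn_integral_FTC_atLeast)
    fix r :: real assume r: "0 \<le> r"
    then have "\<alpha> + r > 0" using assms by simp
    then show "(?F has_real_derivative 1 / (\<alpha> + r) ^ Suc n) (at r)"
      using assms by (auto intro!: derivative_eq_intros simp: power2_eq_square field_simps power_Suc[symmetric] simp del: power_Suc)
        (simp add: field_simps flip: power_add power_Suc)
    show "0 \<le> 1 / (\<alpha> + r) ^ Suc n" using \<open>\<alpha> + r > 0\<close> by simp
  next
    have "filterlim (\<lambda>r. real n * (\<alpha> + r) ^ n) at_top at_top"
      using assms by (intro filterlim_tendsto_pos_mult_at_top[OF tendsto_const] filterlim_pow_at_top
        filterlim_tendsto_add_at_top[OF tendsto_const] filterlim_ident) auto
    then show "(?F \<longlongrightarrow> 0) at_top"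
      by (intro tendsto_divide_0[OF tendsto_const] filterlim_at_top_imp_at_infinity)
  qed auto
  then show ?thesis by simp
qed

lemma nn_integral_inverse_powr_shift:
  fixes p :: real
  assumes "p > 1"
  shows "(\<integral>\<^sup>+r. ennreal ((1 + r) powr (- p)) * indicator {0..} r \<partial>lborel) = ennreal (1 / (p - 1))"
proof -
  let ?F = "\<lambda>r. (- 1 / (p - 1)) * (1 + r) powr (1 - p)"
  have "(\<integral>\<^sup>+r. ennreal ((1 + r) powr (- p)) * indicator {0..} r \<partial>lborel) = ennreal (0 - ?F 0)"
  proof (rule nn_integral_FTC_atLeast)
    fix r :: real assume r: "0 \<le> r"
    have "((\<lambda>r. (1 + r) powr (1 - p)) has_real_derivative (1 - p) * (1 + r) powr (- p)) (at r)"
      using r by (auto intro!: derivative_eq_intros)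
    then have "(?F has_real_derivative (- 1 / (p - 1)) * ((1 - p) * (1 + r) powr (- p))) (at r)"
      by (rule DERIV_cmult)
    moreover have "(- 1 / (p - 1)) * (1 - p) = 1" using assms by (simp add: field_simps)
    ultimately show "(?F has_real_derivative (1 + r) powr (- p)) (at r)"
      by (simp only: mult.assoc[symmetric] mult_1_left)
  next
    have "((\<lambda>r. (1 + r) powr (1 - p)) \<longlongrightarrow> 0) at_top"
      using assms by (intro tendsto_neg_powr filterlim_tendsto_add_at_top[OF tendsto_const] filterlim_ident) auto
    then show "(?F \<longlongrightarrow> 0) at_top" by (rule tendsto_mult_right_zero)
  qed auto
  then show ?thesis by simp
qed

text \<open>The two-parameter family below is closed under integration in \<open>s\<close>; comparing Tonelli
  with the scaling behaviour gives the recursion that is usually obtained by partial integration.\<close>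

definition Kint :: "'a::euclidean_space itself \<Rightarrow> nat \<Rightarrow> ennreal" where
  "Kint _ q = (\<integral>\<^sup>+z. ennreal (1 / (1 + (norm (z::'a))\<^sup>2) ^ q) \<partial>lborel)"

lemma nn_integral_paraboloid:
  fixes d :: "'a::euclidean_space"
  assumes "s > 0"
  shows "(\<integral>\<^sup>+z. ennreal (1 / (s\<^sup>2 + (norm (z - d))\<^sup>2) ^ q) \<partial>lborel)
    = ennreal (s powr (real DIM('a) - 2 * real q)) * Kint TYPE('a) q"
proof -
  have [measurable]: "(\<lambda>z::'a. 1 / (s\<^sup>2 + (norm (z - d))\<^sup>2) ^ q) \<in> borel_measurable borel" by measurable
  have "ennreal (1 / s ^ DIM('a)) * (\<integral>\<^sup>+z. ennreal (1 / (s\<^sup>2 + (norm (z - d))\<^sup>2) ^ q) \<partial>lborel)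
     = (\<integral>\<^sup>+z. ennreal (1 / (s\<^sup>2 + (norm (d + s *\<^sub>R z - d))\<^sup>2) ^ q) \<partial>lborel)"
    using assms by (subst nn_integral_lborel_scale) auto
  also have "\<dots> = (\<integral>\<^sup>+z. ennreal (1 / s ^ (2 * q)) * ennreal (1 / (1 + (norm (z::'a))\<^sup>2) ^ q) \<partial>lborel)"
  proof (intro nn_integral_cong)
    fix z :: 'a
    have "(s\<^sup>2 + (norm (d + s *\<^sub>R z - d))\<^sup>2) ^ q = s ^ (2 * q) * (1 + (norm z)\<^sup>2) ^ q"
      using assms by (simp add: power_mult_distrib power_mult flip: power_mult_distrib) (simp add: algebra_simps)
    then show "ennreal (1 / (s\<^sup>2 + (norm (d + s *\<^sub>R z - d))\<^sup>2) ^ q) = ennreal (1 / s ^ (2 * q)) * ennreal (1 / (1 + (norm z)\<^sup>2) ^ q)"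
      using assms by (simp add: ennreal_mult[symmetric])
  qed
  also have "\<dots> = ennreal (1 / s ^ (2 * q)) * Kint TYPE('a) q"
    by (simp add: Kint_def nn_integral_cmult)
  finally have "ennreal (s ^ DIM('a)) * (ennreal (1 / s ^ DIM('a)) * (\<integral>\<^sup>+z. ennreal (1 / (s\<^sup>2 + (norm (z - d))\<^sup>2) ^ q) \<partial>lborel))
     = ennreal (s ^ DIM('a)) * (ennreal (1 / s ^ (2 * q)) * Kint TYPE('a) q)" by simp
  moreover have "s ^ DIM('a) * (1 / s ^ (2 * q)) = s powr (real DIM('a) - 2 * real q)"
    using assms by (simp add: powr_diff powr_realpow flip: of_nat_mult) (metis of_nat_mult of_nat_numeral powr_realpow)
  ultimately show ?thesis
    using assms by (simp add: mult.assoc[symmetric] ennreal_mult[symmetric])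
qed

text \<open>Both sides equal the double integral of
  \<open>1 / (1 + (norm z)\<^sup>2 + r) ^ Suc q\<close> over \<open>z\<close> and
  \<open>r \<ge> 0\<close>. Integrating in \<open>r\<close> first leaves the power \<open>q\<close>;
  integrating in \<open>z\<close> first rescales by \<open>sqrt (1 + r)\<close> and leaves a pure
  power of \<open>1 + r\<close>.\<close>

lemma Kint_Suc:
  assumes "q \<ge> 1" "2 * q > DIM('a::euclidean_space)"
  shows "ennreal (1 / real q) * Kint TYPE('a) q = ennreal (2 / (2 * real q - real DIM('a))) * Kint TYPE('a) (Suc q)"
proof -
  have "(\<integral>\<^sup>+r. \<integral>\<^sup>+z. ennreal (1 / (1 + (norm (z::'a))\<^sup>2 + r) ^ Suc q) * indicator {0..} r \<partial>lborel \<partial>lborel)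
      = (\<integral>\<^sup>+z. \<integral>\<^sup>+r. ennreal (1 / (1 + (norm (z::'a))\<^sup>2 + r) ^ Suc q) * indicator {0..} r \<partial>lborel \<partial>lborel)"
    by (rule lborel_pair.Fubini') measurable
  also have "\<dots> = (\<integral>\<^sup>+z. ennreal (1 / (real q * (1 + (norm (z::'a))\<^sup>2) ^ q)) \<partial>lborel)"
    using assms by (intro nn_integral_cong nn_integral_inverse_power_shift) (auto simp: add_pos_nonneg)
  also have "\<dots> = (\<integral>\<^sup>+z. ennreal (1 / real q) * ennreal (1 / (1 + (norm (z::'a))\<^sup>2) ^ q) \<partial>lborel)"
    by (intro nn_integral_cong) (simp add: ennreal_mult[symmetric])
  also have "\<dots> = ennreal (1 / real q) * Kint TYPE('a) q"
    by (simp add: Kint_def nn_integral_cmult)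
  finally have 1: "ennreal (1 / real q) * Kint TYPE('a) q
     = (\<integral>\<^sup>+r. \<integral>\<^sup>+z. ennreal (1 / (1 + (norm (z::'a))\<^sup>2 + r) ^ Suc q) * indicator {0..} r \<partial>lborel \<partial>lborel)" by simp
  define p where "p = real (Suc q) - real DIM('a) / 2"
  have "(\<integral>\<^sup>+z. ennreal (1 / (1 + (norm (z::'a))\<^sup>2 + r) ^ Suc q) * indicator {0..} r \<partial>lborel)
      = ennreal ((1 + r) powr (- p)) * indicator {0..} r * Kint TYPE('a) (Suc q)" for r
  proof (cases "r \<ge> 0")
    case True
    have "(\<integral>\<^sup>+z. ennreal (1 / (1 + (norm (z::'a))\<^sup>2 + r) ^ Suc q) \<partial>lborel)
      = (\<integral>\<^sup>+z. ennreal (1 / ((sqrt (1 + r))\<^sup>2 + (norm ((z::'a) - 0))\<^sup>2) ^ Suc q) \<partial>lborel)"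
      using True by (simp add: algebra_simps)
    also have "\<dots> = ennreal (sqrt (1 + r) powr (real DIM('a) - 2 * real (Suc q))) * Kint TYPE('a) (Suc q)"
      using True by (intro nn_integral_paraboloid) auto
    also have "sqrt (1 + r) powr (real DIM('a) - 2 * real (Suc q)) = (1 + r) powr (- p)"
    proof -
      have "sqrt (1 + r) powr (real DIM('a) - 2 * real (Suc q)) = (1 + r) powr (1 / 2 * (real DIM('a) - 2 * real (Suc q)))"
        using True by (simp only: powr_half_sqrt[symmetric] powr_powr)
      also have "1 / 2 * (real DIM('a) - 2 * real (Suc q)) = - p" by (simp add: p_def)
      finally show ?thesis .
    qed
    finally show ?thesis using True by simp
  qed simp
  then have "ennreal (1 / real q) * Kint TYPE('a) q = (\<integral>\<^sup>+r. ennreal ((1 + r) powr (- p)) * indicator {0..} r \<partial>lborel) * Kint TYPE('a) (Suc q)"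
    unfolding 1 by (simp add: nn_integral_multc)
  also have "(\<integral>\<^sup>+r. ennreal ((1 + r) powr (- p)) * indicator {0..} r \<partial>lborel) = ennreal (1 / (p - 1))"
    using assms by (intro nn_integral_inverse_powr_shift) (simp add: p_def field_simps)
  also have "1 / (p - 1) = 2 / (2 * real q - real DIM('a))" by (simp add: p_def field_simps)
  finally show ?thesis .
qed

text \<open>Every coordinate is at most the norm, so the integrand is dominated by the product over
  the basis of the densities \<open>1 / (1 + (z \<bullet> b)\<^sup>2)\<close>, each of finite
  integral by the arctangent.\<close>

lemma Kint_DIM_finite: "Kint TYPE('a::euclidean_space) DIM('a) < top"
proof -
  have "(\<integral>\<^sup>+x. ennreal (1 / (1 + x\<^sup>2)) \<partial>lborel) < top"
  proof -
    have half: "(\<integral>\<^sup>+x. ennreal (1 / (1 + x\<^sup>2)) * indicator {0..} x \<partial>lborel) = ennreal (pi / 2 - arctan 0)"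
      by (rule nn_integral_FTC_atLeast)
        (auto intro!: derivative_eq_intros tendsto_arctan_at_top simp: power2_eq_square inverse_eq_divide add_nonneg_nonneg)
    have "(\<integral>\<^sup>+x. ennreal (1 / (1 + x\<^sup>2)) * indicator {..0} x \<partial>lborel)
      = (\<integral>\<^sup>+x. ennreal (1 / (1 + (0 + (-1) * x)\<^sup>2)) * indicator {..0} (0 + (-1) * x) \<partial>lborel)"
      by (subst nn_integral_real_affine[where c = "-1" and t = 0]) auto
    also have "\<dots> = (\<integral>\<^sup>+x. ennreal (1 / (1 + x\<^sup>2)) * indicator {0..} x \<partial>lborel)"
      by (intro nn_integral_cong) (auto simp: indicator_def)
    finally have half2: "(\<integral>\<^sup>+x. ennreal (1 / (1 + x\<^sup>2)) * indicator {..0} x \<partial>lborel) = ennreal (pi / 2 - arctan 0)"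
      using half by simp
    have "(\<integral>\<^sup>+x. ennreal (1 / (1 + x\<^sup>2)) \<partial>lborel) \<le> (\<integral>\<^sup>+x. ennreal (1 / (1 + x\<^sup>2)) * indicator {0..} x
        + ennreal (1 / (1 + x\<^sup>2)) * indicator {..0} x \<partial>lborel)"
      by (intro nn_integral_mono) (auto simp: indicator_def)
    also have "\<dots> = ennreal (pi / 2 - arctan 0) + ennreal (pi / 2 - arctan 0)"
      by (subst nn_integral_add) (auto simp: half half2)
    also have "\<dots> < top" by (simp add: ennreal_add_less_top)
    finally show ?thesis .
  qed
  then have "(\<Prod>b\<in>(Basis::'a set). (\<integral>\<^sup>+x. ennreal (1 / (1 + x\<^sup>2)) \<partial>lborel)) < top"
    by (simp add: power_less_top_ennreal)
  also have "(\<Prod>b\<in>(Basis::'a set). (\<integral>\<^sup>+x. ennreal (1 / (1 + x\<^sup>2)) \<partial>lborel))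
     = (\<integral>\<^sup>+z. (\<Prod>b\<in>(Basis::'a set). ennreal (1 / (1 + (z \<bullet> b)\<^sup>2))) \<partial>lborel)"
    by (rule nn_integral_lborel_prod[symmetric]) auto
  finally have fin: "(\<integral>\<^sup>+z. (\<Prod>b\<in>(Basis::'a set). ennreal (1 / (1 + (z \<bullet> b)\<^sup>2))) \<partial>lborel) < top" .
  have "Kint TYPE('a) DIM('a) \<le> (\<integral>\<^sup>+z. (\<Prod>b\<in>(Basis::'a set). ennreal (1 / (1 + (z \<bullet> b)\<^sup>2))) \<partial>lborel)"
    unfolding Kint_def
  proof (rule nn_integral_mono)
    fix z :: 'a
    have "(\<Prod>b\<in>(Basis::'a set). 1 / (1 + (norm z)\<^sup>2)) \<le> (\<Prod>b\<in>(Basis::'a set). 1 / (1 + (z \<bullet> b)\<^sup>2))"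
    proof (rule prod_mono, safe)
      fix b :: 'a assume "b \<in> Basis"
      then have "(z \<bullet> b)\<^sup>2 \<le> (norm z)\<^sup>2" using Basis_le_norm[of b z] by (simp add: abs_le_square_iff[symmetric])
      then show "1 / (1 + (norm z)\<^sup>2) \<le> 1 / (1 + (z \<bullet> b)\<^sup>2)"
        by (intro divide_left_mono) (auto intro!: mult_pos_pos add_pos_nonneg)
    qed auto
    then show "ennreal (1 / (1 + (norm z)\<^sup>2) ^ DIM('a)) \<le> (\<Prod>b\<in>(Basis::'a set). ennreal (1 / (1 + (z \<bullet> b)\<^sup>2)))"
      by (subst prod_ennreal) (auto simp: power_one_over intro!: ennreal_leI)
  qed
  with fin show ?thesis by (rule le_less_trans[rotated])
qed

lemma Kint_pos: "Kint TYPE('a::euclidean_space) q > 0"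
proof -
  have "Kint TYPE('a) q \<noteq> 0"
  proof
    assume "Kint TYPE('a) q = 0"
    then have "AE z in (lborel :: 'a measure). ennreal (1 / (1 + (norm z)\<^sup>2) ^ q) = 0"
      unfolding Kint_def by (subst (asm) nn_integral_0_iff_AE) auto
    moreover have "ennreal (1 / (1 + (norm z)\<^sup>2) ^ q) \<noteq> 0" for z :: 'a
    proof -
      have "1 + (norm z)\<^sup>2 > 0" by (simp add: add_pos_nonneg)
      then show ?thesis by simp
    qed
    ultimately have "AE z in (lborel :: 'a measure). False" by simp
    then show False
      using ae_filter_eq_bot_iff[of "lborel :: 'a measure"] emeasure_lborel_UNIV by (simp add: trivial_limit_def)
  qed
  then show ?thesis by (simp add: zero_less_iff_neq_zero)
qed

text \<open>Downward induction from \<open>q = DIM('a)\<close>: the recursion carries finiteness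
  from \<open>Suc q\<close> to \<open>q\<close> while \<open>2 * q - DIM('a)\<close> stays
  positive.\<close>

lemma Kint_finite:
  assumes "q \<ge> 1" "2 * q > DIM('a::euclidean_space)" "q \<le> DIM('a)"
  shows "Kint TYPE('a) q < top"
  using assms
proof (induction "DIM('a) - q" arbitrary: q)
  case 0
  then show ?case using Kint_DIM_finite[where 'a='a] by simp
next
  case (Suc k)
  then have "Kint TYPE('a) (Suc q) < top" by (intro Suc.hyps) auto
  then have "ennreal (1 / real q) * Kint TYPE('a) q < top"
    unfolding Kint_Suc[OF Suc.prems(1,2)] by (simp add: ennreal_mult_less_top)
  then show ?case using Suc.prems by (auto simp: ennreal_mult_less_top)
qed

section \<open>Sobolev inequality by inf-convolution\<close>

text \<open>Let \<open>\<Phi> u r\<close> be the integral of \<open>1 / (u + r) ^ N\<close> for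
  \<open>r \<ge> 0\<close>. The inequality in dimension \<open>N\<close> gives a bound by the
  minimum for \<open>\<Phi>\<close> as a function of \<open>r\<close>. Its suprema are attained at
  \<open>r = 0\<close> and agree for \<open>g\<close> and \<open>W\<close> by \<open>eq\<close>, so
  the one-dimensional inequality improves the minimum to a sum. Integrating in \<open>r\<close>
  lowers the exponent to \<open>N - 1\<close>.\<close>

lemma inf_convolution_nn_integral:
  fixes g W k :: "'a::euclidean_space \<Rightarrow> real"
  assumes [measurable]: "g \<in> borel_measurable borel" "W \<in> borel_measurable borel" "k \<in> borel_measurable borel"
    and pos: "\<And>z. g z > 0" "\<And>z. W z > 0" "\<And>z. k z > 0"
    and N: "DIM('a) \<ge> 2" and t: "t \<ge> 0"
    and eq: "(\<integral>\<^sup>+z. ennreal (1 / g z ^ DIM('a)) \<partial>lborel) = (\<integral>\<^sup>+z. ennreal (1 / W z ^ DIM('a)) \<partial>lborel)"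
    and le: "\<And>x y. k (x + t *\<^sub>R y) \<le> g x + t * W y"
  shows "(\<integral>\<^sup>+z. ennreal (1 / g z ^ (DIM('a) - 1)) \<partial>lborel) + ennreal t * (\<integral>\<^sup>+z. ennreal (1 / W z ^ (DIM('a) - 1)) \<partial>lborel)
    \<le> (\<integral>\<^sup>+z. ennreal (1 / k z ^ (DIM('a) - 1)) \<partial>lborel)"
proof -
  obtain n where n: "DIM('a) = Suc n" "n \<ge> 1" using N by (cases "DIM('a)") auto
  define \<Phi> where "\<Phi> u r = (\<integral>\<^sup>+z. ennreal (1 / (u z + r) ^ Suc n) * indicator {0..} r \<partial>lborel)" for u :: "'a \<Rightarrow> real" and r
  have \<Phi>m[measurable]: "\<Phi> u \<in> borel_measurable borel" if [measurable]: "u \<in> borel_measurable borel" for u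
    unfolding \<Phi>_def by measurable
  have int: "(\<integral>\<^sup>+r. \<Phi> u r \<partial>lborel) = ennreal (1 / real n) * (\<integral>\<^sup>+z. ennreal (1 / u z ^ n) \<partial>lborel)"
    if [measurable]: "u \<in> borel_measurable borel" and u: "\<And>z. u z > 0" for u
  proof -
    have "(\<integral>\<^sup>+r. \<Phi> u r \<partial>lborel) = (\<integral>\<^sup>+z. \<integral>\<^sup>+r. ennreal (1 / (u z + r) ^ Suc n) * indicator {0..} r \<partial>lborel \<partial>lborel)"
      unfolding \<Phi>_def by (rule lborel_pair.Fubini') measurable
    also have "\<dots> = (\<integral>\<^sup>+z. ennreal (1 / (real n * u z ^ n)) \<partial>lborel)"
      by (intro nn_integral_cong nn_integral_inverse_power_shift u n)
    also have "\<dots> = (\<integral>\<^sup>+z. ennreal (1 / real n) * ennreal (1 / u z ^ n) \<partial>lborel)"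
      using u by (intro nn_integral_cong) (simp add: ennreal_mult[symmetric] less_imp_le)
    finally show ?thesis by (simp add: nn_integral_cmult)
  qed
  have mono0: "\<Phi> u r \<le> \<Phi> u 0" if "\<And>z. u z > 0" for u r
    unfolding \<Phi>_def using that
    by (intro nn_integral_mono) (auto simp: indicator_def less_imp_le intro!: ennreal_leI divide_left_mono power_mono mult_pos_pos zero_less_power add_pos_nonneg simp del: power_Suc)
  have eq0: "\<Phi> g 0 = \<Phi> W 0" using eq by (simp add: \<Phi>_def n del: power_Suc)
  have "(\<integral>\<^sup>+r. \<Phi> g r \<partial>lborel) + ennreal t * (\<integral>\<^sup>+r. \<Phi> W r \<partial>lborel) \<le> (\<integral>\<^sup>+r. \<Phi> k r \<partial>lborel)"
  proof (rule Prekopa_Leindler_min_real)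
    show "(\<exists>x. l < \<Phi> g x) \<longleftrightarrow> (\<exists>y. l < \<Phi> W y)" for l
      using mono0[of g] mono0[of W] pos eq0 by (metis less_le_trans)
  next
    fix r s
    show "min (\<Phi> g r) (\<Phi> W s) \<le> \<Phi> k (r + t * s)"
    proof (cases "r \<ge> 0 \<and> s \<ge> 0")
      case True
      then have rs: "r + t * s \<ge> 0" using t by simp
      have "min (\<integral>\<^sup>+z. ennreal (1 / (g z + r) ^ Suc n) \<partial>lborel) (\<integral>\<^sup>+z. ennreal (1 / (W z + s) ^ Suc n) \<partial>lborel)
         \<le> (\<integral>\<^sup>+z. ennreal (1 / (k z + (r + t * s)) ^ Suc n) \<partial>lborel)"
      proof (rule Borell_Brascamp_Lieb_min[where t = t])
        fix x y :: 'a and a b c :: real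
        assume abc: "a > 0" "b > 0" "c > 0" and *: "ennreal (c / a ^ DIM('a)) \<le> ennreal (1 / (g x + r) ^ Suc n)"
          "ennreal (c / b ^ DIM('a)) \<le> ennreal (1 / (W y + s) ^ Suc n)"
        \<comment> \<open>The \<open>N\<close>-th root of \<open>c\<close> turns the two level
          conditions into the linear bounds \<open>d * (g x + r) \<le> a\<close> and
          \<open>d * (W y + s) \<le> b\<close>, which add up.\<close>
        define d where "d = root (Suc n) c"
        have d: "d > 0" "d ^ Suc n = c" using abc by (auto simp: d_def simp del: power_Suc)
        have dle: "d * v \<le> a" if "ennreal (c / a ^ DIM('a)) \<le> ennreal (1 / v ^ Suc n)" "v > 0" "a > 0" for a v
        proof -
          have "c / a ^ Suc n \<le> 1 / v ^ Suc n"
            using that abc by (simp add: ennreal_le_iff n del: power_Suc)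
          then have "(d * v) ^ Suc n \<le> a ^ Suc n"
            using that by (simp add: power_mult_distrib d field_simps del: power_Suc)
          then show ?thesis by (rule power_le_imp_le_base) (use that in simp)
        qed
        have A: "d * (g x + r) \<le> a" and B: "d * (W y + s) \<le> b"
          using dle[OF *(1)] dle[OF *(2)] pos True abc by (auto intro: add_pos_nonneg)
        have kp: "k (x + t *\<^sub>R y) + (r + t * s) > 0" using pos rs by (simp add: add_pos_nonneg)
        have "d * (k (x + t *\<^sub>R y) + (r + t * s)) \<le> d * ((g x + r) + t * (W y + s))"
          using le[of x y] d by (intro mult_left_mono) (auto simp: algebra_simps)
        also have "\<dots> = d * (g x + r) + t * (d * (W y + s))" by (simp add: algebra_simps)
        also have "\<dots> \<le> a + t * b" using A B t by (intro add_mono mult_left_mono) auto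
        finally have "(d * (k (x + t *\<^sub>R y) + (r + t * s))) ^ Suc n \<le> (a + t * b) ^ Suc n"
          using d kp by (intro power_mono) auto
        then have "c * (k (x + t *\<^sub>R y) + (r + t * s)) ^ Suc n \<le> (a + t * b) ^ Suc n"
          by (simp add: power_mult_distrib d del: power_Suc)
        moreover have "a + t * b > 0" using abc t by (simp add: add_pos_nonneg)
        ultimately show "ennreal (c / (a + t * b) ^ DIM('a)) \<le> ennreal (1 / (k (x + t *\<^sub>R y) + (r + t * s)) ^ Suc n)"
          using kp unfolding n by (intro ennreal_leI) (simp add: field_simps del: power_Suc)
      qed (use t in measurable)
      then show ?thesis using True rs by (simp add: \<Phi>_def del: power_Suc)
    next
      case False
      then have "min (\<Phi> g r) (\<Phi> W s) = 0" by (auto simp: \<Phi>_def min_def)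
      then show ?thesis by simp
    qed
  qed (use t in measurable)
  then have "ennreal (1 / real n) * ((\<integral>\<^sup>+z. ennreal (1 / g z ^ n) \<partial>lborel) + ennreal t * (\<integral>\<^sup>+z. ennreal (1 / W z ^ n) \<partial>lborel))
     \<le> ennreal (1 / real n) * (\<integral>\<^sup>+z. ennreal (1 / k z ^ n) \<partial>lborel)"
    using pos by (simp add: int distrib_left mult.left_commute)
  then have "ennreal (real n) * (ennreal (1 / real n) * ((\<integral>\<^sup>+z. ennreal (1 / g z ^ n) \<partial>lborel) + ennreal t * (\<integral>\<^sup>+z. ennreal (1 / W z ^ n) \<partial>lborel)))
     \<le> ennreal (real n) * (ennreal (1 / real n) * (\<integral>\<^sup>+z. ennreal (1 / k z ^ n) \<partial>lborel))"
    by (rule mult_left_mono) simp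
  then show ?thesis using n by (simp add: mult.assoc[symmetric] ennreal_mult[symmetric])
qed

text \<open>Convexity of \<open>x\<close> to the power \<open>- n\<close>, with the tangent taken at
  \<open>v\<close>; substituting \<open>y = v / u\<close> reduces it to Bernoulli's
  inequality.\<close>

lemma inverse_power_tangent:
  fixes u v :: real
  assumes "u > 0" "v > 0"
  shows "1 / v ^ n \<le> 1 / u ^ n + real n * (u - v) / v ^ Suc n"
proof -
  define y where "y = v / u"
  have y: "y > 0" using assms by (simp add: y_def)
  have "1 + real n * (y - 1) \<le> y ^ n" using Bernoulli_inequality[of "y - 1" n] y by simp
  moreover have "real n * ((y - 1) + (1 / y - 1)) \<ge> 0"
  proof -
    have "(y - 1) + (1 / y - 1) = (y - 1)\<^sup>2 / y" using y by (simp add: field_simps power2_eq_square)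
    then show ?thesis using y by simp
  qed
  ultimately have "1 \<le> y ^ n + real n * (1 / y - 1)" by (simp add: algebra_simps)
  then have "1 / v ^ n * 1 \<le> 1 / v ^ n * (y ^ n + real n * (1 / y - 1))"
    using assms by (intro mult_left_mono) auto
  also have "\<dots> = 1 / u ^ n + real n * (u - v) / v ^ Suc n"
    using assms by (simp add: y_def power_divide field_simps)
  finally show ?thesis by simp
qed

text \<open>This is the first-order term in \<open>t\<close> of the preceding inequality with
  \<open>W = (\<sigma>\<^sup>2 + (norm y)\<^sup>2) / 2\<close>. By Hopf-Lax, the inf-convolution is
  heuristically \<open>g + t * (\<sigma>\<^sup>2 - (norm dg)\<^sup>2) / 2\<close> to first order;
  \<open>k\<close> is a lower bound of that form, with \<open>\<eta>\<close> absorbing the failure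
  of \<open>g\<close> to be exactly semiconvex. Dividing by \<open>t\<close> and letting it tend to
  0 leaves \<open>V\<close>, \<open>X\<close> and \<open>D\<close>.\<close>

lemma sharp_Sobolev_approx:
  fixes g :: "'a::euclidean_space \<Rightarrow> real" and dg :: "'a \<Rightarrow> 'a"
  assumes [measurable]: "g \<in> borel_measurable borel" "dg \<in> borel_measurable borel"
    and N: "DIM('a) \<ge> 3" and c: "c > 0"
    and glow: "\<And>z. c * (1 + (norm z)\<^sup>2) \<le> g z"
    and dgup: "\<And>z. (norm (dg z))\<^sup>2 \<le> C * g z"
    and \<eta>: "\<eta> > 0" "\<eta> < 1/4" "\<eta> < \<sigma>\<^sup>2" and \<sigma>: "\<sigma> > 0"
    and semi: "\<And>z h. g z + dg z \<bullet> h - \<eta> * norm h - L * (norm h)\<^sup>2 \<le> g (z + h)"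
    and X: "(\<integral>\<^sup>+z. ennreal (1 / g z ^ DIM('a)) \<partial>lborel) = ennreal X" "X \<ge> 0"
    and D: "(\<integral>\<^sup>+z. ennreal ((norm (dg z))\<^sup>2 / g z ^ DIM('a)) \<partial>lborel) = ennreal D" "D \<ge> 0"
    and XW: "(\<integral>\<^sup>+z. ennreal (1 / ((\<sigma>\<^sup>2 + (norm (z::'a))\<^sup>2) / 2) ^ DIM('a)) \<partial>lborel) = ennreal X"
    and V: "(\<integral>\<^sup>+z. ennreal (1 / ((\<sigma>\<^sup>2 + (norm (z::'a))\<^sup>2) / 2) ^ (DIM('a) - 1)) \<partial>lborel) = ennreal V" "V \<ge> 0"
  shows "V + (real DIM('a) - 1) * (\<sigma>\<^sup>2 - \<eta>) / 2 * X \<le> (real DIM('a) - 1) / (2 * (1 - 2 * \<eta>)) * D"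
proof -
  obtain n where n: "DIM('a) = Suc n" "n \<ge> 2" using N by (cases "DIM('a)") auto
  define q where "q = 1 - 2 * \<eta>"
  have q: "q > 0" using \<eta> by (simp add: q_def)
  have z1: "1 \<le> 1 + (norm (z::'a))\<^sup>2" for z by simp
  have gc: "c \<le> g z" for z
    using order_trans[OF mult_left_mono[OF z1[of z], of c] glow[of z]] c by simp
  have gpos: "g z > 0" for z using gc[of z] c by simp
  have C: "C \<ge> 0" using dgup[of 0] gpos[of 0] by (smt (verit) mult_neg_pos zero_le_power2)
  define L' where "L' = max L 0"
  \<comment> \<open>These constants confine \<open>k / g\<close> to the interval from
    \<open>1 - t * M1\<close> to \<open>1 + t * M2\<close>, so powers of \<open>k\<close> may be
    replaced by powers of \<open>g\<close> at a cost that disappears with \<open>t\<close>.\<close>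
  define M1 where "M1 = C / (2 * q) + \<eta> / (2 * c)"
  define M2 where "M2 = \<sigma>\<^sup>2 / (2 * c)"
  have M: "M1 > 0" "M2 \<ge> 0" using q C c \<eta> by (auto simp: M1_def M2_def add_nonneg_pos)
  \<comment> \<open>Finiteness allows \<open>G\<close> to be cancelled from both sides. The exponent
    \<open>N - 1\<close> exceeds \<open>N / 2\<close> because \<open>N \<ge> 3\<close>.\<close>
  obtain G where G: "(\<integral>\<^sup>+z. ennreal (1 / g z ^ n) \<partial>lborel) = ennreal G" "G \<ge> 0"
  proof -
    have "(\<integral>\<^sup>+z. ennreal (1 / g z ^ n) \<partial>lborel) \<le> (\<integral>\<^sup>+z. ennreal (1 / c ^ n) * ennreal (1 / (1 + (norm (z::'a))\<^sup>2) ^ n) \<partial>lborel)"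
    proof (rule nn_integral_mono)
      fix z :: 'a
      have "(c * (1 + (norm z)\<^sup>2)) ^ n \<le> g z ^ n" using glow c by (intro power_mono) auto
      then have "1 / g z ^ n \<le> 1 / (c * (1 + (norm z)\<^sup>2)) ^ n"
        using gpos[of z] c z1[of z] by (intro divide_left_mono) (auto intro!: mult_pos_pos zero_less_power add_pos_nonneg)
      then show "ennreal (1 / g z ^ n) \<le> ennreal (1 / c ^ n) * ennreal (1 / (1 + (norm z)\<^sup>2) ^ n)"
        using c by (auto simp: ennreal_mult[symmetric] power_mult_distrib intro!: ennreal_leI)
    qed
    also have "\<dots> = ennreal (1 / c ^ n) * Kint TYPE('a) n" by (simp add: Kint_def nn_integral_cmult)
    also have "\<dots> < top" using Kint_finite[where 'a='a, of n] n by (simp add: ennreal_mult_less_top)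
    finally show ?thesis using that by (metis ennreal_cases less_irrefl)
  qed
  have main: "V + real n * (\<sigma>\<^sup>2 - \<eta>) / 2 * (1 / (1 + t * M2) ^ Suc n) * X \<le> real n / (2 * q) * (1 / (1 - t * M1) ^ Suc n) * D"
    if t: "t > 0" "2 * L' * t \<le> \<eta>" "t * M1 < 1" for t
  proof -
    define W where "W y = (\<sigma>\<^sup>2 + (norm (y::'a))\<^sup>2) / 2" for y
    \<comment> \<open>The losses \<open>\<eta> * norm y\<close> and
      \<open>(\<eta> / 2) * (norm y)\<^sup>2\<close> take at most \<open>\<eta> / 2\<close> from the
      constant and \<open>\<eta> * (norm y)\<^sup>2\<close> from the quadratic part of
      \<open>W\<close>; this is the room left by \<open>\<sigma>\<^sup>2 - \<eta>\<close> and
      \<open>q = 1 - 2 * \<eta>\<close>.\<close>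
    define k where "k z = g z + t * ((\<sigma>\<^sup>2 - \<eta>) / 2 - (norm (dg z))\<^sup>2 / (2 * q))" for z
    have [measurable]: "W \<in> borel_measurable borel" "k \<in> borel_measurable borel" unfolding W_def k_def by measurable
    have Wpos: "W y > 0" for y using \<sigma> by (simp add: W_def add_pos_nonneg)
    have klow: "g z * (1 - t * M1) \<le> k z" for z
    proof -
      have "(norm (dg z))\<^sup>2 / (2 * q) \<le> C * g z / (2 * q)" using dgup[of z] q by (intro divide_right_mono) auto
      then have "(norm (dg z))\<^sup>2 / (2 * q) \<le> C / (2 * q) * g z" by simp
      moreover have "\<eta> / 2 \<le> \<eta> / (2 * c) * g z" using gc[of z] c \<eta> by (simp add: field_simps)
      ultimately have "- (g z * M1) \<le> (\<sigma>\<^sup>2 - \<eta>) / 2 - (norm (dg z))\<^sup>2 / (2 * q)"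
      proof -
        have "g z * M1 = C / (2 * q) * g z + \<eta> / (2 * c) * g z" by (simp add: M1_def distrib_left mult.commute)
        moreover have "(\<sigma>\<^sup>2 - \<eta>) / 2 \<ge> - \<eta> / 2" by simp
        ultimately show ?thesis
          using \<open>(norm (dg z))\<^sup>2 / (2 * q) \<le> C / (2 * q) * g z\<close> \<open>\<eta> / 2 \<le> \<eta> / (2 * c) * g z\<close> by linarith
      qed
      from mult_left_mono[OF this, of t] t have "g z + t * - (g z * M1) \<le> k z" by (simp add: k_def del: mult_minus_right)
      moreover have "g z + t * - (g z * M1) = g z * (1 - t * M1)" by (simp add: algebra_simps)
      ultimately show ?thesis by simp
    qed
    have kup: "k z \<le> g z * (1 + t * M2)" for z
    proof -
      have "\<sigma>\<^sup>2 / 2 \<le> M2 * g z" using gc[of z] c mult_left_mono[of c "g z" "\<sigma>\<^sup>2"] by (simp add: M2_def field_simps)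
      moreover have "(norm (dg z))\<^sup>2 / (2 * q) \<ge> 0" using q by simp
      ultimately have "(\<sigma>\<^sup>2 - \<eta>) / 2 - (norm (dg z))\<^sup>2 / (2 * q) \<le> g z * M2"
        using \<eta> by (simp add: algebra_simps diff_divide_distrib)
      from mult_left_mono[OF this, of t] t have "k z \<le> g z + t * (g z * M2)" by (simp add: k_def)
      moreover have "g z + t * (g z * M2) = g z * (1 + t * M2)" by (simp add: algebra_simps)
      ultimately show ?thesis by simp
    qed
    have m1: "1 - t * M1 > 0" and m2: "1 + t * M2 > 0" using t M by (auto intro: add_pos_nonneg)
    have kpos: "k z > 0" for z using klow[of z] gpos[of z] m1 by (smt (verit) mult_pos_pos)
    have conv: "k (x + t *\<^sub>R y) \<le> g x + t * W y" for x y
    proof -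
      define z where "z = x + t *\<^sub>R y"
      have "g z + dg z \<bullet> (- t *\<^sub>R y) - \<eta> * norm (- t *\<^sub>R y) - L * (norm (- t *\<^sub>R y))\<^sup>2 \<le> g (z + (- t *\<^sub>R y))"
        by (rule semi)
      then have 1: "g z - t * (dg z \<bullet> y) - t * (\<eta> * norm y) - L * (t\<^sup>2 * (norm y)\<^sup>2) \<le> g x"
        using t by (simp add: z_def power_mult_distrib mult.left_commute)
      have "L * (t\<^sup>2 * (norm y)\<^sup>2) \<le> L' * (t\<^sup>2 * (norm y)\<^sup>2)" by (intro mult_right_mono) (auto simp: L'_def)
      also have "\<dots> = t * ((L' * t) * (norm y)\<^sup>2)" by (simp add: power2_eq_square)
      also have "\<dots> \<le> t * ((\<eta> / 2) * (norm y)\<^sup>2)" using t by (intro mult_left_mono mult_right_mono) auto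
      finally have 2: "L * (t\<^sup>2 * (norm y)\<^sup>2) \<le> t * ((\<eta> / 2) * (norm y)\<^sup>2)" .
      have "0 \<le> (norm y - 1)\<^sup>2" by simp
      then have "norm y \<le> (1 + (norm y)\<^sup>2) / 2" by (simp add: power2_diff)
      then have 3: "\<eta> * norm y \<le> \<eta> * ((1 + (norm y)\<^sup>2) / 2)" using \<eta> by (intro mult_left_mono) auto
      have "0 \<le> (q * norm y - norm (dg z))\<^sup>2 / (2 * q)" using q by simp
      also have "\<dots> = q * (norm y)\<^sup>2 / 2 - norm (dg z) * norm y + (norm (dg z))\<^sup>2 / (2 * q)"
        using q by (simp add: power2_diff field_simps power2_eq_square)
      finally have "norm (dg z) * norm y \<le> q * (norm y)\<^sup>2 / 2 + (norm (dg z))\<^sup>2 / (2 * q)" by simp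
      then have 4: "dg z \<bullet> y \<le> q * (norm y)\<^sup>2 / 2 + (norm (dg z))\<^sup>2 / (2 * q)"
        using norm_cauchy_schwarz[of "dg z" y] by linarith
      have "(\<sigma>\<^sup>2 - \<eta>) / 2 - (norm (dg z))\<^sup>2 / (2 * q) + dg z \<bullet> y + \<eta> * norm y + (\<eta> / 2) * (norm y)\<^sup>2 \<le> W y"
        using 3 4 unfolding W_def q_def by (simp add: field_simps)
      from mult_left_mono[OF this, of t] t have "t * ((\<sigma>\<^sup>2 - \<eta>) / 2 - (norm (dg z))\<^sup>2 / (2 * q)) + t * (dg z \<bullet> y) + t * (\<eta> * norm y) + t * ((\<eta> / 2) * (norm y)\<^sup>2) \<le> t * W y"
        by (simp add: distrib_left)
      with 1 2 show ?thesis by (simp add: k_def z_def[symmetric])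
    qed
    have A: "ennreal G + ennreal t * ennreal V \<le> (\<integral>\<^sup>+z. ennreal (1 / k z ^ n) \<partial>lborel)"
    proof -
      have "(\<integral>\<^sup>+z. ennreal (1 / g z ^ (DIM('a) - 1)) \<partial>lborel) + ennreal t * (\<integral>\<^sup>+z. ennreal (1 / W z ^ (DIM('a) - 1)) \<partial>lborel)
        \<le> (\<integral>\<^sup>+z. ennreal (1 / k z ^ (DIM('a) - 1)) \<partial>lborel)"
        by (rule inf_convolution_nn_integral) (use N t gpos Wpos kpos conv X XW in \<open>auto simp: W_def\<close>)
      then show ?thesis using G V by (simp add: n W_def)
    qed
    define p where "p = t * (real n * (\<sigma>\<^sup>2 - \<eta>) / 2 * (1 / (1 + t * M2) ^ Suc n))"
    define r where "r = t * (real n / (2 * q) * (1 / (1 - t * M1) ^ Suc n))"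
    have pr: "p \<ge> 0" "r \<ge> 0" using t \<eta> m1 m2 q by (auto simp: p_def r_def)
    \<comment> \<open>The tangent inequality at \<open>k z\<close>, arranged so that both sides have
      nonnegative terms only and can be integrated as they stand.\<close>
    have pw: "1 / k z ^ n + p * (1 / g z ^ Suc n) \<le> 1 / g z ^ n + r * ((norm (dg z))\<^sup>2 / g z ^ Suc n)" for z
    proof -
      have kn: "k z ^ Suc n > 0" using kpos by (rule zero_less_power)
      have "1 / k z ^ n \<le> 1 / g z ^ n + real n * (g z - k z) / k z ^ Suc n"
        by (rule inverse_power_tangent[OF gpos kpos])
      also have "real n * (g z - k z) / k z ^ Suc n = t * (real n / (2 * q)) * (norm (dg z))\<^sup>2 * (1 / k z ^ Suc n)
          - t * (real n * (\<sigma>\<^sup>2 - \<eta>) / 2) * (1 / k z ^ Suc n)"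
      proof -
        have gk: "g z - k z = t * ((norm (dg z))\<^sup>2 / (2 * q) - (\<sigma>\<^sup>2 - \<eta>) / 2)"
          by (simp add: k_def right_diff_distrib)
        have "real n * (t * (a / (2 * q) - b / 2)) / K = t * (real n / (2 * q)) * a * (1 / K) - t * (real n * b / 2) * (1 / K)"
          for a b K :: real by (simp add: right_diff_distrib diff_divide_distrib mult_ac)
        then show ?thesis unfolding gk .
      qed
      finally have 0: "1 / k z ^ n \<le> 1 / g z ^ n + (t * (real n / (2 * q)) * (norm (dg z))\<^sup>2 * (1 / k z ^ Suc n)
          - t * (real n * (\<sigma>\<^sup>2 - \<eta>) / 2) * (1 / k z ^ Suc n))" .
      have "(g z * (1 - t * M1)) ^ Suc n \<le> k z ^ Suc n" using klow gpos m1 by (intro power_mono) (auto simp: less_imp_le)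
      then have "1 / k z ^ Suc n \<le> 1 / (g z * (1 - t * M1)) ^ Suc n"
        using gpos[of z] m1 kn by (intro divide_left_mono) auto
      then have "t * (real n / (2 * q)) * (norm (dg z))\<^sup>2 * (1 / k z ^ Suc n) \<le> t * (real n / (2 * q)) * (norm (dg z))\<^sup>2 * (1 / (g z * (1 - t * M1)) ^ Suc n)"
        using t q by (intro mult_left_mono) auto
      also have "\<dots> = r * ((norm (dg z))\<^sup>2 / g z ^ Suc n)" by (simp add: r_def power_mult_distrib)
      finally have 1: "t * (real n / (2 * q)) * (norm (dg z))\<^sup>2 * (1 / k z ^ Suc n) \<le> r * ((norm (dg z))\<^sup>2 / g z ^ Suc n)" .
      have "k z ^ Suc n \<le> (g z * (1 + t * M2)) ^ Suc n" using kup kpos by (intro power_mono) (auto simp: less_imp_le)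
      then have "1 / (g z * (1 + t * M2)) ^ Suc n \<le> 1 / k z ^ Suc n"
        using gpos[of z] m2 kn by (intro divide_left_mono) auto
      then have "t * (real n * (\<sigma>\<^sup>2 - \<eta>) / 2) * (1 / (g z * (1 + t * M2)) ^ Suc n) \<le> t * (real n * (\<sigma>\<^sup>2 - \<eta>) / 2) * (1 / k z ^ Suc n)"
        using t \<eta> by (intro mult_left_mono) auto
      moreover have "t * (real n * (\<sigma>\<^sup>2 - \<eta>) / 2) * (1 / (g z * (1 + t * M2)) ^ Suc n) = p * (1 / g z ^ Suc n)"
        by (simp add: p_def power_mult_distrib)
      ultimately show ?thesis using 0 1 by linarith
    qed
    have "ennreal G + ennreal t * ennreal V + ennreal p * ennreal X
       \<le> (\<integral>\<^sup>+z. ennreal (1 / k z ^ n) \<partial>lborel) + ennreal p * (\<integral>\<^sup>+z. ennreal (1 / g z ^ Suc n) \<partial>lborel)"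
      using A X n by (intro add_mono) (auto simp del: power_Suc)
    also have "\<dots> = (\<integral>\<^sup>+z. ennreal (1 / k z ^ n + p * (1 / g z ^ Suc n)) \<partial>lborel)"
      using pr kpos gpos by (simp add: nn_integral_add[symmetric] nn_integral_cmult[symmetric] ennreal_mult[symmetric]
          ennreal_plus[symmetric] less_imp_le del: ennreal_plus power_Suc)
    also have "\<dots> \<le> (\<integral>\<^sup>+z. ennreal (1 / g z ^ n + r * ((norm (dg z))\<^sup>2 / g z ^ Suc n)) \<partial>lborel)"
      by (intro nn_integral_mono ennreal_leI pw)
    also have "\<dots> = ennreal G + ennreal r * ennreal D"
      using pr gpos G D n by (simp add: nn_integral_add[symmetric] nn_integral_cmult[symmetric] ennreal_mult[symmetric]
          ennreal_plus[symmetric] less_imp_le del: ennreal_plus power_Suc flip: G(1) D(1))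
    finally have "ennreal (G + t * V + p * X) \<le> ennreal (G + r * D)"
      using G V X D pr t by (simp add: ennreal_plus ennreal_mult)
    then have "G + t * V + p * X \<le> G + r * D" using G D pr by (subst (asm) ennreal_le_iff) auto
    then have "t * (V + real n * (\<sigma>\<^sup>2 - \<eta>) / 2 * (1 / (1 + t * M2) ^ Suc n) * X) \<le> t * (real n / (2 * q) * (1 / (1 - t * M1) ^ Suc n) * D)"
      by (simp add: p_def r_def algebra_simps)
    then show ?thesis using t(1) by (rule mult_left_le_imp_le)
  qed
  have "V + real n * (\<sigma>\<^sup>2 - \<eta>) / 2 * (1 / (1 + 0 * M2) ^ Suc n) * X \<le> real n / (2 * q) * (1 / (1 - 0 * M1) ^ Suc n) * D"
  proof (rule tendsto_le)
    show "((\<lambda>t. real n / (2 * q) * (1 / (1 - t * M1) ^ Suc n) * D) \<longlongrightarrow> real n / (2 * q) * (1 / (1 - 0 * M1) ^ Suc n) * D) (at_right 0)"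
      by (intro tendsto_intros) auto
    show "((\<lambda>t. V + real n * (\<sigma>\<^sup>2 - \<eta>) / 2 * (1 / (1 + t * M2) ^ Suc n) * X) \<longlongrightarrow> V + real n * (\<sigma>\<^sup>2 - \<eta>) / 2 * (1 / (1 + 0 * M2) ^ Suc n) * X) (at_right 0)"
      by (intro tendsto_intros) auto
    have "((\<lambda>t. 2 * L' * t) \<longlongrightarrow> 2 * L' * 0) (at_right 0)" by (intro tendsto_intros)
    then have e1: "\<forall>\<^sub>F t in at_right 0. 2 * L' * t < \<eta>" using \<eta> by (intro order_tendstoD) auto
    have "((\<lambda>t. t * M1) \<longlongrightarrow> 0 * M1) (at_right 0)" by (intro tendsto_intros)
    then have e2: "\<forall>\<^sub>F t in at_right 0. t * M1 < 1" by (intro order_tendstoD) auto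
    show "\<forall>\<^sub>F t in at_right 0. V + real n * (\<sigma>\<^sup>2 - \<eta>) / 2 * (1 / (1 + t * M2) ^ Suc n) * X \<le> real n / (2 * q) * (1 / (1 - t * M1) ^ Suc n) * D"
      using e1 e2 eventually_at_right_less[of 0] by eventually_elim (intro main, auto)
  qed simp
  then show ?thesis by (simp add: n q_def)
qed

text \<open>For \<open>u = g powr (- (N - 2) / 2)\<close> this is the classical sharp Sobolev
  inequality. The comparison paraboloid is scaled to have the same integral \<open>X\<close> as
  \<open>g\<close>; after \<open>\<eta>\<close> tends to 0, \<open>D\<close> is bounded below by
  \<open>2 / (N' - 1) * V + \<sigma>\<^sup>2 * X\<close>, which the recursion for
  \<open>Kint\<close> evaluates in closed form.\<close>

theorem sharp_Sobolev:
  fixes g :: "'a::euclidean_space \<Rightarrow> real" and dg :: "'a \<Rightarrow> 'a"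
  assumes meas: "g \<in> borel_measurable borel" "dg \<in> borel_measurable borel"
    and N: "DIM('a) \<ge> 3" and c: "c > 0"
    and glow: "\<And>z. c * (1 + (norm z)\<^sup>2) \<le> g z"
    and dgup: "\<And>z. (norm (dg z))\<^sup>2 \<le> C * g z"
    and semi: "\<And>\<eta>. \<eta> > 0 \<Longrightarrow> \<exists>L. \<forall>z h. g z + dg z \<bullet> h - \<eta> * norm h - L * (norm h)\<^sup>2 \<le> g (z + h)"
    and X: "(\<integral>\<^sup>+z. ennreal (1 / g z ^ DIM('a)) \<partial>lborel) = ennreal X" "X \<ge> 0"
    and D: "(\<integral>\<^sup>+z. ennreal ((norm (dg z))\<^sup>2 / g z ^ DIM('a)) \<partial>lborel) = ennreal D" "D \<ge> 0"
  shows "4 * real DIM('a) / (real DIM('a) - 2) * enn2real (Kint TYPE('a) DIM('a)) powr (2 / real DIM('a))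
      * X powr ((real DIM('a) - 2) / real DIM('a)) \<le> D"
proof (cases "X = 0")
  case True
  then show ?thesis using D by simp
next
  case False
  then have X0: "X > 0" using X by simp
  define N' where "N' = real DIM('a)"
  have N': "N' \<ge> 3" using N by (simp add: N'_def)
  define I where "I = enn2real (Kint TYPE('a) DIM('a))"
  have KI: "Kint TYPE('a) DIM('a) = ennreal I" using Kint_DIM_finite[where 'a='a] by (simp add: I_def)
  have I: "I > 0" using Kint_pos[where 'a='a, of "DIM('a)"] by (simp add: KI)
  have KI': "Kint TYPE('a) (DIM('a) - 1) = ennreal (2 * (N' - 1) / (N' - 2) * I)"
  proof -
    have "ennreal (1 / real (DIM('a) - 1)) * Kint TYPE('a) (DIM('a) - 1)
       = ennreal (2 / (2 * real (DIM('a) - 1) - real DIM('a))) * Kint TYPE('a) (Suc (DIM('a) - 1))"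
      using N by (intro Kint_Suc) auto
    then have "ennreal (N' - 1) * (ennreal (1 / (N' - 1)) * Kint TYPE('a) (DIM('a) - 1))
       = ennreal (N' - 1) * (ennreal (2 / (N' - 2)) * ennreal I)"
      using N by (simp add: KI N'_def of_nat_diff)
    then show ?thesis using N' I by (simp add: mult.assoc[symmetric] ennreal_mult[symmetric])
  qed
  \<comment> \<open>By scaling, the integral of \<open>1 / W ^ N\<close> is
    \<open>2 ^ N * \<sigma> powr (- N) * I\<close>; this \<open>\<sigma>\<close> makes it equal to
    \<open>X\<close>.\<close>
  define \<sigma> where "\<sigma> = 2 * (I / X) powr (1 / N')"
  have \<sigma>: "\<sigma> > 0" using I X0 by (simp add: \<sigma>_def)
  have \<sigma>N: "\<sigma> powr (- N') = 2 powr (- N') * (X / I)"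
    using I X0 N' by (simp add: \<sigma>_def powr_mult powr_powr powr_minus inverse_eq_divide)
  have W: "(\<integral>\<^sup>+z. ennreal (1 / ((\<sigma>\<^sup>2 + (norm (z::'a))\<^sup>2) / 2) ^ m) \<partial>lborel)
      = ennreal (2 ^ m * \<sigma> powr (N' - 2 * real m)) * Kint TYPE('a) m" for m
  proof -
    have "(\<integral>\<^sup>+z. ennreal (1 / ((\<sigma>\<^sup>2 + (norm (z::'a))\<^sup>2) / 2) ^ m) \<partial>lborel)
       = (\<integral>\<^sup>+z. ennreal (2 ^ m) * ennreal (1 / (\<sigma>\<^sup>2 + (norm ((z::'a) - 0))\<^sup>2) ^ m) \<partial>lborel)"
      by (intro nn_integral_cong) (simp add: ennreal_mult[symmetric] power_divide)
    also have "\<dots> = ennreal (2 ^ m) * (ennreal (\<sigma> powr (real DIM('a) - 2 * real m)) * Kint TYPE('a) m)"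
      using \<sigma> by (subst nn_integral_cmult) (auto simp: nn_integral_paraboloid[where d = 0, simplified])
    finally show ?thesis by (simp add: N'_def mult.assoc[symmetric] ennreal_mult[symmetric])
  qed
  have XW: "(\<integral>\<^sup>+z. ennreal (1 / ((\<sigma>\<^sup>2 + (norm (z::'a))\<^sup>2) / 2) ^ DIM('a)) \<partial>lborel) = ennreal X"
  proof -
    have "2 ^ DIM('a) * \<sigma> powr (N' - 2 * real DIM('a)) * I = X"
      using \<sigma>N I by (simp add: N'_def[symmetric] powr_realpow[symmetric] powr_minus)
    then show ?thesis unfolding W KI using I by (simp add: ennreal_mult[symmetric])
  qed
  define V where "V = 2 ^ (DIM('a) - 1) * \<sigma> powr (N' - 2 * (N' - 1)) * (2 * (N' - 1) / (N' - 2) * I)"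
  have V0: "V \<ge> 0" using N' I by (simp add: V_def)
  have VW: "(\<integral>\<^sup>+z. ennreal (1 / ((\<sigma>\<^sup>2 + (norm (z::'a))\<^sup>2) / 2) ^ (DIM('a) - 1)) \<partial>lborel) = ennreal V"
    unfolding W KI' V_def using N' I N by (simp add: ennreal_mult[symmetric] N'_def of_nat_diff)
  have "V + (N' - 1) * (\<sigma>\<^sup>2 - 0) / 2 * X \<le> (N' - 1) / (2 * (1 - 2 * 0)) * D"
  proof (rule tendsto_le)
    show "((\<lambda>\<eta>. (N' - 1) / (2 * (1 - 2 * \<eta>)) * D) \<longlongrightarrow> (N' - 1) / (2 * (1 - 2 * 0)) * D) (at_right 0)"
      by (intro tendsto_intros) auto
    show "((\<lambda>\<eta>. V + (N' - 1) * (\<sigma>\<^sup>2 - \<eta>) / 2 * X) \<longlongrightarrow> V + (N' - 1) * (\<sigma>\<^sup>2 - 0) / 2 * X) (at_right 0)"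
      by (intro tendsto_intros) auto
    have "\<forall>\<^sub>F \<eta> in at_right 0. \<eta> < min (1/4) (\<sigma>\<^sup>2)"
      using \<sigma> by (intro order_tendstoD[OF tendsto_ident_at]) auto
    then show "\<forall>\<^sub>F \<eta> in at_right 0. V + (N' - 1) * (\<sigma>\<^sup>2 - \<eta>) / 2 * X \<le> (N' - 1) / (2 * (1 - 2 * \<eta>)) * D"
      using eventually_at_right_less[of 0]
    proof eventually_elim
      case (elim \<eta>)
      obtain L where "\<And>z h. g z + dg z \<bullet> h - \<eta> * norm h - L * (norm h)\<^sup>2 \<le> g (z + h)"
        using semi[of \<eta>] elim by auto
      then show ?case unfolding N'_def
        using elim \<sigma> by (intro sharp_Sobolev_approx[OF meas N c glow dgup _ _ _ _ _ X D XW VW V0]) auto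
    qed
  qed simp
  then have *: "2 / (N' - 1) * V + \<sigma>\<^sup>2 * X \<le> D" using N' by (simp add: field_simps)
  have p2: "2 ^ (DIM('a) - 1) = 2 powr (N' - 1)"
    using N by (simp add: powr_realpow[symmetric] N'_def of_nat_diff)
  have \<sigma>2: "\<sigma>\<^sup>2 = 4 * (I / X) powr (2 / N')"
    using I X0 by (simp add: \<sigma>_def power_mult_distrib powr_power)
  have "2 / (N' - 1) * V = 2 / (N' - 1) * (2 powr (N' - 1) * (\<sigma> powr (- N') * \<sigma> powr 2) * (2 * (N' - 1) / (N' - 2) * I))"
    unfolding V_def p2 by (simp add: powr_add[symmetric])
  also have "\<dots> = 2 * (2 powr (N' - 1) * 2 powr (- N')) * (X * \<sigma>\<^sup>2) * (2 / (N' - 2))"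
  proof -
    have r: "c1 * (p * (P * y * s) * (c2 * I)) = (c1 * c2) * (p * P) * ((y * I) * s)" for c1 c2 p P y s
      by (simp add: mult_ac)
    have "2 / (N' - 1) * (2 * (N' - 1) / (N' - 2)) = 2 * (2 / (N' - 2))" using N' by (simp add: divide_simps)
    moreover have "X / I * I = X" using I by simp
    moreover have "\<sigma> powr 2 = \<sigma>\<^sup>2" using \<sigma> by simp
    ultimately show ?thesis unfolding \<sigma>N r by (simp add: mult_ac)
  qed
  also have "2 powr (N' - 1) * 2 powr (- N') = 1 / (2::real)"
  proof -
    have "2 powr (N' - 1) * 2 powr (- N') = 2 powr ((N' - 1) + (- N'))" by (rule powr_add[symmetric])
    also have "(N' - 1) + (- N') = - 1" by simp
    finally show ?thesis by (simp add: powr_minus_divide)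
  qed
  finally have "2 / (N' - 1) * V = X * \<sigma>\<^sup>2 * (2 / (N' - 2))" by simp
  with * have "X * \<sigma>\<^sup>2 * (2 / (N' - 2)) + \<sigma>\<^sup>2 * X \<le> D" by simp
  moreover have "X * \<sigma>\<^sup>2 * (2 / (N' - 2)) + \<sigma>\<^sup>2 * X = N' / (N' - 2) * (X * \<sigma>\<^sup>2)"
    using N' by (simp add: field_simps)
  moreover have "X * \<sigma>\<^sup>2 = 4 * (I powr (2 / N') * X powr ((N' - 2) / N'))"
  proof -
    have "X powr ((N' - 2) / N') = X powr (1 - 2 / N')" using N' by (simp add: field_simps)
    also have "\<dots> = X * X powr (- (2 / N'))" using X0 by (simp add: powr_diff powr_minus_divide)
    finally show ?thesis using I X0 by (simp add: \<sigma>2 powr_divide powr_minus_divide)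
  qed
  ultimately show ?thesis by (simp add: I_def N'_def mult.assoc mult.left_commute)
qed

section \<open>Cylindrical coordinates and truncation\<close>

text \<open>The same cone formula as in \<open>sph_int\<close>, with values in
  \<open>ennreal\<close>, so that Tonelli and monotonicity apply before any integrability is
  known.\<close>

definition sph_nn :: "('a::euclidean_space \<Rightarrow> ennreal) \<Rightarrow> ennreal" where
  "sph_nn f = ennreal (real DIM('a)) * (\<integral>\<^sup>+z. f (z /\<^sub>R norm z) * indicator (ball 0 1) z \<partial>lborel)"

lemma nn_integral_exp_tail:
  fixes b c :: real
  assumes "c > 0"
  shows "(\<integral>\<^sup>+y. ennreal (exp (- c * y)) * indicator {b..} y \<partial>lborel) = ennreal (exp (- c * b) / c)"
proof -
  have "(\<integral>\<^sup>+y. ennreal (exp (- c * y)) * indicator {b..} y \<partial>lborel) = ennreal (0 - (- (1 / c) * exp (- c * b)))"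
  proof (rule nn_integral_FTC_atLeast)
    show "((\<lambda>y. - (1 / c) * exp (- c * y)) has_real_derivative exp (- c * y)) (at y)" for y
      using assms by (auto intro!: derivative_eq_intros)
    have "filterlim (\<lambda>y. c * y) at_top at_top"
      using assms by (intro filterlim_tendsto_pos_mult_at_top[OF tendsto_const] filterlim_ident)
    then have "filterlim (\<lambda>y. - (c * y)) at_bot at_top" by (simp add: filterlim_uminus_at_top)
    then have "((\<lambda>y. exp (- c * y)) \<longlongrightarrow> 0) at_top"
      by (auto intro: filterlim_compose[OF exp_at_bot])
    then show "((\<lambda>y. - (1 / c) * exp (- c * y)) \<longlongrightarrow> 0) at_top" by (rule tendsto_mult_right_zero)
  qed auto
  then show ?thesis by simp
qed

text \<open>Polar coordinates with \<open>norm z = exp y\<close>. Because \<open>sph_nn\<close> is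
  itself an integral over the unit ball, it is enough to shift \<open>y\<close> by
  \<open>ln (norm z)\<close>, exchange the integrals and rescale by \<open>exp y\<close>.\<close>

theorem nn_integral_cylinder:
  fixes F :: "'a::euclidean_space \<Rightarrow> ennreal"
  assumes [measurable]: "F \<in> borel_measurable borel"
  shows "(\<integral>\<^sup>+z. F z \<partial>lborel) = sph_nn (\<lambda>x. \<integral>\<^sup>+y. ennreal (exp y ^ DIM('a)) * F (exp y *\<^sub>R x) \<partial>lborel)"
proof -
  let ?N = "DIM('a)"
  let ?B = "indicator (ball (0::'a) 1) :: 'a \<Rightarrow> ennreal"
  have "(\<integral>\<^sup>+z. (\<integral>\<^sup>+y. ennreal (exp y ^ ?N) * F (exp y *\<^sub>R (z /\<^sub>R norm z)) \<partial>lborel) * ?B z \<partial>lborel)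
      = (\<integral>\<^sup>+z. \<integral>\<^sup>+y. ennreal ((exp y * norm z) ^ ?N) * F (exp y *\<^sub>R z) * ?B z \<partial>lborel \<partial>lborel)"
  proof (rule nn_integral_cong_AE)
    have "AE z in lborel. z \<noteq> (0::'a)" by (rule AE_lborel_singleton)
    then show "AE z in lborel. (\<integral>\<^sup>+y. ennreal (exp y ^ ?N) * F (exp y *\<^sub>R (z /\<^sub>R norm z)) \<partial>lborel) * ?B z
        = (\<integral>\<^sup>+y. ennreal ((exp y * norm z) ^ ?N) * F (exp y *\<^sub>R z) * ?B z \<partial>lborel)"
    proof eventually_elim
      case (elim z)
      have "(\<integral>\<^sup>+y. ennreal (exp y ^ ?N) * F (exp y *\<^sub>R (z /\<^sub>R norm z)) \<partial>lborel)
        = (\<integral>\<^sup>+y. ennreal (exp (ln (norm z) + 1 * y) ^ ?N) * F (exp (ln (norm z) + 1 * y) *\<^sub>R (z /\<^sub>R norm z)) \<partial>lborel)"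
        by (subst nn_integral_real_affine[where c = 1 and t = "ln (norm z)"]) auto
      also have "\<dots> = (\<integral>\<^sup>+y. ennreal ((exp y * norm z) ^ ?N) * F (exp y *\<^sub>R z) \<partial>lborel)"
        using elim by (intro nn_integral_cong) (simp add: exp_add mult.commute mult.assoc[symmetric])
      finally show ?case by (simp add: nn_integral_multc)
    qed
  qed
  also have "\<dots> = (\<integral>\<^sup>+y. \<integral>\<^sup>+z. ennreal ((exp y * norm z) ^ ?N) * F (exp y *\<^sub>R z) * ?B z \<partial>lborel \<partial>lborel)"
    by (rule lborel_pair.Fubini') (auto simp: indicator_def dist_norm)
  also have "\<dots> = (\<integral>\<^sup>+y. \<integral>\<^sup>+x. ennreal (exp (- real ?N * y)) * (ennreal (norm x ^ ?N) * F x * indicator (ball 0 (exp y)) x) \<partial>lborel \<partial>lborel)"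
  proof (rule nn_integral_cong)
    fix y :: real
    have m: "(\<lambda>x::'a. ennreal (norm x ^ ?N) * F x * indicator (ball 0 (exp y)) x) \<in> borel_measurable borel"
      by (intro borel_measurable_times_ennreal borel_measurable_indicator) auto
    have "(\<integral>\<^sup>+z. ennreal ((exp y * norm z) ^ ?N) * F (exp y *\<^sub>R z) * ?B z \<partial>lborel)
      = (\<integral>\<^sup>+z. ennreal (norm (0 + exp y *\<^sub>R z) ^ ?N) * F (0 + exp y *\<^sub>R z) * indicator (ball 0 (exp y)) (0 + exp y *\<^sub>R z) \<partial>lborel)"
      by (intro nn_integral_cong) (auto simp: indicator_def)
    also have "\<dots> = ennreal (1 / exp y ^ ?N) * (\<integral>\<^sup>+x. ennreal (norm x ^ ?N) * F x * indicator (ball 0 (exp y)) x \<partial>lborel)"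
      by (rule nn_integral_lborel_scale[OF m]) auto
    also have "1 / exp y ^ ?N = exp (- real ?N * y)"
      by (simp add: exp_minus exp_of_nat_mult inverse_eq_divide)
    finally show "(\<integral>\<^sup>+z. ennreal ((exp y * norm z) ^ ?N) * F (exp y *\<^sub>R z) * ?B z \<partial>lborel)
      = (\<integral>\<^sup>+x. ennreal (exp (- real ?N * y)) * (ennreal (norm x ^ ?N) * F x * indicator (ball 0 (exp y)) x) \<partial>lborel)"
      using m by (subst nn_integral_cmult) auto
  qed
  also have "\<dots> = (\<integral>\<^sup>+x. \<integral>\<^sup>+y. ennreal (exp (- real ?N * y)) * (ennreal (norm x ^ ?N) * F x * indicator (ball 0 (exp y)) x) \<partial>lborel \<partial>lborel)"
    by (rule lborel_pair.Fubini') (auto simp: indicator_def dist_norm)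
  \<comment> \<open>For fixed \<open>x\<close> the condition \<open>norm x < exp y\<close> leaves
    the integral of \<open>exp (- N * y)\<close> over \<open>y > ln (norm x)\<close>. It equals
    \<open>1 / (N * norm x ^ N)\<close> and cancels the weight together with the factor
    \<open>N\<close> of the cone formula.\<close>
  also have "\<dots> = (\<integral>\<^sup>+x. ennreal (1 / real ?N) * F x \<partial>lborel)"
  proof (rule nn_integral_cong_AE)
    have "AE x in lborel. x \<noteq> (0::'a)" by (rule AE_lborel_singleton)
    then show "AE x in lborel. (\<integral>\<^sup>+y. ennreal (exp (- real ?N * y)) * (ennreal (norm x ^ ?N) * F x * indicator (ball 0 (exp y)) x) \<partial>lborel)
        = ennreal (1 / real ?N) * F x"
    proof eventually_elim
      case (elim x)
      have "(\<integral>\<^sup>+y. ennreal (exp (- real ?N * y)) * (ennreal (norm x ^ ?N) * F x * indicator (ball 0 (exp y)) x) \<partial>lborel)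
         = (\<integral>\<^sup>+y. ennreal (norm x ^ ?N) * F x * (ennreal (exp (- real ?N * y)) * indicator {ln (norm x)..} y) \<partial>lborel)"
      proof (rule nn_integral_cong_AE)
        have "AE y in lborel. y \<noteq> ln (norm x)" by (rule AE_lborel_singleton)
        then show "AE y in lborel. ennreal (exp (- real ?N * y)) * (ennreal (norm x ^ ?N) * F x * indicator (ball 0 (exp y)) x)
          = ennreal (norm x ^ ?N) * F x * (ennreal (exp (- real ?N * y)) * indicator {ln (norm x)..} y)"
        proof eventually_elim
          case (elim y)
          have "norm x < exp y \<longleftrightarrow> ln (norm x) < y"
            using \<open>x \<noteq> 0\<close> by (metis exp_less_cancel_iff exp_ln zero_less_norm_iff)
          then show ?case using elim by (auto simp: indicator_def mult_ac)
        qed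
      qed
      also have "\<dots> = ennreal (norm x ^ ?N) * F x * ennreal (exp (- real ?N * ln (norm x)) / real ?N)"
        by (subst nn_integral_cmult) (auto simp: nn_integral_exp_tail[where c = "real ?N", simplified])
      also have "exp (- real ?N * ln (norm x)) = 1 / norm x ^ ?N"
        using elim by (simp add: exp_minus exp_of_nat_mult inverse_eq_divide)
      also have "ennreal (norm x ^ ?N) * F x * ennreal (1 / norm x ^ ?N / real ?N) = ennreal (norm x ^ ?N * (1 / norm x ^ ?N / real ?N)) * F x"
        by (subst ennreal_mult) (auto simp: mult_ac)
      also have "norm x ^ ?N * (1 / norm x ^ ?N / real ?N) = 1 / real ?N" using elim by simp
      finally show ?case .
    qed
  qed
  also have "\<dots> = ennreal (1 / real ?N) * (\<integral>\<^sup>+x. F x \<partial>lborel)" by (simp add: nn_integral_cmult)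
  finally have "sph_nn (\<lambda>x. \<integral>\<^sup>+y. ennreal (exp y ^ ?N) * F (exp y *\<^sub>R x) \<partial>lborel)
     = ennreal (real ?N) * (ennreal (1 / real ?N) * (\<integral>\<^sup>+x. F x \<partial>lborel))"
    by (simp add: sph_nn_def)
  then show ?thesis by (simp add: mult.assoc[symmetric] ennreal_mult[symmetric])
qed

lemma sph_nn_mono:
  assumes "\<And>x. norm x = 1 \<Longrightarrow> f x \<le> g x"
  shows "sph_nn f \<le> sph_nn (g :: 'a::euclidean_space \<Rightarrow> ennreal)"
  unfolding sph_nn_def
proof (intro mult_left_mono nn_integral_mono_AE)
  have "AE z in lborel. z \<noteq> (0::'a)" by (rule AE_lborel_singleton)
  then show "AE z in lborel. f (z /\<^sub>R norm z) * indicator (ball 0 1) z \<le> g (z /\<^sub>R norm z) * indicator (ball 0 1) z"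
    by eventually_elim (intro mult_right_mono assms, auto)
qed simp

lemma sph_nn_cong: "(\<And>x. norm x = 1 \<Longrightarrow> f x = g x) \<Longrightarrow> sph_nn f = sph_nn (g :: 'a::euclidean_space \<Rightarrow> ennreal)"
  by (intro antisym sph_nn_mono) auto

lemma borel_measurable_radial:
  fixes f :: "'a::euclidean_space \<Rightarrow> ennreal"
  assumes [measurable]: "f \<in> borel_measurable borel"
  shows "(\<lambda>z. f (z /\<^sub>R norm z) * indicator (ball 0 1) z) \<in> borel_measurable borel"
proof (rule borel_measurable_times_ennreal)
  have "(\<lambda>z::'a. z /\<^sub>R norm z) \<in> borel_measurable borel" by measurable
  then show "(\<lambda>z. f (z /\<^sub>R norm z)) \<in> borel_measurable borel" by (rule measurable_compose) fact
  show "indicator (ball 0 1) \<in> borel_measurable (borel :: 'a measure)" by (rule borel_measurable_indicator) auto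
qed

lemma sph_nn_add:
  fixes f g :: "'a::euclidean_space \<Rightarrow> ennreal"
  assumes "f \<in> borel_measurable borel" "g \<in> borel_measurable borel"
  shows "sph_nn (\<lambda>x. f x + g x) = sph_nn f + sph_nn g"
  unfolding sph_nn_def distrib_right
  using borel_measurable_radial[OF assms(1)] borel_measurable_radial[OF assms(2)]
  by (subst nn_integral_add) (auto simp: distrib_left)

lemma sph_nn_cmult:
  fixes f :: "'a::euclidean_space \<Rightarrow> ennreal"
  assumes "f \<in> borel_measurable borel"
  shows "sph_nn (\<lambda>x. c * f x) = c * sph_nn f"
  unfolding sph_nn_def mult.assoc[of c] using borel_measurable_radial[OF assms]
  by (subst nn_integral_cmult) (auto simp: mult_ac)

lemma sph_nn_const_finite: "sph_nn (\<lambda>_::'a::euclidean_space. ennreal c) < top"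
proof -
  have "emeasure lborel (ball (0::'a) 1) < top" using emeasure_lborel_ball_finite by (simp add: less_top)
  then show ?thesis by (simp add: sph_nn_def nn_integral_cmult_indicator ennreal_mult_less_top)
qed

lemma sph_nn_const_pos:
  assumes "c > 0" shows "sph_nn (\<lambda>_::'a::euclidean_space. ennreal c) > 0"
proof -
  have "emeasure lborel (ball (0::'a) 1) \<noteq> 0"
    using open_not_negligible[of "ball (0::'a) 1"]
    by (auto simp: negligible_iff_null_sets null_sets_def emeasure_completion)
  then show ?thesis using assms
    by (auto simp: sph_nn_def nn_integral_cmult_indicator zero_less_iff_neq_zero[symmetric] ennreal_zero_less_mult_iff)
qed

lemma nn_integral_even:
  fixes f :: "real \<Rightarrow> ennreal"
  assumes [measurable]: "f \<in> borel_measurable borel"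
  shows "(\<integral>\<^sup>+y. f (- y) \<partial>lborel) = (\<integral>\<^sup>+y. f y \<partial>lborel)"
  by (subst (2) nn_integral_real_affine[where c = "-1" and t = 0]) auto

text \<open>Without its linear part \<open>2 * \<beta> * z\<close>, the gradient is continuous with
  compact support, hence bounded and uniformly continuous; this gives an oscillation bound
  \<open>\<eta> + L * norm (y - x)\<close> for every \<open>\<eta> > 0\<close>. The linear part
  belongs to a convex function and only helps. The slack \<open>\<eta> * norm h\<close> is what
  makes \<open>C^1\<close> regularity enough.\<close>

lemma semiconvex_of_C1:
  fixes g :: "'a::euclidean_space \<Rightarrow> real" and dg :: "'a \<Rightarrow> 'a"
  assumes der: "\<And>z. (g has_derivative (\<lambda>h. dg z \<bullet> h)) (at z)"
    and cont: "continuous_on UNIV dg"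
    and far: "\<And>z. norm z \<ge> R \<Longrightarrow> dg z = (2 * \<beta>) *\<^sub>R z" and \<beta>: "\<beta> \<ge> 0"
  shows "\<exists>B. \<forall>z. norm (dg z) \<le> B + 2 * \<beta> * norm z"
    and "\<eta> > 0 \<Longrightarrow> \<exists>L. \<forall>z h. g z + dg z \<bullet> h - \<eta> * norm h - L * (norm h)\<^sup>2 \<le> g (z + h)"
proof -
  define dp where "dp z = dg z - (2 * \<beta>) *\<^sub>R z" for z
  have dpc: "continuous_on UNIV dp" unfolding dp_def by (intro continuous_intros cont)
  have dp0: "dp z = 0" if "norm z \<ge> R" for z using far[OF that] by (simp add: dp_def)
  have "compact (dp ` cball 0 R)"
    by (intro compact_continuous_image continuous_on_subset[OF dpc]) auto
  then have "bounded (dp ` cball 0 R)" by (rule compact_imp_bounded)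
  then obtain B where B: "\<And>z. z \<in> cball 0 R \<Longrightarrow> norm (dp z) \<le> B" "B > 0"
    unfolding bounded_pos by blast
  have Bd: "norm (dp z) \<le> B" for z
    using B dp0[of z] by (cases "norm z \<le> R") auto
  show "\<exists>B. \<forall>z. norm (dg z) \<le> B + 2 * \<beta> * norm z"
  proof (intro exI allI)
    fix z
    have "norm (dg z) \<le> norm (dp z) + norm ((2 * \<beta>) *\<^sub>R z)" unfolding dp_def using norm_triangle_ineq4
      by (metis diff_add_cancel norm_triangle_ineq)
    then show "norm (dg z) \<le> B + 2 * \<beta> * norm z" using Bd[of z] \<beta> by simp
  qed
  assume \<eta>: "\<eta> > 0"
  have "uniformly_continuous_on (cball 0 (R + 1)) dp"
    by (intro compact_uniformly_continuous continuous_on_subset[OF dpc]) auto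
  then obtain d where d: "d > 0"
    "\<And>x y. x \<in> cball 0 (R + 1) \<Longrightarrow> y \<in> cball 0 (R + 1) \<Longrightarrow> dist y x < d \<Longrightarrow> dist (dp y) (dp x) < \<eta>"
    unfolding uniformly_continuous_on_def using \<eta> by metis
  define d' where "d' = min d 1"
  have d': "d' > 0" using d by (simp add: d'_def)
  \<comment> \<open>From distance \<open>d'\<close> on, the trivial oscillation bound
    \<open>2 * B\<close> is at most \<open>L * norm (y - x)\<close>; at smaller distances uniform
    continuity supplies \<open>\<eta>\<close>.\<close>
  define L where "L = 2 * B / d'"
  have osc: "norm (dp y - dp x) \<le> \<eta> + L * norm (y - x)" for x y
  proof (cases "norm (y - x) < d'")
    case True
    have LB: "0 \<le> L * norm (y - x)" using B d' by (simp add: L_def)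
    show ?thesis
    proof (cases "norm x \<le> R + 1 \<and> norm y \<le> R + 1")
      case True
      then have "dist (dp y) (dp x) < \<eta>" using d(2)[of x y] \<open>norm (y - x) < d'\<close> by (simp add: d'_def dist_norm)
      then show ?thesis using LB by (simp add: dist_norm)
    next
      case False
      have "norm x \<le> norm y + norm (y - x)" "norm y \<le> norm x + norm (y - x)"
        using norm_triangle_ineq4[of y "y - x"] norm_triangle_sub[of y x] by auto
      then have "norm x \<ge> R" "norm y \<ge> R" using False True by (auto simp: d'_def)
      then show ?thesis using dp0 LB \<eta> by simp
    qed
  next
    case False
    have "norm (dp y - dp x) \<le> 2 * B" using norm_triangle_ineq4[of "dp y" "dp x"] Bd[of x] Bd[of y] by simp
    also have "2 * B = L * d'" using d' by (simp add: L_def)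
    also have "\<dots> \<le> L * norm (y - x)" using False B d' by (intro mult_left_mono) (auto simp: L_def)
    finally show ?thesis using \<eta> by simp
  qed
  show "\<exists>L. \<forall>z h. g z + dg z \<bullet> h - \<eta> * norm h - L * (norm h)\<^sup>2 \<le> g (z + h)"
  proof (intro exI allI)
    fix z h
    define \<phi> where "\<phi> t = g (z + t *\<^sub>R h)" for t
    have "(\<phi> has_derivative (\<lambda>s. dg (z + t *\<^sub>R h) \<bullet> (s *\<^sub>R h))) (at t within S)" for t S
      unfolding \<phi>_def
      by (rule has_derivative_compose[where g = g and g' = "\<lambda>h'. dg (z + t *\<^sub>R h) \<bullet> h'" and f' = "\<lambda>s. s *\<^sub>R h"])
        (auto intro!: derivative_eq_intros der)
    then have "\<exists>t\<in>{0<..<1}. norm (\<phi> 1 - \<phi> 0) \<ge> 0 \<and> \<phi> 1 - \<phi> 0 = dg (z + t *\<^sub>R h) \<bullet> ((1 - 0) *\<^sub>R h)"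
      using mvt_simple[of 0 1 \<phi> "\<lambda>t s. dg (z + t *\<^sub>R h) \<bullet> (s *\<^sub>R h)"] by auto
    then obtain t where t: "0 < t" "t < 1" "g (z + h) - g z = dg (z + t *\<^sub>R h) \<bullet> h"
      by (auto simp: \<phi>_def)
    have "dg (z + t *\<^sub>R h) \<bullet> h = dg z \<bullet> h + (dp (z + t *\<^sub>R h) - dp z) \<bullet> h + 2 * \<beta> * t * (norm h)\<^sup>2"
      by (simp add: dp_def inner_diff_left inner_add_left algebra_simps power2_norm_eq_inner)
    moreover have "- ((\<eta> + L * norm h) * norm h) \<le> (dp (z + t *\<^sub>R h) - dp z) \<bullet> h"
    proof -
      have "norm (dp (z + t *\<^sub>R h) - dp z) \<le> \<eta> + L * norm (t *\<^sub>R h)" using osc[of "z + t *\<^sub>R h" z] by simp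
      also have "L * norm (t *\<^sub>R h) \<le> L * norm h"
        using t B d' by (intro mult_left_mono) (auto simp: L_def mult_left_le_one_le)
      finally have "norm (dp (z + t *\<^sub>R h) - dp z) * norm h \<le> (\<eta> + L * norm h) * norm h"
        by (intro mult_right_mono) auto
      moreover have "\<bar>(dp (z + t *\<^sub>R h) - dp z) \<bullet> h\<bar> \<le> norm (dp (z + t *\<^sub>R h) - dp z) * norm h"
        by (rule Cauchy_Schwarz_ineq2)
      ultimately show ?thesis by linarith
    qed
    moreover have "2 * \<beta> * t * (norm h)\<^sup>2 \<ge> 0" using \<beta> t by simp
    moreover have "(\<eta> + L * norm h) * norm h = \<eta> * norm h + L * (norm h)\<^sup>2" by (simp add: algebra_simps power2_eq_square)
    ultimately show "g z + dg z \<bullet> h - \<eta> * norm h - L * (norm h)\<^sup>2 \<le> g (z + h)" using t(3) by linarith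
  qed
qed

section \<open>Cutoff and profile in the axial variable\<close>

lemma has_real_derivative_positive_part:
  fixes \<phi> \<phi>' :: "real \<Rightarrow> real"
  assumes "\<And>s. (\<phi> has_real_derivative \<phi>' s) (at s)" "\<phi> 0 = 0" "\<phi>' 0 = 0"
  shows "((\<lambda>s. if s \<le> 0 then 0 else \<phi> s) has_real_derivative (if s \<le> 0 then 0 else \<phi>' s)) (at s)"
proof -
  consider "s < 0" | "s > 0" | "s = 0" by linarith
  then show ?thesis
  proof cases
    case 1
    have "((\<lambda>s. 0) has_real_derivative 0) (at s)" by simp
    then have "((\<lambda>s. if s \<le> 0 then 0 else \<phi> s) has_real_derivative 0) (at s)"
      by (rule has_field_derivative_transform_within_open[where S = "{..<0}"]) (use 1 in auto)
    then show ?thesis using 1 by simp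
  next
    case 2
    have "((\<lambda>s. if s \<le> 0 then 0 else \<phi> s) has_real_derivative \<phi>' s) (at s)"
      by (rule has_field_derivative_transform_within_open[where S = "{0<..}", OF assms(1)]) (use 2 in auto)
    then show ?thesis using 2 by simp
  next
    case 3
    have "((\<lambda>h. \<phi> h / h) \<longlongrightarrow> 0) (at 0)"
      using assms(1)[of 0] assms(2,3) by (simp add: DERIV_def)
    then have "((\<lambda>h. (if h \<le> 0 then 0 else \<phi> h) / h) \<longlongrightarrow> 0) (at 0)"
    proof (rule Lim_null_comparison[rotated, OF tendsto_norm_zero])
      show "\<forall>\<^sub>F h in at 0. norm ((if h \<le> 0 then 0 else \<phi> h) / h) \<le> norm (\<phi> h / h)"
      proof (intro always_eventually allI)
        fix h :: real show "norm ((if h \<le> 0 then 0 else \<phi> h) / h) \<le> norm (\<phi> h / h)"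
        proof (cases "h \<le> 0")
          case True
          then have "(if h \<le> 0 then 0 else \<phi> h) / h = 0" by simp
          then show ?thesis by (metis norm_zero norm_ge_zero)
        qed simp
      qed
    qed
    then show ?thesis using 3 assms(2) by (simp add: DERIV_def cong: if_cong)
  qed
qed

definition pos2 :: "real \<Rightarrow> real" where "pos2 s = (max 0 s)\<^sup>2"

lemma pos2_derivative: "(pos2 has_real_derivative 2 * max 0 s) (at s)"
proof -
  have "((\<lambda>s. if s \<le> 0 then 0 else s\<^sup>2) has_real_derivative (if s \<le> 0 then 0 else 2 * s)) (at s)"
    by (rule has_real_derivative_positive_part) (auto intro!: derivative_eq_intros)
  moreover have "pos2 = (\<lambda>s. if s \<le> 0 then 0 else s\<^sup>2)" by (auto simp: pos2_def max_def)
  moreover have "2 * max 0 s = (if s \<le> 0 then 0 else 2 * s)" by (auto simp: max_def)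
  ultimately show ?thesis by simp
qed

text \<open>A \<open>C^1\<close> plateau, as \<open>pos2\<close> is \<open>C^1\<close>: it is 1 for
  \<open>\<bar>y\<bar> \<le> T\<close> and vanishes once the excess of \<open>\<bar>y\<bar>\<close>
  over \<open>T\<close> reaches 1.\<close>

definition cutoff :: "real \<Rightarrow> real \<Rightarrow> real" where
  "cutoff T y = pos2 (1 - pos2 (y - T) - pos2 (- y - T))"

definition cutoff' :: "real \<Rightarrow> real \<Rightarrow> real" where
  "cutoff' T y = 2 * max 0 (1 - pos2 (y - T) - pos2 (- y - T)) * (- 2 * max 0 (y - T) + 2 * max 0 (- y - T))"

lemma cutoff_derivative: "(cutoff T has_real_derivative cutoff' T y) (at y)"
  unfolding cutoff_def[abs_def] cutoff'_def
  by (rule DERIV_chain'[OF _ pos2_derivative] derivative_eq_intros DERIV_chain'[OF _ pos2_derivative] refl | simp)+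

text \<open>The profile equals \<open>y\<^sup>2\<close> up to \<open>\<bar>y\<bar> = T\<close> and is continued in a \<open>C\<^sup>1\<close> way by a combination of
  \<open>cosh\<close> and \<open>sinh\<close>, so that \<open>exp y * profile T y\<close> is a quadratic polynomial in \<open>exp y\<close> there.\<close>

definition kap :: "real \<Rightarrow> real \<Rightarrow> real" where
  "kap T s = (if s \<le> 0 then 0 else T\<^sup>2 * cosh s + 2 * T * sinh s - (T + s)\<^sup>2)"

definition kap' :: "real \<Rightarrow> real \<Rightarrow> real" where
  "kap' T s = (if s \<le> 0 then 0 else T\<^sup>2 * sinh s + 2 * T * cosh s - 2 * (T + s))"

lemma kap_derivative: "(kap T has_real_derivative kap' T s) (at s)"
  unfolding kap_def[abs_def] kap'_def
  by (rule has_real_derivative_positive_part) (auto intro!: derivative_eq_intros)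

definition profile :: "real \<Rightarrow> real \<Rightarrow> real" where
  "profile T y = y\<^sup>2 + kap T (y - T) + kap T (- y - T)"

definition profile' :: "real \<Rightarrow> real \<Rightarrow> real" where
  "profile' T y = 2 * y + kap' T (y - T) - kap' T (- y - T)"

lemma profile_derivative: "(profile T has_real_derivative profile' T y) (at y)"
  unfolding profile_def[abs_def] profile'_def
  by (rule DERIV_chain'[OF _ kap_derivative] derivative_eq_intros refl | simp)+

lemma cutoff_even: "cutoff T (- y) = cutoff T y" "cutoff' T (- y) = - cutoff' T y"
  by (simp_all add: cutoff_def cutoff'_def algebra_simps)

lemma profile_even: "profile T (- y) = profile T y" "profile' T (- y) = - profile' T y"
  by (simp_all add: profile_def profile'_def)

lemma cutoff_inner:
  assumes "\<bar>y\<bar> \<le> T" shows "cutoff T y = 1" "cutoff' T y = 0"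
proof -
  have "max 0 (y - T) = 0" "max 0 (- y - T) = 0" using assms by auto
  then show "cutoff T y = 1" "cutoff' T y = 0" by (simp_all add: cutoff_def cutoff'_def pos2_def)
qed

lemma cutoff_outer:
  assumes "\<bar>y\<bar> \<ge> T + 1" "T \<ge> 0" shows "cutoff T y = 0" "cutoff' T y = 0"
proof -
  have *: "pos2 s \<ge> 1" if "s \<ge> 1" for s using that by (simp add: pos2_def)
  have "pos2 s \<ge> 0" for s by (simp add: pos2_def)
  then have "1 - pos2 (y - T) - pos2 (- y - T) \<le> 0"
    using *[of "y - T"] *[of "- y - T"] assms by (cases "y \<ge> 0") (smt (verit))+
  then show "cutoff T y = 0" "cutoff' T y = 0" by (simp_all add: cutoff_def cutoff'_def pos2_def[of "1 - _ - _"])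
qed

lemma cutoff_bounds:
  assumes "T \<ge> 0" shows "0 \<le> cutoff T y" "cutoff T y \<le> 1" "\<bar>cutoff' T y\<bar> \<le> 4"
proof -
  have p: "pos2 s \<ge> 0" for s by (simp add: pos2_def)
  then have m: "0 \<le> max 0 (1 - pos2 (y - T) - pos2 (- y - T))" "max 0 (1 - pos2 (y - T) - pos2 (- y - T)) \<le> 1"
    unfolding max_def by (smt (verit) p)+
  show "0 \<le> cutoff T y" by (simp add: cutoff_def p)
  show "cutoff T y \<le> 1" unfolding cutoff_def pos2_def[of "1 - _ - _"] using m by (simp add: power_le_one)
  show "\<bar>cutoff' T y\<bar> \<le> 4"
  proof (cases "\<bar>y\<bar> \<ge> T + 1")
    case True then show ?thesis using cutoff_outer[OF True assms] by simp
  next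
    case False
    then have "\<bar>- 2 * max 0 (y - T) + 2 * max 0 (- y - T)\<bar> \<le> 2" using assms unfolding max_def by (smt (verit))
    with m have "\<bar>2 * max 0 (1 - pos2 (y - T) - pos2 (- y - T))\<bar> * \<bar>- 2 * max 0 (y - T) + 2 * max 0 (- y - T)\<bar> \<le> 2 * 2"
      by (intro mult_mono) auto
    then show ?thesis by (simp add: cutoff'_def abs_mult)
  qed
qed

lemma profile_inner:
  assumes "\<bar>y\<bar> \<le> T" shows "profile T y = y\<^sup>2" "profile' T y = 2 * y"
  using assms by (auto simp: profile_def profile'_def kap_def kap'_def abs_le_iff)

lemma profile_outer:
  assumes "\<bar>y\<bar> > T" "T \<ge> 0"
  shows "profile T y = T\<^sup>2 * cosh (\<bar>y\<bar> - T) + 2 * T * sinh (\<bar>y\<bar> - T)"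
    "profile' T y = sgn y * (T\<^sup>2 * sinh (\<bar>y\<bar> - T) + 2 * T * cosh (\<bar>y\<bar> - T))"
  using assms by (cases "y \<ge> 0"; simp add: profile_def profile'_def kap_def kap'_def power2_eq_square algebra_simps)+

lemma kap'_continuous: "continuous_on UNIV (kap' T)"
proof -
  have "kap' T s = T\<^sup>2 * sinh (max 0 s) + 2 * T * cosh (max 0 s) - 2 * (T + max 0 s)" for s
    by (auto simp: kap'_def max_def)
  then have "kap' T = (\<lambda>s. T\<^sup>2 * sinh (max 0 s) + 2 * T * cosh (max 0 s) - 2 * (T + max 0 s))" by blast
  then show ?thesis by (auto intro!: continuous_intros)
qed

lemma profile_continuous: "continuous_on UNIV (profile T)" "continuous_on UNIV (profile' T)"
proof -
  show "continuous_on UNIV (profile T)"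
    using profile_derivative by (intro continuous_at_imp_continuous_on ballI) (blast intro: DERIV_isCont)
  show "continuous_on UNIV (profile' T)"
    unfolding profile'_def[abs_def]
    by (intro continuous_intros continuous_on_compose2[OF kap'_continuous]) auto
qed

lemma cutoff_continuous: "continuous_on UNIV (cutoff T)" "continuous_on UNIV (cutoff' T)"
proof -
  show "continuous_on UNIV (cutoff T)"
    using cutoff_derivative by (intro continuous_at_imp_continuous_on ballI) (blast intro: DERIV_isCont)
  show "continuous_on UNIV (cutoff' T)"
    unfolding cutoff'_def[abs_def] pos2_def[abs_def] by (intro continuous_intros)
qed

section \<open>Homogeneous functions and their truncated lifts\<close>

lemma borel_measurable_continuous_punctured:
  fixes f :: "'a::euclidean_space \<Rightarrow> 'b::euclidean_space"
  assumes "continuous_on (- {0}) f"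
  shows "f \<in> borel_measurable borel"
  by (rule borel_measurable_continuous_countable_exceptions[of "{0}"]) (use assms in auto)

text \<open>Ambient form of a positive \<open>C^1\<close> function on the sphere: the extension is
  constant along rays, so on the unit sphere \<open>da\<close> is the tangential gradient.\<close>

locale homogeneous_C1 =
  fixes a :: "'a::euclidean_space \<Rightarrow> real" and da :: "'a \<Rightarrow> 'a"
  assumes pos: "z \<noteq> 0 \<Longrightarrow> a z > 0"
    and der: "z \<noteq> 0 \<Longrightarrow> (a has_derivative (\<lambda>h. da z \<bullet> h)) (at z)"
    and cont: "continuous_on (- {0}) da"
    and hom: "c > 0 \<Longrightarrow> a (c *\<^sub>R z) = a z"
begin

lemma a_continuous: "continuous_on (- {0}) a"
  using der by (intro continuous_at_imp_continuous_on ballI) (auto intro: has_derivative_continuous)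

lemma a_measurable [measurable]: "a \<in> borel_measurable borel"
  by (rule borel_measurable_continuous_punctured[OF a_continuous])

lemma da_measurable [measurable]: "da \<in> borel_measurable borel"
  by (rule borel_measurable_continuous_punctured[OF cont])

lemma da_scale:
  assumes "c > 0" "z \<noteq> 0" shows "da (c *\<^sub>R z) = (1 / c) *\<^sub>R da z"
proof -
  have "((\<lambda>z. a (c *\<^sub>R z)) has_derivative (\<lambda>h. da (c *\<^sub>R z) \<bullet> (c *\<^sub>R h))) (at z)"
    by (rule has_derivative_compose[where g = a and g' = "\<lambda>h'. da (c *\<^sub>R z) \<bullet> h'" and f' = "\<lambda>h. c *\<^sub>R h"])
      (use assms in \<open>auto intro!: derivative_eq_intros der\<close>)
  then have "(a has_derivative (\<lambda>h. da (c *\<^sub>R z) \<bullet> (c *\<^sub>R h))) (at z)" using hom[OF assms(1)] by simp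
  then have "(\<lambda>h. da (c *\<^sub>R z) \<bullet> (c *\<^sub>R h)) = (\<lambda>h. da z \<bullet> h)"
    using der[OF assms(2)] by (rule has_derivative_unique)
  then have "(c *\<^sub>R da (c *\<^sub>R z)) \<bullet> h = da z \<bullet> h" for h by (auto dest: fun_cong[of _ _ h])
  then have "c *\<^sub>R da (c *\<^sub>R z) = da z" by (metis vector_eq_rdot)
  then have "(1 / c) *\<^sub>R (c *\<^sub>R da (c *\<^sub>R z)) = (1 / c) *\<^sub>R da z" by simp
  then show ?thesis using assms by simp
qed

lemma da_orthogonal:
  assumes "z \<noteq> 0" shows "da z \<bullet> z = 0"
proof -
  have "((\<lambda>t::real. a ((1 + t) *\<^sub>R z)) has_derivative (\<lambda>t. da z \<bullet> (t *\<^sub>R z))) (at 0)"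
    by (rule has_derivative_compose[where g = a and g' = "\<lambda>h'. da z \<bullet> h'" and f' = "\<lambda>t. t *\<^sub>R z"])
      (use assms der[OF assms] in \<open>auto intro!: derivative_eq_intros simp: algebra_simps\<close>)
  moreover have "((\<lambda>t::real. a ((1 + t) *\<^sub>R z)) has_derivative (\<lambda>t. 0)) (at 0)"
    by (rule has_derivative_transform_within_open[where f = "\<lambda>_. a z" and s = "{-1<..}"]) (auto simp: hom)
  ultimately have "(\<lambda>t. da z \<bullet> (t *\<^sub>R z)) = (\<lambda>t. 0)" by (rule has_derivative_unique)
  then show ?thesis by (auto dest: fun_cong[of _ _ 1])
qed

lemma a_sphere: "z \<noteq> 0 \<Longrightarrow> a z = a (z /\<^sub>R norm z)"
  by (simp add: hom)

lemma bounds: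
  obtains a0 a1 M where "a0 > 0" "M \<ge> 0" "\<And>z. z \<noteq> 0 \<Longrightarrow> a0 \<le> a z" "\<And>z. z \<noteq> 0 \<Longrightarrow> a z \<le> a1"
    "\<And>x. norm x = 1 \<Longrightarrow> (norm (da x))\<^sup>2 \<le> M"
proof -
  let ?S = "sphere (0::'a) 1"
  have ne: "?S \<noteq> {}" by simp
  have sub: "?S \<subseteq> - {0}" by auto
  have c: "continuous_on ?S a" "continuous_on ?S da"
    using continuous_on_subset[OF a_continuous sub] continuous_on_subset[OF cont sub] .
  obtain x0 where x0: "x0 \<in> ?S" "\<And>x. x \<in> ?S \<Longrightarrow> a x0 \<le> a x" using continuous_attains_inf[OF _ ne c(1)] by auto
  obtain x1 where x1: "x1 \<in> ?S" "\<And>x. x \<in> ?S \<Longrightarrow> a x \<le> a x1" using continuous_attains_sup[OF _ ne c(1)] by auto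
  obtain x2 where x2: "x2 \<in> ?S" "\<And>x. x \<in> ?S \<Longrightarrow> (norm (da x))\<^sup>2 \<le> (norm (da x2))\<^sup>2"
    using continuous_attains_sup[OF compact_sphere ne continuous_on_power[OF continuous_on_norm[OF c(2)]]] by blast
  have S: "z /\<^sub>R norm z \<in> ?S" if "z \<noteq> 0" for z :: 'a using that by simp
  show ?thesis
  proof (rule that[of "a x0" "(norm (da x2))\<^sup>2" "a x1"])
    show "a x0 > 0" using x0 sub by (intro pos) auto
    show "a x0 \<le> a z" "a z \<le> a x1" if "z \<noteq> 0" for z
      using x0(2)[OF S[OF that]] x1(2)[OF S[OF that]] a_sphere[OF that] by auto
  qed (use x2 in auto)
qed

text \<open>The truncated lift on the cylinder, carried to the whole space by
  \<open>z = exp y *\<^sub>R x\<close>. The value at 0 is the constant term of the quadratic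
  polynomial with which it agrees near the origin.\<close>

definition glue :: "real \<Rightarrow> 'a \<Rightarrow> real" where
  "glue T z = (if z = 0 then exp (- T) * (T\<^sup>2 / 2 + T)
     else norm z * (cutoff T (ln (norm z)) * a z + profile T (ln (norm z))))"

definition dglue :: "real \<Rightarrow> 'a \<Rightarrow> 'a" where
  "dglue T z = (if z = 0 then 0
     else ((cutoff T (ln (norm z)) * a z + profile T (ln (norm z)) + cutoff' T (ln (norm z)) * a z + profile' T (ln (norm z))) / norm z) *\<^sub>R z
       + (norm z * cutoff T (ln (norm z))) *\<^sub>R da z)"

lemma glue_derivative_punctured:
  assumes z: "z \<noteq> 0"
  shows "(glue T has_derivative (\<lambda>h. dglue T z \<bullet> h)) (at z)"
proof -
  have n: "(norm has_derivative (\<lambda>h. (z \<bullet> h) / norm z)) (at z)"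
    using has_derivative_norm[OF z] by (simp add: sgn_div_norm inverse_eq_divide inner_commute)
  have "(ln has_derivative (\<lambda>h. h / norm z)) (at (norm z))"
  proof -
    have "(*) (1 / norm z) = (\<lambda>h. h / norm z)" by auto
    then show ?thesis using z DERIV_ln_divide[of "norm z"] by (simp add: has_field_derivative_def)
  qed
  from has_derivative_compose[OF n this]
  have L: "((\<lambda>z. ln (norm z)) has_derivative (\<lambda>h. (z \<bullet> h) / (norm z)\<^sup>2)) (at z)"
    by (simp add: power2_eq_square)
  have c: "((\<lambda>z. cutoff T (ln (norm z))) has_derivative (\<lambda>h. cutoff' T (ln (norm z)) * ((z \<bullet> h) / (norm z)\<^sup>2))) (at z)"
    by (rule has_derivative_compose[OF L cutoff_derivative[unfolded has_field_derivative_def]])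
  have p: "((\<lambda>z. profile T (ln (norm z))) has_derivative (\<lambda>h. profile' T (ln (norm z)) * ((z \<bullet> h) / (norm z)\<^sup>2))) (at z)"
    by (rule has_derivative_compose[OF L profile_derivative[unfolded has_field_derivative_def]])
  have "((\<lambda>z. norm z * (cutoff T (ln (norm z)) * a z + profile T (ln (norm z)))) has_derivative
     (\<lambda>h. norm z * ((cutoff T (ln (norm z)) * (da z \<bullet> h) + cutoff' T (ln (norm z)) * ((z \<bullet> h) / (norm z)\<^sup>2) * a z)
        + profile' T (ln (norm z)) * ((z \<bullet> h) / (norm z)\<^sup>2))
       + (z \<bullet> h) / norm z * (cutoff T (ln (norm z)) * a z + profile T (ln (norm z))))) (at z)"
    by (rule has_derivative_mult[OF n has_derivative_add[OF has_derivative_mult[OF c der[OF z]] p]])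
  moreover have "(\<lambda>h. norm z * ((cutoff T (ln (norm z)) * (da z \<bullet> h) + cutoff' T (ln (norm z)) * ((z \<bullet> h) / (norm z)\<^sup>2) * a z)
        + profile' T (ln (norm z)) * ((z \<bullet> h) / (norm z)\<^sup>2))
       + (z \<bullet> h) / norm z * (cutoff T (ln (norm z)) * a z + profile T (ln (norm z)))) = (\<lambda>h. dglue T z \<bullet> h)"
    using z by (simp add: fun_eq_iff dglue_def inner_add_left power2_eq_square field_simps)
  ultimately have "((\<lambda>z. norm z * (cutoff T (ln (norm z)) * a z + profile T (ln (norm z)))) has_derivative
     (\<lambda>h. dglue T z \<bullet> h)) (at z)" by simp
  then show ?thesis
    by (rule has_derivative_transform_within_open[where s = "- {0}"]) (use z in \<open>auto simp: glue_def\<close>)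
qed

text \<open>Multiplied by \<open>exp y\<close>, the functions \<open>cosh\<close> and
  \<open>sinh\<close> leave only constants and multiples of \<open>(exp y)\<^sup>2\<close>. Hence
  the lift passes smoothly through the origin, and its gradient is a multiple of \<open>z\<close>
  both near 0 and near infinity.\<close>

lemma profile_outer_exp:
  assumes "T \<ge> 0" "\<bar>y\<bar> > T"
  shows "y < 0 \<Longrightarrow> exp y * profile T y = exp (- T) * (T\<^sup>2 / 2 + T) + exp T * (T\<^sup>2 / 2 - T) * (exp y)\<^sup>2"
    and "y < 0 \<Longrightarrow> profile T y + profile' T y = exp T * (T\<^sup>2 - 2 * T) * exp y"
    and "y > 0 \<Longrightarrow> profile T y + profile' T y = exp (- T) * (T\<^sup>2 + 2 * T) * exp y"
proof -
  have s: "cosh s = (exp s + exp (- s)) / 2" "sinh s = (exp s - exp (- s)) / 2" for s :: real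
    by (simp_all add: cosh_def sinh_def)
  show "exp y * profile T y = exp (- T) * (T\<^sup>2 / 2 + T) + exp T * (T\<^sup>2 / 2 - T) * (exp y)\<^sup>2" if "y < 0"
  proof -
    have e: "exp (\<bar>y\<bar> - T) = exp (- T) / exp y" "exp (- (\<bar>y\<bar> - T)) = exp T * exp y"
      using that by (simp_all add: exp_diff exp_add[symmetric] exp_minus field_simps)
    have "q * (T\<^sup>2 * ((p / q + r * q) / 2) + 2 * T * ((p / q - r * q) / 2))
      = p * (T\<^sup>2 / 2 + T) + r * (T\<^sup>2 / 2 - T) * q\<^sup>2" if "q > 0" for p q r :: real
      using that by (simp add: field_simps power2_eq_square)
    from this[OF exp_gt_zero] show ?thesis unfolding profile_outer[OF assms(2,1)] s e .
  qed
  show "profile T y + profile' T y = exp T * (T\<^sup>2 - 2 * T) * exp y" if "y < 0"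
  proof -
    have e: "exp (\<bar>y\<bar> - T) = exp (- T) / exp y" "exp (- (\<bar>y\<bar> - T)) = exp T * exp y"
      using that by (simp_all add: exp_diff exp_add[symmetric] exp_minus field_simps)
    show ?thesis unfolding profile_outer[OF assms(2,1)] s e using that by (simp add: field_simps power2_eq_square)
  qed
  show "profile T y + profile' T y = exp (- T) * (T\<^sup>2 + 2 * T) * exp y" if "y > 0"
  proof -
    have e: "exp (\<bar>y\<bar> - T) = exp (- T) * exp y"
      using that by (simp add: exp_add[symmetric])
    show ?thesis unfolding profile_outer[OF assms(2,1)] s e using that by (simp add: field_simps power2_eq_square)
  qed
qed

lemma glue_near:
  assumes "T \<ge> 0" "norm z < exp (- T - 1)"
  shows "glue T z = exp (- T) * (T\<^sup>2 / 2 + T) + exp T * (T\<^sup>2 / 2 - T) * (norm z)\<^sup>2"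
    and "dglue T z = (exp T * (T\<^sup>2 - 2 * T)) *\<^sub>R z"
proof -
  have "glue T z = exp (- T) * (T\<^sup>2 / 2 + T) + exp T * (T\<^sup>2 / 2 - T) * (norm z)\<^sup>2
     \<and> dglue T z = (exp T * (T\<^sup>2 - 2 * T)) *\<^sub>R z"
  proof (cases "z = 0")
    case False
    define y where "y = ln (norm z)"
    have ny: "norm z = exp y" using False by (simp add: y_def)
    have "y < - T - 1" using assms(2) by (simp add: ny)
    then have y: "\<bar>y\<bar> > T" "\<bar>y\<bar> \<ge> T + 1" "y < 0" using assms(1) by auto
    note c = cutoff_outer[OF y(2) assms(1)] and p = profile_outer_exp[OF assms(1) y(1)]
    show ?thesis using False by (simp add: glue_def dglue_def ny c p(1,2)[OF y(3)])
  qed (simp add: glue_def dglue_def)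
  then show "glue T z = exp (- T) * (T\<^sup>2 / 2 + T) + exp T * (T\<^sup>2 / 2 - T) * (norm z)\<^sup>2"
    "dglue T z = (exp T * (T\<^sup>2 - 2 * T)) *\<^sub>R z" by auto
qed

lemma dglue_far:
  assumes "T \<ge> 0" "norm z \<ge> exp (T + 1)"
  shows "dglue T z = (2 * (exp (- T) * (T\<^sup>2 / 2 + T))) *\<^sub>R z"
proof -
  have z: "z \<noteq> 0" using assms by (auto simp: not_le)
  define y where "y = ln (norm z)"
  have ny: "norm z = exp y" using z by (simp add: y_def)
  have "y \<ge> T + 1" using assms(2) by (simp add: ny)
  then have y: "\<bar>y\<bar> > T" "\<bar>y\<bar> \<ge> T + 1" "y > 0" using assms(1) by auto
  note c = cutoff_outer[OF y(2) assms(1)] and p = profile_outer_exp(3)[OF assms(1) y(1,3)]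
  have "dglue T z = ((profile T y + profile' T y) / exp y) *\<^sub>R z"
    using z c by (simp add: dglue_def ny)
  also have "\<dots> = (exp (- T) * (T\<^sup>2 + 2 * T)) *\<^sub>R z" by (simp add: p)
  also have "exp (- T) * (T\<^sup>2 + 2 * T) = 2 * (exp (- T) * (T\<^sup>2 / 2 + T))" by (simp add: field_simps)
  finally show ?thesis .
qed

lemma glue_derivative:
  assumes "T \<ge> 0"
  shows "(glue T has_derivative (\<lambda>h. dglue T z \<bullet> h)) (at z)"
proof (cases "z = 0")
  case True
  have "((\<lambda>z. exp (- T) * (T\<^sup>2 / 2 + T) + exp T * (T\<^sup>2 / 2 - T) * (norm z)\<^sup>2) has_derivative (\<lambda>h. dglue T 0 \<bullet> h)) (at 0)"
    unfolding power2_norm_eq_inner by (auto intro!: derivative_eq_intros simp: dglue_def)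
  then show ?thesis unfolding True
    by (rule has_derivative_transform_within_open[where s = "ball 0 (exp (- T - 1))"])
      (auto simp: glue_near[OF assms])
qed (rule glue_derivative_punctured)

lemma dglue_continuous:
  assumes "T \<ge> 0"
  shows "continuous_on UNIV (dglue T)"
proof -
  have ln: "continuous_on (- {0::'a}) (\<lambda>z. ln (norm z))" by (auto intro!: continuous_intros)
  have "continuous_on (- {0}) (\<lambda>z. ((cutoff T (ln (norm z)) * a z + profile T (ln (norm z)) + cutoff' T (ln (norm z)) * a z + profile' T (ln (norm z))) / norm z) *\<^sub>R z
       + (norm z * cutoff T (ln (norm z))) *\<^sub>R da z)"
    by (intro continuous_intros a_continuous cont ln continuous_on_compose2[OF cutoff_continuous(1) ln]
      continuous_on_compose2[OF cutoff_continuous(2) ln] continuous_on_compose2[OF profile_continuous(1) ln]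
      continuous_on_compose2[OF profile_continuous(2) ln]) auto
  then have 1: "continuous_on (- {0}) (dglue T)"
    by (rule continuous_on_eq) (auto simp: dglue_def)
  have "continuous_on (ball 0 (exp (- T - 1))) (\<lambda>z::'a. (exp T * (T\<^sup>2 - 2 * T)) *\<^sub>R z)" by (intro continuous_intros)
  then have 2: "continuous_on (ball 0 (exp (- T - 1))) (dglue T)"
    by (rule continuous_on_eq) (auto simp: glue_near[OF assms])
  have "continuous_on (- {0} \<union> ball 0 (exp (- T - 1))) (dglue T)"
    by (intro continuous_on_open_Un 1 2) auto
  moreover have "- {0} \<union> ball 0 (exp (- T - 1)) = (UNIV :: 'a set)" by auto
  ultimately show ?thesis by simp
qed

end

text \<open>The usual sharp Sobolev constant times \<open>4 / (N - 2)\<^sup>2\<close>; the factor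
  comes from writing the energy of \<open>u\<close> through
  \<open>g = u powr (- 2 / (N - 2))\<close>.\<close>

definition sobolev_const :: "'a::euclidean_space itself \<Rightarrow> real" where
  "sobolev_const _ = 4 * real DIM('a) / (real DIM('a) - 2) * enn2real (Kint TYPE('a) DIM('a)) powr (2 / real DIM('a))"

lemma sobolev_const_pos: "DIM('a::euclidean_space) \<ge> 3 \<Longrightarrow> sobolev_const TYPE('a) > 0"
proof -
  assume N: "DIM('a) \<ge> 3"
  have "enn2real (Kint TYPE('a) DIM('a)) > 0"
    using Kint_pos[where 'a='a, of "DIM('a)"] Kint_DIM_finite[where 'a='a] by (simp add: enn2real_positive_iff)
  then show ?thesis using N by (simp add: sobolev_const_def)
qed

section \<open>Energy balance of the truncation\<close>

lemma nn_integral_two_sided_tail: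
  "(\<integral>\<^sup>+y. ennreal (exp (- 2 * (\<bar>y\<bar> - T))) * indicator {y. \<bar>y\<bar> > T} y \<partial>lborel) \<le> 1"
proof -
  let ?f = "\<lambda>y. ennreal (exp (2 * T)) * (ennreal (exp (- 2 * y)) * indicator {T..} y)"
  have half: "(\<integral>\<^sup>+y. ?f y \<partial>lborel) = ennreal (1 / 2)"
    by (subst nn_integral_cmult) (auto simp: nn_integral_exp_tail[of 2, simplified] ennreal_mult[symmetric] exp_add[symmetric] mult_exp_exp)
  have "(\<integral>\<^sup>+y. ennreal (exp (- 2 * (\<bar>y\<bar> - T))) * indicator {y. \<bar>y\<bar> > T} y \<partial>lborel) \<le> (\<integral>\<^sup>+y. ?f y + ?f (- y) \<partial>lborel)"
  proof (rule nn_integral_mono)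
    fix y :: real
    have *: "exp (- 2 * (s - T)) = exp (2 * T) * exp (- 2 * s)" for s by (simp add: exp_add[symmetric])
    show "ennreal (exp (- 2 * (\<bar>y\<bar> - T))) * indicator {y. \<bar>y\<bar> > T} y \<le> ?f y + ?f (- y)"
    proof (cases "\<bar>y\<bar> > T")
      case True
      have f: "?f s = ennreal (exp (- 2 * (s - T)))" if "s > T" for s
        using that by (simp only: * ennreal_mult[OF exp_ge_zero exp_ge_zero]) simp
      consider "y \<ge> 0" "y > T" | "y < 0" "- y > T" using True by linarith
      then show ?thesis
      proof cases
        case 1
        then show ?thesis using True f[OF 1(2)] by (simp add: add_increasing2)
      next
        case 2
        then show ?thesis using True f[OF 2(2)] by (simp add: add_increasing)
      qed
    qed simp
  qed
  also have "\<dots> = (\<integral>\<^sup>+y. ?f y \<partial>lborel) + (\<integral>\<^sup>+y. ?f (- y) \<partial>lborel)" by (rule nn_integral_add) auto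
  also have "(\<integral>\<^sup>+y. ?f (- y) \<partial>lborel) = (\<integral>\<^sup>+y. ?f y \<partial>lborel)" by (rule nn_integral_even) auto
  also have "(\<integral>\<^sup>+y. ?f y \<partial>lborel) + (\<integral>\<^sup>+y. ?f y \<partial>lborel) = 1"
  proof -
    have "ennreal (1 / 2) + ennreal (1 / 2) = ennreal (1 / 2 + 1 / 2)" by (rule ennreal_plus[symmetric]) auto
    then show ?thesis unfolding half by (simp only: field_sum_of_halves ennreal_1)
  qed
  finally show ?thesis .
qed

lemma profile_outer_bounds:
  assumes "\<bar>y\<bar> > T" "T \<ge> 2"
  shows "T\<^sup>2 * exp (\<bar>y\<bar> - T) / 2 \<le> profile T y" "profile T y \<le> T\<^sup>2 * exp (\<bar>y\<bar> - T)"
    "\<bar>profile' T y\<bar> \<le> T\<^sup>2 * exp (\<bar>y\<bar> - T)"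
proof -
  define u where "u = \<bar>y\<bar> - T"
  have u: "u > 0" using assms by (simp add: u_def)
  have TT: "2 * T \<le> T\<^sup>2" using assms by (simp add: power2_eq_square)
  have sh: "sinh u \<ge> 0" "cosh u \<ge> 1" using u by (auto simp: cosh_real_ge_1)
  have cs: "cosh u + sinh u = exp u" by (simp add: cosh_plus_sinh)
  have cu: "cosh u \<ge> exp u / 2" by (simp add: cosh_def)
  have p: "profile T y = T\<^sup>2 * cosh u + 2 * T * sinh u" "\<bar>profile' T y\<bar> = T\<^sup>2 * sinh u + 2 * T * cosh u"
    using profile_outer[of T y] assms sh by (auto simp: u_def abs_mult sgn_if)
  have "T\<^sup>2 * (exp u / 2) \<le> T\<^sup>2 * cosh u" using cu by (intro mult_left_mono) auto
  then show "T\<^sup>2 * exp (\<bar>y\<bar> - T) / 2 \<le> profile T y"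
    unfolding p u_def[symmetric] using sh assms by (simp add: add_increasing2)
  have "2 * T * sinh u \<le> T\<^sup>2 * sinh u" "2 * T * cosh u \<le> T\<^sup>2 * cosh u"
    using TT sh by (auto intro!: mult_right_mono)
  then show "profile T y \<le> T\<^sup>2 * exp (\<bar>y\<bar> - T)" "\<bar>profile' T y\<bar> \<le> T\<^sup>2 * exp (\<bar>y\<bar> - T)"
    unfolding p u_def[symmetric] cs[symmetric] by (simp_all add: distrib_left)
qed

text \<open>Cutting off at \<open>T\<close> costs \<open>O(T powr (4 - 2 * N))\<close> but saves energy of order \<open>T powr (5 - 2 * N)\<close>,
  which is the source of strictness.\<close>

lemma cutoff_energy_gain:
  fixes A \<Psi> K T :: real and n :: nat
  assumes A: "0 < A" "A \<le> T\<^sup>2" and \<Psi>: "0 \<le> \<Psi>" "\<Psi> \<le> T\<^sup>2" and K: "0 \<le> K" "2 * K \<le> T ^ 4" and n: "n \<ge> 2"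
    and T: "T \<ge> 2" "T > 60 * 2 ^ (n + 2) * 5 ^ n"
  defines "\<delta> \<equiv> (T / (2 * 5 ^ n) - 30 * 2 ^ (n + 2)) / (T\<^sup>2) ^ n"
  shows "(\<integral>\<^sup>+y. ennreal (((cutoff T y * A + profile T y)\<^sup>2 + (cutoff' T y * A + profile' T y)\<^sup>2 + (cutoff T y)\<^sup>2 * \<Psi>)
        / (cutoff T y * A + profile T y) ^ (n + 2)) \<partial>lborel)
      + ennreal K * (\<integral>\<^sup>+y. ennreal (1 / (A + y\<^sup>2) ^ (n + 2)) * indicator {y. \<bar>y\<bar> > T} y \<partial>lborel) + ennreal \<delta>
    \<le> (\<integral>\<^sup>+y. ennreal (((A + y\<^sup>2)\<^sup>2 + 4 * y\<^sup>2 + \<Psi>) / (A + y\<^sup>2) ^ (n + 2)) \<partial>lborel)"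
proof -
  define G where "G y = cutoff T y * A + profile T y" for y
  define G' where "G' y = cutoff' T y * A + profile' T y" for y
  \<comment> \<open>\<open>c\<close> bounds the truncated density beyond \<open>T\<close>, up to an
    exponential of integral at most 1. \<open>l\<close> is the saving kept on the interval from
    \<open>T\<close> to \<open>2 * T\<close>, where
    \<open>A + y\<^sup>2 \<le> 5 * T\<^sup>2\<close>. The interval has length \<open>T\<close>, and
    \<open>\<delta>\<close> is the surplus \<open>l * T - c\<close>.\<close>
  define c where "c = 30 * 2 ^ (n + 2) / (T\<^sup>2) ^ n"
  define l where "l = 1 / (2 * (5 * T\<^sup>2) ^ n)"
  let ?eT = "\<lambda>y. ((G y)\<^sup>2 + (G' y)\<^sup>2 + (cutoff T y)\<^sup>2 * \<Psi>) / G y ^ (n + 2)"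
  let ?e = "\<lambda>y. ((A + y\<^sup>2)\<^sup>2 + 4 * y\<^sup>2 + \<Psi>) / (A + y\<^sup>2) ^ (n + 2)"
  let ?x = "\<lambda>y. 1 / (A + y\<^sup>2) ^ (n + 2)"
  have T0: "T > 0" using T by simp
  have Gm [measurable]: "G \<in> borel_measurable borel" "G' \<in> borel_measurable borel" "cutoff T \<in> borel_measurable borel"
    unfolding G_def G'_def using profile_continuous cutoff_continuous
    by (auto intro!: borel_measurable_continuous_onI continuous_intros)
  have c0: "c \<ge> 0" and l0: "l \<ge> 0" using T0 by (auto simp: c_def l_def)
  have Ay: "A + y\<^sup>2 > 0" for y using A by (simp add: add_pos_nonneg)
  have Gpos: "G y > 0" for y
  proof (cases "\<bar>y\<bar> \<le> T")
    case True then show ?thesis using cutoff_inner[OF True] profile_inner[OF True] Ay by (simp add: G_def)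
  next
    case False
    then have "profile T y > 0" using profile_outer_bounds(1)[of T y] T by (smt (verit) exp_gt_zero half_gt_zero mult_pos_pos zero_less_power)
    then show ?thesis using cutoff_bounds(1)[of T y] A T0 by (simp add: G_def add_nonneg_pos)
  qed
  have tail: "?eT y \<le> c * exp (- 2 * (\<bar>y\<bar> - T))" if y: "\<bar>y\<bar> > T" for y
  proof -
    define E where "E = exp (\<bar>y\<bar> - T)"
    have E: "E \<ge> 1" using y by (simp add: E_def)
    note b = profile_outer_bounds[OF y T(1), folded E_def] and cb = cutoff_bounds[of T y]
    have TE: "T\<^sup>2 \<le> T\<^sup>2 * E" using E by (simp add: mult_le_cancel_left1)
    have TE0: "T\<^sup>2 * E > 0" using T0 E by simp
    have cA0: "0 \<le> cutoff T y * A" using cb A T0 by auto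
    have cA1: "cutoff T y * A \<le> 1 * T\<^sup>2" using cb A T0 by (intro mult_mono) auto
    have "\<bar>cutoff' T y\<bar> * \<bar>A\<bar> \<le> 4 * T\<^sup>2" using cb A T0 by (intro mult_mono) auto
    then have "\<bar>cutoff' T y * A\<bar> \<le> 4 * T\<^sup>2" by (simp add: abs_mult)
    then have G'b: "\<bar>G' y\<bar> \<le> 5 * (T\<^sup>2 * E)" unfolding G'_def using b TE by linarith
    have Gb: "G y \<le> 2 * (T\<^sup>2 * E)" "T\<^sup>2 * E / 2 \<le> G y" unfolding G_def using b TE cA0 cA1 by linarith+
    have "(cutoff T y)\<^sup>2 * \<Psi> \<le> 1 * (T\<^sup>2 * E)\<^sup>2"
    proof (rule mult_mono)
      show "(cutoff T y)\<^sup>2 \<le> 1" using cb T0 by (simp add: power_le_one)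
      have "1 \<le> T\<^sup>2 * E" using T TE by (smt (verit) one_le_power)
      then show "\<Psi> \<le> (T\<^sup>2 * E)\<^sup>2" using \<Psi> TE by (smt (verit) power2_eq_square mult_le_cancel_left1)
    qed (use \<Psi> in auto)
    moreover have "(G y)\<^sup>2 \<le> (2 * (T\<^sup>2 * E))\<^sup>2" using Gb Gpos[of y] by (intro power_mono) auto
    moreover have "(G' y)\<^sup>2 \<le> (5 * (T\<^sup>2 * E))\<^sup>2" using G'b TE0 by (intro abs_le_square_iff[THEN iffD1]) auto
    \<comment> \<open>\<open>30 = 4 + 25 + 1\<close>: the value is at most
      \<open>2 * (T\<^sup>2 * E)\<close>, the \<open>y\<close>-derivative at most five times
      \<open>T\<^sup>2 * E\<close>, and the gradient term at most its square.\<close>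
    ultimately have num: "(G y)\<^sup>2 + (G' y)\<^sup>2 + (cutoff T y)\<^sup>2 * \<Psi> \<le> 30 * (T\<^sup>2 * E)\<^sup>2"
      by (simp add: power_mult_distrib)
    have "(T\<^sup>2 * E / 2) ^ (n + 2) \<le> G y ^ (n + 2)" using Gb TE0 by (intro power_mono) auto
    then have "?eT y \<le> 30 * (T\<^sup>2 * E)\<^sup>2 / (T\<^sup>2 * E / 2) ^ (n + 2)"
      using num TE0 by (intro frac_le) auto
    also have "\<dots> = 30 * 2 ^ (n + 2) * ((T\<^sup>2 * E)\<^sup>2 / (T\<^sup>2 * E) ^ (n + 2))" by (simp add: power_divide)
    also have "(T\<^sup>2 * E)\<^sup>2 / (T\<^sup>2 * E) ^ (n + 2) = 1 / ((T\<^sup>2) ^ n * E ^ n)"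
    proof -
      have "z\<^sup>2 / z ^ (n + 2) = 1 / z ^ n" if "z > 0" for z :: real using that by (simp add: power_add power2_eq_square)
      from this[OF TE0] show ?thesis by (simp add: power_mult_distrib)
    qed
    also have "30 * 2 ^ (n + 2) * (1 / ((T\<^sup>2) ^ n * E ^ n)) = c * (1 / E ^ n)" by (simp add: c_def)
    also have "\<dots> \<le> c * (1 / E ^ 2)"
      using E n c0 by (intro mult_left_mono divide_left_mono power_increasing) auto
    also have "1 / E ^ 2 = exp (- 2 * (\<bar>y\<bar> - T))"
    proof -
      have "E ^ 2 = exp (2 * (\<bar>y\<bar> - T))" by (simp add: E_def power2_eq_square flip: exp_add)
      then have "1 / E ^ 2 = exp (- (2 * (\<bar>y\<bar> - T)))" by (simp only: exp_minus inverse_eq_divide)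
      then show ?thesis by simp
    qed
    finally show ?thesis .
  qed
  \<comment> \<open>The untruncated density is at least \<open>1 / Y ^ n\<close> with
    \<open>Y = A + y\<^sup>2\<close>. One half of it pays for \<open>K\<close> times the mass
    density, by \<open>2 * K \<le> T ^ 4 \<le> Y\<^sup>2\<close>; the other half is the
    saving.\<close>
  have gain: "K * ?x y + l * indicator {T<..2*T} y \<le> ?e y" if y: "\<bar>y\<bar> > T" for y
  proof -
    have yT: "T\<^sup>2 \<le> y\<^sup>2" using y T0 by (intro abs_le_square_iff[THEN iffD1]) auto
    define Y where "Y = A + y\<^sup>2"
    have Y: "Y > 0" "T\<^sup>2 \<le> Y" using Ay yT A by (auto simp: Y_def)
    have "2 * K \<le> T ^ 4" by (rule K)
    also have "T ^ 4 = (T\<^sup>2)\<^sup>2" by simp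
    also have "\<dots> \<le> Y\<^sup>2" using Y by (intro power_mono) auto
    finally have "K * (1 / Y ^ (n + 2)) \<le> (Y\<^sup>2 / 2) * (1 / Y ^ (n + 2))" using Y by (intro mult_right_mono) auto
    also have "\<dots> = 1 / (2 * Y ^ n)" using Y by (simp add: power_add power2_eq_square)
    finally have 1: "K * (1 / Y ^ (n + 2)) \<le> 1 / (2 * Y ^ n)" .
    have 2: "l * indicator {T<..2*T} y \<le> 1 / (2 * Y ^ n)"
    proof (cases "y \<in> {T<..2*T}")
      case True
      then have "y\<^sup>2 \<le> (2 * T)\<^sup>2" using T0 by (intro power_mono) auto
      then have "Y \<le> 5 * T\<^sup>2" using A by (simp add: Y_def power_mult_distrib)
      then have "Y ^ n \<le> (5 * T\<^sup>2) ^ n" using Y by (intro power_mono) auto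
      then show ?thesis using True Y T0 unfolding l_def by (simp add: frac_le)
    qed (use Y in auto)
    have "1 / Y ^ n = Y\<^sup>2 / Y ^ (n + 2)" using Y by (simp add: power_add power2_eq_square)
    also have "\<dots> \<le> ?e y" unfolding Y_def[symmetric] using Y \<Psi> by (intro divide_right_mono) auto
    finally show ?thesis using 1 2 unfolding Y_def[symmetric] by (simp add: field_simps)
  qed
  have pw: "ennreal (?eT y) + ennreal K * (ennreal (?x y) * indicator {y. \<bar>y\<bar> > T} y) + ennreal l * indicator {T<..2*T} y
     \<le> ennreal (?e y) + ennreal c * (ennreal (exp (- 2 * (\<bar>y\<bar> - T))) * indicator {y. \<bar>y\<bar> > T} y)" for y
  proof (cases "\<bar>y\<bar> > T")
    case False
    then have y: "\<bar>y\<bar> \<le> T" by simp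
    have "?eT y = ?e y" using cutoff_inner[OF y] profile_inner[OF y] by (simp add: G_def G'_def power_mult_distrib)
    then show ?thesis using False y by (auto simp: indicator_def)
  next
    case True
    have e0: "?eT y \<ge> 0" "?x y \<ge> 0" "?e y \<ge> 0" using Gpos[of y] \<Psi> Ay[of y] by (auto intro!: divide_nonneg_nonneg add_nonneg_nonneg simp: less_imp_le)
    have "?eT y + (K * ?x y + l * indicator {T<..2*T} y) \<le> c * exp (- 2 * (\<bar>y\<bar> - T)) + ?e y"
      by (intro add_mono tail gain True)
    then have "ennreal (?eT y + (K * ?x y + l * indicator {T<..2*T} y)) \<le> ennreal (c * exp (- 2 * (\<bar>y\<bar> - T)) + ?e y)"
      by (rule ennreal_leI)
    also have "ennreal (?eT y + (K * ?x y + l * indicator {T<..2*T} y)) = ennreal (?eT y) + (ennreal K * ennreal (?x y) + ennreal l * indicator {T<..2*T} y)"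
    proof -
      have lin: "ennreal (u + (K * v + l * i)) = ennreal u + (ennreal K * ennreal v + ennreal l * ennreal i)"
        if "u \<ge> 0" "v \<ge> 0" "i \<ge> 0" for u v i :: real using that K l0 by (simp add: ennreal_mult)
      show ?thesis by (subst lin) (use e0 in \<open>auto simp: ennreal_indicator\<close>)
    qed
    also have "ennreal (c * exp (- 2 * (\<bar>y\<bar> - T)) + ?e y) = ennreal c * ennreal (exp (- 2 * (\<bar>y\<bar> - T))) + ennreal (?e y)"
      using e0 c0 by (simp add: ennreal_plus ennreal_mult')
    finally show ?thesis using True by (simp add: add_ac)
  qed
  have "(\<integral>\<^sup>+y. ennreal (?eT y) \<partial>lborel) + ennreal K * (\<integral>\<^sup>+y. ennreal (?x y) * indicator {y. \<bar>y\<bar> > T} y \<partial>lborel)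
       + ennreal l * emeasure lborel {T<..2*T}
    = (\<integral>\<^sup>+y. ennreal (?eT y) + ennreal K * (ennreal (?x y) * indicator {y. \<bar>y\<bar> > T} y) + ennreal l * indicator {T<..2*T} y \<partial>lborel)"
    by (simp add: nn_integral_add nn_integral_cmult)
  also have "\<dots> \<le> (\<integral>\<^sup>+y. ennreal (?e y) + ennreal c * (ennreal (exp (- 2 * (\<bar>y\<bar> - T))) * indicator {y. \<bar>y\<bar> > T} y) \<partial>lborel)"
    by (intro nn_integral_mono pw)
  also have "\<dots> = (\<integral>\<^sup>+y. ennreal (?e y) \<partial>lborel) + ennreal c * (\<integral>\<^sup>+y. ennreal (exp (- 2 * (\<bar>y\<bar> - T))) * indicator {y. \<bar>y\<bar> > T} y \<partial>lborel)"
    by (simp add: nn_integral_add nn_integral_cmult)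
  also have "\<dots> \<le> (\<integral>\<^sup>+y. ennreal (?e y) \<partial>lborel) + ennreal c * 1"
    by (intro add_left_mono mult_left_mono nn_integral_two_sided_tail) auto
  also have "ennreal l * emeasure lborel {T<..2*T} = ennreal (l * T)" using T0 l0 by (simp add: ennreal_mult)
  also have "l * T = c + \<delta>"
    using T0 by (simp add: l_def c_def \<delta>_def power_mult_distrib field_simps)
  also have "ennreal (c + \<delta>) = ennreal \<delta> + ennreal c"
  proof -
    have "T / (2 * 5 ^ n) - 30 * 2 ^ (n + 2) \<ge> 0" using T(2) by (simp add: field_simps)
    then have "\<delta> \<ge> 0" by (simp add: \<delta>_def)
    then show ?thesis using c0 by (simp add: ennreal_plus add.commute)
  qed
  finally have "ennreal c + ((\<integral>\<^sup>+y. ennreal (?eT y) \<partial>lborel) + ennreal K * (\<integral>\<^sup>+y. ennreal (?x y) * indicator {y. \<bar>y\<bar> > T} y \<partial>lborel) + ennreal \<delta>)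
     \<le> ennreal c + (\<integral>\<^sup>+y. ennreal (?e y) \<partial>lborel)" by (simp add: add_ac)
  then show ?thesis by (subst (asm) ennreal_add_left_cancel_le) (auto simp: G_def G'_def)
qed

section \<open>Sobolev inequality for truncated lifts\<close>

context homogeneous_C1
begin

text \<open>On the cylinder \<open>1 + (norm z)\<^sup>2\<close> becomes
  \<open>exp y * (exp (- y) + exp y)\<close>, so the untwisted lift is to be compared with
  \<open>exp \<bar>y\<bar>\<close>. For \<open>\<bar>y\<bar> \<le> T\<close> this is bounded and
  positivity of \<open>a\<close> is enough; beyond \<open>T\<close> the profile itself grows
  exponentially.\<close>

lemma glue_lower:
  assumes T: "T \<ge> 2"
  obtains c where "c > 0" "\<And>z. c * (1 + (norm z)\<^sup>2) \<le> glue T z"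
proof -
  obtain a0 a1 M where a0: "a0 > 0" "\<And>z. z \<noteq> 0 \<Longrightarrow> a0 \<le> a z" using bounds by metis
  define c where "c = min (a0 / (2 * exp T)) (T\<^sup>2 * exp (- T) / 4)"
  have c: "c > 0" using a0 T by (simp add: c_def)
  have c1: "c * (2 * exp T) \<le> a0" and c2: "c \<le> T\<^sup>2 * exp (- T) / 4"
    by (simp_all add: c_def min_def field_simps)
  have "c * (1 + (norm z)\<^sup>2) \<le> glue T z" for z
  proof (cases "z = 0")
    case True
    have "T\<^sup>2 / 4 \<le> T\<^sup>2 / 2 + T" using T by simp
    then have "exp (- T) * (T\<^sup>2 / 4) \<le> exp (- T) * (T\<^sup>2 / 2 + T)" by (intro mult_left_mono) auto
    moreover have "exp (- T) * (T\<^sup>2 / 4) = T\<^sup>2 * exp (- T) / 4" by simp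
    ultimately have "c \<le> exp (- T) * (T\<^sup>2 / 2 + T)" using c2 by linarith
    then show ?thesis using True by (simp add: glue_def)
  next
    case False
    define y where "y = ln (norm z)"
    have ny: "norm z = exp y" using False by (simp add: y_def)
    define G where "G = cutoff T y * a z + profile T y"
    have g: "glue T z = exp y * G" using False by (simp add: glue_def ny G_def)
    have e1: "1 + (norm z)\<^sup>2 = exp y * (exp (- y) + exp y)"
      by (simp add: ny distrib_left power2_eq_square exp_minus)
    have e2: "exp (- y) + exp y \<le> 2 * exp \<bar>y\<bar>" by (cases "y \<ge> 0") auto
    have "c * (exp (- y) + exp y) \<le> G"
    proof (cases "\<bar>y\<bar> \<le> T")
      case True
      have "c * (exp (- y) + exp y) \<le> c * (2 * exp \<bar>y\<bar>)" using e2 c by (intro mult_left_mono) auto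
      also have "\<dots> \<le> c * (2 * exp T)" using True c by (intro mult_left_mono) auto
      also have "\<dots> \<le> a0" by (rule c1)
      also have "\<dots> \<le> G" using a0(2)[OF False] cutoff_inner[OF True] profile_inner[OF True] by (simp add: G_def add_increasing2)
      finally show ?thesis .
    next
      case o: False
      have "c * (exp (- y) + exp y) \<le> (T\<^sup>2 * exp (- T) / 4) * (2 * exp \<bar>y\<bar>)" using e2 c c2 by (intro mult_mono) auto
      also have "\<dots> = T\<^sup>2 * exp (\<bar>y\<bar> - T) / 2" by (simp add: exp_diff exp_minus field_simps)
      also have "\<dots> \<le> profile T y" using o T by (intro profile_outer_bounds) auto
      also have "\<dots> \<le> G" using cutoff_bounds(1)[of T y] pos[OF False] T by (simp add: G_def)
      finally show ?thesis .
    qed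
    then show ?thesis unfolding g e1 by (simp add: mult.left_commute)
  qed
  with c show ?thesis using that by blast
qed

text \<open>The radial derivative of \<open>exp y * G\<close> is \<open>G + G'\<close>, and the
  tangential gradient is orthogonal to it by \<open>da_orthogonal\<close>, so the squares
  add.\<close>

lemma glue_cylinder:
  assumes "norm x = 1"
  shows "glue T (exp y *\<^sub>R x) = exp y * (cutoff T y * a x + profile T y)"
    and "(norm (dglue T (exp y *\<^sub>R x)))\<^sup>2 = ((cutoff T y * a x + profile T y) + (cutoff' T y * a x + profile' T y))\<^sup>2 + (cutoff T y)\<^sup>2 * (norm (da x))\<^sup>2"
proof -
  have x: "x \<noteq> 0" using assms by auto
  have n: "norm (exp y *\<^sub>R x) = exp y" using assms by simp
  show "glue T (exp y *\<^sub>R x) = exp y * (cutoff T y * a x + profile T y)"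
    using x assms by (simp add: glue_def hom)
  define u where "u = (cutoff T y * a x + profile T y) + (cutoff' T y * a x + profile' T y)"
  have "dglue T (exp y *\<^sub>R x) = u *\<^sub>R x + cutoff T y *\<^sub>R da x"
    using x assms by (simp add: dglue_def hom da_scale u_def add_ac)
  moreover have "(norm (u *\<^sub>R x + cutoff T y *\<^sub>R da x))\<^sup>2 = u\<^sup>2 * (norm x)\<^sup>2 + (cutoff T y)\<^sup>2 * (norm (da x))\<^sup>2 + 2 * u * cutoff T y * (da x \<bullet> x)"
    unfolding power2_norm_eq_inner
    by (simp add: inner_add_left inner_add_right inner_commute power2_eq_square algebra_simps)
  ultimately show "(norm (dglue T (exp y *\<^sub>R x)))\<^sup>2 = ((cutoff T y * a x + profile T y) + (cutoff' T y * a x + profile' T y))\<^sup>2 + (cutoff T y)\<^sup>2 * (norm (da x))\<^sup>2"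
    using assms da_orthogonal[OF x] by (simp add: u_def)
qed

lemma glue_measurable:
  assumes "T \<ge> 0" shows "glue T \<in> borel_measurable borel" "dglue T \<in> borel_measurable borel"
proof -
  have "continuous_on UNIV (glue T)"
    using glue_derivative[OF assms] by (intro continuous_at_imp_continuous_on ballI) (auto intro: has_derivative_continuous)
  then show "glue T \<in> borel_measurable borel" by (rule borel_measurable_continuous_onI)
  show "dglue T \<in> borel_measurable borel" by (rule borel_measurable_continuous_onI[OF dglue_continuous[OF assms]])
qed

text \<open>Here \<open>sharp_Sobolev\<close> is carried to the cylinder. The energy density arrives
  with the cross term \<open>2 * G * G'\<close>, which is odd in \<open>y\<close> because the lift
  is even; averaging over \<open>y\<close> and \<open>- y\<close> removes it.\<close>

lemma glue_Sobolev:
  assumes N: "DIM('a) \<ge> 3" and T: "T \<ge> 2"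
    and D: "sph_nn (\<lambda>x. \<integral>\<^sup>+y. ennreal (((cutoff T y * a x + profile T y)\<^sup>2 + (cutoff' T y * a x + profile' T y)\<^sup>2 + (cutoff T y)\<^sup>2 * (norm (da x))\<^sup>2)
        / (cutoff T y * a x + profile T y) ^ DIM('a)) \<partial>lborel) = ennreal D" "D \<ge> 0"
  obtains X where "X \<ge> 0" "sph_nn (\<lambda>x. \<integral>\<^sup>+y. ennreal (1 / (cutoff T y * a x + profile T y) ^ DIM('a)) \<partial>lborel) = ennreal X"
    "sobolev_const TYPE('a) * X powr ((real DIM('a) - 2) / real DIM('a)) \<le> D"
proof -
  have T0: "T \<ge> 0" using T by simp
  note [measurable] = glue_measurable[OF T0]
  obtain c where c: "c > 0" "\<And>z. c * (1 + (norm z)\<^sup>2) \<le> glue T z" using glue_lower[OF T] by metis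
  have gpos: "glue T z > 0" for z
  proof -
    have "0 < c * (1 + (norm z)\<^sup>2)" using c(1) by (intro mult_pos_pos add_pos_nonneg) auto
    then show ?thesis using c(2)[of z] by linarith
  qed
  let ?G = "\<lambda>x y. cutoff T y * a x + profile T y"
  let ?G' = "\<lambda>x y. cutoff' T y * a x + profile' T y"
  have exp1: "ennreal (exp y ^ DIM('a)) * ennreal (v / (exp y * G) ^ DIM('a)) = ennreal (v / G ^ DIM('a))" for y v G :: real
    by (simp add: ennreal_mult'[symmetric] power_mult_distrib)
  have Xeq: "(\<integral>\<^sup>+z. ennreal (1 / glue T z ^ DIM('a)) \<partial>lborel) = sph_nn (\<lambda>x. \<integral>\<^sup>+y. ennreal (1 / ?G x y ^ DIM('a)) \<partial>lborel)"
    by (subst nn_integral_cylinder, measurable) (intro sph_nn_cong, simp only: glue_cylinder exp1)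
  have Deq: "(\<integral>\<^sup>+z. ennreal ((norm (dglue T z))\<^sup>2 / glue T z ^ DIM('a)) \<partial>lborel) = ennreal D"
  proof -
    have "(\<integral>\<^sup>+z. ennreal ((norm (dglue T z))\<^sup>2 / glue T z ^ DIM('a)) \<partial>lborel)
      = sph_nn (\<lambda>x. \<integral>\<^sup>+y. ennreal (((?G x y + ?G' x y)\<^sup>2 + (cutoff T y)\<^sup>2 * (norm (da x))\<^sup>2) / ?G x y ^ DIM('a)) \<partial>lborel)"
      by (subst nn_integral_cylinder, measurable) (intro sph_nn_cong, simp only: glue_cylinder exp1)
    also have "\<dots> = sph_nn (\<lambda>x. \<integral>\<^sup>+y. ennreal (((?G x y)\<^sup>2 + (?G' x y)\<^sup>2 + (cutoff T y)\<^sup>2 * (norm (da x))\<^sup>2) / ?G x y ^ DIM('a)) \<partial>lborel)"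
    proof (rule sph_nn_cong)
      fix x :: 'a assume x: "norm x = 1"
      have [measurable]: "cutoff T \<in> borel_measurable borel" "cutoff' T \<in> borel_measurable borel"
        "profile T \<in> borel_measurable borel" "profile' T \<in> borel_measurable borel"
        using cutoff_continuous profile_continuous by (auto intro: borel_measurable_continuous_onI)
      have Gp: "?G x y > 0" for y
        using gpos[of "exp y *\<^sub>R x"] x by (simp add: glue_cylinder zero_less_mult_iff)
      define f where "f y = ennreal (((?G x y + ?G' x y)\<^sup>2 + (cutoff T y)\<^sup>2 * (norm (da x))\<^sup>2) / ?G x y ^ DIM('a))" for y
      have [measurable]: "f \<in> borel_measurable borel" unfolding f_def by measurable
      have "ennreal (((?G x y)\<^sup>2 + (?G' x y)\<^sup>2 + (cutoff T y)\<^sup>2 * (norm (da x))\<^sup>2) / ?G x y ^ DIM('a))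
         = ennreal (1/2) * f y + ennreal (1/2) * f (- y)" for y
      proof -
        define p q r s where "p = ?G x y" and "q = ?G' x y" and "r = (cutoff T y)\<^sup>2 * (norm (da x))\<^sup>2" and "s = ?G x y ^ DIM('a)"
        have s: "s > 0" "r \<ge> 0" using Gp by (auto simp: s_def r_def)
        have fy: "f y = ennreal (((p + q)\<^sup>2 + r) / s)" by (simp add: f_def p_def q_def r_def s_def)
        have fy': "f (- y) = ennreal (((p - q)\<^sup>2 + r) / s)"
          by (simp add: f_def p_def q_def r_def s_def cutoff_even profile_even algebra_simps)
        have split: "(p\<^sup>2 + q\<^sup>2 + r) / s = (1/2) * (((p + q)\<^sup>2 + r) / s) + (1/2) * (((p - q)\<^sup>2 + r) / s)"
          using s by (simp add: field_simps power2_eq_square)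
        have "ennreal ((p\<^sup>2 + q\<^sup>2 + r) / s) = ennreal (1/2) * f y + ennreal (1/2) * f (- y)"
        proof -
          have lin: "ennreal (c * P + c * Q) = ennreal c * ennreal P + ennreal c * ennreal Q"
            if "c \<ge> 0" "P \<ge> 0" "Q \<ge> 0" for c P Q :: real using that by (simp add: ennreal_mult)
          have "((p + q)\<^sup>2 + r) / s \<ge> 0" "((p - q)\<^sup>2 + r) / s \<ge> 0" using s by auto
          from lin[OF _ this, of "1/2"] show ?thesis
            unfolding fy fy' split by simp
        qed
        then show ?thesis by (simp add: p_def q_def r_def s_def)
      qed
      then have "(\<integral>\<^sup>+y. ennreal (((?G x y)\<^sup>2 + (?G' x y)\<^sup>2 + (cutoff T y)\<^sup>2 * (norm (da x))\<^sup>2) / ?G x y ^ DIM('a)) \<partial>lborel)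
        = ennreal (1/2) * (\<integral>\<^sup>+y. f y \<partial>lborel) + ennreal (1/2) * (\<integral>\<^sup>+y. f (- y) \<partial>lborel)"
        by (simp only: nn_integral_add nn_integral_cmult) (subst nn_integral_add, measurable, simp add: nn_integral_cmult)
      also have "\<dots> = (ennreal (1/2) + ennreal (1/2)) * (\<integral>\<^sup>+y. f y \<partial>lborel)"
        by (simp only: nn_integral_even[of f] distrib_right) (simp add: nn_integral_even)
      also have "ennreal (1/2) + ennreal (1/2) = ennreal (1/2 + 1/2)" by (rule ennreal_plus[symmetric]) auto
      finally show "(\<integral>\<^sup>+y. ennreal (((?G x y + ?G' x y)\<^sup>2 + (cutoff T y)\<^sup>2 * (norm (da x))\<^sup>2) / ?G x y ^ DIM('a)) \<partial>lborel)
         = (\<integral>\<^sup>+y. ennreal (((?G x y)\<^sup>2 + (?G' x y)\<^sup>2 + (cutoff T y)\<^sup>2 * (norm (da x))\<^sup>2) / ?G x y ^ DIM('a)) \<partial>lborel)"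
        by (simp add: f_def)
    qed
    finally show ?thesis using D by simp
  qed
  have "(\<integral>\<^sup>+z. ennreal (1 / glue T z ^ DIM('a)) \<partial>lborel) \<le> (\<integral>\<^sup>+z. ennreal (1 / c ^ DIM('a)) * ennreal (1 / (1 + (norm (z::'a))\<^sup>2) ^ DIM('a)) \<partial>lborel)"
  proof (rule nn_integral_mono)
    fix z :: 'a
    have z1: "1 + (norm z)\<^sup>2 > 0" by (simp add: add_pos_nonneg)
    have "(c * (1 + (norm z)\<^sup>2)) ^ DIM('a) \<le> glue T z ^ DIM('a)" using c z1 by (intro power_mono) auto
    then have "1 / glue T z ^ DIM('a) \<le> 1 / (c * (1 + (norm z)\<^sup>2)) ^ DIM('a)"
      using gpos[of z] c z1 by (intro divide_left_mono) auto
    then show "ennreal (1 / glue T z ^ DIM('a)) \<le> ennreal (1 / c ^ DIM('a)) * ennreal (1 / (1 + (norm z)\<^sup>2) ^ DIM('a))"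
      using c by (auto simp: ennreal_mult[symmetric] power_mult_distrib intro!: ennreal_leI)
  qed
  also have "\<dots> = ennreal (1 / c ^ DIM('a)) * Kint TYPE('a) DIM('a)" by (simp add: Kint_def nn_integral_cmult)
  also have "\<dots> < top" using Kint_DIM_finite[where 'a='a] by (simp add: ennreal_mult_less_top)
  finally obtain X where X: "(\<integral>\<^sup>+z. ennreal (1 / glue T z ^ DIM('a)) \<partial>lborel) = ennreal X" "X \<ge> 0"
    by (metis ennreal_cases less_irrefl)
  let ?\<beta> = "exp (- T) * (T\<^sup>2 / 2 + T)"
  have \<beta>: "?\<beta> \<ge> 0" using T by simp
  note semi = semiconvex_of_C1[OF glue_derivative[OF T0] dglue_continuous[OF T0] dglue_far[OF T0] \<beta>]
  obtain B where B: "\<And>z. norm (dglue T z) \<le> B + 2 * ?\<beta> * norm z" using semi(1) by blast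
  define C where "C = (2 * B\<^sup>2 + 8 * ?\<beta>\<^sup>2) / c"
  have dgup: "(norm (dglue T z))\<^sup>2 \<le> C * glue T z" for z
  proof -
    have "(norm (dglue T z))\<^sup>2 \<le> (B + 2 * ?\<beta> * norm z)\<^sup>2" using B[of z] by (intro power_mono) auto
    also have "\<dots> \<le> 2 * B\<^sup>2 + 2 * (2 * ?\<beta> * norm z)\<^sup>2"
      using sum_squares_bound[of B "2 * ?\<beta> * norm z"] by (simp add: power2_sum)
    also have "\<dots> \<le> (2 * B\<^sup>2 + 8 * ?\<beta>\<^sup>2) * (1 + (norm z)\<^sup>2)"
    proof -
      have "2 * B\<^sup>2 + 2 * (2 * b * r)\<^sup>2 \<le> (2 * B\<^sup>2 + 8 * b\<^sup>2) * (1 + r\<^sup>2)" for b r :: real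
        by (simp add: power_mult_distrib algebra_simps)
      then show ?thesis .
    qed
    also have "\<dots> = C * (c * (1 + (norm z)\<^sup>2))" using c by (simp add: C_def)
    also have "\<dots> \<le> C * glue T z" using c by (intro mult_left_mono) (auto simp: C_def)
    finally show ?thesis .
  qed
  have "sobolev_const TYPE('a) * X powr ((real DIM('a) - 2) / real DIM('a)) \<le> D"
    unfolding sobolev_const_def
    by (rule sharp_Sobolev[OF glue_measurable[OF T0] N c dgup semi(2) X Deq D(2)])
  then show ?thesis using that X Xeq by metis
qed

end

context homogeneous_C1
begin

text \<open>Truncation loses at most the mass \<open>TL\<close> lying beyond \<open>T\<close>, but
  by \<open>cutoff_energy_gain\<close> lowers the energy by at least \<open>K * TL + d\<close> with
  \<open>d > 0\<close>. With \<open>K\<close> the slope of the chord of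
  \<open>S * x powr \<theta>\<close> from 0 to \<open>X\<close>, concavity shows that the lost mass
  lowers the Sobolev bound by at most \<open>K * TL\<close>, so \<open>d\<close> remains.\<close>

theorem cylinder_Sobolev_strict:
  assumes N: "DIM('a) \<ge> 4"
    and E: "sph_nn (\<lambda>x. \<integral>\<^sup>+y. ennreal (((a x + y\<^sup>2)\<^sup>2 + 4 * y\<^sup>2 + (norm (da x))\<^sup>2) / (a x + y\<^sup>2) ^ DIM('a)) \<partial>lborel) = ennreal E" "E \<ge> 0"
    and X: "sph_nn (\<lambda>x. \<integral>\<^sup>+y. ennreal (1 / (a x + y\<^sup>2) ^ DIM('a)) \<partial>lborel) = ennreal X" "X \<ge> 0"
  shows "sobolev_const TYPE('a) * X powr ((real DIM('a) - 2) / real DIM('a)) < E"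
proof -
  obtain n where n: "DIM('a) = n + 2" "n \<ge> 2" using N that[of "DIM('a) - 2"] by simp
  obtain a0 a1 M where bd: "a0 > 0" "M \<ge> 0" "\<And>z. z \<noteq> 0 \<Longrightarrow> a0 \<le> a z" "\<And>z. z \<noteq> 0 \<Longrightarrow> a z \<le> a1"
    "\<And>x. norm x = 1 \<Longrightarrow> (norm (da x))\<^sup>2 \<le> M" using bounds by metis
  define S where "S = sobolev_const TYPE('a)"
  have S: "S > 0" unfolding S_def by (rule sobolev_const_pos) (use N in simp)
  define \<theta> where "\<theta> = (real DIM('a) - 2) / real DIM('a)"
  have \<theta>: "\<theta> = 1 - 2 / real DIM('a)" by (simp add: \<theta>_def diff_divide_distrib)
  \<comment> \<open>Equal to \<open>S * X powr \<theta> / X\<close> when \<open>X > 0\<close>, as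
    \<open>\<theta> = 1 - 2 / N\<close>.\<close>
  define K where "K = S * X powr (- 2 / real DIM('a))"
  have K: "K \<ge> 0" using S by (simp add: K_def)
  define P :: real where "P = 60 * 2 ^ (n + 2) * 5 ^ n"
  have P: "P > 0" by (simp add: P_def)
  \<comment> \<open>A sum beyond all thresholds of \<open>cutoff_energy_gain\<close> at once; as
    \<open>T \<ge> 1\<close>, linear bounds also serve for \<open>T\<^sup>2\<close> and
    \<open>T ^ 4\<close>.\<close>
  define T where "T = 3 + P + \<bar>a1\<bar> + M + 2 * K"
  have TT: "T \<ge> 2" "T > 60 * 2 ^ (n + 2) * 5 ^ n" "T \<ge> a1" "T \<ge> M" "T \<ge> 2 * K"
    unfolding P_def[symmetric] T_def using bd(2) K P by linarith+
  have T1: "1 \<le> T" using TT by simp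
  have T2: "T \<le> T\<^sup>2" "T \<le> T ^ 4" using power_increasing[OF _ T1, of 1 2] power_increasing[OF _ T1, of 1 4] by simp_all
  define \<delta> where "\<delta> = (T / (2 * 5 ^ n) - 30 * 2 ^ (n + 2)) / (T\<^sup>2) ^ n"
  have "T / (2 * 5 ^ n) - 30 * 2 ^ (n + 2) > 0" using TT(2) by (simp add: field_simps)
  then have \<delta>: "\<delta> > 0" using TT(1) by (simp add: \<delta>_def)
  have [measurable]: "cutoff T \<in> borel_measurable borel" "cutoff' T \<in> borel_measurable borel"
    "profile T \<in> borel_measurable borel" "profile' T \<in> borel_measurable borel"
    using cutoff_continuous profile_continuous by (auto intro: borel_measurable_continuous_onI)
  define f where "f x = (\<integral>\<^sup>+y. ennreal (((cutoff T y * a x + profile T y)\<^sup>2 + (cutoff' T y * a x + profile' T y)\<^sup>2 + (cutoff T y)\<^sup>2 * (norm (da x))\<^sup>2)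
        / (cutoff T y * a x + profile T y) ^ DIM('a)) \<partial>lborel)" for x
  define k where "k x = (\<integral>\<^sup>+y. ennreal (1 / (a x + y\<^sup>2) ^ DIM('a)) * indicator {y. \<bar>y\<bar> > T} y \<partial>lborel)" for x
  define h where "h x = (\<integral>\<^sup>+y. ennreal (1 / (cutoff T y * a x + profile T y) ^ DIM('a)) \<partial>lborel)" for x
  have [measurable]: "f \<in> borel_measurable borel" "k \<in> borel_measurable borel" "h \<in> borel_measurable borel"
    unfolding f_def k_def h_def by measurable
  have x0: "x \<noteq> 0" if "norm x = 1" for x :: 'a using that by auto
  have "sph_nn (\<lambda>x. f x + ennreal K * k x + ennreal \<delta>) \<le> ennreal E"
    unfolding E(1)[symmetric]
  proof (rule sph_nn_mono)
    fix x :: 'a assume x: "norm x = 1"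
    show "f x + ennreal K * k x + ennreal \<delta> \<le> (\<integral>\<^sup>+y. ennreal (((a x + y\<^sup>2)\<^sup>2 + 4 * y\<^sup>2 + (norm (da x))\<^sup>2) / (a x + y\<^sup>2) ^ DIM('a)) \<partial>lborel)"
      unfolding f_def k_def \<delta>_def n(1)
    proof (rule cutoff_energy_gain)
      show "a x \<le> T\<^sup>2" using bd(4)[OF x0[OF x]] TT(3) T2 by linarith
      show "(norm (da x))\<^sup>2 \<le> T\<^sup>2" using bd(5)[OF x] TT(4) T2 by linarith
      show "2 * K \<le> T ^ 4" using TT(5) T2 by linarith
    qed (use pos[OF x0[OF x]] K n TT in auto)
  qed
  then have le1: "sph_nn f + ennreal K * sph_nn k + sph_nn (\<lambda>_::'a. ennreal \<delta>) \<le> ennreal E"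
    by (simp add: sph_nn_add sph_nn_cmult)
  have "ennreal X \<le> sph_nn (\<lambda>x. h x + k x)"
    unfolding X(1)[symmetric]
  proof (rule sph_nn_mono)
    fix x :: 'a assume x: "norm x = 1"
    have "(\<integral>\<^sup>+y. ennreal (1 / (a x + y\<^sup>2) ^ DIM('a)) \<partial>lborel)
      \<le> (\<integral>\<^sup>+y. ennreal (1 / (cutoff T y * a x + profile T y) ^ DIM('a)) + ennreal (1 / (a x + y\<^sup>2) ^ DIM('a)) * indicator {y. \<bar>y\<bar> > T} y \<partial>lborel)"
    proof (rule nn_integral_mono)
      fix y
      show "ennreal (1 / (a x + y\<^sup>2) ^ DIM('a)) \<le> ennreal (1 / (cutoff T y * a x + profile T y) ^ DIM('a)) + ennreal (1 / (a x + y\<^sup>2) ^ DIM('a)) * indicator {y. \<bar>y\<bar> > T} y"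
      proof (cases "\<bar>y\<bar> > T")
        case False
        then have "\<bar>y\<bar> \<le> T" by simp
        then show ?thesis using cutoff_inner[of y T] profile_inner[of y T] by simp
      qed simp
    qed
    also have "\<dots> = h x + k x" unfolding h_def k_def by (rule nn_integral_add) measurable
    finally show "(\<integral>\<^sup>+y. ennreal (1 / (a x + y\<^sup>2) ^ DIM('a)) \<partial>lborel) \<le> h x + k x" .
  qed
  then have le2: "ennreal X \<le> sph_nn h + sph_nn k" by (simp add: sph_nn_add)
  have "sph_nn k \<le> ennreal X"
    unfolding X(1)[symmetric] k_def
    by (intro sph_nn_mono nn_integral_mono) (auto simp: indicator_def)
  then obtain TL where TL: "sph_nn k = ennreal TL" "TL \<ge> 0"
    by (metis ennreal_cases ennreal_less_top leD less_top)
  have "sph_nn f \<le> sph_nn f + ennreal K * sph_nn k + sph_nn (\<lambda>_::'a. ennreal \<delta>)"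
    by (simp add: add.assoc add_increasing2)
  then have "sph_nn f \<le> ennreal E" using le1 by (rule order_trans)
  then obtain D where D: "sph_nn f = ennreal D" "D \<ge> 0"
    by (metis ennreal_cases ennreal_less_top leD less_top)
  obtain d where d: "sph_nn (\<lambda>_::'a. ennreal \<delta>) = ennreal d" "d > 0"
  proof -
    obtain d where "sph_nn (\<lambda>_::'a. ennreal \<delta>) = ennreal d" "d \<ge> 0"
      using sph_nn_const_finite[where 'a='a, of \<delta>] by (metis ennreal_cases less_irrefl)
    then show ?thesis using that sph_nn_const_pos[where 'a='a, OF \<delta>] by (metis ennreal_0 less_eq_real_def less_irrefl)
  qed
  obtain XT where XT: "XT \<ge> 0" "sph_nn h = ennreal XT" "S * XT powr \<theta> \<le> D"
    using glue_Sobolev[OF _ TT(1) D(1)[unfolded f_def[abs_def]] D(2)] N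
    unfolding h_def[abs_def] S_def \<theta>_def by auto
  have r1: "D + K * TL + d \<le> E"
  proof -
    have "ennreal (D + K * TL + d) \<le> ennreal E"
      using le1 D TL d K by (simp add: ennreal_mult)
    then show ?thesis using E(2) by (simp add: ennreal_le_iff)
  qed
  have r2: "X \<le> XT + TL"
  proof -
    have "ennreal X \<le> ennreal (XT + TL)" using le2 XT TL by simp
    then show ?thesis using XT TL by (subst (asm) ennreal_le_iff) auto
  qed
  have KTL: "K * TL \<ge> 0" using K TL by simp
  have "S * X powr \<theta> < E"
  proof (cases "X \<le> XT")
    case True
    have "\<theta> \<ge> 0" using N by (simp add: \<theta>_def)
    then have "X powr \<theta> \<le> XT powr \<theta>" using X True by (intro powr_mono2) auto
    then have "S * X powr \<theta> \<le> S * XT powr \<theta>" using S by (intro mult_left_mono) auto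
    then show ?thesis using XT(3) r1 d KTL by linarith
  next
    case False
    then have X0: "X > 0" using XT by simp
    have split: "v powr \<theta> = v * v powr (- 2 / real DIM('a))" if "v > 0" for v
      using that by (simp add: \<theta> powr_diff powr_minus_divide)
    \<comment> \<open>The chord inequality: \<open>x powr (- 2 / N)\<close> decreases, so
      \<open>K * x\<close> lies below \<open>S * x powr \<theta>\<close> for
      \<open>x \<le> X\<close>.\<close>
    have "XT * X powr (- 2 / real DIM('a)) \<le> XT powr \<theta>"
    proof (cases "XT = 0")
      case False
      with XT have p: "XT > 0" by simp
      have "X powr (- 2 / real DIM('a)) \<le> XT powr (- 2 / real DIM('a))"
        using p \<open>\<not> X \<le> XT\<close> by (intro powr_mono2') auto
      then show ?thesis unfolding split[OF p] using p by (intro mult_left_mono) auto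
    qed simp
    then have "S * (XT * X powr (- 2 / real DIM('a))) \<le> S * XT powr \<theta>" using S by (intro mult_left_mono) auto
    then have 1: "K * XT \<le> D" using XT(3) by (simp add: K_def mult_ac)
    have "S * X powr \<theta> = K * X" by (simp add: split[OF X0] K_def mult_ac)
    also have "\<dots> \<le> K * (XT + TL)" using r2 K by (rule mult_left_mono)
    also have "\<dots> \<le> D + K * TL" using 1 by (simp add: distrib_left)
    finally show ?thesis using r1 d by linarith
  qed
  then show ?thesis by (simp add: S_def \<theta>_def)
qed

end

section \<open>Concentrating bubbles\<close>

text \<open>On the sphere this is \<open>2 - 2 * p * (x \<bullet> e)\<close>, with minimum
  \<open>2 * (1 - p)\<close> at \<open>e\<close> for unit \<open>e\<close> and
  \<open>p \<ge> 0\<close>; its negative powers concentrate at \<open>e\<close> as \<open>p\<close>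
  tends to 1.\<close>

definition bub :: "'a::euclidean_space \<Rightarrow> real \<Rightarrow> 'a \<Rightarrow> real" where
  "bub e p z = 2 * (1 - p * ((z \<bullet> e) / norm z))"

definition dbub :: "'a::euclidean_space \<Rightarrow> real \<Rightarrow> 'a \<Rightarrow> 'a" where
  "dbub e p z = (- 2 * p) *\<^sub>R (e /\<^sub>R norm z - ((z \<bullet> e) / norm z ^ 3) *\<^sub>R z)"

lemma bub_lower:
  assumes "norm e = 1" "0 \<le> p"
  shows "2 * (1 - p) \<le> bub e p z"
proof (cases "z = 0")
  case False
  have "z \<bullet> e \<le> norm z" using norm_cauchy_schwarz[of z e] assms by simp
  then have "(z \<bullet> e) / norm z \<le> 1" using False by (simp add: field_simps)
  then have "p * ((z \<bullet> e) / norm z) \<le> p * 1" using assms by (intro mult_left_mono) auto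
  then show ?thesis by (simp add: bub_def)
qed (use assms in \<open>simp add: bub_def\<close>)

lemma homogeneous_C1_bub:
  assumes e: "norm e = 1" and p: "0 \<le> p" "p < 1"
  shows "homogeneous_C1 (bub e p) (dbub e p)"
proof
  fix z :: 'a
  show "bub e p z > 0" using bub_lower[OF e p(1), of z] p by simp
  show "bub e p (c *\<^sub>R z) = bub e p z" if "c > 0" for c using that by (simp add: bub_def)
  assume z: "z \<noteq> 0"
  have n: "(norm has_derivative (\<lambda>h. (z \<bullet> h) / norm z)) (at z)"
    using has_derivative_norm[OF z] by (simp add: sgn_div_norm inverse_eq_divide inner_commute)
  have "((\<lambda>z. 2 * (1 - p * ((z \<bullet> e) / norm z))) has_derivative (\<lambda>h. 2 * (0 - p * (((h \<bullet> e) * norm z - (z \<bullet> e) * ((z \<bullet> h) / norm z)) / (norm z * norm z))))) (at z)"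
    using z by (intro derivative_intros n has_derivative_mult_right has_derivative_diff has_derivative_const
        has_derivative_divide') auto
  moreover have "2 * (0 - p * (((h \<bullet> e) * norm z - (z \<bullet> e) * ((z \<bullet> h) / norm z)) / (norm z * norm z))) = dbub e p z \<bullet> h" for h
    using z unfolding dbub_def inner_scaleR_left inner_diff_left
    by (simp add: inner_commute field_simps power3_eq_cube)
  ultimately show "(bub e p has_derivative (\<lambda>h. dbub e p z \<bullet> h)) (at z)" unfolding bub_def[abs_def] by simp
next
  show "continuous_on (- {0}) (dbub e p)"
    unfolding dbub_def[abs_def] by (intro continuous_intros) auto
qed

lemma dbub_sphere:
  assumes "norm e = 1" "norm x = 1"
  shows "(norm (dbub e p x))\<^sup>2 = 4 * p\<^sup>2 * (1 - (x \<bullet> e)\<^sup>2)"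
proof -
  have "x \<bullet> x = 1" "e \<bullet> e = 1" using assms by (simp_all add: power2_norm_eq_inner[symmetric])
  then have "(norm (e - (x \<bullet> e) *\<^sub>R x))\<^sup>2 = 1 - (x \<bullet> e)\<^sup>2"
    unfolding power2_norm_eq_inner
    by (simp add: inner_diff_left inner_diff_right inner_commute power2_eq_square)
  then show ?thesis using assms by (simp add: dbub_def power_mult_distrib)
qed

section \<open>Comparison of the lifted and the extremal profile\<close>

lemma sinh_bounds:
  fixes t :: real
  assumes "t \<ge> 0"
  shows "t \<le> sinh t" "sinh t \<le> t * cosh t"
proof -
  have "sinh 0 - 0 \<le> sinh t - t"
    by (rule DERIV_nonneg_imp_nondecreasing[OF assms, of "\<lambda>t. sinh t - t"])
      (auto intro!: derivative_eq_intros exI cosh_real_ge_1)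
  then show "t \<le> sinh t" by simp
  have "0 * cosh 0 - sinh 0 \<le> t * cosh t - sinh t"
    by (rule DERIV_nonneg_imp_nondecreasing[OF assms, of "\<lambda>t. t * cosh t - sinh t"])
      (auto intro!: derivative_eq_intros exI)
  then show "sinh t \<le> t * cosh t" by simp
qed

text \<open>All three rest on \<open>2 * cosh y - 2 = (2 * sinh (y / 2))\<^sup>2\<close> and the two
  bounds for \<open>sinh\<close>. They compare the lifted profile \<open>y\<^sup>2\<close> with the
  extremal one: it is never larger, and near \<open>y = 0\<close> the two differ by a factor close
  to 1.\<close>

lemma cosh_profile_bounds:
  fixes y :: real
  shows "y\<^sup>2 \<le> 2 * cosh y - 2" "y\<^sup>2 \<le> (sinh y)\<^sup>2"
    and "\<bar>y\<bar> \<le> \<eta> \<Longrightarrow> 2 * cosh y - 2 \<le> (cosh \<eta>)\<^sup>2 * y\<^sup>2"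
proof -
  define t where "t = \<bar>y\<bar> / 2"
  have t: "t \<ge> 0" by (simp add: t_def)
  have c: "2 * cosh y - 2 = (2 * sinh t)\<^sup>2"
  proof -
    have "cosh y = cosh (2 * t)" by (simp add: t_def)
    also have "\<dots> = (cosh t)\<^sup>2 + (sinh t)\<^sup>2" by (rule cosh_double)
    finally show ?thesis by (simp add: cosh_square_eq power_mult_distrib)
  qed
  have y: "y\<^sup>2 = (2 * t)\<^sup>2" by (simp add: t_def)
  show "y\<^sup>2 \<le> 2 * cosh y - 2" unfolding c y using sinh_bounds(1)[OF t] t by (intro power_mono) auto
  have "\<bar>y\<bar> \<le> sinh \<bar>y\<bar>" by (intro sinh_bounds) auto
  then have "\<bar>y\<bar>\<^sup>2 \<le> (sinh \<bar>y\<bar>)\<^sup>2" by (intro power_mono) auto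
  then show "y\<^sup>2 \<le> (sinh y)\<^sup>2" by (cases "y \<ge> 0") auto
  assume \<eta>: "\<bar>y\<bar> \<le> \<eta>"
  have "2 * sinh t \<le> cosh \<eta> * (2 * t)"
  proof -
    have "cosh t \<le> cosh \<eta>" using \<eta> t by (simp add: t_def cosh_real_nonneg_le_iff)
    then have "t * cosh t \<le> t * cosh \<eta>" using t by (rule mult_left_mono)
    then show ?thesis using sinh_bounds(2)[OF t] by (simp add: mult.commute)
  qed
  then have "(2 * sinh t)\<^sup>2 \<le> (cosh \<eta> * (2 * t))\<^sup>2" using t by (intro power_mono) auto
  then show "2 * cosh y - 2 \<le> (cosh \<eta>)\<^sup>2 * y\<^sup>2" unfolding c y by (simp add: power_mult_distrib)
qed

text \<open>In cylindrical coordinates \<open>z = exp y *\<^sub>R x\<close> the paraboloid \<open>q\<^sup>2 + (norm (z - p *\<^sub>R e))\<^sup>2\<close>, with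
  \<open>q\<^sup>2 = 1 - p\<^sup>2\<close>, becomes \<open>exp y * (bub e p x + 2 * cosh y - 2)\<close>.\<close>

lemma bubble_integrals:
  fixes e :: "'a::euclidean_space"
  assumes N: "DIM('a) \<ge> 3" and e: "norm e = 1" and p: "0 < p" "p < 1"
  defines "I \<equiv> enn2real (Kint TYPE('a) DIM('a))" and "q \<equiv> sqrt (1 - p\<^sup>2)" and "N' \<equiv> real DIM('a)"
  shows "sph_nn (\<lambda>x. \<integral>\<^sup>+y. ennreal (1 / (bub e p x + 2 * cosh y - 2) ^ DIM('a)) \<partial>lborel) = ennreal (q powr (- N') * I)"
    and "sph_nn (\<lambda>x. \<integral>\<^sup>+y. ennreal (((bub e p x + 2 * cosh y - 2)\<^sup>2 + 4 * (sinh y)\<^sup>2 + (norm (dbub e p x))\<^sup>2)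
           / (bub e p x + 2 * cosh y - 2) ^ DIM('a)) \<partial>lborel) = ennreal (4 * N' / (N' - 2) * q powr (2 - N') * I)"
proof -
  have N': "N' \<ge> 3" using N by (simp add: N'_def)
  have p2: "p\<^sup>2 < 1" using p by (simp add: power_less_one_iff)
  have q: "q > 0" "q\<^sup>2 = 1 - p\<^sup>2" using p2 by (auto simp: q_def)
  have KI: "Kint TYPE('a) DIM('a) = ennreal I" using Kint_DIM_finite[where 'a='a] by (simp add: I_def)
  have I: "I > 0" using Kint_pos[where 'a='a, of "DIM('a)"] by (simp add: KI)
  interpret homogeneous_C1 "bub e p" "dbub e p" by (rule homogeneous_C1_bub) (use e p in auto)
  define D where "D x y = bub e p x + 2 * cosh y - 2" for x :: 'a and y
  have Dpos: "D x y > 0" for x y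
  proof -
    have "bub e p x > 0" using bub_lower[OF e, of p x] p by simp
    then show ?thesis using cosh_real_ge_1[of y] by (simp add: D_def)
  qed
  have g: "q\<^sup>2 + (norm (exp y *\<^sub>R x - p *\<^sub>R e))\<^sup>2 = exp y * D x y" if "norm x = 1" for x y
  proof -
    have "x \<bullet> x = 1" "e \<bullet> e = 1" using that e by (simp_all add: power2_norm_eq_inner[symmetric])
    then have "q\<^sup>2 + (norm (exp y *\<^sub>R x - p *\<^sub>R e))\<^sup>2 = 1 + exp y * exp y - 2 * p * exp y * (x \<bullet> e)"
      unfolding q power2_norm_eq_inner
      by (simp add: inner_diff_left inner_diff_right inner_commute power2_eq_square algebra_simps)
    also have "\<dots> = exp y * D x y"
      using that by (simp add: D_def bub_def cosh_def exp_minus field_simps)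
    finally show ?thesis .
  qed
  have exp1: "ennreal (exp y ^ DIM('a)) * ennreal (v / (exp y * G) ^ DIM('a)) = ennreal (v / G ^ DIM('a))" for y v G :: real
    by (simp add: ennreal_mult'[symmetric] power_mult_distrib)
  have Xb: "(\<integral>\<^sup>+z. ennreal (1 / (q\<^sup>2 + (norm (z - p *\<^sub>R e))\<^sup>2) ^ DIM('a)) \<partial>lborel) = ennreal (q powr (- N') * I)"
    using I by (subst nn_integral_paraboloid[OF q(1)]) (simp add: KI N'_def ennreal_mult)
  have "(\<integral>\<^sup>+z. ennreal (1 / (q\<^sup>2 + (norm (z - p *\<^sub>R e))\<^sup>2) ^ DIM('a)) \<partial>lborel)
      = sph_nn (\<lambda>x. \<integral>\<^sup>+y. ennreal (1 / D x y ^ DIM('a)) \<partial>lborel)"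
    by (subst nn_integral_cylinder, measurable) (intro sph_nn_cong, simp only: g exp1)
  then show "sph_nn (\<lambda>x. \<integral>\<^sup>+y. ennreal (1 / (bub e p x + 2 * cosh y - 2) ^ DIM('a)) \<partial>lborel) = ennreal (q powr (- N') * I)"
    by (simp add: D_def Xb)
  \<comment> \<open>The energy of the paraboloid, whose gradient is
    \<open>2 *\<^sub>R (z - p *\<^sub>R e)\<close>.\<close>
  define F where "F = (\<integral>\<^sup>+z. ennreal (4 * (norm (z - p *\<^sub>R e))\<^sup>2 / (q\<^sup>2 + (norm (z - p *\<^sub>R e))\<^sup>2) ^ DIM('a)) \<partial>lborel)"
  have KI': "Kint TYPE('a) (DIM('a) - 1) = ennreal (2 * (N' - 1) / (N' - 2) * I)"
  proof -
    have "ennreal (1 / real (DIM('a) - 1)) * Kint TYPE('a) (DIM('a) - 1)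
       = ennreal (2 / (2 * real (DIM('a) - 1) - real DIM('a))) * Kint TYPE('a) (Suc (DIM('a) - 1))"
      using N by (intro Kint_Suc) auto
    then have "ennreal (N' - 1) * (ennreal (1 / (N' - 1)) * Kint TYPE('a) (DIM('a) - 1))
       = ennreal (N' - 1) * (ennreal (2 / (N' - 2)) * ennreal I)"
      using N by (simp add: KI N'_def of_nat_diff)
    then show ?thesis using N' I by (simp add: mult.assoc[symmetric] ennreal_mult[symmetric])
  qed
  \<comment> \<open>The numerator is four times the paraboloid minus \<open>4 * q\<^sup>2\<close>.
    Adding the second part on the left keeps every term nonnegative and leaves the integral with
    exponent \<open>N - 1\<close>, known from the recursion.\<close>
  have "F + ennreal (4 * q\<^sup>2) * ennreal (q powr (- N') * I) = ennreal 4 * (ennreal (q powr (2 - N')) * ennreal (2 * (N' - 1) / (N' - 2) * I))"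
  proof -
    have "F + ennreal (4 * q\<^sup>2) * ennreal (q powr (- N') * I) = (\<integral>\<^sup>+z. ennreal (4 * (norm (z - p *\<^sub>R e))\<^sup>2 / (q\<^sup>2 + (norm (z - p *\<^sub>R e))\<^sup>2) ^ DIM('a))
        + ennreal (4 * q\<^sup>2) * ennreal (1 / (q\<^sup>2 + (norm (z - p *\<^sub>R e))\<^sup>2) ^ DIM('a)) \<partial>lborel)"
      unfolding F_def Xb[symmetric] by (subst nn_integral_add) (auto simp: nn_integral_cmult)
    also have "\<dots> = (\<integral>\<^sup>+z. ennreal 4 * ennreal (1 / (q\<^sup>2 + (norm (z - p *\<^sub>R e))\<^sup>2) ^ (DIM('a) - 1)) \<partial>lborel)"
    proof (rule nn_integral_cong)
      fix z
      define r s where "r = (norm (z - p *\<^sub>R e))\<^sup>2" and "s = q\<^sup>2 + r"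
      have "r \<ge> 0" by (simp add: r_def)
      moreover have "q\<^sup>2 > 0" using q(1) by (rule zero_less_power)
      ultimately have rs: "r \<ge> 0" "s > 0" unfolding s_def by linarith+
      have "s ^ DIM('a) = s * s ^ (DIM('a) - 1)" using N by (simp add: power_eq_if)
      then have "s / s ^ DIM('a) = 1 / s ^ (DIM('a) - 1)" using rs by simp
      moreover have "4 * r / S + 4 * q\<^sup>2 * (1 / S) = 4 * (s / S)" for S
        unfolding s_def by (simp add: add_divide_distrib)
      ultimately have "4 * r / s ^ DIM('a) + 4 * q\<^sup>2 * (1 / s ^ DIM('a)) = 4 * (1 / s ^ (DIM('a) - 1))"
        by simp
      then show "ennreal (4 * (norm (z - p *\<^sub>R e))\<^sup>2 / (q\<^sup>2 + (norm (z - p *\<^sub>R e))\<^sup>2) ^ DIM('a))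
        + ennreal (4 * q\<^sup>2) * ennreal (1 / (q\<^sup>2 + (norm (z - p *\<^sub>R e))\<^sup>2) ^ DIM('a))
        = ennreal 4 * ennreal (1 / (q\<^sup>2 + (norm (z - p *\<^sub>R e))\<^sup>2) ^ (DIM('a) - 1))"
      proof -
        have lin: "ennreal u + ennreal c * ennreal v = ennreal k * ennreal w"
          if "u + c * v = k * w" "u \<ge> 0" "c \<ge> 0" "v \<ge> 0" "k \<ge> 0" "w \<ge> 0" for u c v k w :: real
          using that by (metis ennreal_mult ennreal_plus mult_nonneg_nonneg)
        show ?thesis unfolding r_def[symmetric] s_def[symmetric]
          by (rule lin) (fact, use rs in auto)
      qed
    qed
    also have "\<dots> = ennreal 4 * (ennreal (q powr (real DIM('a) - 2 * real (DIM('a) - 1))) * Kint TYPE('a) (DIM('a) - 1))"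
      by (subst nn_integral_cmult) (auto simp: nn_integral_paraboloid[OF q(1)])
    also have "real DIM('a) - 2 * real (DIM('a) - 1) = 2 - N'" using N by (simp add: N'_def of_nat_diff)
    finally show ?thesis unfolding KI' .
  qed
  then have "F + ennreal (4 * q powr (2 - N') * I) = ennreal (4 * q powr (2 - N') * (2 * (N' - 1) / (N' - 2)) * I)"
  proof -
    have "q\<^sup>2 * q powr (- N') = q powr (2 - N')"
      using q(1) by (simp add: powr_diff powr_minus_divide)
    moreover have "ennreal (4 * q\<^sup>2) * ennreal (q powr (- N') * I) = ennreal (4 * (q\<^sup>2 * q powr (- N')) * I)"
      using I by (simp add: ennreal_mult'[symmetric] mult.assoc)
    moreover have "ennreal 4 * (ennreal (q powr (2 - N')) * ennreal (2 * (N' - 1) / (N' - 2) * I))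
       = ennreal (4 * (q powr (2 - N') * (2 * (N' - 1) / (N' - 2) * I)))"
      using I N' by (subst ennreal_mult, simp, simp, subst ennreal_mult) auto
    ultimately show ?thesis using \<open>F + _ = _\<close> by (simp add: mult.assoc)
  qed
  moreover have "4 * q powr (2 - N') * (2 * (N' - 1) / (N' - 2)) * I = 4 * N' / (N' - 2) * q powr (2 - N') * I + 4 * q powr (2 - N') * I"
    using N' by (simp add: field_simps)
  ultimately have "ennreal (4 * q powr (2 - N') * I) + F = ennreal (4 * q powr (2 - N') * I) + ennreal (4 * N' / (N' - 2) * q powr (2 - N') * I)"
    using N' I by (simp add: add.commute ennreal_plus)
  then have Feq: "F = ennreal (4 * N' / (N' - 2) * q powr (2 - N') * I)"
    by (subst (asm) ennreal_add_left_cancel) auto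
  have sq: "exp y * D x y - q\<^sup>2 = (norm (exp y *\<^sub>R x - p *\<^sub>R e))\<^sup>2" if "norm x = 1" for x y
    using g[OF that, of y] by simp
  have fr: "4 * (norm (exp y *\<^sub>R x - p *\<^sub>R e))\<^sup>2 / (q\<^sup>2 + (norm (exp y *\<^sub>R x - p *\<^sub>R e))\<^sup>2) ^ DIM('a)
     = 4 * (exp y * D x y - q\<^sup>2) / (exp y * D x y) ^ DIM('a)" if "norm x = 1" for x y
    by (simp only: g[OF that] sq[OF that])
  have "F = sph_nn (\<lambda>x. \<integral>\<^sup>+y. ennreal (4 * (exp y * D x y - q\<^sup>2) / D x y ^ DIM('a)) \<partial>lborel)"
    unfolding F_def by (subst nn_integral_cylinder, measurable) (intro sph_nn_cong, simp only: fr exp1)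
  also have "\<dots> = sph_nn (\<lambda>x. \<integral>\<^sup>+y. ennreal (((D x y)\<^sup>2 + 4 * (sinh y)\<^sup>2 + (norm (dbub e p x))\<^sup>2) / D x y ^ DIM('a)) \<partial>lborel)"
  proof (rule sph_nn_cong)
    fix x :: 'a assume x: "norm x = 1"
    define f where "f y = ennreal (4 * (exp y * D x y - q\<^sup>2) / D x y ^ DIM('a))" for y
    have [measurable]: "D x \<in> borel_measurable borel" unfolding D_def cosh_def by measurable
    have [measurable]: "f \<in> borel_measurable borel" unfolding f_def by measurable
    have "ennreal (((D x y)\<^sup>2 + 4 * (sinh y)\<^sup>2 + (norm (dbub e p x))\<^sup>2) / D x y ^ DIM('a))
        = ennreal (1/2) * f y + ennreal (1/2) * f (- y)" for y
    proof -
      define s where "s = D x y ^ DIM('a)"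
      have s: "s > 0" using Dpos by (simp add: s_def)
      have ev: "D x (- y) = D x y" by (simp add: D_def)
      define P Q where "P = 4 * (exp y * D x y - q\<^sup>2) / s" and "Q = 4 * (exp (- y) * D x y - q\<^sup>2) / s"
      have PQ: "P \<ge> 0" "Q \<ge> 0"
        using sq[OF x, of y] sq[OF x, of "- y"] s by (auto simp: P_def Q_def ev)
      have lin: "ennreal (c * P + c * Q) = ennreal c * ennreal P + ennreal c * ennreal Q"
        if "c \<ge> 0" for c :: real using that PQ by (simp add: ennreal_mult)
      define c where "c = x \<bullet> e"
      have Dc: "D x y = 2 * cosh y - 2 * p * c" using x by (simp add: D_def bub_def c_def)
      have "(D x y)\<^sup>2 + 4 * (sinh y)\<^sup>2 + (norm (dbub e p x))\<^sup>2 = (D x y)\<^sup>2 + 4 * ((cosh y)\<^sup>2 - 1) + 4 * p\<^sup>2 * (1 - c\<^sup>2)"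
        using dbub_sphere[OF e x] by (simp add: c_def sinh_square_eq)
      \<comment> \<open>With \<open>D = 2 * cosh y - 2 * p * c\<close> the terms in
        \<open>p\<^sup>2 * c\<^sup>2\<close> cancel; what remains is a multiple of \<open>D\<close>
        and the constant \<open>4 * p\<^sup>2 - 4 = - 4 * q\<^sup>2\<close>. The next step writes
        \<open>cosh y\<close> as the average of \<open>exp y\<close> and \<open>exp (- y)\<close>,
        which matches the symmetrised integrand.\<close>
      also have "\<dots> = 4 * cosh y * D x y - 4 * q\<^sup>2"
        unfolding Dc q by (simp add: power2_eq_square algebra_simps)
      also have "\<dots> = 1/2 * (4 * (exp y * D x y - q\<^sup>2)) + 1/2 * (4 * (exp (- y) * D x y - q\<^sup>2))"
        by (simp add: cosh_def algebra_simps)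
      finally have "((D x y)\<^sup>2 + 4 * (sinh y)\<^sup>2 + (norm (dbub e p x))\<^sup>2) / s = 1/2 * P + 1/2 * Q"
        unfolding P_def Q_def by (simp only: add_divide_distrib times_divide_eq_right)
      then show ?thesis using lin[of "1/2"] unfolding f_def ev s_def[symmetric] P_def[symmetric] Q_def[symmetric] by simp
    qed
    then have "(\<integral>\<^sup>+y. ennreal (((D x y)\<^sup>2 + 4 * (sinh y)\<^sup>2 + (norm (dbub e p x))\<^sup>2) / D x y ^ DIM('a)) \<partial>lborel)
      = ennreal (1/2) * (\<integral>\<^sup>+y. f y \<partial>lborel) + ennreal (1/2) * (\<integral>\<^sup>+y. f (- y) \<partial>lborel)"
      by (simp only:) (subst nn_integral_add, measurable, simp add: nn_integral_cmult)
    also have "\<dots> = (ennreal (1/2) + ennreal (1/2)) * (\<integral>\<^sup>+y. f y \<partial>lborel)"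
      by (simp only: distrib_right) (simp add: nn_integral_even)
    also have "ennreal (1/2) + ennreal (1/2) = ennreal (1/2 + 1/2)" by (rule ennreal_plus[symmetric]) auto
    finally show "(\<integral>\<^sup>+y. ennreal (4 * (exp y * D x y - q\<^sup>2) / D x y ^ DIM('a)) \<partial>lborel)
      = (\<integral>\<^sup>+y. ennreal (((D x y)\<^sup>2 + 4 * (sinh y)\<^sup>2 + (norm (dbub e p x))\<^sup>2) / D x y ^ DIM('a)) \<partial>lborel)"
      by (simp add: f_def)
  qed
  finally show "sph_nn (\<lambda>x. \<integral>\<^sup>+y. ennreal (((bub e p x + 2 * cosh y - 2)\<^sup>2 + 4 * (sinh y)\<^sup>2 + (norm (dbub e p x))\<^sup>2)
           / (bub e p x + 2 * cosh y - 2) ^ DIM('a)) \<partial>lborel) = ennreal (4 * N' / (N' - 2) * q powr (2 - N') * I)"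
    using Feq by (simp add: D_def)
qed

text \<open>Away from \<open>y = 0\<close> the lifted bubble has an energy density below an
  integrable function independent of \<open>p\<close>, so this region contributes a bounded amount
  however strong the concentration is. The exponent \<open>n + 4\<close> stands for the
  dimension.\<close>

lemma cylinder_tail_bound:
  fixes d y \<Psi> \<eta> :: real
  assumes \<eta>: "0 < \<eta>" "\<eta> < \<bar>y\<bar>" and d: "y\<^sup>2 \<le> d" and \<Psi>: "\<Psi> \<le> 4"
  shows "(d\<^sup>2 + 4 * y\<^sup>2 + \<Psi>) / d ^ (n + 4)
    \<le> (1 + 4 / \<eta>\<^sup>2 + 4 / (\<eta>\<^sup>2)\<^sup>2) / (\<eta>\<^sup>2) ^ (n + 1) * (1 + 1 / \<eta>\<^sup>2) * (1 / (1 + y\<^sup>2))"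
proof -
  define r where "r = \<eta>\<^sup>2"
  have r: "r > 0" using \<eta> by (simp add: r_def)
  have ry: "r \<le> y\<^sup>2" unfolding r_def using \<eta> by (intro abs_le_square_iff[THEN iffD1]) auto
  have y: "y\<^sup>2 > 0" using ry r by linarith
  have rd: "r \<le> d" "d > 0" using ry d r by linarith+
  define A where "A = 1 + 4 / r + 4 / r\<^sup>2"
  have A: "A > 0" using r by (simp add: A_def add_pos_pos)
  have "1 * d \<le> d / r * d" using rd r by (intro mult_right_mono) auto
  then have a1: "4 * d \<le> 4 / r * d\<^sup>2" by (simp add: power2_eq_square)
  have "r\<^sup>2 \<le> d\<^sup>2" using rd r by (intro power_mono) auto
  then have a2: "4 \<le> 4 / r\<^sup>2 * d\<^sup>2" using r by (simp add: field_simps)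
  have "d\<^sup>2 + 4 * y\<^sup>2 + \<Psi> \<le> d\<^sup>2 + 4 / r * d\<^sup>2 + 4 / r\<^sup>2 * d\<^sup>2" using a1 a2 d \<Psi> by linarith
  also have "\<dots> = A * d\<^sup>2" by (simp add: A_def distrib_right)
  finally have "(d\<^sup>2 + 4 * y\<^sup>2 + \<Psi>) / d ^ (n + 4) \<le> A * d\<^sup>2 / d ^ (n + 4)" using rd by (intro divide_right_mono) auto
  also have "\<dots> = A / (d ^ (n + 1) * d)" using rd by (simp add: power_add power2_eq_square numeral_eq_Suc)
  also have "\<dots> \<le> A / (r ^ (n + 1) * y\<^sup>2)"
    using rd r A y d by (intro divide_left_mono mult_mono power_mono mult_pos_pos) auto
  also have "\<dots> = A / r ^ (n + 1) * (1 / y\<^sup>2)" by simp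
  also have "\<dots> \<le> A / r ^ (n + 1) * ((1 + 1 / r) * (1 / (1 + y\<^sup>2)))"
  proof (intro mult_left_mono)
    have "1 \<le> y\<^sup>2 / r" using ry r by simp
    then have "1 + y\<^sup>2 \<le> y\<^sup>2 * (1 + 1 / r)" by (simp add: distrib_left)
    then show "1 / y\<^sup>2 \<le> (1 + 1 / r) * (1 / (1 + y\<^sup>2))" 
      using y by (simp add: pos_le_divide_eq pos_divide_le_eq mult.commute add_pos_pos)
  qed (use A r in auto)
  finally show ?thesis by (simp add: A_def r_def mult.assoc)
qed

text \<open>For \<open>\<bar>y\<bar> \<le> \<eta>\<close> the density is at most
  \<open>(cosh \<eta>) ^ (2 * N)\<close> times that of the exact bubble, a factor close to 1; for
  larger \<open>\<bar>y\<bar>\<close> the energy is bounded by a constant \<open>C1\<close>. As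
  \<open>p\<close> tends to 1 the energy of the exact bubble grows like
  \<open>q powr (2 - N)\<close> with \<open>q = sqrt (1 - p\<^sup>2)\<close>, and \<open>C1\<close>
  becomes negligible.\<close>

theorem bubble_concentration:
  fixes e :: "'a::euclidean_space"
  assumes N: "DIM('a) \<ge> 4" and e: "norm e = 1" and \<epsilon>: "\<epsilon> > 0"
  shows "\<exists>p. 0 < p \<and> p < 1 \<and> (\<forall>E X. E \<ge> 0 \<longrightarrow> X \<ge> 0 \<longrightarrow>
      sph_nn (\<lambda>x. \<integral>\<^sup>+y. ennreal (((bub e p x + y\<^sup>2)\<^sup>2 + 4 * y\<^sup>2 + (norm (dbub e p x))\<^sup>2) / (bub e p x + y\<^sup>2) ^ DIM('a)) \<partial>lborel) = ennreal E \<longrightarrow>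
      sph_nn (\<lambda>x. \<integral>\<^sup>+y. ennreal (1 / (bub e p x + y\<^sup>2) ^ DIM('a)) \<partial>lborel) = ennreal X \<longrightarrow>
      E \<le> (sobolev_const TYPE('a) + \<epsilon>) * X powr ((real DIM('a) - 2) / real DIM('a)))"
proof -
  define S where "S = sobolev_const TYPE('a)"
  have S: "S > 0" unfolding S_def by (rule sobolev_const_pos) (use N in simp)
  define N' where "N' = real DIM('a)"
  have N': "N' \<ge> 4" using N by (simp add: N'_def)
  define \<theta> where "\<theta> = (N' - 2) / N'"
  have \<theta>: "\<theta> > 0" "\<theta> = 1 - 2 / N'" using N' by (simp_all add: \<theta>_def diff_divide_distrib)
  define I where "I = enn2real (Kint TYPE('a) DIM('a))"
  have KI: "Kint TYPE('a) DIM('a) = ennreal I" using Kint_DIM_finite[where 'a='a] by (simp add: I_def)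
  have I: "I > 0" using Kint_pos[where 'a='a, of "DIM('a)"] by (simp add: KI)
  obtain n where n: "DIM('a) = n + 4" using N that[of "DIM('a) - 4"] by simp
  have "((\<lambda>\<eta>. S * ((cosh \<eta>)\<^sup>2) ^ DIM('a)) \<longlongrightarrow> S * ((cosh 0)\<^sup>2) ^ DIM('a)) (at_right (0::real))"
    by (intro tendsto_intros)
  then have "\<forall>\<^sub>F \<eta> in at_right (0::real). S * ((cosh \<eta>)\<^sup>2) ^ DIM('a) < S + \<epsilon> / 2"
    by (rule order_tendstoD) (use \<epsilon> in simp)
  then have "\<forall>\<^sub>F \<eta> in at_right (0::real). S * ((cosh \<eta>)\<^sup>2) ^ DIM('a) < S + \<epsilon> / 2 \<and> 0 < \<eta>"
    using eventually_at_right_less[of 0] by (rule eventually_conj)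
  then obtain \<eta> :: real where \<eta>: "\<eta> > 0" "S * ((cosh \<eta>)\<^sup>2) ^ DIM('a) < S + \<epsilon> / 2"
    using eventually_happens'[OF trivial_limit_at_right_real] by blast
  define c where "c = (1 + 4 / \<eta>\<^sup>2 + 4 / (\<eta>\<^sup>2)\<^sup>2) / (\<eta>\<^sup>2) ^ (n + 1) * (1 + 1 / \<eta>\<^sup>2)"
  have c: "c \<ge> 0" by (simp add: c_def)
  have "ennreal c * Kint TYPE(real) 1 < top" using Kint_finite[where 'a=real, of 1] by (simp add: ennreal_mult_less_top)
  then obtain C0 where C0: "ennreal c * Kint TYPE(real) 1 = ennreal C0" "C0 \<ge> 0" by (metis ennreal_cases less_irrefl)
  obtain C1 where C1: "sph_nn (\<lambda>_::'a. ennreal C0) = ennreal C1" "C1 \<ge> 0"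
    using sph_nn_const_finite[where 'a='a, of C0] by (metis ennreal_cases less_irrefl)
  \<comment> \<open>The aim is \<open>C1 \<le> \<epsilon> / 2 * Xb powr \<theta>\<close>, where
    \<open>Xb powr \<theta> = q powr (2 - N') * I powr \<theta>\<close>. As
    \<open>q powr (2 - N') \<ge> 1 / q\<close>, it is enough that \<open>R \<le> 1 / q\<close>;
    taking \<open>1 / q = R + 2\<close> also keeps \<open>q\<close> below 1.\<close>
  define R where "R = C1 / (\<epsilon> / 2 * I powr \<theta>)"
  have R: "R \<ge> 0" using C1 \<epsilon> by (simp add: R_def)
  define q where "q = 1 / (R + 2)"
  have q: "0 < q" "q < 1" using R by (auto simp: q_def)
  define p where "p = sqrt (1 - q\<^sup>2)"
  have q2: "0 < q\<^sup>2" "q\<^sup>2 < 1" using q by (auto simp: power_less_one_iff)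
  have p: "0 < p" "p < 1" using q2 by (auto simp: p_def)
  have qp: "sqrt (1 - p\<^sup>2) = q" using q2 q by (simp add: p_def)
  interpret homogeneous_C1 "bub e p" "dbub e p" by (rule homogeneous_C1_bub) (use e p in auto)
  note bi = bubble_integrals[OF _ e p, folded qp[symmetric], unfolded qp, folded N'_def I_def]
  have N3: "DIM('a) \<ge> 3" using N by simp
  define Xb where "Xb = q powr (- N') * I"
  have Xb0: "Xb > 0" using q I by (simp add: Xb_def)
  have Xb\<theta>: "Xb powr \<theta> = q powr (2 - N') * I powr \<theta>"
  proof -
    have "- N' * \<theta> = 2 - N'" using N' by (simp add: \<theta>_def)
    then show ?thesis using q I by (simp add: Xb_def powr_mult powr_powr)
  qed
  \<comment> \<open>The exact bubble attains equality in the Sobolev inequality.\<close>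
  have Eb: "4 * N' / (N' - 2) * q powr (2 - N') * I = S * Xb powr \<theta>"
  proof -
    have "I = I powr (2 / N') * I powr \<theta>" using I by (simp add: powr_add[symmetric] \<theta>(2))
    then show ?thesis unfolding Xb\<theta> S_def sobolev_const_def N'_def[symmetric] I_def[symmetric] by (simp add: mult_ac)
  qed
  have C1le: "C1 \<le> \<epsilon> / 2 * Xb powr \<theta>"
  proof -
    have "R \<le> 1 / q" using R by (simp add: q_def)
    also have "1 / q = q powr (- 1)" using q by (simp add: powr_minus_divide)
    also have "\<dots> \<le> q powr (2 - N')" using q N' by (intro powr_mono') auto
    finally have "\<epsilon> / 2 * I powr \<theta> * R \<le> \<epsilon> / 2 * I powr \<theta> * q powr (2 - N')" using \<epsilon> by (intro mult_left_mono) auto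
    then show ?thesis using \<epsilon> I by (simp add: R_def Xb\<theta> mult_ac)
  qed
  have Dpos: "bub e p x + y\<^sup>2 > 0" for x y
    using bub_lower[OF e, of p x] p by (simp add: add_pos_nonneg)
  have dD: "bub e p x + y\<^sup>2 \<le> bub e p x + 2 * cosh y - 2" for x y
    using cosh_profile_bounds(1)[of y] by simp
  have [measurable]: "(\<lambda>x::real. cosh x) \<in> borel_measurable borel" "(\<lambda>x::real. sinh x) \<in> borel_measurable borel"
    unfolding cosh_def sinh_def by measurable
  show ?thesis
  proof (intro exI[of _ p] conjI allI impI p)
    fix E X :: real
    assume EX: "E \<ge> 0" "X \<ge> 0"
      and E: "sph_nn (\<lambda>x. \<integral>\<^sup>+y. ennreal (((bub e p x + y\<^sup>2)\<^sup>2 + 4 * y\<^sup>2 + (norm (dbub e p x))\<^sup>2) / (bub e p x + y\<^sup>2) ^ DIM('a)) \<partial>lborel) = ennreal E"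
      and X: "sph_nn (\<lambda>x. \<integral>\<^sup>+y. ennreal (1 / (bub e p x + y\<^sup>2) ^ DIM('a)) \<partial>lborel) = ennreal X"
    \<comment> \<open>Since \<open>y\<^sup>2 \<le> 2 * cosh y - 2\<close>, passing to the lifted
      profile only increases the mass, so the mass of the exact bubble may be used in the
      bound.\<close>
    have "ennreal Xb \<le> ennreal X"
      unfolding X[symmetric] Xb_def bi(1)[OF N3, symmetric]
    proof (intro sph_nn_mono nn_integral_mono ennreal_leI)
      fix x y
      have "(bub e p x + y\<^sup>2) ^ DIM('a) \<le> (bub e p x + 2 * cosh y - 2) ^ DIM('a)"
        using dD Dpos by (intro power_mono) (auto simp: less_imp_le)
      moreover have "(bub e p x + y\<^sup>2) ^ DIM('a) > 0" using Dpos by (rule zero_less_power)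
      ultimately show "1 / (bub e p x + 2 * cosh y - 2) ^ DIM('a) \<le> 1 / (bub e p x + y\<^sup>2) ^ DIM('a)"
        by (intro divide_left_mono) auto
    qed
    then have XbX: "Xb \<le> X" using EX by (simp add: ennreal_le_iff)
    define k where "k = ((cosh \<eta>)\<^sup>2) ^ DIM('a)"
    have k: "k \<ge> 0" by (simp add: k_def)
    let ?f = "\<lambda>x y. ((bub e p x + 2 * cosh y - 2)\<^sup>2 + 4 * (sinh y)\<^sup>2 + (norm (dbub e p x))\<^sup>2) / (bub e p x + 2 * cosh y - 2) ^ DIM('a)"
    have "ennreal E \<le> sph_nn (\<lambda>x. ennreal k * (\<integral>\<^sup>+y. ennreal (?f x y) \<partial>lborel) + ennreal C0)"
      unfolding E[symmetric]
    proof (rule sph_nn_mono)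
      fix x :: 'a assume x: "norm x = 1"
      have \<Psi>: "(norm (dbub e p x))\<^sup>2 \<le> 4"
      proof -
        have "p\<^sup>2 * (1 - (x \<bullet> e)\<^sup>2) \<le> p\<^sup>2 * 1" by (intro mult_left_mono) auto
        moreover have "p\<^sup>2 \<le> 1" using p by (simp add: power_le_one)
        ultimately show ?thesis using dbub_sphere[OF e x, of p] by simp
      qed
      have "(\<integral>\<^sup>+y. ennreal (((bub e p x + y\<^sup>2)\<^sup>2 + 4 * y\<^sup>2 + (norm (dbub e p x))\<^sup>2) / (bub e p x + y\<^sup>2) ^ DIM('a)) \<partial>lborel)
         \<le> (\<integral>\<^sup>+y. ennreal k * ennreal (?f x y) + ennreal c * ennreal (1 / (1 + (norm y)\<^sup>2) ^ 1) \<partial>lborel)"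
      proof (rule nn_integral_mono)
        fix y :: real
        define d D where "d = bub e p x + y\<^sup>2" and "D = bub e p x + 2 * cosh y - 2"
        have dD': "0 < d" "d \<le> D" using Dpos dD by (auto simp: d_def D_def)
        have f0: "?f x y \<ge> 0" using dD' by (auto simp: D_def intro!: divide_nonneg_nonneg)
        have "(d\<^sup>2 + 4 * y\<^sup>2 + (norm (dbub e p x))\<^sup>2) / d ^ DIM('a) \<le> k * ?f x y + c * (1 / (1 + (norm y)\<^sup>2) ^ 1)"
        proof (cases "\<bar>y\<bar> \<le> \<eta>")
          case True
          have "1 \<le> (cosh \<eta>)\<^sup>2" using cosh_real_ge_1[of \<eta>] by (rule one_le_power)
          then have "bub e p x \<le> (cosh \<eta>)\<^sup>2 * bub e p x"
            using Dpos[of x 0] by (simp add: mult_le_cancel_right1)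
          then have "D \<le> (cosh \<eta>)\<^sup>2 * d" using cosh_profile_bounds(3)[OF True] by (simp add: D_def d_def distrib_left)
          then have "D ^ DIM('a) \<le> ((cosh \<eta>)\<^sup>2 * d) ^ DIM('a)" using dD' by (intro power_mono) auto
          then have Dk: "D ^ DIM('a) \<le> k * d ^ DIM('a)" by (simp add: k_def power_mult_distrib)
          have num: "d\<^sup>2 + 4 * y\<^sup>2 + (norm (dbub e p x))\<^sup>2 \<le> D\<^sup>2 + 4 * (sinh y)\<^sup>2 + (norm (dbub e p x))\<^sup>2"
            using dD' cosh_profile_bounds(2)[of y] by (intro add_mono power_mono) auto
          have "1 / d ^ DIM('a) \<le> k * (1 / D ^ DIM('a))" using Dk dD' by (simp add: field_simps)
          then have "(d\<^sup>2 + 4 * y\<^sup>2 + (norm (dbub e p x))\<^sup>2) * (1 / d ^ DIM('a))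
            \<le> (D\<^sup>2 + 4 * (sinh y)\<^sup>2 + (norm (dbub e p x))\<^sup>2) * (k * (1 / D ^ DIM('a)))"
            using num dD' by (intro mult_mono) auto
          then have "(d\<^sup>2 + 4 * y\<^sup>2 + (norm (dbub e p x))\<^sup>2) / d ^ DIM('a) \<le> k * ?f x y" by (simp add: D_def mult_ac)
          then show ?thesis using c by (simp add: add_increasing2)
        next
          case False
          have "y\<^sup>2 \<le> d" using Dpos[of x 0] by (simp add: d_def)
          then have "(d\<^sup>2 + 4 * y\<^sup>2 + (norm (dbub e p x))\<^sup>2) / d ^ DIM('a) \<le> c * (1 / (1 + y\<^sup>2))"
            unfolding n c_def using \<eta> False \<Psi> by (intro cylinder_tail_bound) auto
          moreover have "k * ?f x y \<ge> 0" using k f0 by (rule mult_nonneg_nonneg)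
          ultimately show ?thesis by simp
        qed
        then have "ennreal ((d\<^sup>2 + 4 * y\<^sup>2 + (norm (dbub e p x))\<^sup>2) / d ^ DIM('a)) \<le> ennreal (k * ?f x y + c * (1 / (1 + (norm y)\<^sup>2) ^ 1))"
          by (rule ennreal_leI)
        also have "\<dots> = ennreal k * ennreal (?f x y) + ennreal c * ennreal (1 / (1 + (norm y)\<^sup>2) ^ 1)"
        proof -
          have lin: "ennreal (k * u + c * v) = ennreal k * ennreal u + ennreal c * ennreal v"
            if "u \<ge> 0" "v \<ge> 0" for u v using that k c by (simp add: ennreal_mult)
          show ?thesis using f0 by (intro lin) auto
        qed
        finally show "ennreal (((bub e p x + y\<^sup>2)\<^sup>2 + 4 * y\<^sup>2 + (norm (dbub e p x))\<^sup>2) / (bub e p x + y\<^sup>2) ^ DIM('a))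
          \<le> ennreal k * ennreal (?f x y) + ennreal c * ennreal (1 / (1 + (norm y)\<^sup>2) ^ 1)"
          by (simp add: d_def)
      qed
      also have "\<dots> = ennreal k * (\<integral>\<^sup>+y. ennreal (?f x y) \<partial>lborel) + ennreal c * Kint TYPE(real) 1"
        unfolding Kint_def by (subst nn_integral_add) (auto simp: nn_integral_cmult)
      finally show "(\<integral>\<^sup>+y. ennreal (((bub e p x + y\<^sup>2)\<^sup>2 + 4 * y\<^sup>2 + (norm (dbub e p x))\<^sup>2) / (bub e p x + y\<^sup>2) ^ DIM('a)) \<partial>lborel)
         \<le> ennreal k * (\<integral>\<^sup>+y. ennreal (?f x y) \<partial>lborel) + ennreal C0" unfolding C0(1) .
    qed
    also have "\<dots> = ennreal k * sph_nn (\<lambda>x. \<integral>\<^sup>+y. ennreal (?f x y) \<partial>lborel) + ennreal C1"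
      by (subst sph_nn_add) (auto simp: sph_nn_cmult C1)
    also have "\<dots> = ennreal k * ennreal (S * Xb powr \<theta>) + ennreal C1"
      by (simp only: bi(2)[OF N3] Eb)
    also have "\<dots> = ennreal (k * (S * Xb powr \<theta>) + C1)" using k S C1 by (simp add: ennreal_mult)
    finally have "E \<le> k * (S * Xb powr \<theta>) + C1" using k S C1 by (subst (asm) ennreal_le_iff) auto
    also have "\<dots> \<le> (S + \<epsilon> / 2) * Xb powr \<theta> + \<epsilon> / 2 * Xb powr \<theta>"
    proof (intro add_mono C1le)
      have "S * k * Xb powr \<theta> \<le> (S + \<epsilon> / 2) * Xb powr \<theta>" using \<eta>(2) by (intro mult_right_mono) (auto simp: k_def)
      then show "k * (S * Xb powr \<theta>) \<le> (S + \<epsilon> / 2) * Xb powr \<theta>" by (simp add: mult_ac)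
    qed
    also have "\<dots> = (S + \<epsilon>) * Xb powr \<theta>" by (simp add: algebra_simps)
    also have "\<dots> \<le> (S + \<epsilon>) * X powr \<theta>"
      using XbX Xb0 \<theta> S \<epsilon> by (intro mult_left_mono powr_mono2) auto
    finally show "E \<le> (sobolev_const TYPE('a) + \<epsilon>) * X powr ((real DIM('a) - 2) / real DIM('a))"
      by (simp add: S_def \<theta>_def N'_def)
  qed
qed

section \<open>Dirichlet energy of homogeneous functions\<close>

lemma sph_int_cong:
  fixes f g :: "'a::euclidean_space \<Rightarrow> real"
  assumes g: "g \<in> borel_measurable borel" and eq: "\<And>x. norm x = 1 \<Longrightarrow> f x = g x"
  shows "sph_int f = sph_int g"
proof -
  let ?F = "\<lambda>f z. indicator (ball 0 1) z *\<^sub>R (f (z /\<^sub>R norm z) :: real)"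
  have "(\<lambda>z. z /\<^sub>R norm z) \<in> borel_measurable (borel :: 'a measure)" by measurable
  from measurable_compose[OF this g] have "(\<lambda>z. g (z /\<^sub>R norm z)) \<in> borel_measurable borel" .
  moreover have "indicat_real (ball (0::'a) 1) \<in> borel_measurable (borel :: 'a measure)" by (rule borel_measurable_indicator) auto
  ultimately have G: "?F g \<in> borel_measurable lborel" by (simp add: borel_measurable_scaleR)
  \<comment> \<open>The integrands can differ only at the origin, where
    \<open>z /\<^sub>R norm z\<close> is \<open>0\<close> and not a unit vector.\<close>
  have F: "?F f \<in> borel_measurable lborel"
    by (rule measurable_discrete_difference[OF G, of "{0}"]) (auto simp: eq)
  have "integral\<^sup>L lborel (?F f) = integral\<^sup>L lborel (?F g)"
  proof (rule integral_cong_AE[OF F G])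
    have "AE z in lborel. z \<noteq> (0::'a)" by (rule AE_lborel_singleton)
    then show "AE z in lborel. ?F f z = ?F g z" by eventually_elim (simp add: eq)
  qed
  then show ?thesis by (simp add: sph_int_def set_lebesgue_integral_def)
qed

text \<open>The bounds on the sphere make the integral finite; otherwise the Bochner integral would
  be 0 by convention and not the true value.\<close>

lemma sph_nn_sph_int:
  fixes f :: "'a::euclidean_space \<Rightarrow> real"
  assumes f [measurable]: "f \<in> borel_measurable borel" and bd: "\<And>x. norm x = 1 \<Longrightarrow> 0 \<le> f x" "\<And>x. norm x = 1 \<Longrightarrow> f x \<le> b"
  shows "sph_nn (\<lambda>x. ennreal (f x)) = ennreal (sph_int f)" "sph_int f \<ge> 0"
proof -
  let ?F = "\<lambda>z. indicator (ball 0 1) z *\<^sub>R f (z /\<^sub>R norm z)"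
  have "(\<lambda>z. z /\<^sub>R norm z) \<in> borel_measurable (borel :: 'a measure)" by measurable
  from measurable_compose[OF this f] have "(\<lambda>z. f (z /\<^sub>R norm z)) \<in> borel_measurable borel" .
  moreover have "indicat_real (ball (0::'a) 1) \<in> borel_measurable (borel :: 'a measure)" by (rule borel_measurable_indicator) auto
  ultimately have F: "?F \<in> borel_measurable lborel" by (simp add: borel_measurable_scaleR)
  have ae: "AE z in lborel. z \<noteq> (0::'a)" by (rule AE_lborel_singleton)
  have nn: "AE z in lborel. 0 \<le> ?F z" using ae by eventually_elim (simp add: bd)
  have eq: "(\<integral>\<^sup>+z. ennreal (f (z /\<^sub>R norm z)) * indicator (ball 0 1) z \<partial>lborel) = (\<integral>\<^sup>+z. ennreal (?F z) \<partial>lborel)"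
    by (intro nn_integral_cong) (auto simp: indicator_def)
  have fin: "sph_nn (\<lambda>x. ennreal (f x)) < top"
    by (rule le_less_trans[OF sph_nn_mono sph_nn_const_finite[of b]]) (auto intro: ennreal_leI bd)
  have int: "integral\<^sup>L lborel ?F = enn2real (\<integral>\<^sup>+z. ennreal (?F z) \<partial>lborel)"
    by (rule integral_eq_nn_integral[OF F nn])
  have "(\<integral>\<^sup>+z. ennreal (?F z) \<partial>lborel) < top"
  proof -
    have "ennreal (real DIM('a)) * (\<integral>\<^sup>+z. ennreal (?F z) \<partial>lborel) < top"
      using fin by (simp only: sph_nn_def eq)
    moreover have "ennreal (real DIM('a)) \<noteq> 0" by simp
    ultimately show ?thesis unfolding ennreal_mult_less_top by force
  qed
  then have "ennreal (integral\<^sup>L lborel ?F) = (\<integral>\<^sup>+z. ennreal (?F z) \<partial>lborel)" unfolding int by simp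
  moreover have "integral\<^sup>L lborel ?F \<ge> 0" unfolding int by simp
  ultimately show "sph_nn (\<lambda>x. ennreal (f x)) = ennreal (sph_int f)" "sph_int f \<ge> 0"
    by (simp_all add: sph_nn_def eq sph_int_def set_lebesgue_integral_def ennreal_mult)
qed

lemma sph_int_pos:
  fixes f :: "'a::euclidean_space \<Rightarrow> real"
  assumes f: "f \<in> borel_measurable borel" and c: "c > 0" "\<And>x. norm x = 1 \<Longrightarrow> c \<le> f x" "\<And>x. norm x = 1 \<Longrightarrow> f x \<le> b"
  shows "sph_int f > 0"
proof -
  have f0: "0 \<le> f x" if "norm x = 1" for x using c that by force
  have "0 < sph_nn (\<lambda>_::'a. ennreal c)" by (rule sph_nn_const_pos[OF c(1)])
  also have "\<dots> \<le> sph_nn (\<lambda>x. ennreal (f x))" by (intro sph_nn_mono ennreal_leI c)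
  also have "\<dots> = ennreal (sph_int f)" by (rule sph_nn_sph_int[OF f f0 c(3)])
  finally show ?thesis by simp
qed

definition kap0 :: "nat \<Rightarrow> real" where "kap0 N = enn2real (Kint TYPE(real) N)"

text \<open>Rescaling \<open>y\<close> by \<open>sqrt A\<close> turns each power integral into a
  multiple of \<open>Kint TYPE(real)\<close>, and the recursion expresses the exponents
  \<open>N - 1\<close> and \<open>N - 2\<close> through \<open>\<kappa>\<close>. The numerator is
  reduced by \<open>4 * y\<^sup>2 = 4 * (A + y\<^sup>2) - 4 * A\<close>.\<close>

lemma cylinder_fibre_integrals:
  fixes A \<Psi> :: real
  assumes A: "A > 0" and \<Psi>: "\<Psi> \<ge> 0" and N: "N \<ge> 4"
  defines "\<kappa> \<equiv> kap0 N" and "N' \<equiv> real N"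
  shows "\<kappa> > 0"
    and "(\<integral>\<^sup>+y. ennreal (1 / (A + y\<^sup>2) ^ N) \<partial>lborel) = ennreal (\<kappa> * A powr (1/2 - N'))"
    and "(\<integral>\<^sup>+y. ennreal (((A + y\<^sup>2)\<^sup>2 + 4 * y\<^sup>2 + \<Psi>) / (A + y\<^sup>2) ^ N) \<partial>lborel)
      = ennreal (\<kappa> * (4 * (N' - 1) * (N' - 2) / ((2 * N' - 3) * (2 * N' - 5)) * A powr (5/2 - N')
          + \<Psi> * A powr (1/2 - N') + 4 / (2 * N' - 3) * A powr (3/2 - N')))"
proof -
  have N': "N' \<ge> 4" using N by (simp add: N'_def)
  have Kf: "Kint TYPE(real) N < top"
  proof -
    have "Kint TYPE(real) N \<le> Kint TYPE(real) 1"
      unfolding Kint_def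
    proof (intro nn_integral_mono ennreal_leI)
      fix z :: real
      have "(1 + (norm z)\<^sup>2) ^ 1 \<le> (1 + (norm z)\<^sup>2) ^ N" using N by (intro power_increasing) auto
      then show "1 / (1 + (norm z)\<^sup>2) ^ N \<le> 1 / (1 + (norm z)\<^sup>2) ^ 1"
        by (intro divide_left_mono) (auto intro!: mult_pos_pos zero_less_power add_pos_nonneg)
    qed
    also have "\<dots> < top" by (rule Kint_finite) auto
    finally show ?thesis .
  qed
  have K0: "Kint TYPE(real) N = ennreal \<kappa>" using Kf by (simp add: \<kappa>_def kap0_def)
  then show \<kappa>: "\<kappa> > 0" using Kint_pos[where 'a=real, of N] by simp
  have step: "Kint TYPE(real) q = ennreal (2 * real q / (2 * real q - 1) * k)"
    if "q \<ge> 1" "Kint TYPE(real) (Suc q) = ennreal k" "k \<ge> 0" for q k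
  proof -
    have "ennreal (1 / real q) * Kint TYPE(real) q = ennreal (2 / (2 * real q - real DIM(real))) * Kint TYPE(real) (Suc q)"
      using that by (intro Kint_Suc) auto
    then have "ennreal (real q) * (ennreal (1 / real q) * Kint TYPE(real) q) = ennreal (real q) * (ennreal (2 / (2 * real q - 1)) * ennreal k)"
      using that by simp
    moreover have "real q \<ge> 1" using that by simp
    ultimately show ?thesis using that by (simp add: mult.assoc[symmetric] ennreal_mult[symmetric])
  qed
  have K1: "Kint TYPE(real) (N - 1) = ennreal ((2 * N' - 2) / (2 * N' - 3) * \<kappa>)"
    using step[of "N - 1" \<kappa>] N K0 \<kappa> by (simp add: N'_def of_nat_diff)
  have K2: "Kint TYPE(real) (N - 2) = ennreal ((2 * N' - 4) / (2 * N' - 5) * ((2 * N' - 2) / (2 * N' - 3) * \<kappa>))"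
  proof -
    have "Suc (N - 2) = N - 1" using N by simp
    then show ?thesis
      using step[of "N - 2" "(2 * N' - 2) / (2 * N' - 3) * \<kappa>"] N K1 \<kappa> N' by (simp add: N'_def of_nat_diff)
  qed
  have par: "(\<integral>\<^sup>+y. ennreal (1 / (A + y\<^sup>2) ^ q) \<partial>lborel) = ennreal (A powr (1/2 - real q)) * Kint TYPE(real) q" for q
  proof -
    have "(\<integral>\<^sup>+y. ennreal (1 / (A + y\<^sup>2) ^ q) \<partial>lborel) = (\<integral>\<^sup>+y. ennreal (1 / ((sqrt A)\<^sup>2 + (norm ((y::real) - 0))\<^sup>2) ^ q) \<partial>lborel)"
      using A by simp
    also have "\<dots> = ennreal (sqrt A powr (real DIM(real) - 2 * real q)) * Kint TYPE(real) q"
      using A by (intro nn_integral_paraboloid) auto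
    also have "sqrt A powr (real DIM(real) - 2 * real q) = A powr (1/2 * (1 - 2 * real q))"
      using A by (simp only: powr_half_sqrt[symmetric] powr_powr DIM_real of_nat_1)
    also have "1/2 * (1 - 2 * real q) = 1/2 - real q" by (simp add: algebra_simps)
    finally show ?thesis .
  qed
  show int0: "(\<integral>\<^sup>+y. ennreal (1 / (A + y\<^sup>2) ^ N) \<partial>lborel) = ennreal (\<kappa> * A powr (1/2 - N'))"
    using \<kappa> by (simp add: par K0 N'_def ennreal_mult[symmetric] mult.commute)
  define P where "P = \<kappa> * (4 * (N' - 1) * (N' - 2) / ((2 * N' - 3) * (2 * N' - 5)) * A powr (5/2 - N')
          + \<Psi> * A powr (1/2 - N') + 4 / (2 * N' - 3) * A powr (3/2 - N'))"
  have P0: "P \<ge> 0" using \<kappa> N' \<Psi> by (auto simp: P_def intro!: mult_nonneg_nonneg add_nonneg_nonneg divide_nonneg_nonneg)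
  have Ay: "A + y\<^sup>2 > 0" for y using A by (simp add: add_pos_nonneg)
  \<comment> \<open>The term with \<open>- 4 * A\<close> is moved to the left-hand side, where it is
    nonnegative; it is finite and is cancelled at the end.\<close>
  have "(\<integral>\<^sup>+y. ennreal (((A + y\<^sup>2)\<^sup>2 + 4 * y\<^sup>2 + \<Psi>) / (A + y\<^sup>2) ^ N) \<partial>lborel) + ennreal (4 * A) * ennreal (\<kappa> * A powr (1/2 - N'))
     = (\<integral>\<^sup>+y. ennreal (((A + y\<^sup>2)\<^sup>2 + 4 * y\<^sup>2 + \<Psi>) / (A + y\<^sup>2) ^ N) + ennreal (4 * A) * ennreal (1 / (A + y\<^sup>2) ^ N) \<partial>lborel)"
    unfolding int0[symmetric] by (subst nn_integral_add) (auto simp: nn_integral_cmult)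
  also have "\<dots> = (\<integral>\<^sup>+y. ennreal (1 / (A + y\<^sup>2) ^ (N - 2)) + (ennreal 4 * ennreal (1 / (A + y\<^sup>2) ^ (N - 1)) + ennreal \<Psi> * ennreal (1 / (A + y\<^sup>2) ^ N)) \<partial>lborel)"
  proof (rule nn_integral_cong)
    fix y
    define d where "d = A + y\<^sup>2"
    have d: "d > 0" "y\<^sup>2 \<le> d" using Ay A by (auto simp: d_def)
    have e1: "d ^ N = d * d ^ (N - 1)" "d ^ N = d\<^sup>2 * d ^ (N - 2)"
    proof -
      obtain k where "N = k + 2" using N that[of "N - 2"] by simp
      then show "d ^ N = d * d ^ (N - 1)" "d ^ N = d\<^sup>2 * d ^ (N - 2)" by (simp_all add: power2_eq_square)
    qed
    have q1: "d / d ^ N = 1 / d ^ (N - 1)" using d unfolding e1(1) by simp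
    have q2: "d\<^sup>2 / d ^ N = 1 / d ^ (N - 2)" using d unfolding e1(2) by simp
    have "(d\<^sup>2 + 4 * y\<^sup>2 + \<Psi>) / d ^ N + 4 * A * (1 / d ^ N) = d\<^sup>2 / d ^ N + (4 * (d / d ^ N) + \<Psi> * (1 / d ^ N))"
      by (simp add: d_def add_divide_distrib)
    also have "\<dots> = 1 / d ^ (N - 2) + (4 * (1 / d ^ (N - 1)) + \<Psi> * (1 / d ^ N))" unfolding q1 q2 ..
    finally have eq: "(d\<^sup>2 + 4 * y\<^sup>2 + \<Psi>) / d ^ N + 4 * A * (1 / d ^ N) = 1 / d ^ (N - 2) + (4 * (1 / d ^ (N - 1)) + \<Psi> * (1 / d ^ N))" .
    have l1: "ennreal u + ennreal v * ennreal w = ennreal (u + v * w)" if "u \<ge> 0" "v \<ge> 0" "w \<ge> 0" for u v w :: real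
      using that by (simp add: ennreal_mult)
    have l2: "ennreal u + (ennreal v * ennreal w + ennreal s * ennreal t) = ennreal (u + (v * w + s * t))"
      if "u \<ge> 0" "v \<ge> 0" "w \<ge> 0" "s \<ge> 0" "t \<ge> 0" for u v w s t :: real
      using that by (simp add: ennreal_mult)
    show "ennreal (((A + y\<^sup>2)\<^sup>2 + 4 * y\<^sup>2 + \<Psi>) / (A + y\<^sup>2) ^ N) + ennreal (4 * A) * ennreal (1 / (A + y\<^sup>2) ^ N)
      = ennreal (1 / (A + y\<^sup>2) ^ (N - 2)) + (ennreal 4 * ennreal (1 / (A + y\<^sup>2) ^ (N - 1)) + ennreal \<Psi> * ennreal (1 / (A + y\<^sup>2) ^ N))"
      unfolding d_def[symmetric] using d \<Psi> A by (subst l1, simp, simp, simp, subst l2) (auto simp only: eq, auto)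
  qed
  also have "\<dots> = ennreal (A powr (1/2 - real (N - 2))) * Kint TYPE(real) (N - 2)
      + (ennreal 4 * (ennreal (A powr (1/2 - real (N - 1))) * Kint TYPE(real) (N - 1)) + ennreal \<Psi> * ennreal (\<kappa> * A powr (1/2 - N')))"
    by (subst nn_integral_add, measurable, subst nn_integral_add, measurable) (simp add: nn_integral_cmult par[symmetric] int0[symmetric])
  also have "\<dots> = ennreal (P + 4 * A * (\<kappa> * A powr (1/2 - N')))"
  proof -
    have r: "1/2 - real (N - 2) = 5/2 - N'" "1/2 - real (N - 1) = 3/2 - N'" using N by (simp_all add: N'_def of_nat_diff)
    have A1: "A * A powr (1/2 - N') = A powr (3/2 - N')"
      using A by (simp add: powr_mult_base)
    define u v where "u = A powr (5/2 - N')" and "v = A powr (3/2 - N')"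
    have "ennreal u * ennreal ((2 * N' - 4) / (2 * N' - 5) * ((2 * N' - 2) / (2 * N' - 3) * \<kappa>))
        + (ennreal 4 * (ennreal v * ennreal ((2 * N' - 2) / (2 * N' - 3) * \<kappa>)) + ennreal \<Psi> * ennreal (\<kappa> * A powr (1/2 - N')))
      = ennreal (u * ((2 * N' - 4) / (2 * N' - 5) * ((2 * N' - 2) / (2 * N' - 3) * \<kappa>))
        + (4 * (v * ((2 * N' - 2) / (2 * N' - 3) * \<kappa>)) + \<Psi> * (\<kappa> * A powr (1/2 - N'))))"
    proof -
      have l: "ennreal a * ennreal b + (ennreal 4 * (ennreal c * ennreal d) + ennreal s * ennreal t) = ennreal (a * b + (4 * (c * d) + s * t))"
        if "a \<ge> 0" "b \<ge> 0" "c \<ge> 0" "d \<ge> 0" "s \<ge> 0" "t \<ge> 0" for a b c d s t :: real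
        using that by (simp add: ennreal_mult)
      show ?thesis using N' \<kappa> \<Psi> by (intro l) (auto simp: u_def v_def)
    qed
    also have "u * ((2 * N' - 4) / (2 * N' - 5) * ((2 * N' - 2) / (2 * N' - 3) * \<kappa>))
        + (4 * (v * ((2 * N' - 2) / (2 * N' - 3) * \<kappa>)) + \<Psi> * (\<kappa> * A powr (1/2 - N'))) = P + 4 * (\<kappa> * v)"
    proof -
      have c1: "(2 * N' - 2) / (2 * N' - 3) = 1 + 1 / (2 * N' - 3)" using N' by (simp add: field_simps)
      have c2: "(2 * N' - 4) / (2 * N' - 5) * ((2 * N' - 2) / (2 * N' - 3)) = 4 * (N' - 1) * (N' - 2) / ((2 * N' - 3) * (2 * N' - 5))"
        by (simp add: algebra_simps)
      have "u * ((2 * N' - 4) / (2 * N' - 5) * ((2 * N' - 2) / (2 * N' - 3) * \<kappa>)) = \<kappa> * (4 * (N' - 1) * (N' - 2) / ((2 * N' - 3) * (2 * N' - 5)) * u)"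
        unfolding c2[symmetric] by simp
      moreover have "4 * (v * ((2 * N' - 2) / (2 * N' - 3) * \<kappa>)) = \<kappa> * (4 / (2 * N' - 3) * v) + 4 * (\<kappa> * v)"
        unfolding c1 by (simp add: algebra_simps)
      ultimately show ?thesis by (simp add: P_def u_def v_def algebra_simps)
    qed
    also have "4 * (\<kappa> * v) = 4 * A * (\<kappa> * A powr (1/2 - N'))" by (simp add: v_def A1[symmetric])
    finally show ?thesis unfolding r K1 K2 u_def v_def .
  qed
  also have "\<dots> = ennreal P + ennreal (4 * A) * ennreal (\<kappa> * A powr (1/2 - N'))"
    using P0 \<kappa> A by (simp add: ennreal_mult[symmetric])
  finally have "ennreal (4 * A) * ennreal (\<kappa> * A powr (1/2 - N')) + (\<integral>\<^sup>+y. ennreal (((A + y\<^sup>2)\<^sup>2 + 4 * y\<^sup>2 + \<Psi>) / (A + y\<^sup>2) ^ N) \<partial>lborel)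
     = ennreal (4 * A) * ennreal (\<kappa> * A powr (1/2 - N')) + ennreal P" by (simp add: add.commute)
  then have "(\<integral>\<^sup>+y. ennreal (((A + y\<^sup>2)\<^sup>2 + 4 * y\<^sup>2 + \<Psi>) / (A + y\<^sup>2) ^ N) \<partial>lborel) = ennreal P"
    by (subst (asm) ennreal_add_left_cancel) (simp add: ennreal_mult_eq_top_iff)
  then show "(\<integral>\<^sup>+y. ennreal (((A + y\<^sup>2)\<^sup>2 + 4 * y\<^sup>2 + \<Psi>) / (A + y\<^sup>2) ^ N) \<partial>lborel)
      = ennreal (\<kappa> * (4 * (N' - 1) * (N' - 2) / ((2 * N' - 3) * (2 * N' - 5)) * A powr (5/2 - N')
          + \<Psi> * A powr (1/2 - N') + 4 / (2 * N' - 3) * A powr (3/2 - N')))" by (simp add: P_def)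
qed

section \<open>Smooth bump functions\<close>

lemma Ck_on_Suc_imp: "Ck_on (Suc k) f U \<Longrightarrow> Ck_on k f U"
  by (induction k arbitrary: f) auto

lemma Ck_on_const: "Ck_on k (\<lambda>_. c) UNIV"
proof (induction k arbitrary: c)
  case (Suc k)
  have "frechet_derivative (\<lambda>_. c) (at x) = (\<lambda>_. 0)" for x :: 'a
    by (rule frechet_derivative_at[symmetric]) simp
  then show ?case using Suc by simp
qed simp

lemma Ck_on_add: "Ck_on k f UNIV \<Longrightarrow> Ck_on k g UNIV \<Longrightarrow> Ck_on k (\<lambda>x. f x + g x) UNIV"
proof (induction k arbitrary: f g)
  case (Suc k)
  have "frechet_derivative (\<lambda>x. f x + g x) (at x) v = frechet_derivative f (at x) v + frechet_derivative g (at x) v" for x v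
  proof -
    have "((\<lambda>x. f x + g x) has_derivative (\<lambda>v. frechet_derivative f (at x) v + frechet_derivative g (at x) v)) (at x)"
      using Suc.prems by (intro has_derivative_add) (auto simp: frechet_derivative_works[symmetric])
    from fun_cong[OF frechet_derivative_at[OF this], of v] show ?thesis by simp
  qed
  then show ?case using Suc by (auto intro!: continuous_intros)
qed (auto intro!: continuous_intros)

lemma Ck_on_mult: "Ck_on k f UNIV \<Longrightarrow> Ck_on k g UNIV \<Longrightarrow> Ck_on k (\<lambda>x. f x * g x) UNIV"
proof (induction k arbitrary: f g)
  case (Suc k)
  have "frechet_derivative (\<lambda>x. f x * g x) (at x) v = f x * frechet_derivative g (at x) v + frechet_derivative f (at x) v * g x" for x v
  proof -
    have "((\<lambda>x. f x * g x) has_derivative (\<lambda>v. f x * frechet_derivative g (at x) v + frechet_derivative f (at x) v * g x)) (at x)"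
      using Suc.prems by (intro has_derivative_mult) (auto simp: frechet_derivative_works[symmetric])
    from fun_cong[OF frechet_derivative_at[OF this], of v] show ?thesis by simp
  qed
  moreover have "Ck_on k f UNIV" "Ck_on k g UNIV" using Suc.prems by (auto intro: Ck_on_Suc_imp simp del: Ck_on.simps)
  ultimately show ?case using Suc by (auto intro!: continuous_intros Ck_on_add)
qed (auto intro!: continuous_intros)

lemma Ck_on_prod:
  "finite I \<Longrightarrow> (\<And>i. i \<in> I \<Longrightarrow> Ck_on k (f i) UNIV) \<Longrightarrow> Ck_on k (\<lambda>x. \<Prod>i\<in>I. f i x) UNIV"
  by (induction I rule: finite_induct) (auto intro!: Ck_on_const Ck_on_mult)

text \<open>For \<open>n = 0\<close> this is the standard smooth function that is flat at 0. The
  extra powers of \<open>1 / s\<close> make the family closed under differentiation up to linear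
  combinations, so smoothness follows by induction on the order with \<open>n\<close>
  arbitrary.\<close>

definition flat :: "nat \<Rightarrow> real \<Rightarrow> real" where
  "flat n s = (if s \<le> 0 then 0 else (1 / s) ^ n * exp (- (1 / s)))"

lemma flat_derivative: "(flat n has_real_derivative flat (n + 2) s - real n * flat (n + 1) s) (at s)"
proof -
  consider "s < 0" | "s > 0" | "s = 0" by linarith
  then show ?thesis
  proof cases
    case 1
    have "((\<lambda>s. 0) has_real_derivative 0) (at s)" by simp
    then have "(flat n has_real_derivative 0) (at s)"
      by (rule has_field_derivative_transform_within_open[where S = "{..<0}"]) (use 1 in \<open>auto simp: flat_def\<close>)
    then show ?thesis using 1 by (simp add: flat_def)
  next
    case 2
    have "((\<lambda>s. (1 / s) ^ n * exp (- (1 / s))) has_real_derivative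
        (1 / s) ^ n * (exp (- (1 / s)) * (1 / s)\<^sup>2) + (real n * (1 / s) ^ (n - 1) * (- ((1 / s)\<^sup>2))) * exp (- (1 / s))) (at s)"
    proof -
      have i: "((\<lambda>s. 1 / s) has_real_derivative - ((1 / s)\<^sup>2)) (at s)"
        using 2 by (auto intro!: derivative_eq_intros simp: power2_eq_square)
      show ?thesis
        by (rule DERIV_cong[OF DERIV_mult[OF DERIV_power[OF i, of n] DERIV_fun_exp[OF DERIV_minus[OF i]]]]) simp
    qed
    moreover have "(1 / s) ^ n * (exp (- (1 / s)) * (1 / s)\<^sup>2) + (real n * (1 / s) ^ (n - 1) * (- ((1 / s)\<^sup>2))) * exp (- (1 / s))
       = flat (n + 2) s - real n * flat (n + 1) s"
    proof -
      define v where "v = 1 / s"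
      have f: "flat m s = v ^ m * exp (- v)" for m using 2 by (simp add: flat_def v_def)
      have p: "real n * v ^ (n - 1) * v\<^sup>2 = real n * v ^ (n + 1)"
        by (cases n) (simp_all add: power2_eq_square)
      have "v ^ n * (exp (- v) * v\<^sup>2) + real n * v ^ (n - 1) * (- v\<^sup>2) * exp (- v)
         = v ^ n * v\<^sup>2 * exp (- v) - (real n * v ^ (n - 1) * v\<^sup>2) * exp (- v)" by (simp add: mult_ac)
      also have "\<dots> = flat (n + 2) s - real n * flat (n + 1) s"
        unfolding p f by (simp add: power_add power2_eq_square mult_ac)
      finally show ?thesis by (simp only: v_def)
    qed
    ultimately have "((\<lambda>s. (1 / s) ^ n * exp (- (1 / s))) has_real_derivative flat (n + 2) s - real n * flat (n + 1) s) (at s)" by simp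
    then show ?thesis
      by (rule has_field_derivative_transform_within_open[where S = "{0<..}"]) (use 2 in \<open>auto simp: flat_def\<close>)
  next
    case 3
    have "((\<lambda>h. (1 / h) ^ (n + 1) / exp (1 / h)) \<longlongrightarrow> 0) (at_right (0::real))"
      using filterlim_compose[OF tendsto_power_div_exp_0[of "n + 1"] filterlim_inverse_at_top_right]
      by (simp add: inverse_eq_divide)
    then have r: "((\<lambda>h. flat n h / h) \<longlongrightarrow> 0) (at_right 0)"
      by (rule Lim_transform_eventually)
        (auto simp: flat_def eventually_at_right_field exp_minus field_simps intro!: exI[of _ 1])
    have l: "((\<lambda>h. flat n h / h) \<longlongrightarrow> 0) (at_left 0)"
      by (rule tendsto_eventually) (auto simp: flat_def eventually_at_left_field intro!: exI[of _ "-1"])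
    have "((\<lambda>h. flat n h / h) \<longlongrightarrow> 0) (at 0)" using l r by (simp add: filterlim_split_at)
    then show ?thesis using 3 by (simp add: DERIV_def flat_def)
  qed
qed

lemma Ck_on_flat: "Ck_on k (\<lambda>x. flat n (c * (x \<bullet> i) + d)) UNIV"
proof (induction k arbitrary: n)
  case 0
  show ?case using flat_derivative
    by (auto intro!: continuous_at_imp_continuous_on isCont_o2[where g = "flat n"] DERIV_isCont continuous_intros)
next
  case (Suc k)
  have D: "((\<lambda>x. flat n (c * (x \<bullet> i) + d)) has_derivative
      (\<lambda>v. (flat (n + 2) (c * (x \<bullet> i) + d) - real n * flat (n + 1) (c * (x \<bullet> i) + d)) * (c * (v \<bullet> i)))) (at x)" for x
    by (rule has_derivative_compose[OF _ flat_derivative[unfolded has_field_derivative_def]])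
      (auto intro!: derivative_eq_intros)
  have F: "frechet_derivative (\<lambda>x. flat n (c * (x \<bullet> i) + d)) (at x) v
      = (flat (n + 2) (c * (x \<bullet> i) + d) + (- real n) * flat (n + 1) (c * (x \<bullet> i) + d)) * (c * (v \<bullet> i))" for x v
    using fun_cong[OF frechet_derivative_at[OF D[of x]], of v] by simp
  have "continuous_on UNIV (\<lambda>x. flat n (c * (x \<bullet> i) + d))"
    using D by (intro continuous_at_imp_continuous_on ballI) (auto intro: has_derivative_continuous)
  moreover have "(\<lambda>x. flat n (c * (x \<bullet> i) + d)) differentiable (at x)" for x
    using D by (auto simp: differentiable_def)
  moreover have "Ck_on k (\<lambda>x. (flat (n + 2) (c * (x \<bullet> i) + d) + (- real n) * flat (n + 1) (c * (x \<bullet> i) + d)) * (c * (v \<bullet> i))) UNIV" for v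
    by (intro Ck_on_mult Ck_on_add Ck_on_const Suc.IH)
  ultimately show ?case by (simp add: F)
qed

text \<open>The shift by 1 puts the support inside the box shrunk by \<open>1 / j\<close> on each
  side. As \<open>exp (- 1 / s)\<close> tends to 1 for large \<open>s\<close>, the bumps converge to
  the indicator of the open box.\<close>

definition box_bump :: "'a::euclidean_space \<Rightarrow> 'a \<Rightarrow> nat \<Rightarrow> 'a \<Rightarrow> real" where
  "box_bump l u j x = (\<Prod>i\<in>Basis. flat 0 (real j * (x \<bullet> i) + (- real j * (l \<bullet> i) - 1)) * flat 0 (- real j * (x \<bullet> i) + (real j * (u \<bullet> i) - 1)))"

lemma flat0_bounds: "0 \<le> flat 0 s" "flat 0 s \<le> 1" "flat 0 s \<noteq> 0 \<longleftrightarrow> s > 0"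
  by (auto simp: flat_def)

lemma box_bump_test_fun:
  assumes j: "j \<ge> 1" and sub: "box l u \<subseteq> U"
  shows "test_fun (box_bump l u j) U"
proof -
  define K where "K = cbox (l + (1 / real j) *\<^sub>R One) (u - (1 / real j) *\<^sub>R One)"
  have "x \<in> K" if "box_bump l u j x \<noteq> 0" for x
  proof -
    have A: "real j * (x \<bullet> i) + (- real j * (l \<bullet> i) - 1) > 0 \<and> - real j * (x \<bullet> i) + (real j * (u \<bullet> i) - 1) > 0" if "i \<in> Basis" for i
      using \<open>box_bump l u j x \<noteq> 0\<close> that unfolding box_bump_def by (auto simp: flat0_bounds(3))
    have "1 / real j \<le> x \<bullet> i - l \<bullet> i \<and> 1 / real j \<le> u \<bullet> i - x \<bullet> i" if "i \<in> Basis" for i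
    proof -
      have q: "1 / real j \<le> v" if "1 < real j * v" for v
        using that j by (simp add: pos_divide_le_eq mult.commute)
      show ?thesis using A[OF that] by (intro conjI q) (auto simp: right_diff_distrib)
    qed
    then show ?thesis by (force simp: K_def mem_box inner_add_left inner_diff_left)
  qed
  then have "{x. box_bump l u j x \<noteq> 0} \<subseteq> K" by auto
  then have cl: "closure {x. box_bump l u j x \<noteq> 0} \<subseteq> K" by (rule closure_minimal) (simp add: K_def closed_cbox)
  have KU: "K \<subseteq> box l u"
  proof
    fix x assume x: "x \<in> K"
    have jp: "1 / real j > 0" using j by simp
    have h: "l \<bullet> i + 1 / real j \<le> x \<bullet> i \<and> x \<bullet> i \<le> u \<bullet> i - 1 / real j" if "i \<in> Basis" for i
      using that x by (auto simp: K_def mem_box inner_add_left inner_diff_left)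
    show "x \<in> box l u" unfolding mem_box
    proof
      fix i :: 'a assume "i \<in> Basis"
      from h[OF this] jp show "l \<bullet> i < x \<bullet> i \<and> x \<bullet> i < u \<bullet> i" by linarith
    qed
  qed
  have "smooth_on (box_bump l u j) UNIV"
    unfolding smooth_on_def box_bump_def[abs_def] by (intro allI Ck_on_prod Ck_on_mult Ck_on_flat) auto
  moreover have "compact (closure {x. box_bump l u j x \<noteq> 0})"
  proof -
    have "compact K" by (simp add: K_def compact_cbox)
    then show ?thesis using cl by (meson closed_closure compact_eq_bounded_closed bounded_subset)
  qed
  ultimately show ?thesis using cl KU sub unfolding test_fun_def by blast
qed

lemma box_bump_limit: "(\<lambda>j. box_bump l u j x) \<longlonglongrightarrow> indicator (box l u) x"
proof (cases "x \<in> box l u")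
  case True
  have lim: "(\<lambda>j. flat 0 (real j * a + (b j - 1))) \<longlonglongrightarrow> 1" if "\<And>j. real j * a + b j = real j * c" "c > 0" for a b c
  proof -
    have f: "filterlim (\<lambda>j. - 1 + real j * c) at_top sequentially"
      using that(2) by (intro filterlim_tendsto_add_at_top[OF tendsto_const] filterlim_at_top_mult_tendsto_pos[OF tendsto_const] filterlim_real_sequentially)
    then have "(\<lambda>j. exp (- (inverse (- 1 + real j * c)))) \<longlonglongrightarrow> exp (- 0)"
      by (intro tendsto_intros tendsto_inverse_0_at_top)
    moreover have "\<forall>\<^sub>F j in sequentially. exp (- (inverse (- 1 + real j * c))) = flat 0 (- 1 + real j * c)"
      using filterlim_at_top_dense[THEN iffD1, OF f, rule_format, of 0]
      by eventually_elim (simp add: flat_def inverse_eq_divide)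
    ultimately have "(\<lambda>j. flat 0 (- 1 + real j * c)) \<longlonglongrightarrow> exp (- 0)" by (rule Lim_transform_eventually)
    moreover have r: "real j * a + (b j - 1) = - 1 + real j * c" for j using that(1)[of j] by linarith
    ultimately show ?thesis unfolding r by simp
  qed
  have "(\<lambda>j. box_bump l u j x) \<longlonglongrightarrow> (\<Prod>i\<in>(Basis::'a set). 1 * 1)"
    unfolding box_bump_def
  proof (intro tendsto_prod tendsto_mult)
    fix i :: 'a assume i: "i \<in> Basis"
    show "(\<lambda>j. flat 0 (real j * (x \<bullet> i) + (- real j * (l \<bullet> i) - 1))) \<longlonglongrightarrow> 1"
      using True i by (intro lim[where c = "x \<bullet> i - l \<bullet> i"]) (auto simp: mem_box algebra_simps)
    have "(\<lambda>j. flat 0 (real j * (- (x \<bullet> i)) + (real j * (u \<bullet> i) - 1))) \<longlonglongrightarrow> 1"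
      using True i by (intro lim[where c = "u \<bullet> i - x \<bullet> i"]) (auto simp: mem_box algebra_simps)
    then show "(\<lambda>j. flat 0 (- real j * (x \<bullet> i) + (real j * (u \<bullet> i) - 1))) \<longlonglongrightarrow> 1" by simp
  qed
  then show ?thesis using True by simp
next
  case False
  then obtain i where i: "i \<in> Basis" "\<not> (l \<bullet> i < x \<bullet> i \<and> x \<bullet> i < u \<bullet> i)" by (auto simp: mem_box)
  have "box_bump l u j x = 0" for j
  proof -
    have "real j * (x \<bullet> i) \<le> real j * (l \<bullet> i) \<or> real j * (u \<bullet> i) \<le> real j * (x \<bullet> i)"
      using i(2) by (auto simp: not_less intro: mult_left_mono)
    then have "flat 0 (real j * (x \<bullet> i) + (- real j * (l \<bullet> i) - 1)) * flat 0 (- real j * (x \<bullet> i) + (real j * (u \<bullet> i) - 1)) = 0"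
      by (auto simp: flat_def)
    then show ?thesis unfolding box_bump_def using i(1) by (intro prod_zero) auto
  qed
  then show ?thesis using False by simp
qed

lemma box_bump_bounds: "0 \<le> box_bump l u j x" "box_bump l u j x \<le> 1"
  unfolding box_bump_def
  by (auto intro!: prod_nonneg prod_le_1 mult_nonneg_nonneg mult_le_one flat0_bounds)

section \<open>Uniqueness of weak gradients\<close>

text \<open>The positive and the negative part of \<open>D\<close> define measures that agree on
  boxes, an intersection-stable generator, and hence everywhere. Uniqueness of densities then makes
  the two parts equal almost everywhere, which forces \<open>D\<close> to vanish there.\<close>

lemma AE_eq_0_if_box_integrals_0:
  fixes D :: "'a::euclidean_space \<Rightarrow> real"
  assumes D: "integrable lborel D" and box: "\<And>l u. (LINT x:box l u|lborel. D x) = 0"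
  shows "AE x in lborel. D x = 0"
proof -
  define P M where "P = density lborel (\<lambda>x. ennreal (D x))" and "M = density lborel (\<lambda>x. ennreal (- D x))"
  have [measurable]: "D \<in> borel_measurable borel" using D by auto
  have fin: "(\<integral>\<^sup>+x. ennreal (D x) \<partial>lborel) < top" "(\<integral>\<^sup>+x. ennreal (- D x) \<partial>lborel) < top"
    using D by (auto simp: real_integrable_def less_top)
  have em: "emeasure P A = (\<integral>\<^sup>+x. ennreal (indicator A x * D x) \<partial>lborel)"
    "emeasure M A = (\<integral>\<^sup>+x. ennreal (- (indicator A x * D x)) \<partial>lborel)" if "A \<in> sets borel" for A
    using that by (auto simp: P_def M_def emeasure_density indicator_def intro!: nn_integral_cong)
  have "P = M"
  proof (rule measure_eqI_generator_eq)
    let ?E = "range (\<lambda>(a, b). box a b::'a set)"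
    show "Int_stable ?E" by (auto simp: Int_stable_def box_Int_box)
    show "?E \<subseteq> Pow UNIV" "sets P = sigma_sets UNIV ?E" "sets M = sigma_sets UNIV ?E"
      by (simp_all add: borel_eq_box P_def M_def)
    let ?A = "\<lambda>n::nat. box (- (real n *\<^sub>R One)) (real n *\<^sub>R One) :: 'a set"
    show "range ?A \<subseteq> ?E" "(\<Union>i. ?A i) = UNIV" unfolding UN_box_eq_UNIV by auto
    show "emeasure P (?A i) \<noteq> \<infinity>" for i
    proof -
      have "emeasure P (?A i) \<le> (\<integral>\<^sup>+x. ennreal (D x) \<partial>lborel)"
        by (subst em) (auto intro!: nn_integral_mono simp: indicator_def)
      then show ?thesis using fin(1) by (auto simp: top_unique)
    qed
    fix X assume "X \<in> ?E"
    then obtain l u where X: "X = box l u" by auto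
    have int: "integrable lborel (\<lambda>x. indicator X x * D x)"
      using integrable_mult_indicator[OF _ D, of X] by (simp add: X)
    have "0 = integral\<^sup>L lborel (\<lambda>x. indicator X x * D x)"
      using box[of l u] by (simp add: X set_lebesgue_integral_def)
    also have "\<dots> = enn2real (emeasure P X) - enn2real (emeasure M X)"
      using real_lebesgue_integral_def[OF int] by (simp add: em X)
    finally have "enn2real (emeasure P X) = enn2real (emeasure M X)" by simp
    moreover have "emeasure P X < top" "emeasure M X < top"
      using int by (auto simp: real_integrable_def em X less_top)
    ultimately show "emeasure P X = emeasure M X" by (metis ennreal_enn2real)
  qed
  then have "density lborel (\<lambda>x. ennreal (D x)) = density lborel (\<lambda>x. ennreal (- D x))"
    by (simp only: P_def M_def)
  then have "AE x in lborel. ennreal (D x) = ennreal (- D x)"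
    by (intro sigma_finite_measure.density_unique[OF sigma_finite_lborel]) simp_all
  then show ?thesis
  proof eventually_elim
    case (elim x)
    show ?case
    proof (cases "D x \<ge> 0")
      case True
      then have "ennreal (D x) = 0" using elim by (simp add: ennreal_neg)
      with True show ?thesis by simp
    next
      case False
      then have "ennreal (- D x) = 0" using elim by (simp add: ennreal_neg)
      with False show ?thesis by (simp add: ennreal_eq_0_iff)
    qed
  qed
qed

text \<open>The fundamental lemma of the calculus of variations. Bumps filling a box inside
  \<open>U\<close> show by dominated convergence that \<open>D\<close> has integral 0 over it; on
  one such box all intersections with boxes are again boxes, and \<open>U\<close> is a countable
  union of open boxes.\<close>

lemma AE_eq_0_if_test_integrals_0:
  fixes D :: "'a::euclidean_space \<Rightarrow> real"
  assumes U: "open U" and D: "set_integrable lborel U D"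
    and test: "\<And>\<phi>. test_fun \<phi> U \<Longrightarrow> (LINT x:U|lborel. D x * \<phi> x) = 0"
  shows "AE x in lborel. x \<in> U \<longrightarrow> D x = 0"
proof -
  have Ds: "integrable lborel (\<lambda>x. indicator U x * D x)" using D by (simp add: set_integrable_def)
  have box: "(LINT x|lborel. indicator (box l u) x * D x) = 0" if lu: "box l u \<subseteq> U" for l u
  proof -
    have "(\<lambda>j. LINT x|lborel. (indicator U x * D x) * box_bump l u (Suc j) x) \<longlonglongrightarrow> (LINT x|lborel. (indicator U x * D x) * indicator (box l u) x)"
    proof (rule integral_dominated_convergence[where w = "\<lambda>x. \<bar>indicator U x * D x\<bar>"])
      show "(\<lambda>x. (indicator U x * D x) * indicator (box l u) x) \<in> borel_measurable lborel"
        using Ds by (intro borel_measurable_times borel_measurable_integrable borel_measurable_indicator) auto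
      show "(\<lambda>x. (indicator U x * D x) * box_bump l u (Suc j) x) \<in> borel_measurable lborel" for j
      proof -
        have "continuous_on UNIV (box_bump l u (Suc j))"
          using box_bump_test_fun[OF _ lu, of "Suc j"] unfolding test_fun_def smooth_on_def
          by (metis Ck_on.simps(1) le_add1 plus_1_eq_Suc)
        then have "box_bump l u (Suc j) \<in> borel_measurable borel" by (rule borel_measurable_continuous_onI)
        then show ?thesis by (intro borel_measurable_times[OF borel_measurable_integrable[OF Ds]]) simp
      qed
      show "integrable lborel (\<lambda>x. \<bar>indicator U x * D x\<bar>)" using Ds by (rule integrable_abs)
      show "AE x in lborel. (\<lambda>j. (indicator U x * D x) * box_bump l u (Suc j) x) \<longlonglongrightarrow> (indicator U x * D x) * indicator (box l u) x"
        by (intro AE_I2 tendsto_mult tendsto_const LIMSEQ_Suc box_bump_limit)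
      show "AE x in lborel. norm ((indicator U x * D x) * box_bump l u (Suc j) x) \<le> \<bar>indicator U x * D x\<bar>" for j
      proof (rule AE_I2)
        fix x
        have "\<bar>v * b\<bar> \<le> \<bar>v\<bar>" if "0 \<le> b" "b \<le> 1" for v b :: real
          using that mult_left_mono[of b 1 "\<bar>v\<bar>"] by (simp add: abs_mult)
        then show "norm ((indicator U x * D x) * box_bump l u (Suc j) x) \<le> \<bar>indicator U x * D x\<bar>"
          unfolding real_norm_def using box_bump_bounds by blast
      qed
    qed
    moreover have "(LINT x|lborel. (indicator U x * D x) * box_bump l u (Suc j) x) = 0" for j
      using test[OF box_bump_test_fun[OF _ lu, of "Suc j"]] by (simp add: set_lebesgue_integral_def mult.assoc)
    ultimately have "(LINT x|lborel. (indicator U x * D x) * indicator (box l u) x) = 0"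
      using LIMSEQ_unique[OF _ tendsto_const] by fastforce
    moreover have "(\<lambda>x. (indicator U x * D x) * indicator (box l u) x) = (\<lambda>x. indicator (box l u) x * D x)"
      using lu by (auto simp: fun_eq_iff indicator_def)
    ultimately show ?thesis by simp
  qed
  have one: "AE x in lborel. x \<in> B \<longrightarrow> D x = 0" if B: "B = box a b" "B \<subseteq> U" for B a b
  proof -
    have eq: "indicator B x * (indicator U x * D x) = indicator B x * D x" for x using B by (auto simp: indicator_def)
    have "integrable lborel (\<lambda>x. indicator B x * (indicator U x * D x))"
      using integrable_mult_indicator[OF _ Ds, of B] B by simp
    then have int: "integrable lborel (\<lambda>x. indicator B x * D x)" by (simp only: eq)
    have "AE x in lborel. indicator B x * D x = 0"
    proof (rule AE_eq_0_if_box_integrals_0[OF int])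
      fix l u :: 'a
      obtain l' u' where lu: "box l u \<inter> B = box l' u'" using B by (auto simp: box_Int_box)
      have "(LINT x:box l u|lborel. indicator B x * D x) = (LINT x|lborel. indicator (box l' u') x * D x)"
        unfolding lu[symmetric] set_lebesgue_integral_def
        by (intro Bochner_Integration.integral_cong) (auto simp: indicator_def)
      also have "\<dots> = 0" using lu B by (intro box) auto
      finally show "(LINT x:box l u|lborel. indicator B x * D x) = 0" .
    qed
    then show ?thesis by eventually_elim (auto simp: indicator_def split: if_splits)
  qed
  obtain \<D> where d: "countable \<D>" "\<D> \<subseteq> Pow U" "\<And>X. X \<in> \<D> \<Longrightarrow> \<exists>a b. X = box a b" "\<Union>\<D> = U"
    using open_countable_Union_open_box[OF U] by metis
  have "AE x in lborel. \<forall>B\<in>\<D>. x \<in> B \<longrightarrow> D x = 0"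
    using d one by (subst AE_ball_countable) (auto, metis PowD subsetD)
  then show ?thesis by eventually_elim (use d(4) in blast)
qed

text \<open>Serves to evaluate \<open>sph_dirichlet\<close>, which picks its weak gradient by
  \<open>SOME\<close>. Finite measure of \<open>U\<close> and
  \<open>norm v \<le> 1 + (norm v)\<^sup>2\<close> make square-integrable fields integrable, so the
  fundamental lemma applies to each component of the difference.\<close>

lemma weak_grad_L2_unique:
  fixes F :: "'a::euclidean_space \<Rightarrow> real"
  assumes U: "open U" "emeasure lborel U < top" and G: "weak_grad_L2 U F G1" "weak_grad_L2 U F G2"
  shows "AE x in lborel. x \<in> U \<longrightarrow> G1 x = G2 x"
proof -
  have Ub: "U \<in> sets lborel" using U by simp
  have int: "set_integrable lborel U (\<lambda>x. G x \<bullet> i)" if "weak_grad_L2 U F G" "i \<in> Basis" for G i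
  proof -
    have m: "(\<lambda>x. indicator U x *\<^sub>R G x) \<in> borel_measurable lborel"
      and s: "integrable lborel (\<lambda>x. indicator U x *\<^sub>R (norm (G x))\<^sup>2)"
      using that by (auto simp: weak_grad_L2_def set_borel_measurable_def set_integrable_def)
    have one: "integrable lborel (indicat_real U)" using U Ub by (intro integrable_real_indicator) auto
    have "integrable lborel (\<lambda>x. (indicator U x *\<^sub>R G x) \<bullet> i)"
    proof (rule Bochner_Integration.integrable_bound[OF Bochner_Integration.integrable_add[OF one s]])
      show "(\<lambda>x. (indicator U x *\<^sub>R G x) \<bullet> i) \<in> borel_measurable lborel"
          by (rule borel_measurable_inner[OF m borel_measurable_const])
      show "AE x in lborel. norm ((indicator U x *\<^sub>R G x) \<bullet> i) \<le> norm (indicat_real U x + indicator U x *\<^sub>R (norm (G x))\<^sup>2)"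
      proof (rule AE_I2)
        fix x
        have "\<bar>G x \<bullet> i\<bar> \<le> norm (G x)" using Basis_le_norm[OF that(2)] .
        also have "norm (G x) \<le> 1 + (norm (G x))\<^sup>2"
        proof -
          have "0 \<le> (norm (G x) - 1)\<^sup>2" by simp
          also have "\<dots> = (norm (G x))\<^sup>2 - 2 * norm (G x) + 1" by (simp add: power2_diff)
          finally show ?thesis using zero_le_power2[of "norm (G x)"] by linarith
        qed
        finally show "norm ((indicator U x *\<^sub>R G x) \<bullet> i) \<le> norm (indicat_real U x + indicator U x *\<^sub>R (norm (G x))\<^sup>2)"
          by (cases "x \<in> U") auto
      qed
    qed
    then show ?thesis by (simp add: set_integrable_def)
  qed
  have "AE x in lborel. \<forall>i\<in>Basis. x \<in> U \<longrightarrow> (G1 x - G2 x) \<bullet> i = 0"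
  proof (subst AE_ball_countable, simp add: countable_finite, intro ballI)
    fix i :: 'a assume i: "i \<in> Basis"
    have I: "set_integrable lborel U (\<lambda>x. G1 x \<bullet> i)" "set_integrable lborel U (\<lambda>x. G2 x \<bullet> i)"
      using int G i by auto
    show "AE x in lborel. x \<in> U \<longrightarrow> (G1 x - G2 x) \<bullet> i = 0"
    proof (rule AE_eq_0_if_test_integrals_0[OF U(1)])
      show "set_integrable lborel U (\<lambda>x. (G1 x - G2 x) \<bullet> i)"
        unfolding inner_diff_left by (intro set_integral_diff I)
      fix \<phi> assume \<phi>: "test_fun \<phi> U"
      have c: "continuous_on UNIV \<phi>" using \<phi> unfolding test_fun_def smooth_on_def by (metis Ck_on.simps(1))
      have "compact (closure {x. \<phi> x \<noteq> 0})" using \<phi> by (simp add: test_fun_def)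
      then have "compact (\<phi> ` closure {x. \<phi> x \<noteq> 0})" by (intro compact_continuous_image continuous_on_subset[OF c]) auto
      then obtain B where B: "\<And>x. x \<in> closure {x. \<phi> x \<noteq> 0} \<Longrightarrow> \<bar>\<phi> x\<bar> \<le> B" "B > 0"
        unfolding bounded_pos using compact_imp_bounded bounded_pos by (metis image_eqI real_norm_def)
      have Bd: "\<bar>\<phi> x\<bar> \<le> B" for x
        using B closure_subset[of "{x. \<phi> x \<noteq> 0}"] by (cases "\<phi> x = 0") auto
      have prod: "set_integrable lborel U (\<lambda>x. G x \<bullet> i * \<phi> x)" if "set_integrable lborel U (\<lambda>x. G x \<bullet> i)" for G
      proof -
        have s: "integrable lborel (\<lambda>x. indicator U x *\<^sub>R (G x \<bullet> i))" using that by (simp add: set_integrable_def)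
        have "integrable lborel (\<lambda>x. (indicator U x *\<^sub>R (G x \<bullet> i)) * \<phi> x)"
        proof (rule Bochner_Integration.integrable_bound[OF integrable_mult_right[OF s, of B]])
          show "(\<lambda>x. indicator U x *\<^sub>R (G x \<bullet> i) * \<phi> x) \<in> borel_measurable lborel"
            using borel_measurable_continuous_onI[OF c]
            by (intro borel_measurable_times[OF borel_measurable_integrable[OF s]]) simp
          show "AE x in lborel. norm (indicator U x *\<^sub>R (G x \<bullet> i) * \<phi> x) \<le> norm (B * indicator U x *\<^sub>R (G x \<bullet> i))"
            using Bd B(2) by (intro AE_I2) (auto simp: abs_mult indicator_def mult.commute intro: mult_right_mono)
        qed
        then show ?thesis by (simp add: set_integrable_def mult.assoc)
      qed
      have "(LINT x:U|lborel. (G1 x - G2 x) \<bullet> i * \<phi> x) = (LINT x:U|lborel. G1 x \<bullet> i * \<phi> x) - (LINT x:U|lborel. G2 x \<bullet> i * \<phi> x)"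
        by (subst set_integral_diff(2)[symmetric]) (auto simp: inner_diff_left left_diff_distrib intro: prod I)
      also have "\<dots> = 0"
      proof -
        have "(LINT x:U|lborel. F x * frechet_derivative \<phi> (at x) i) = - (LINT x:U|lborel. G x \<bullet> i * \<phi> x)"
          if "weak_grad_L2 U F G" for G using that \<phi> i unfolding weak_grad_L2_def by blast
        from this[OF G(1)] this[OF G(2)] show ?thesis by simp
      qed
      finally show "(LINT x:U|lborel. (G1 x - G2 x) \<bullet> i * \<phi> x) = 0" .
    qed
  qed
  then show ?thesis
  proof eventually_elim
    case (elim x)
    show ?case
    proof
      assume "x \<in> U"
      with elim have "G1 x \<bullet> i = G2 x \<bullet> i" if "i \<in> Basis" for i
        using that by (simp add: inner_diff_left)
      then show "G1 x = G2 x" by (rule euclidean_eqI)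
    qed
  qed
qed

section \<open>Integration by parts for homogeneous functions\<close>

lemma integrable_const_indicator:
  assumes "A \<in> sets borel" "emeasure lborel A < top"
  shows "integrable lborel (\<lambda>z. B * indicat_real A z)"
proof (rule integrable_mult_right)
  show "integrable lborel (indicat_real A)"
    by (rule integrable_real_indicator) (use assms in simp_all)
qed

lemma integrable_continuous_compact_support:
  fixes f :: "'a::euclidean_space \<Rightarrow> real"
  assumes "continuous_on UNIV f" "\<And>z. norm z \<ge> R \<Longrightarrow> f z = 0"
  shows "integrable lborel f" "\<exists>B>0. \<forall>z. \<bar>f z\<bar> \<le> B"
proof -
  have "compact (f ` cball 0 R)" by (intro compact_continuous_image continuous_on_subset[OF assms(1)]) auto
  then have "bounded (f ` cball 0 R)" by (rule compact_imp_bounded)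
  then obtain B where B: "B > 0" "\<And>z. z \<in> cball 0 R \<Longrightarrow> \<bar>f z\<bar> \<le> B"
    unfolding bounded_pos by (metis image_eqI real_norm_def)
  have Bd: "\<bar>f z\<bar> \<le> B * indicat_real (cball 0 R) z" for z
    using B assms(2)[of z] by (cases "norm z \<le> R") (auto simp: indicator_def)
  show "integrable lborel f"
  proof (rule Bochner_Integration.integrable_bound)
    have "emeasure lborel (cball (0::'a) R) < top" using emeasure_lborel_cball_finite by (simp add: less_top)
    then show "integrable lborel (\<lambda>z. B * indicat_real (cball (0::'a) R) z)"
      by (rule integrable_const_indicator[OF borel_closed[OF closed_cball]])
    show "f \<in> borel_measurable lborel" using borel_measurable_continuous_onI[OF assms(1)] by simp
    show "AE z in lborel. norm (f z) \<le> norm (B * indicat_real (cball 0 R) z)"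
      unfolding real_norm_def by (intro AE_I2 order_trans[OF Bd abs_ge_self])
  qed
  show "\<exists>B>0. \<forall>z. \<bar>f z\<bar> \<le> B"
  proof (intro exI[of _ B] conjI allI B(1))
    fix z :: 'a
    have "B * indicat_real (cball 0 R) z \<le> B" using B(1) by (simp add: indicator_def)
    with Bd[of z] show "\<bar>f z\<bar> \<le> B" by linarith
  qed
qed

text \<open>By translation invariance every difference quotient along \<open>v\<close> has integral
  0. The mean value theorem bounds the quotients by \<open>B\<close>, and steps of length at most 1
  keep them supported within radius \<open>R + norm v\<close>, so dominated convergence
  applies.\<close>

lemma integral_directional_derivative_eq_0:
  fixes \<psi> \<psi>' :: "'a::euclidean_space \<Rightarrow> real"
  assumes der: "\<And>z. ((\<lambda>t. \<psi> (z + t *\<^sub>R v)) has_real_derivative \<psi>' z) (at 0)"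
    and cont: "continuous_on UNIV \<psi>" "continuous_on UNIV \<psi>'"
    and R: "\<And>z. norm z \<ge> R \<Longrightarrow> \<psi> z = 0" "\<And>z. norm z \<ge> R \<Longrightarrow> \<psi>' z = 0"
  shows "(LINT z|lborel. \<psi>' z) = 0"
proof -
  have int: "integrable lborel \<psi>" by (rule integrable_continuous_compact_support[OF cont(1) R(1)])
  obtain B where B: "B > 0" "\<And>z. \<bar>\<psi>' z\<bar> \<le> B" using integrable_continuous_compact_support(2)[OF cont(2) R(2)] by auto
  have trans: "(LINT z|lborel. \<psi> (c + z)) = (LINT z|lborel. \<psi> z)" "integrable lborel (\<lambda>z. \<psi> (c + z))" for c
  proof -
    have d: "distr lborel borel ((+) c) = lborel" by (rule lborel_distr_plus)
    have m: "(+) c \<in> borel_measurable lborel" "\<psi> \<in> borel_measurable borel"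
      using borel_measurable_continuous_onI[OF cont(1)] by auto
    show "(LINT z|lborel. \<psi> (c + z)) = (LINT z|lborel. \<psi> z)"
      using integral_distr[of "(+) c" lborel borel \<psi>] m d by simp
    show "integrable lborel (\<lambda>z. \<psi> (c + z))"
      using integrable_distr_eq[of "(+) c" lborel borel \<psi>] m d int by simp
  qed
  have der': "((\<lambda>t. \<psi> (z + t *\<^sub>R v)) has_real_derivative \<psi>' (z + s *\<^sub>R v)) (at s)" for z s
  proof -
    have "((\<lambda>t. \<psi> ((z + s *\<^sub>R v) + t *\<^sub>R v)) has_real_derivative \<psi>' (z + s *\<^sub>R v)) (at (s + - s))"
      using der[of "z + s *\<^sub>R v"] by simp
    then have "((\<lambda>t. \<psi> ((z + s *\<^sub>R v) + (t + - s) *\<^sub>R v)) has_real_derivative \<psi>' (z + s *\<^sub>R v)) (at s)"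
      by (subst (asm) DERIV_shift) simp
    then show ?thesis by (simp add: algebra_simps)
  qed
  define u where "u k z = real (Suc k) * (\<psi> ((1 / real (Suc k)) *\<^sub>R v + z) - \<psi> z)" for k z
  have u0: "(LINT z|lborel. u k z) = 0" for k
    unfolding u_def using trans[of "(1 / real (Suc k)) *\<^sub>R v"] int by simp
  have "(\<lambda>k. LINT z|lborel. u k z) \<longlonglongrightarrow> (LINT z|lborel. \<psi>' z)"
  proof (rule integral_dominated_convergence[where w = "\<lambda>z. B * indicat_real (cball 0 (R + norm v)) z"])
    have "emeasure lborel (cball (0::'a) (R + norm v)) < top" using emeasure_lborel_cball_finite by (simp add: less_top)
    then show "integrable lborel (\<lambda>z. B * indicat_real (cball (0::'a) (R + norm v)) z)"
      by (rule integrable_const_indicator[OF borel_closed[OF closed_cball]])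
    show "\<psi>' \<in> borel_measurable lborel" using borel_measurable_continuous_onI[OF cont(2)] by simp
    show "u k \<in> borel_measurable lborel" for k
      unfolding u_def using trans[of "(1 / real (Suc k)) *\<^sub>R v"] int
      by (intro borel_measurable_times borel_measurable_diff borel_measurable_integrable) auto
    show "AE z in lborel. (\<lambda>k. u k z) \<longlonglongrightarrow> \<psi>' z"
    proof (rule AE_I2)
      fix z
      have "(\<lambda>h. (\<psi> (z + (0 + h) *\<^sub>R v) - \<psi> (z + 0 *\<^sub>R v)) / h) \<midarrow>0\<rightarrow> \<psi>' z"
        using der[of z] by (simp only: DERIV_def)
      then have t: "((\<lambda>h. (\<psi> (h *\<^sub>R v + z) - \<psi> z) / h) \<longlongrightarrow> \<psi>' z) (at 0)" by (simp add: add.commute)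
      have "filterlim (\<lambda>k. 1 / real (Suc k)) (at 0) sequentially"
        using LIMSEQ_inverse_real_of_nat by (auto simp: filterlim_at inverse_eq_divide)
      from filterlim_compose[OF t this] show "(\<lambda>k. u k z) \<longlonglongrightarrow> \<psi>' z" by (simp add: u_def mult.commute)
    qed
    show "AE z in lborel. norm (u k z) \<le> B * indicat_real (cball 0 (R + norm v)) z" for k
    proof (rule AE_I2)
      fix z
      define h where "h = 1 / real (Suc k)"
      have h: "0 < h" "h \<le> 1" by (auto simp: h_def)
      show "norm (u k z) \<le> B * indicat_real (cball 0 (R + norm v)) z"
      proof (cases "norm z \<le> R + norm v")
        case True
        obtain s where "\<psi> (z + h *\<^sub>R v) - \<psi> (z + 0 *\<^sub>R v) = (h - 0) * \<psi>' (z + s *\<^sub>R v)"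
          using MVT2[OF h(1), of "\<lambda>t. \<psi> (z + t *\<^sub>R v)" "\<lambda>s. \<psi>' (z + s *\<^sub>R v)"] der' by auto
        then have "u k z = real (Suc k) * (h * \<psi>' (z + s *\<^sub>R v))"
          unfolding u_def h_def[symmetric] by (simp add: add.commute)
        then have "u k z = \<psi>' (z + s *\<^sub>R v)" by (simp add: h_def)
        then show ?thesis using B(2) True by simp
      next
        case False
        have "norm (h *\<^sub>R v) \<le> norm v" using h by (simp add: mult_left_le_one_le)
        moreover have "norm z \<le> norm (h *\<^sub>R v + z) + norm (h *\<^sub>R v)" by (metis add_diff_cancel_left' norm_triangle_ineq4)
        ultimately have "R \<le> norm (h *\<^sub>R v + z)" "R \<le> norm z" using False norm_ge_zero[of v] by linarith+
        then show ?thesis unfolding u_def h_def[symmetric] using False R(1) by simp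
      qed
    qed
  qed
  then show ?thesis using u0 LIMSEQ_unique[OF _ tendsto_const] by fastforce
qed

context homogeneous_C1
begin

text \<open>As \<open>(norm (da z))\<^sup>2\<close> is homogeneous of degree -2, the axial factor is
  the integral of \<open>exp ((N - 2) * y)\<close> over \<open>y < 0\<close>, namely
  \<open>1 / (N - 2)\<close>. This is the factor that \<open>sph_dirichlet\<close>
  compensates.\<close>

lemma dirichlet_nn:
  assumes N: "DIM('a) \<ge> 3"
  shows "(\<integral>\<^sup>+z. ennreal (indicator punct_ball z *\<^sub>R (norm (da z))\<^sup>2) \<partial>lborel)
    = ennreal (1 / (real DIM('a) - 2)) * ennreal (sph_int (\<lambda>x. (norm (da x))\<^sup>2))"
proof -
  obtain M where M: "\<And>x. norm x = 1 \<Longrightarrow> (norm (da x))\<^sup>2 \<le> M" using bounds by metis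
  have [measurable]: "punct_ball \<in> sets (borel :: 'a measure)" unfolding punct_ball_def by simp
  have "(\<integral>\<^sup>+z. ennreal (indicator punct_ball z *\<^sub>R (norm (da z))\<^sup>2) \<partial>lborel)
      = sph_nn (\<lambda>x. \<integral>\<^sup>+y. ennreal (exp y ^ DIM('a)) * ennreal (indicator punct_ball (exp y *\<^sub>R x) *\<^sub>R (norm (da (exp y *\<^sub>R x)))\<^sup>2) \<partial>lborel)"
    by (rule nn_integral_cylinder) measurable
  also have "\<dots> = sph_nn (\<lambda>x. ennreal (1 / (real DIM('a) - 2)) * ennreal ((norm (da x))\<^sup>2))"
  proof (rule sph_nn_cong)
    fix x :: 'a assume x: "norm x = 1"
    then have x0: "x \<noteq> 0" by auto
    define c where "c = real DIM('a) - 2"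
    have c: "c > 0" using N by (simp add: c_def)
    have "ennreal (exp y ^ DIM('a)) * ennreal (indicator punct_ball (exp y *\<^sub>R x) *\<^sub>R (norm (da (exp y *\<^sub>R x)))\<^sup>2)
       = (ennreal (exp (c * y)) * indicator {y. y < 0} y) * ennreal ((norm (da x))\<^sup>2)" for y
    proof -
      have "exp y ^ DIM('a) * (norm (da (exp y *\<^sub>R x)))\<^sup>2 = exp (c * y) * (norm (da x))\<^sup>2"
      proof -
        have "exp y ^ DIM('a) = exp (c * y) * (exp y)\<^sup>2"
          by (simp add: c_def power2_eq_square left_diff_distrib flip: exp_of_nat_mult exp_add)
        then show ?thesis using x0 by (simp add: da_scale power_divide)
      qed
      then show ?thesis using x
        by (cases "y < 0") (auto simp: punct_ball_def indicator_def ennreal_mult'[symmetric])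
    qed
    then have "(\<integral>\<^sup>+y. ennreal (exp y ^ DIM('a)) * ennreal (indicator punct_ball (exp y *\<^sub>R x) *\<^sub>R (norm (da (exp y *\<^sub>R x)))\<^sup>2) \<partial>lborel)
       = (\<integral>\<^sup>+y. ennreal (exp (c * y)) * indicator {y. y < 0} y \<partial>lborel) * ennreal ((norm (da x))\<^sup>2)"
      by (simp add: nn_integral_multc)
    also have "(\<integral>\<^sup>+y. ennreal (exp (c * y)) * indicator {y. y < 0} y \<partial>lborel)
       = (\<integral>\<^sup>+y. ennreal (exp (c * - y)) * indicator {y. y < 0} (- y) \<partial>lborel)"
      by (rule nn_integral_even[symmetric]) measurable
    also have "\<dots> = (\<integral>\<^sup>+y. ennreal (exp (- c * y)) * indicator {0..} y \<partial>lborel)"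
    proof (rule nn_integral_cong_AE)
      have "AE y in lborel. y \<noteq> (0::real)" by (rule AE_lborel_singleton)
      then show "AE y in lborel. ennreal (exp (c * - y)) * indicator {y. y < 0} (- y) = ennreal (exp (- c * y)) * indicator {0..} y"
        by eventually_elim (auto simp: indicator_def)
    qed
    also have "\<dots> = ennreal (1 / c)" using nn_integral_exp_tail[OF c, of 0] by simp
    finally show "(\<integral>\<^sup>+y. ennreal (exp y ^ DIM('a)) * ennreal (indicator punct_ball (exp y *\<^sub>R x) *\<^sub>R (norm (da (exp y *\<^sub>R x)))\<^sup>2) \<partial>lborel)
       = ennreal (1 / (real DIM('a) - 2)) * ennreal ((norm (da x))\<^sup>2)" by (simp add: c_def)
  qed
  also have "\<dots> = ennreal (1 / (real DIM('a) - 2)) * ennreal (sph_int (\<lambda>x. (norm (da x))\<^sup>2))"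
    by (subst sph_nn_cmult, measurable) (simp add: sph_nn_sph_int[OF _ _ M])
  finally show ?thesis .
qed

text \<open>A test function on the punctured ball vanishes near the origin, so its products with
  \<open>a\<close> and \<open>da\<close> are continuous on the whole space with compact support. The
  derivative of \<open>a * \<phi>\<close> therefore has integral 0, which is the weak identity. The
  value of \<open>F\<close> at the origin is left open because \<open>hext\<close> is arbitrary
  there.\<close>

lemma weak_gradient:
  assumes N: "DIM('a) \<ge> 3" and F: "\<And>z. z \<noteq> 0 \<Longrightarrow> F z = a z"
  shows "weak_grad_L2 punct_ball F da"
  unfolding weak_grad_L2_def
proof (intro conjI allI impI ballI)
  have U [measurable]: "punct_ball \<in> sets (borel :: 'a measure)" unfolding punct_ball_def by simp
  have UF: "indicator punct_ball x *\<^sub>R F x = indicator punct_ball x *\<^sub>R a x" for x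
    using F by (cases "x = 0") (auto simp: punct_ball_def indicator_def)
  obtain a0 a1 where a: "a0 > 0" "\<And>z. z \<noteq> 0 \<Longrightarrow> a0 \<le> a z" "\<And>z. z \<noteq> 0 \<Longrightarrow> a z \<le> a1" using bounds by metis
  show "set_borel_measurable lborel punct_ball F"
    unfolding set_borel_measurable_def UF by measurable
  show "set_borel_measurable lborel punct_ball da"
    unfolding set_borel_measurable_def by measurable
  have UF2: "indicator punct_ball x *\<^sub>R (F x)\<^sup>2 = indicator punct_ball x *\<^sub>R (a x)\<^sup>2" for x
    using F by (cases "x = 0") (auto simp: punct_ball_def indicator_def)
  show "set_integrable lborel punct_ball (\<lambda>x. (F x)\<^sup>2)"
    unfolding set_integrable_def UF2
  proof (rule Bochner_Integration.integrable_bound)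
    have "emeasure lborel (punct_ball :: 'a set) \<le> emeasure lborel (ball (0::'a) 1)"
      by (rule emeasure_mono) (auto simp: punct_ball_def)
    also have "\<dots> < top" using emeasure_lborel_ball_finite by (simp add: less_top)
    finally show "integrable lborel (\<lambda>x. a1\<^sup>2 * indicat_real (punct_ball :: 'a set) x)"
      by (intro integrable_const_indicator) simp_all
    show "AE x in lborel. norm (indicator punct_ball x *\<^sub>R (a x)\<^sup>2) \<le> norm (a1\<^sup>2 * indicat_real punct_ball x)"
    proof (rule AE_I2)
      fix x
      have "(a x)\<^sup>2 \<le> a1\<^sup>2" if "x \<noteq> 0" using a(3)[OF that] pos[OF that] by (intro power_mono) auto
      then show "norm (indicator punct_ball x *\<^sub>R (a x)\<^sup>2) \<le> norm (a1\<^sup>2 * indicat_real punct_ball x)"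
        by (auto simp: punct_ball_def indicator_def)
    qed
  qed measurable
  show "set_integrable lborel punct_ball (\<lambda>x. (norm (da x))\<^sup>2)"
    unfolding set_integrable_def
  proof (rule integrableI_bounded)
    show "(\<integral>\<^sup>+x. ennreal (norm (indicator punct_ball x *\<^sub>R (norm (da x))\<^sup>2)) \<partial>lborel) < \<infinity>"
      using dirichlet_nn[OF N] by (simp add: ennreal_mult_less_top)
  qed measurable
  fix \<phi> :: "'a \<Rightarrow> real" and i :: 'a
  assume \<phi>: "test_fun \<phi> punct_ball" and i: "i \<in> Basis"
  let ?S = "closure {x. \<phi> x \<noteq> 0}"
  define d where "d z = frechet_derivative \<phi> (at z) i" for z
  have "Ck_on 1 \<phi> UNIV" using \<phi> by (simp add: test_fun_def smooth_on_def del: Ck_on.simps)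
  then have \<phi>c: "continuous_on UNIV \<phi>" and \<phi>d: "\<And>x. \<phi> differentiable (at x)" and dc: "continuous_on UNIV d"
    by (auto simp: d_def)
  have S: "?S \<subseteq> punct_ball" using \<phi> by (simp add: test_fun_def)
  have out: "\<phi> z = 0" "d z = 0" if "z \<notin> ?S" for z
  proof -
    show "\<phi> z = 0" using that closure_subset[of "{x. \<phi> x \<noteq> 0}"] by auto
    have "(\<phi> has_derivative (\<lambda>_. 0)) (at z)"
      by (rule has_derivative_transform_within_open[where f = "\<lambda>_. 0" and s = "- ?S"])
        (use that closure_subset[of "{x. \<phi> x \<noteq> 0}"] in auto)
    from frechet_derivative_at[OF this] show "d z = 0" by (simp add: d_def fun_eq_iff)
  qed
  have far: "\<phi> z = 0" "d z = 0" if "norm z \<ge> 1" for z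
  proof -
    have "z \<notin> punct_ball" using that by (simp add: punct_ball_def)
    then show "\<phi> z = 0" "d z = 0" using S out by blast+
  qed
  have "0 \<in> - ?S" using S by (auto simp: punct_ball_def)
  then obtain \<delta> where \<delta>: "\<delta> > 0" "ball 0 \<delta> \<subseteq> - ?S" using openE[of "- ?S" 0] by auto
  have near: "\<phi> z = 0" "d z = 0" if "norm z < \<delta>" for z
  proof -
    have "z \<in> ball 0 \<delta>" using that by simp
    then have "z \<notin> ?S" using \<delta>(2) by blast
    then show "\<phi> z = 0" "d z = 0" by (rule out)+
  qed
  have glue: "continuous_on UNIV f" if c: "continuous_on (- {0}) f" and z: "\<And>z. norm z < \<delta> \<Longrightarrow> f z = 0" for f :: "'a \<Rightarrow> real"
  proof -
    have "continuous_on (ball 0 \<delta>) f"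
      by (rule continuous_on_eq[of _ "\<lambda>_. 0"]) (auto simp: z)
    then have "continuous_on (- {0} \<union> ball 0 \<delta>) f" using c by (intro continuous_on_open_Un) auto
    moreover have "- {0} \<union> ball 0 \<delta> = (UNIV :: 'a set)" using \<delta> by auto
    ultimately show ?thesis by simp
  qed
  have c1: "continuous_on UNIV (\<lambda>z. a z * d z)" and c2: "continuous_on UNIV (\<lambda>z. (da z \<bullet> i) * \<phi> z)"
    and c3: "continuous_on UNIV (\<lambda>z. a z * \<phi> z)"
    by (rule glue; auto intro!: continuous_intros a_continuous cont continuous_on_subset[OF dc] continuous_on_subset[OF \<phi>c] simp: near)+
  have c4: "continuous_on UNIV (\<lambda>z. a z * d z + (da z \<bullet> i) * \<phi> z)" by (intro continuous_intros c1 c2)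
  have "(LINT z|lborel. a z * d z + (da z \<bullet> i) * \<phi> z) = 0"
  proof (rule integral_directional_derivative_eq_0[where v = i, OF _ c3 c4])
    fix z
    show "((\<lambda>t. a (z + t *\<^sub>R i) * \<phi> (z + t *\<^sub>R i)) has_real_derivative a z * d z + (da z \<bullet> i) * \<phi> z) (at 0)"
    proof (cases "z = 0")
      case True
      have "((\<lambda>t. a (z + t *\<^sub>R i) * \<phi> (z + t *\<^sub>R i)) has_real_derivative 0) (at 0)"
        by (rule has_field_derivative_transform_within_open[where f = "\<lambda>_. 0" and S = "ball 0 \<delta>"])
          (use True i near \<delta> in auto)
      then show ?thesis using True near[of 0] \<delta> by simp
    next
      case False
      have l: "((\<lambda>t. z + t *\<^sub>R i) has_derivative (\<lambda>t. t *\<^sub>R i)) (at 0)" by (auto intro!: derivative_eq_intros)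
      have A: "((\<lambda>t. a (z + t *\<^sub>R i)) has_derivative (\<lambda>t. da z \<bullet> (t *\<^sub>R i))) (at 0)"
        by (rule has_derivative_compose[OF l, of a]) (use der[OF False] in simp)
      have "(\<phi> has_derivative frechet_derivative \<phi> (at z)) (at z)" using \<phi>d by (simp add: frechet_derivative_works[symmetric])
      then have P: "((\<lambda>t. \<phi> (z + t *\<^sub>R i)) has_derivative (\<lambda>t. frechet_derivative \<phi> (at z) (t *\<^sub>R i))) (at 0)"
        by (intro has_derivative_compose[OF l, of \<phi>]) simp
      have "linear (frechet_derivative \<phi> (at z))"
        using \<open>(\<phi> has_derivative frechet_derivative \<phi> (at z)) (at z)\<close> by (rule has_derivative_linear)
      then have lin: "frechet_derivative \<phi> (at z) (t *\<^sub>R i) = t * d z" for t by (simp add: linear_cmul d_def)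
      have "((\<lambda>t. a (z + t *\<^sub>R i) * \<phi> (z + t *\<^sub>R i)) has_derivative
         (\<lambda>t. a (z + 0 *\<^sub>R i) * frechet_derivative \<phi> (at z) (t *\<^sub>R i) + (da z \<bullet> (t *\<^sub>R i)) * \<phi> (z + 0 *\<^sub>R i))) (at 0)"
        by (rule has_derivative_mult[OF A P])
      then show ?thesis unfolding has_field_derivative_def
        by (rule has_derivative_eq_rhs) (auto simp: lin fun_eq_iff algebra_simps)
    qed
  qed (use far in auto)
  moreover have "integrable lborel (\<lambda>z. a z * d z)" "integrable lborel (\<lambda>z. (da z \<bullet> i) * \<phi> z)"
    by (rule integrable_continuous_compact_support[OF c1, of 1] integrable_continuous_compact_support[OF c2, of 1]; simp add: far)+
  ultimately have "(LINT z|lborel. a z * d z) = - (LINT z|lborel. (da z \<bullet> i) * \<phi> z)" by simp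
  moreover have e1: "indicator punct_ball z *\<^sub>R (F z * d z) = a z * d z" for z
    using out[of z] S F by (cases "z \<in> ?S") (auto simp: punct_ball_def indicator_def)
  moreover have e2: "indicator punct_ball z *\<^sub>R ((da z \<bullet> i) * \<phi> z) = (da z \<bullet> i) * \<phi> z" for z
    using out[of z] S by (cases "z \<in> ?S") (auto simp: punct_ball_def indicator_def)
  ultimately show "(LINT x:punct_ball|lborel. F x * frechet_derivative \<phi> (at x) i) = - (LINT x:punct_ball|lborel. (da x \<bullet> i) * \<phi> x)"
    by (simp only: set_lebesgue_integral_def d_def[symmetric] e1 e2)
qed

text \<open>The field chosen by \<open>SOME\<close> agrees almost everywhere with the classical
  gradient by uniqueness, so the abstract energy equals the classical one.\<close>

lemma sph_W12_dirichlet: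
  assumes N: "DIM('a) \<ge> 3" and w: "\<And>x. norm x = 1 \<Longrightarrow> w x = a x"
  shows "sph_W12 w" "sph_dirichlet w = sph_int (\<lambda>x. (norm (da x))\<^sup>2)"
proof -
  have "hext w z = a z" if "z \<noteq> 0" for z using w[of "z /\<^sub>R norm z"] a_sphere[OF that] that by (simp add: hext_def)
  then have wg: "weak_grad_L2 punct_ball (hext w) da" by (rule weak_gradient[OF N])
  then show "sph_W12 w" by (auto simp: sph_W12_def)
  define G where "G = (SOME G. weak_grad_L2 punct_ball (hext w) G)"
  have G: "weak_grad_L2 punct_ball (hext w) G" unfolding G_def
    by (rule someI[where P = "weak_grad_L2 punct_ball (hext w)", OF wg])
  have o: "open (punct_ball :: 'a set)" by (auto simp: punct_ball_def)
  have "emeasure lborel (punct_ball :: 'a set) \<le> emeasure lborel (ball (0::'a) 1)"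
    by (rule emeasure_mono) (auto simp: punct_ball_def)
  also have "\<dots> < top" using emeasure_lborel_ball_finite by (simp add: less_top)
  finally have ae: "AE x in lborel. x \<in> punct_ball \<longrightarrow> G x = da x" by (rule weak_grad_L2_unique[OF o _ G wg])
  have m: "(\<lambda>x. indicator punct_ball x *\<^sub>R (norm (H x))\<^sup>2) \<in> borel_measurable lborel"
    if "weak_grad_L2 punct_ball (hext w) H" for H
    using that by (auto simp: weak_grad_L2_def set_integrable_def)
  obtain M where M: "\<And>x. norm x = 1 \<Longrightarrow> (norm (da x))\<^sup>2 \<le> M" using bounds by metis
  have s0: "sph_int (\<lambda>x. (norm (da x))\<^sup>2) \<ge> 0" by (rule sph_nn_sph_int(2)[OF _ _ M]) auto
  have "(LINT x:punct_ball|lborel. (norm (G x))\<^sup>2) = (LINT x:punct_ball|lborel. (norm (da x))\<^sup>2)"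
    unfolding set_lebesgue_integral_def
    by (rule integral_cong_AE[OF m[OF G] m[OF wg]]) (use ae in eventually_elim, auto simp: indicator_def)
  also have "\<dots> = enn2real (ennreal (1 / (real DIM('a) - 2)) * ennreal (sph_int (\<lambda>x. (norm (da x))\<^sup>2)))"
    unfolding set_lebesgue_integral_def dirichlet_nn[OF N, symmetric]
    by (rule integral_eq_nn_integral[OF m[OF wg]]) auto
  also have "\<dots> = sph_int (\<lambda>x. (norm (da x))\<^sup>2) / (real DIM('a) - 2)"
    using s0 N by (simp add: ennreal_mult[symmetric])
  finally show "sph_dirichlet w = sph_int (\<lambda>x. (norm (da x))\<^sup>2)"
    using N by (simp add: sph_dirichlet_def G_def[symmetric])
qed

end

section \<open>Weighted Yamabe quotient\<close>

text \<open>At \<open>m = 1/2\<close> and \<open>n = N - 1\<close>, the numbers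
  \<open>N - 5/2\<close> and \<open>N - 3/2\<close> are \<open>m + n - 2\<close> and
  \<open>m + n - 1\<close>, and \<open>(N - 1) * (N - 2)\<close> is the scalar curvature of the
  sphere.\<close>

definition yamabe_energy :: "('a::euclidean_space \<Rightarrow> real) \<Rightarrow> ('a \<Rightarrow> 'a) \<Rightarrow> real" where
  "yamabe_energy W dW = sph_int (\<lambda>x. (norm (dW x))\<^sup>2)
     + (real DIM('a) - 5/2) / (4 * (real DIM('a) - 3/2)) * ((real DIM('a) - 1) * (real DIM('a) - 2)) * sph_int (\<lambda>x. (W x)\<^sup>2)"

text \<open>The exponents are \<open>2 * m / n\<close> and \<open>(2 * m + n - 2) / n\<close> at
  \<open>m = 1/2\<close>, \<open>n = N - 1\<close>.\<close>

definition yamabe_quotient :: "real \<Rightarrow> real \<Rightarrow> real \<Rightarrow> real \<Rightarrow> real" where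
  "yamabe_quotient N E B C = E * B powr (1 / (N - 1)) / C powr ((N - 2) / (N - 1))"

text \<open>The constant left when the lifted energy is minimised over the scale \<open>t\<close>;
  \<open>16 / (2 * N - 5)\<^sup>2\<close> and \<open>4 / (2 * N - 3)\<close> are the weights of the
  two terms in \<open>lift_integrals\<close>.\<close>

definition yamabe_factor :: "real \<Rightarrow> real \<Rightarrow> real" where
  "yamabe_factor N \<kappa> = \<kappa> * N / (N - 1) * ((16 / (2 * N - 5)\<^sup>2) powr (1 - 1 / N) * ((N - 1) * (4 / (2 * N - 3))) powr (1 / N))"

text \<open>The power \<open>(N - 1) / N\<close> gives \<open>C\<close> the Sobolev exponent
  \<open>(N - 2) / N\<close> and makes the exponents of \<open>E\<close> and \<open>B\<close> add up
  to 1, as optimisation over a scale requires.\<close>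

lemma yamabe_quotient_powr:
  assumes "E > 0" "B > 0" "C > 0" "N \<ge> 4"
  shows "yamabe_quotient N E B C powr ((N - 1) / N) = E powr (1 - 1 / N) * B powr (1 / N) / C powr ((N - 2) / N)"
proof -
  have e: "1 / (N - 1) * ((N - 1) / N) = 1 / N" "(N - 2) / (N - 1) * ((N - 1) / N) = (N - 2) / N" "(N - 1) / N = 1 - 1 / N"
  proof -
    have N: "N - 1 \<noteq> 0" "N \<noteq> 0" using assms(4) by auto
    have c: "u / v * (v / w) = u / w" if "v \<noteq> 0" for u v w :: real using that by simp
    show "1 / (N - 1) * ((N - 1) / N) = 1 / N" "(N - 2) / (N - 1) * ((N - 1) / N) = (N - 2) / N"
      by (rule c[OF N(1)])+
    show "(N - 1) / N = 1 - 1 / N" using N(2) by (simp add: diff_divide_distrib)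
  qed
  have "(E * B powr p / C powr q) powr r = E powr r * B powr (p * r) / C powr (q * r)" for p q r
    using assms by (simp add: powr_mult powr_divide powr_powr)
  from this[of "1 / (N - 1)" "(N - 2) / (N - 1)" "(N - 1) / N"] show ?thesis
    unfolding yamabe_quotient_def e(1,2) by (simp only: e(3))
qed

lemma yamabe_quotient_lower:
  fixes S \<kappa> E B C N :: real
  assumes pos: "S > 0" "\<kappa> > 0" "E > 0" "B > 0" "C > 0" and N: "N \<ge> 4"
    and less: "\<And>t. t > 0 \<Longrightarrow> S * (\<kappa> * t powr (1/2 - N) * C) powr ((N - 2) / N)
      < \<kappa> * (16 / (2 * N - 5)\<^sup>2 * t powr (5/2 - N) * E + 4 / (2 * N - 3) * t powr (3/2 - N) * B)"
  shows "S * \<kappa> powr ((N - 2) / N) < yamabe_factor N \<kappa> * yamabe_quotient N E B C powr ((N - 1) / N)"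
proof -
  define \<theta> k1 k2 where "\<theta> = (N - 2) / N" and "k1 = 16 / (2 * N - 5)\<^sup>2" and "k2 = 4 / (2 * N - 3)"
  have k: "k1 > 0" "k2 > 0" using N by (auto simp: k1_def k2_def)
  have F: "yamabe_factor N \<kappa> = \<kappa> * N / (N - 1) * (k1 powr (1 - 1 / N) * ((N - 1) * k2) powr (1 / N))"
    by (simp only: yamabe_factor_def k1_def k2_def)
  \<comment> \<open>With all powers of \<open>t\<close> collected on the right, that side is a
    multiple of \<open>k1 * E * t powr (1 / N) + k2 * B * t powr (1 / N - 1)\<close>. This is its
    minimiser, where the second term is \<open>1 / (N - 1)\<close> of the first.\<close>
  define t where "t = (N - 1) * k2 * B / (k1 * E)"
  have t: "t > 0" using k pos N by (simp add: t_def)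
  have "S * (\<kappa> * t powr (1/2 - N) * C) powr \<theta> < \<kappa> * (k1 * t powr (5/2 - N) * E + k2 * t powr (3/2 - N) * B)"
    using less[OF t] by (simp add: \<theta>_def k1_def k2_def)
  then have "t powr (N - 5/2) * (S * (\<kappa> * t powr (1/2 - N) * C) powr \<theta>)
     < t powr (N - 5/2) * (\<kappa> * (k1 * t powr (5/2 - N) * E + k2 * t powr (3/2 - N) * B))"
    using t by (intro mult_strict_left_mono) auto
  also have "\<dots> = \<kappa> * (k1 * E * (t powr (N - 5/2) * t powr (5/2 - N)) + k2 * B * (t powr (N - 5/2) * t powr (3/2 - N)))"
    by (simp add: algebra_simps)
  also have "t powr (N - 5/2) * t powr (5/2 - N) = 1" using t by (simp add: powr_add[symmetric])
  also have "t powr (N - 5/2) * t powr (3/2 - N) = 1 / t" using t by (simp add: powr_add[symmetric] powr_minus_divide)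
  also have "k1 * E * 1 + k2 * B * (1 / t) = N / (N - 1) * (k1 * E)"
    using N k pos by (simp add: t_def field_simps)
  also have "t powr (N - 5/2) * (S * (\<kappa> * t powr (1/2 - N) * C) powr \<theta>) = S * \<kappa> powr \<theta> * C powr \<theta> * t powr (- (1 / N))"
  proof -
    have "(1/2 - N) * \<theta> + (N - 5/2) = - (1 / N)" using N by (simp add: \<theta>_def field_simps)
    then have "t powr (N - 5/2) * t powr ((1/2 - N) * \<theta>) = t powr (- (1 / N))"
      by (simp add: powr_add[symmetric] add.commute)
    moreover have "(\<kappa> * t powr (1/2 - N) * C) powr \<theta> = \<kappa> powr \<theta> * t powr ((1/2 - N) * \<theta>) * C powr \<theta>"
      using pos t by (simp add: powr_mult powr_powr)
    ultimately show ?thesis by (simp add: mult_ac)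
  qed
  finally have "S * \<kappa> powr \<theta> * (C powr \<theta> * t powr (- (1 / N))) < \<kappa> * (N / (N - 1) * (k1 * E))" by (simp add: mult.assoc)
  then have "S * \<kappa> powr \<theta> < \<kappa> * (N / (N - 1) * (k1 * E)) / (C powr \<theta> * t powr (- (1 / N)))"
  proof -
    have Y: "C powr \<theta> * t powr (- (1 / N)) > 0" using pos t by simp
    assume "S * \<kappa> powr \<theta> * (C powr \<theta> * t powr (- (1 / N))) < \<kappa> * (N / (N - 1) * (k1 * E))"
    then show ?thesis by (simp only: pos_less_divide_eq[OF Y])
  qed
  also have "\<dots> = \<kappa> * N / (N - 1) * (k1 * E * t powr (1 / N)) / C powr \<theta>"
    using t by (simp add: powr_minus_divide)
  also have "k1 * E * t powr (1 / N) = k1 powr (1 - 1 / N) * ((N - 1) * k2) powr (1 / N) * (E powr (1 - 1 / N) * B powr (1 / N))"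
  proof -
    have "t powr (1 / N) = ((N - 1) * k2) powr (1 / N) * B powr (1 / N) / (k1 powr (1 / N) * E powr (1 / N))"
      using N k pos by (simp add: t_def powr_divide powr_mult)
    moreover have "k1 = k1 powr (1 - 1 / N) * k1 powr (1 / N)" "E = E powr (1 - 1 / N) * E powr (1 / N)"
      using k pos by (simp_all add: powr_add[symmetric])
    moreover have "k1 powr (1 / N) > 0" "E powr (1 / N) > 0" using k pos by auto
    moreover have "p * q * (u * v / (x * y)) = p' * u * (q' * v)" if "p = p' * x" "q = q' * y" "x > 0" "y > 0"
      for p q u v x y p' q' :: real
      using that by simp
    ultimately show ?thesis by metis
  qed
  also have "\<kappa> * N / (N - 1) * (k1 powr (1 - 1 / N) * ((N - 1) * k2) powr (1 / N) * (E powr (1 - 1 / N) * B powr (1 / N))) / C powr \<theta>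
     = yamabe_factor N \<kappa> * (E powr (1 - 1 / N) * B powr (1 / N) / C powr \<theta>)"
    by (simp add: F mult_ac)
  finally show ?thesis unfolding yamabe_quotient_powr[OF pos(3-5) N] by (simp add: \<theta>_def)
qed

text \<open>The same optimisation read as the weighted arithmetic-geometric mean inequality with
  weights \<open>1 - 1 / N\<close> and \<open>1 / N\<close>: the value at \<open>t = 1\<close> is
  never below the minimum over \<open>t\<close>, so a single lift is enough.\<close>

lemma yamabe_quotient_upper:
  fixes S \<kappa> E B C N :: real
  assumes pos: "\<kappa> > 0" "E > 0" "B > 0" "C > 0" and N: "N \<ge> 4"
    and le: "\<kappa> * (16 / (2 * N - 5)\<^sup>2 * E + 4 / (2 * N - 3) * B) \<le> S * (\<kappa> * C) powr ((N - 2) / N)"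
  shows "yamabe_factor N \<kappa> * yamabe_quotient N E B C powr ((N - 1) / N) \<le> S * \<kappa> powr ((N - 2) / N)"
proof -
  define \<theta> k1 k2 where "\<theta> = (N - 2) / N" and "k1 = 16 / (2 * N - 5)\<^sup>2" and "k2 = 4 / (2 * N - 3)"
  have k: "k1 > 0" "k2 > 0" using N by (auto simp: k1_def k2_def)
  have F: "yamabe_factor N \<kappa> = \<kappa> * N / (N - 1) * (k1 powr (1 - 1 / N) * ((N - 1) * k2) powr (1 / N))"
    by (simp only: yamabe_factor_def k1_def k2_def)
  have "(k1 * E) powr (1 - 1 / N) * ((N - 1) * k2 * B) powr (1 / N) \<le> (1 - 1 / N) * (k1 * E) + 1 / N * ((N - 1) * k2 * B)"
    using N k pos by (intro Youngs_inequality_0) auto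
  also have "\<dots> = (N - 1) / N * (k1 * E + k2 * B)" using N by (simp add: field_simps)
  finally have "\<kappa> * N / (N - 1) * ((k1 * E) powr (1 - 1 / N) * ((N - 1) * k2 * B) powr (1 / N))
     \<le> \<kappa> * N / (N - 1) * ((N - 1) / N * (k1 * E + k2 * B))"
    using N pos by (intro mult_left_mono) auto
  also have "\<dots> = \<kappa> * (k1 * E + k2 * B)" using N by simp
  also have "\<dots> \<le> S * (\<kappa> * C) powr \<theta>" using le by (simp add: \<theta>_def k1_def k2_def)
  also have "\<dots> = S * \<kappa> powr \<theta> * C powr \<theta>" using pos by (simp add: powr_mult)
  also have "\<kappa> * N / (N - 1) * ((k1 * E) powr (1 - 1 / N) * ((N - 1) * k2 * B) powr (1 / N))
     = yamabe_factor N \<kappa> * (E powr (1 - 1 / N) * B powr (1 / N))"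
    using N k pos by (simp add: F powr_mult mult_ac)
  finally have "yamabe_factor N \<kappa> * (E powr (1 - 1 / N) * B powr (1 / N)) / C powr \<theta> \<le> S * \<kappa> powr \<theta>"
    using pos by (simp add: pos_divide_le_eq)
  then show ?thesis unfolding yamabe_quotient_powr[OF pos(2-4) N] by (simp add: \<theta>_def)
qed

section \<open>Lifting a function on the sphere to the cylinder\<close>

context homogeneous_C1
begin

lemma homogeneous_C1_powr:
  assumes c: "c > 0"
  shows "homogeneous_C1 (\<lambda>z. c * a z powr r) (\<lambda>z. (c * r * a z powr (r - 1)) *\<^sub>R da z)"
proof
  fix z :: 'a
  show "c * a (s *\<^sub>R z) powr r = c * a z powr r" if "s > 0" for s using hom[OF that] by simp
  assume z: "z \<noteq> 0"
  show "c * a z powr r > 0" using pos[OF z] c by simp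
  have "((\<lambda>x. x powr r) has_real_derivative r * a z powr (r - 1)) (at (a z))"
    using pos[OF z] by (rule has_real_derivative_powr)
  then have "((\<lambda>x. c * x powr r) has_real_derivative c * (r * a z powr (r - 1))) (at (a z))"
    by (rule DERIV_cmult)
  from has_derivative_compose[OF der[OF z] this[unfolded has_field_derivative_def]]
  show "((\<lambda>z. c * a z powr r) has_derivative (\<lambda>h. ((c * r * a z powr (r - 1)) *\<^sub>R da z) \<bullet> h)) (at z)"
    by (simp add: mult.assoc)
next
  have "continuous_on (- {0}) (\<lambda>z. a z powr (r - 1))"
    using pos by (intro continuous_on_powr a_continuous continuous_on_const) (metis ComplD less_irrefl singletonI)
  then have "continuous_on (- {0}) (\<lambda>z. c * r * a z powr (r - 1))" by (rule continuous_on_mult_left)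
  then show "continuous_on (- {0}) (\<lambda>z. (c * r * a z powr (r - 1)) *\<^sub>R da z)"
    by (rule continuous_on_scaleR[OF _ cont])
qed

lemma sphere_integral_powr:
  "sph_nn (\<lambda>x. ennreal (a x powr r)) = ennreal (sph_int (\<lambda>x. a x powr r))" "sph_int (\<lambda>x. a x powr r) > 0"
proof -
  obtain a0 a1 M where b: "a0 > 0" "\<And>z. z \<noteq> 0 \<Longrightarrow> a0 \<le> a z" "\<And>z. z \<noteq> 0 \<Longrightarrow> a z \<le> a1" using bounds by metis
  have x0: "x \<noteq> 0" if "norm x = 1" for x :: 'a using that by auto
  have lo: "min (a0 powr r) (a1 powr r) \<le> a x powr r" and up: "a x powr r \<le> max (a0 powr r) (a1 powr r)" if "norm x = 1" for x
  proof -
    have "a0 \<le> a x" "a x \<le> a1" "a0 > 0" using b x0[OF that] by auto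
    moreover from this have "r \<ge> 0 \<Longrightarrow> a0 powr r \<le> a x powr r \<and> a x powr r \<le> a1 powr r"
      by (intro conjI powr_mono2) auto
    moreover from calculation have "r \<le> 0 \<Longrightarrow> a1 powr r \<le> a x powr r \<and> a x powr r \<le> a0 powr r"
      by (intro conjI powr_mono2') auto
    ultimately show "min (a0 powr r) (a1 powr r) \<le> a x powr r" "a x powr r \<le> max (a0 powr r) (a1 powr r)"
      by (cases "r \<ge> 0"; force)+
  qed
  obtain x1 :: 'a where "x1 \<noteq> 0" by (metis nonzero_Basis SOME_Basis)
  then have "a1 > 0" using b(1) b(2)[of x1] b(3)[of x1] by linarith
  then have p: "min (a0 powr r) (a1 powr r) > 0" using b(1) by simp
  show "sph_nn (\<lambda>x. ennreal (a x powr r)) = ennreal (sph_int (\<lambda>x. a x powr r))"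
    by (rule sph_nn_sph_int[OF _ _ up]) auto
  show "sph_int (\<lambda>x. a x powr r) > 0" by (rule sph_int_pos[OF _ p lo up]) auto
qed

lemma sphere_integral_gradient:
  "sph_nn (\<lambda>x. ennreal ((norm (da x))\<^sup>2)) = ennreal (sph_int (\<lambda>x. (norm (da x))\<^sup>2))" "sph_int (\<lambda>x. (norm (da x))\<^sup>2) \<ge> 0"
proof -
  obtain M where M: "\<And>x. norm x = 1 \<Longrightarrow> (norm (da x))\<^sup>2 \<le> M" using bounds by metis
  show "sph_nn (\<lambda>x. ennreal ((norm (da x))\<^sup>2)) = ennreal (sph_int (\<lambda>x. (norm (da x))\<^sup>2))"
    "sph_int (\<lambda>x. (norm (da x))\<^sup>2) \<ge> 0"
    by (rule sph_nn_sph_int[OF _ _ M]; simp)+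
qed

lemma sphere_integral_square: "sph_int (\<lambda>x. (a x)\<^sup>2) = sph_int (\<lambda>x. a x powr 2)"
proof (rule sph_int_cong)
  fix x :: 'a assume "norm x = 1"
  then have "a x > 0" by (intro pos) auto
  then show "(a x)\<^sup>2 = a x powr 2" by simp
qed simp

lemma yamabe_energy_pos:
  assumes "DIM('a) \<ge> 4"
  shows "yamabe_energy a da > 0"
proof -
  have N: "real DIM('a) \<ge> 4" using assms by simp
  have "(real DIM('a) - 5/2) / (4 * (real DIM('a) - 3/2)) * ((real DIM('a) - 1) * (real DIM('a) - 2)) > 0"
    using N by (intro mult_pos_pos divide_pos_pos) auto
  then have "(real DIM('a) - 5/2) / (4 * (real DIM('a) - 3/2)) * ((real DIM('a) - 1) * (real DIM('a) - 2)) * sph_int (\<lambda>x. (a x)\<^sup>2) > 0"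
    unfolding sphere_integral_square using sphere_integral_powr(2)[of 2] by (rule mult_pos_pos)
  then show ?thesis unfolding yamabe_energy_def using sphere_integral_gradient(2) by linarith
qed

lemma sph_Q_eq:
  assumes N: "DIM('a) \<ge> 4" and w: "\<And>x. norm x = 1 \<Longrightarrow> w x = a x"
  defines "N' \<equiv> real DIM('a)"
  shows "sph_Q (1/2) w = yamabe_quotient N' (yamabe_energy a da)
     (sph_int (\<lambda>x. a x powr (2 * (N' - 3/2) / (N' - 5/2)))) (sph_int (\<lambda>x. a x powr (2 * (N' - 1/2) / (N' - 5/2))))"
proof -
  have N': "N' \<ge> 4" using N by (simp add: N'_def)
  have d: "sph_dirichlet w = sph_int (\<lambda>x. (norm (da x))\<^sup>2)" by (rule sph_W12_dirichlet) (use N w in auto)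
  have ap: "a x > 0" if "norm x = 1" for x using that by (intro pos) auto
  have i1: "sph_int (\<lambda>x. (w x)\<^sup>2) = sph_int (\<lambda>x. (a x)\<^sup>2)" by (rule sph_int_cong) (auto simp: w)
  have i2: "sph_int (\<lambda>x. \<bar>w x\<bar> powr r * 1 powr (-1)) = sph_int (\<lambda>x. a x powr r)" for r
    by (rule sph_int_cong) (auto simp: w ap less_imp_le)
  have i3: "sph_int (\<lambda>x. \<bar>w x\<bar> powr r) = sph_int (\<lambda>x. a x powr r)" for r
    by (rule sph_int_cong) (auto simp: w ap less_imp_le)
  have e: "1/2 + (N' - 1) - 2 = N' - 5/2" "1/2 + (N' - 1) - 1 = N' - 3/2" "1/2 + (N' - 1) = N' - 1/2"
    "2 * (1/2) / (N' - 1) = 1 / (N' - 1)" "2 * (1/2) + (N' - 1) - 2 = N' - 2" by simp_all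
  show ?thesis
    unfolding sph_Q_def Let_def i1 i2 i3 d N'_def[symmetric] round_scal_def yamabe_quotient_def yamabe_energy_def e(1,2,4,5)
    unfolding e(3) ..
qed

text \<open>The exponent \<open>\<beta> = - 2 / (m + n - 2)\<close> is chosen so that, after
  \<open>y\<close> is integrated out, the remaining powers of \<open>\<alpha>\<close> become those
  in the quotient: \<open>\<beta> * (5/2 - N') = 2\<close> yields the square, and the other two
  yield its critical exponents. In the gradient term all powers of \<open>a\<close> cancel.\<close>

lemma lift_integrals:
  assumes N: "DIM('a) \<ge> 4" and t: "t > 0"
  defines "N' \<equiv> real DIM('a)" and "\<kappa> \<equiv> kap0 DIM('a)"
  defines "\<beta> \<equiv> - (2 / (N' - 5/2))"
  defines "\<alpha> \<equiv> \<lambda>z. t * a z powr \<beta>" and "d\<alpha> \<equiv> \<lambda>z. (t * \<beta> * a z powr (\<beta> - 1)) *\<^sub>R da z"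
  shows "sph_nn (\<lambda>x. \<integral>\<^sup>+y. ennreal (1 / (\<alpha> x + y\<^sup>2) ^ DIM('a)) \<partial>lborel)
      = ennreal (\<kappa> * t powr (1/2 - N') * sph_int (\<lambda>x. a x powr (2 * (N' - 1/2) / (N' - 5/2))))"
    and "sph_nn (\<lambda>x. \<integral>\<^sup>+y. ennreal (((\<alpha> x + y\<^sup>2)\<^sup>2 + 4 * y\<^sup>2 + (norm (d\<alpha> x))\<^sup>2) / (\<alpha> x + y\<^sup>2) ^ DIM('a)) \<partial>lborel)
      = ennreal (\<kappa> * (16 / (2 * N' - 5)\<^sup>2 * t powr (5/2 - N') * yamabe_energy a da
          + 4 / (2 * N' - 3) * t powr (3/2 - N') * sph_int (\<lambda>x. a x powr (2 * (N' - 3/2) / (N' - 5/2)))))"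
proof -
  have N': "N' \<ge> 4" using N by (simp add: N'_def)
  have N5: "2 * N' - 5 > 0" "N' - 5/2 > 0" using N' by auto
  have \<kappa>: "\<kappa> > 0" unfolding \<kappa>_def by (rule cylinder_fibre_integrals(1)[of 1 0]) (use N in auto)
  have ap: "a x > 0" if "norm x = 1" for x using that by (intro pos) auto
  have \<alpha>p: "\<alpha> x > 0" if "norm x = 1" for x using ap[OF that] t by (simp add: \<alpha>_def)
  have \<beta>: "\<beta> * (1/2 - N') = 2 * (N' - 1/2) / (N' - 5/2)" "\<beta> * (3/2 - N') = 2 * (N' - 3/2) / (N' - 5/2)"
    "\<beta> * (5/2 - N') = 2" "\<beta>\<^sup>2 = 16 / (2 * N' - 5)\<^sup>2"
    using N5 by (simp_all add: \<beta>_def field_simps power2_eq_square)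
  have ex: "\<alpha> x powr s = t powr s * a x powr (\<beta> * s)" if "norm x = 1" for x s
    using ap[OF that] t by (simp add: \<alpha>_def powr_mult powr_powr)
  let ?c = "\<lambda>r. sph_int (\<lambda>x. a x powr r)"
  have "sph_nn (\<lambda>x. \<integral>\<^sup>+y. ennreal (1 / (\<alpha> x + y\<^sup>2) ^ DIM('a)) \<partial>lborel)
      = sph_nn (\<lambda>x. ennreal (\<kappa> * t powr (1/2 - N')) * ennreal (a x powr (2 * (N' - 1/2) / (N' - 5/2))))"
  proof (rule sph_nn_cong)
    fix x :: 'a assume x: "norm x = 1"
    have "(\<integral>\<^sup>+y. ennreal (1 / (\<alpha> x + y\<^sup>2) ^ DIM('a)) \<partial>lborel) = ennreal (\<kappa> * \<alpha> x powr (1/2 - N'))"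
      unfolding \<kappa>_def N'_def by (rule cylinder_fibre_integrals(2)[OF \<alpha>p[OF x] order_refl N])
    also have "\<kappa> * \<alpha> x powr (1/2 - N') = \<kappa> * t powr (1/2 - N') * a x powr (2 * (N' - 1/2) / (N' - 5/2))"
      by (simp only: ex[OF x] \<beta> mult.assoc)
    finally show "(\<integral>\<^sup>+y. ennreal (1 / (\<alpha> x + y\<^sup>2) ^ DIM('a)) \<partial>lborel)
      = ennreal (\<kappa> * t powr (1/2 - N')) * ennreal (a x powr (2 * (N' - 1/2) / (N' - 5/2)))"
      using \<kappa> by (simp add: ennreal_mult)
  qed
  also have "\<dots> = ennreal (\<kappa> * t powr (1/2 - N')) * ennreal (?c (2 * (N' - 1/2) / (N' - 5/2)))"
    by (subst sph_nn_cmult, measurable) (simp only: sphere_integral_powr(1))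
  finally show "sph_nn (\<lambda>x. \<integral>\<^sup>+y. ennreal (1 / (\<alpha> x + y\<^sup>2) ^ DIM('a)) \<partial>lborel)
      = ennreal (\<kappa> * t powr (1/2 - N') * ?c (2 * (N' - 1/2) / (N' - 5/2)))"
    using \<kappa> sphere_integral_powr(2) by (simp add: ennreal_mult less_imp_le)
  define u1 u2 u3 where "u1 = \<kappa> * (4 * (N' - 1) * (N' - 2) / ((2 * N' - 3) * (2 * N' - 5)) * t powr (5/2 - N'))"
    and "u2 = \<kappa> * (16 / (2 * N' - 5)\<^sup>2 * t powr (5/2 - N'))" and "u3 = \<kappa> * (4 / (2 * N' - 3) * t powr (3/2 - N'))"
  have u: "u1 \<ge> 0" "u2 \<ge> 0" "u3 \<ge> 0"
    using \<kappa> N' by (auto simp: u1_def u2_def u3_def intro!: mult_nonneg_nonneg divide_nonneg_nonneg)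
  have "sph_nn (\<lambda>x. \<integral>\<^sup>+y. ennreal (((\<alpha> x + y\<^sup>2)\<^sup>2 + 4 * y\<^sup>2 + (norm (d\<alpha> x))\<^sup>2) / (\<alpha> x + y\<^sup>2) ^ DIM('a)) \<partial>lborel)
     = sph_nn (\<lambda>x. ennreal u1 * ennreal (a x powr 2) + (ennreal u2 * ennreal ((norm (da x))\<^sup>2)
         + ennreal u3 * ennreal (a x powr (2 * (N' - 3/2) / (N' - 5/2)))))"
  proof (rule sph_nn_cong)
    fix x :: 'a assume x: "norm x = 1"
    have "(norm (d\<alpha> x))\<^sup>2 * \<alpha> x powr (1/2 - N') = 16 / (2 * N' - 5)\<^sup>2 * t powr (5/2 - N') * (norm (da x))\<^sup>2"
    proof -
      have "(a x powr (\<beta> - 1))\<^sup>2 * a x powr (\<beta> * (1/2 - N')) = a x powr ((\<beta> - 1) + (\<beta> - 1) + \<beta> * (1/2 - N'))"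
        by (simp only: power2_eq_square powr_add)
      also have "(\<beta> - 1) + (\<beta> - 1) + \<beta> * (1/2 - N') = \<beta> * (5/2 - N') - 2" by (simp add: algebra_simps)
      also have "\<dots> = 0" using \<beta>(3) by simp
      finally have A: "(a x powr (\<beta> - 1))\<^sup>2 * a x powr (\<beta> * (1/2 - N')) = 1" using ap[OF x] by simp
      have T: "t\<^sup>2 * t powr (1/2 - N') = t powr (5/2 - N')"
      proof -
        have "t\<^sup>2 * t powr (1/2 - N') = t powr 2 * t powr (1/2 - N')" using t by simp
        also have "\<dots> = t powr (2 + (1/2 - N'))" by (rule powr_add[symmetric])
        also have "2 + (1/2 - N') = 5/2 - N'" by simp
        finally show ?thesis .
      qed
      have "(norm (d\<alpha> x))\<^sup>2 = t\<^sup>2 * \<beta>\<^sup>2 * (a x powr (\<beta> - 1))\<^sup>2 * (norm (da x))\<^sup>2"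
        by (simp add: d\<alpha>_def power_mult_distrib)
      then have "(norm (d\<alpha> x))\<^sup>2 * \<alpha> x powr (1/2 - N') = \<beta>\<^sup>2 * (t\<^sup>2 * t powr (1/2 - N')) * ((a x powr (\<beta> - 1))\<^sup>2 * a x powr (\<beta> * (1/2 - N'))) * (norm (da x))\<^sup>2"
        by (simp only: ex[OF x] mult_ac)
      then show ?thesis by (simp only: A T \<beta>(4) mult_1_right)
    qed
    moreover have "\<alpha> x powr (5/2 - N') = t powr (5/2 - N') * a x powr 2" "\<alpha> x powr (3/2 - N') = t powr (3/2 - N') * a x powr (2 * (N' - 3/2) / (N' - 5/2))"
      by (simp_all only: ex[OF x] \<beta>)
    moreover have "(\<integral>\<^sup>+y. ennreal (((\<alpha> x + y\<^sup>2)\<^sup>2 + 4 * y\<^sup>2 + (norm (d\<alpha> x))\<^sup>2) / (\<alpha> x + y\<^sup>2) ^ DIM('a)) \<partial>lborel)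
       = ennreal (\<kappa> * (4 * (N' - 1) * (N' - 2) / ((2 * N' - 3) * (2 * N' - 5)) * \<alpha> x powr (5/2 - N')
          + (norm (d\<alpha> x))\<^sup>2 * \<alpha> x powr (1/2 - N') + 4 / (2 * N' - 3) * \<alpha> x powr (3/2 - N')))"
      unfolding \<kappa>_def N'_def by (rule cylinder_fibre_integrals(3)[OF \<alpha>p[OF x] _ N]) simp
    ultimately have "(\<integral>\<^sup>+y. ennreal (((\<alpha> x + y\<^sup>2)\<^sup>2 + 4 * y\<^sup>2 + (norm (d\<alpha> x))\<^sup>2) / (\<alpha> x + y\<^sup>2) ^ DIM('a)) \<partial>lborel)
      = ennreal (u1 * a x powr 2 + (u2 * (norm (da x))\<^sup>2 + u3 * a x powr (2 * (N' - 3/2) / (N' - 5/2))))"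
    proof -
      have alg: "k * (c0 * (p * v) + c2 * p * g + c1 * (q * w)) = k * (c0 * p) * v + (k * (c2 * p) * g + k * (c1 * q) * w)"
        for k c0 p v c2 g c1 q w :: real by (simp add: algebra_simps)
      assume P: "(norm (d\<alpha> x))\<^sup>2 * \<alpha> x powr (1/2 - N') = 16 / (2 * N' - 5)\<^sup>2 * t powr (5/2 - N') * (norm (da x))\<^sup>2"
        and Q: "\<alpha> x powr (5/2 - N') = t powr (5/2 - N') * a x powr 2" "\<alpha> x powr (3/2 - N') = t powr (3/2 - N') * a x powr (2 * (N' - 3/2) / (N' - 5/2))"
        and R: "(\<integral>\<^sup>+y. ennreal (((\<alpha> x + y\<^sup>2)\<^sup>2 + 4 * y\<^sup>2 + (norm (d\<alpha> x))\<^sup>2) / (\<alpha> x + y\<^sup>2) ^ DIM('a)) \<partial>lborel)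
       = ennreal (\<kappa> * (4 * (N' - 1) * (N' - 2) / ((2 * N' - 3) * (2 * N' - 5)) * \<alpha> x powr (5/2 - N')
          + (norm (d\<alpha> x))\<^sup>2 * \<alpha> x powr (1/2 - N') + 4 / (2 * N' - 3) * \<alpha> x powr (3/2 - N')))"
      show ?thesis unfolding R P Q u1_def u2_def u3_def alg ..
    qed
    then show "(\<integral>\<^sup>+y. ennreal (((\<alpha> x + y\<^sup>2)\<^sup>2 + 4 * y\<^sup>2 + (norm (d\<alpha> x))\<^sup>2) / (\<alpha> x + y\<^sup>2) ^ DIM('a)) \<partial>lborel)
      = ennreal u1 * ennreal (a x powr 2) + (ennreal u2 * ennreal ((norm (da x))\<^sup>2)
         + ennreal u3 * ennreal (a x powr (2 * (N' - 3/2) / (N' - 5/2))))"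
      using u by (simp add: ennreal_mult)
  qed
  also have "\<dots> = ennreal u1 * ennreal (?c 2) + (ennreal u2 * ennreal (sph_int (\<lambda>x. (norm (da x))\<^sup>2))
       + ennreal u3 * ennreal (?c (2 * (N' - 3/2) / (N' - 5/2))))"
    by (subst sph_nn_add, measurable, subst sph_nn_add, measurable, (subst sph_nn_cmult, measurable)+)
      (simp only: sphere_integral_powr(1) sphere_integral_gradient(1))
  also have "\<dots> = ennreal (u1 * ?c 2 + (u2 * sph_int (\<lambda>x. (norm (da x))\<^sup>2) + u3 * ?c (2 * (N' - 3/2) / (N' - 5/2))))"
    using u sphere_integral_powr(2) sphere_integral_gradient(2) by (simp add: ennreal_mult less_imp_le)
  also have "u1 * ?c 2 + (u2 * sph_int (\<lambda>x. (norm (da x))\<^sup>2) + u3 * ?c (2 * (N' - 3/2) / (N' - 5/2)))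
     = \<kappa> * (16 / (2 * N' - 5)\<^sup>2 * t powr (5/2 - N') * yamabe_energy a da + 4 / (2 * N' - 3) * t powr (3/2 - N') * ?c (2 * (N' - 3/2) / (N' - 5/2)))"
  proof -
    \<comment> \<open>Relative to the gradient term, the fibre integral produces exactly the
      coefficient of the scalar curvature in the weighted conformal Laplacian; this is where the
      energy of the quotient appears.\<close>
    have "4 * (N' - 1) * (N' - 2) / ((2 * N' - 3) * (2 * N' - 5))
       = 16 / (2 * N' - 5)\<^sup>2 * ((N' - 5/2) / (4 * (N' - 3/2)) * ((N' - 1) * (N' - 2)))"
      using N' by (simp add: divide_simps power2_eq_square) (simp add: algebra_simps)
    then have "u1 = u2 * ((N' - 5/2) / (4 * (N' - 3/2)) * ((N' - 1) * (N' - 2)))" by (simp add: u1_def u2_def)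
    moreover have "k * (c * p) * A * s + (k * (c * p) * g + k * (c1 * q) * b) = k * (c * p * (g + A * s) + c1 * q * b)"
      for k c p A s g c1 q b :: real by (simp add: algebra_simps)
    ultimately show ?thesis
      unfolding yamabe_energy_def N'_def[symmetric] sphere_integral_square u3_def
      by (simp only: u2_def)
  qed
  finally show "sph_nn (\<lambda>x. \<integral>\<^sup>+y. ennreal (((\<alpha> x + y\<^sup>2)\<^sup>2 + 4 * y\<^sup>2 + (norm (d\<alpha> x))\<^sup>2) / (\<alpha> x + y\<^sup>2) ^ DIM('a)) \<partial>lborel)
      = ennreal (\<kappa> * (16 / (2 * N' - 5)\<^sup>2 * t powr (5/2 - N') * yamabe_energy a da
          + 4 / (2 * N' - 3) * t powr (3/2 - N') * ?c (2 * (N' - 3/2) / (N' - 5/2))))" .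
qed

end

section \<open>Lower and upper comparison of the quotient with the constant\<close>

lemma homogeneous_C1_hext:
  fixes w :: "'a::euclidean_space \<Rightarrow> real"
  assumes "sph_smooth w" and wp: "\<And>x. x \<in> sphere 0 1 \<Longrightarrow> w x > 0"
  shows "homogeneous_C1 (hext w) (\<lambda>z. \<Sum>i\<in>Basis. frechet_derivative (hext w) (at z) i *\<^sub>R i)"
proof
  have "Ck_on (Suc 0) (hext w) (UNIV - {0})"
    using assms(1) unfolding sph_smooth_def smooth_on_def by blast
  then have df: "\<And>z. z \<noteq> 0 \<Longrightarrow> hext w differentiable (at z)"
    and cf: "\<And>v. continuous_on (UNIV - {0}) (\<lambda>z. frechet_derivative (hext w) (at z) v)"
    by auto
  show "continuous_on (- {0}) (\<lambda>z. \<Sum>i\<in>Basis. frechet_derivative (hext w) (at z) i *\<^sub>R i)"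
    using cf by (intro continuous_intros) (simp add: Compl_eq_Diff_UNIV)
  fix z :: 'a
  show "hext w (c *\<^sub>R z) = hext w z" if "c > 0" for c
    using that by (simp add: hext_def divide_simps)
  assume z: "z \<noteq> 0"
  then show "hext w z > 0" unfolding hext_def by (intro wp) simp
  have D: "(hext w has_derivative frechet_derivative (hext w) (at z)) (at z)"
    using df[OF z] by (simp add: frechet_derivative_works)
  have "frechet_derivative (hext w) (at z) h = (\<Sum>i\<in>Basis. frechet_derivative (hext w) (at z) i *\<^sub>R i) \<bullet> h" for h
  proof -
    interpret linear "frechet_derivative (hext w) (at z)"
      using D by (rule has_derivative_linear)
    have "frechet_derivative (hext w) (at z) h = frechet_derivative (hext w) (at z) (\<Sum>i\<in>Basis. (h \<bullet> i) *\<^sub>R i)"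
      by (simp add: euclidean_representation)
    also have "\<dots> = (\<Sum>i\<in>Basis. (h \<bullet> i) * frechet_derivative (hext w) (at z) i)"
      by (simp add: sum scale)
    also have "\<dots> = (\<Sum>i\<in>Basis. frechet_derivative (hext w) (at z) i *\<^sub>R i) \<bullet> h"
      unfolding inner_sum_left by (simp add: inner_commute mult.commute)
    finally show ?thesis .
  qed
  then show "(hext w has_derivative (\<lambda>h. (\<Sum>i\<in>Basis. frechet_derivative (hext w) (at z) i *\<^sub>R i) \<bullet> h)) (at z)"
    using D by (metis (no_types, lifting) ext)
qed

text \<open>Bounds the set under \<open>sph_Lambda\<close> from below, so that its infimum has the
  intended meaning. The bound holds for every \<open>w\<close>, even when \<open>SOME\<close>
  returns an unspecified field or an integral is 0 by convention, because only the signs of the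
  integrands count.\<close>

lemma sph_Q_nonneg:
  fixes w :: "'a::euclidean_space \<Rightarrow> real"
  assumes "DIM('a) \<ge> 4"
  shows "sph_Q (1/2) w \<ge> 0"
proof -
  have N: "real DIM('a) \<ge> 4" using assms by simp
  have si: "sph_int f \<ge> 0" if "\<And>x. f x \<ge> 0" for f :: "'a \<Rightarrow> real"
    unfolding sph_int_def set_lebesgue_integral_def using that
    by (intro mult_nonneg_nonneg integral_nonneg_AE) auto
  have sd: "sph_dirichlet w \<ge> 0"
    unfolding sph_dirichlet_def Let_def set_lebesgue_integral_def using N
    by (intro mult_nonneg_nonneg integral_nonneg_AE) auto
  have "(1/2 + (real DIM('a) - 1) - 2) / (4 * (1/2 + (real DIM('a) - 1) - 1)) * round_scal TYPE('a) \<ge> 0"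
    unfolding round_scal_def using N by (intro mult_nonneg_nonneg divide_nonneg_nonneg) auto
  then have "sph_dirichlet w + (1/2 + (real DIM('a) - 1) - 2) / (4 * (1/2 + (real DIM('a) - 1) - 1)) * round_scal TYPE('a)
      * sph_int (\<lambda>x. (w x)\<^sup>2) \<ge> 0"
    using sd si[of "\<lambda>x. (w x)\<^sup>2"] by (intro add_nonneg_nonneg[OF _ mult_nonneg_nonneg]) auto
  then show ?thesis unfolding sph_Q_def Let_def by (intro divide_nonneg_nonneg mult_nonneg_nonneg) auto
qed

context homogeneous_C1
begin

lemma sph_Lambda_admissible:
  "\<not> (AE x in lborel. x \<in> ball 0 1 \<longrightarrow> hext a x = 0)"
proof -
  have "hext a z \<noteq> 0" if "z \<noteq> 0" for z
    using pos[of "z /\<^sub>R norm z"] that by (simp add: hext_def)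
  then have sub: "ball 0 1 - {0} \<subseteq> {z. \<not> (z \<in> ball 0 1 \<longrightarrow> hext a z = 0)}" by auto
  have "\<not> (AE x in lborel. x \<in> ball 0 1 \<longrightarrow> hext a x = 0)"
  proof
    assume "AE x in lborel. x \<in> ball 0 1 \<longrightarrow> hext a x = 0"
    then have "AE x in lborel. x \<notin> ball (0::'a) 1 - {0}"
      by eventually_elim (use sub in blast)
    then have "ball (0::'a) 1 - {0} \<in> null_sets lborel"
      by (subst (asm) AE_iff_null_sets[symmetric]) auto
    then have "negligible (ball (0::'a) 1 - {0})"
      by (simp add: negligible_iff_null_sets null_sets_completionI)
    moreover have "open (ball (0::'a) 1 - {0})" by (simp add: open_Diff)
    moreover have "ball (0::'a) 1 - {0} \<noteq> {}"
    proof -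
      have "(1/2) *\<^sub>R (SOME i. i \<in> Basis) \<in> ball (0::'a) 1 - {0}"
        using nonzero_Basis[OF SOME_Basis] norm_Basis[OF SOME_Basis] by simp
      then show ?thesis by blast
    qed
    ultimately show False using open_not_negligible by blast
  qed
  then show ?thesis .
qed

lemma sph_Lambda_bounds:
  assumes N: "DIM('a) \<ge> 4"
  shows "sph_Lambda (1/2) TYPE('a) \<le> sph_Q (1/2) a" "sph_Lambda (1/2) TYPE('a) \<ge> 0"
proof -
  have "sph_W12 a" by (rule sph_W12_dirichlet) (use N in auto)
  then have m: "sph_Q (1/2) a \<in> {sph_Q (1/2) w | w :: 'a \<Rightarrow> real.
       sph_W12 w \<and> \<not> (AE x in lborel. x \<in> ball 0 1 \<longrightarrow> hext w x = 0)}"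
    using sph_Lambda_admissible by blast
  have nn: "y \<ge> 0" if "y \<in> {sph_Q (1/2) w | w :: 'a \<Rightarrow> real.
       sph_W12 w \<and> \<not> (AE x in lborel. x \<in> ball 0 1 \<longrightarrow> hext w x = 0)}" for y
    using that sph_Q_nonneg[OF N] by blast
  show "sph_Lambda (1/2) TYPE('a) \<le> sph_Q (1/2) a"
    unfolding sph_Lambda_def by (rule cInf_lower[OF m bdd_belowI[OF nn]])
  show "sph_Lambda (1/2) TYPE('a) \<ge> 0"
    unfolding sph_Lambda_def by (rule cInf_greatest[OF _ nn]) (use m in blast)
qed

text \<open>The lift satisfies the strict cylinder inequality at every scale \<open>t\<close>, so in
  particular at the optimal one, which is selected inside
  \<open>yamabe_quotient_lower\<close>.\<close>

lemma sph_Q_strict_lower: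
  assumes N: "DIM('a) \<ge> 4" and w: "\<And>x. norm x = 1 \<Longrightarrow> w x = a x"
  shows "sobolev_const TYPE('a) * kap0 DIM('a) powr ((real DIM('a) - 2) / real DIM('a))
      < yamabe_factor (real DIM('a)) (kap0 DIM('a)) * sph_Q (1/2) w powr ((real DIM('a) - 1) / real DIM('a))"
proof -
  have Q: "sph_Q (1/2) w = yamabe_quotient (real DIM('a)) (yamabe_energy a da)
     (sph_int (\<lambda>x. a x powr (2 * (real DIM('a) - 3/2) / (real DIM('a) - 5/2))))
     (sph_int (\<lambda>x. a x powr (2 * (real DIM('a) - 1/2) / (real DIM('a) - 5/2))))"
    by (rule sph_Q_eq[OF N]) (rule w)
  show ?thesis
    unfolding Q
  proof (rule yamabe_quotient_lower)
    show N': "real DIM('a) \<ge> 4" using N by simp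
    show S: "sobolev_const TYPE('a) > 0" by (rule sobolev_const_pos) (use N in simp)
    show k: "kap0 DIM('a) > 0" by (rule cylinder_fibre_integrals(1)[of 1 0]) (use N in auto)
    show E: "yamabe_energy a da > 0" by (rule yamabe_energy_pos[OF N])
    show "sph_int (\<lambda>x. a x powr (2 * (real DIM('a) - 3/2) / (real DIM('a) - 5/2))) > 0"
      "sph_int (\<lambda>x. a x powr (2 * (real DIM('a) - 1/2) / (real DIM('a) - 5/2))) > 0"
      by (rule sphere_integral_powr(2))+
    fix t :: real assume t: "t > 0"
    interpret L: homogeneous_C1 "\<lambda>z. t * a z powr (- (2 / (real DIM('a) - 5/2)))"
      "\<lambda>z. (t * (- (2 / (real DIM('a) - 5/2))) * a z powr ((- (2 / (real DIM('a) - 5/2))) - 1)) *\<^sub>R da z"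
      by (rule homogeneous_C1_powr[OF t])
    show "sobolev_const TYPE('a) * (kap0 DIM('a) * t powr (1/2 - real DIM('a))
           * sph_int (\<lambda>x. a x powr (2 * (real DIM('a) - 1/2) / (real DIM('a) - 5/2)))) powr ((real DIM('a) - 2) / real DIM('a))
        < kap0 DIM('a) * (16 / (2 * real DIM('a) - 5)\<^sup>2 * t powr (5/2 - real DIM('a)) * yamabe_energy a da
            + 4 / (2 * real DIM('a) - 3) * t powr (3/2 - real DIM('a)) * sph_int (\<lambda>x. a x powr (2 * (real DIM('a) - 3/2) / (real DIM('a) - 5/2))))"
      by (rule L.cylinder_Sobolev_strict[OF N lift_integrals(2)[OF N t] _ lift_integrals(1)[OF N t]];
          intro mult_nonneg_nonneg add_nonneg_nonneg divide_nonneg_nonneg less_imp_le[OF k] less_imp_le[OF E]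
            less_imp_le[OF sphere_integral_powr(2)]) (use N' in auto)
  qed
qed

end

text \<open>A suitable power of a concentrating bubble is a competitor for the infimum whose lift at
  scale 1 is extremal up to \<open>\<epsilon>\<close>; the quotient of this competitor bounds
  \<open>sph_Lambda\<close> from above.\<close>

lemma sph_Q_upper:
  assumes N: "DIM('a::euclidean_space) \<ge> 4" and \<epsilon>: "\<epsilon> > 0"
  shows "yamabe_factor (real DIM('a)) (kap0 DIM('a)) * sph_Lambda (1/2) TYPE('a) powr ((real DIM('a) - 1) / real DIM('a))
      \<le> (sobolev_const TYPE('a) + \<epsilon>) * kap0 DIM('a) powr ((real DIM('a) - 2) / real DIM('a))"
proof -
  define N' where "N' = real DIM('a)"
  define \<beta> where "\<beta> = - (2 / (N' - 5/2))"
  \<comment> \<open>The inverse of \<open>\<beta>\<close>: lifting \<open>W = bub e p powr r\<close>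
    at \<open>t = 1\<close> gives back \<open>bub e p\<close> and, by the chain rule,
    \<open>dbub e p\<close>.\<close>
  define r where "r = - ((N' - 5/2) / 2)"
  have N': "N' \<ge> 4" using N by (simp add: N'_def)
  have r\<beta>: "r * \<beta> = 1" "\<beta> * r = 1" using N' by (simp_all add: r_def \<beta>_def)
  obtain e :: 'a where e: "norm e = 1" using SOME_Basis norm_Basis by blast
  obtain p where p: "0 < p" "p < 1" and conc: "\<And>E X. E \<ge> 0 \<Longrightarrow> X \<ge> 0 \<Longrightarrow>
      sph_nn (\<lambda>x. \<integral>\<^sup>+y. ennreal (((bub e p x + y\<^sup>2)\<^sup>2 + 4 * y\<^sup>2 + (norm (dbub e p x))\<^sup>2) / (bub e p x + y\<^sup>2) ^ DIM('a)) \<partial>lborel) = ennreal E \<Longrightarrow>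
      sph_nn (\<lambda>x. \<integral>\<^sup>+y. ennreal (1 / (bub e p x + y\<^sup>2) ^ DIM('a)) \<partial>lborel) = ennreal X \<Longrightarrow>
      E \<le> (sobolev_const TYPE('a) + \<epsilon>) * X powr ((real DIM('a) - 2) / real DIM('a))"
    using bubble_concentration[OF N e \<epsilon>] by blast
  interpret b: homogeneous_C1 "bub e p" "dbub e p"
    by (rule homogeneous_C1_bub) (use e p in auto)
  define W dW where "W = (\<lambda>z. 1 * bub e p z powr r)" and "dW = (\<lambda>z. (1 * r * bub e p z powr (r - 1)) *\<^sub>R dbub e p z)"
  interpret W: homogeneous_C1 W dW unfolding W_def dW_def by (rule b.homogeneous_C1_powr) simp
  have bp: "bub e p x > 0" if "norm x = 1" for x using that by (intro b.pos) auto
  have al: "1 * W x powr \<beta> = bub e p x" if "norm x = 1" for x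
    using bp[OF that] by (simp add: W_def powr_powr r\<beta>)
  have dal: "(1 * \<beta> * W x powr (\<beta> - 1)) *\<^sub>R dW x = dbub e p x" if x: "norm x = 1" for x
  proof -
    have "W x powr (\<beta> - 1) * bub e p x powr (r - 1) = bub e p x powr (r * (\<beta> - 1) + (r - 1))"
      by (simp only: W_def mult_1 powr_powr powr_add)
    also have "r * (\<beta> - 1) + (r - 1) = 0" using r\<beta> by (simp add: algebra_simps)
    finally have "W x powr (\<beta> - 1) * bub e p x powr (r - 1) = 1" using bp[OF x] by simp
    then have "(\<beta> * r) * (W x powr (\<beta> - 1) * bub e p x powr (r - 1)) = 1" by (simp add: r\<beta>)
    then have "1 * \<beta> * W x powr (\<beta> - 1) * (1 * r * bub e p x powr (r - 1)) = 1" by (simp only: mult_ac mult_1)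
    then show ?thesis by (simp only: dW_def scaleR_scaleR scaleR_one)
  qed
  let ?E = "yamabe_energy W dW"
  let ?B = "sph_int (\<lambda>x. W x powr (2 * (N' - 3/2) / (N' - 5/2)))"
  let ?C = "sph_int (\<lambda>x. W x powr (2 * (N' - 1/2) / (N' - 5/2)))"
  have pos: "kap0 DIM('a) > 0" "?E > 0" "?B > 0" "?C > 0"
    using cylinder_fibre_integrals(1)[of 1 0, OF _ _ N] W.yamabe_energy_pos[OF N] W.sphere_integral_powr(2) by auto
  note L = W.lift_integrals[OF N zero_less_one, folded N'_def, folded \<beta>_def]
  have "kap0 DIM('a) * (16 / (2 * N' - 5)\<^sup>2 * 1 powr (5/2 - N') * ?E + 4 / (2 * N' - 3) * 1 powr (3/2 - N') * ?B)
     \<le> (sobolev_const TYPE('a) + \<epsilon>) * (kap0 DIM('a) * 1 powr (1/2 - N') * ?C) powr ((real DIM('a) - 2) / real DIM('a))"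
  proof (rule conc)
    show "kap0 DIM('a) * (16 / (2 * N' - 5)\<^sup>2 * 1 powr (5/2 - N') * ?E + 4 / (2 * N' - 3) * 1 powr (3/2 - N') * ?B) \<ge> 0"
      "kap0 DIM('a) * 1 powr (1/2 - N') * ?C \<ge> 0"
      using pos N' by (auto intro!: mult_nonneg_nonneg add_nonneg_nonneg)
    show "sph_nn (\<lambda>x. \<integral>\<^sup>+y. ennreal (1 / (bub e p x + y\<^sup>2) ^ DIM('a)) \<partial>lborel) = ennreal (kap0 DIM('a) * 1 powr (1/2 - N') * ?C)"
      unfolding L(1)[symmetric] by (rule sph_nn_cong) (simp only: al)
    show "sph_nn (\<lambda>x. \<integral>\<^sup>+y. ennreal (((bub e p x + y\<^sup>2)\<^sup>2 + 4 * y\<^sup>2 + (norm (dbub e p x))\<^sup>2) / (bub e p x + y\<^sup>2) ^ DIM('a)) \<partial>lborel)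
      = ennreal (kap0 DIM('a) * (16 / (2 * N' - 5)\<^sup>2 * 1 powr (5/2 - N') * ?E + 4 / (2 * N' - 3) * 1 powr (3/2 - N') * ?B))"
      unfolding L(2)[symmetric] by (rule sph_nn_cong) (simp only: al dal)
  qed
  then have "yamabe_factor N' (kap0 DIM('a)) * yamabe_quotient N' ?E ?B ?C powr ((N' - 1) / N')
      \<le> (sobolev_const TYPE('a) + \<epsilon>) * kap0 DIM('a) powr ((N' - 2) / N')"
    by (intro yamabe_quotient_upper[OF pos N']) (simp add: N'_def)
  moreover have "sph_Q (1/2) W = yamabe_quotient N' ?E ?B ?C"
    unfolding N'_def by (rule W.sph_Q_eq[OF N]) simp
  moreover have "yamabe_factor N' (kap0 DIM('a)) \<ge> 0"
    unfolding yamabe_factor_def using N' pos(1) by (intro mult_nonneg_nonneg divide_nonneg_nonneg) auto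
  moreover have "sph_Lambda (1/2) TYPE('a) powr ((N' - 1) / N') \<le> sph_Q (1/2) W powr ((N' - 1) / N')"
    using N' W.sph_Lambda_bounds[OF N] by (intro powr_mono2) auto
  then have "yamabe_factor N' (kap0 DIM('a)) * sph_Lambda (1/2) TYPE('a) powr ((N' - 1) / N')
     \<le> yamabe_factor N' (kap0 DIM('a)) * sph_Q (1/2) W powr ((N' - 1) / N')"
    by (rule mult_left_mono) fact
  ultimately show ?thesis
    unfolding N'_def by (simp only:)
qed

theorem theorem1p4:
  assumes "DIM('a::euclidean_space) \<ge> 4"
  shows "\<not> (\<exists>w :: 'a \<Rightarrow> real. sph_smooth w \<and> (\<forall>x\<in>sphere 0 1. w x > 0) \<and>
              sph_Q (1/2) w = sph_Lambda (1/2) TYPE('a))"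
proof
  assume "\<exists>w :: 'a \<Rightarrow> real. sph_smooth w \<and> (\<forall>x\<in>sphere 0 1. w x > 0) \<and>
              sph_Q (1/2) w = sph_Lambda (1/2) TYPE('a)"
  then obtain w :: "'a \<Rightarrow> real" where w: "sph_smooth w" "\<And>x. x \<in> sphere 0 1 \<Longrightarrow> w x > 0"
    and Q: "sph_Q (1/2) w = sph_Lambda (1/2) TYPE('a)" by blast
  interpret homogeneous_C1 "hext w" "\<lambda>z. \<Sum>i\<in>Basis. frechet_derivative (hext w) (at z) i *\<^sub>R i"
    by (rule homogeneous_C1_hext[OF w])
  have "w x = hext w x" if "norm x = 1" for x using that by (simp add: hext_def)
  note lower = sph_Q_strict_lower[OF assms this, unfolded Q]
  have k: "kap0 DIM('a) powr ((real DIM('a) - 2) / real DIM('a)) > 0"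
    using cylinder_fibre_integrals(1)[of 1 0, OF _ _ assms] by simp
  \<comment> \<open>Dividing by the positive power of \<open>kap0\<close> isolates the Sobolev
    constant, so that \<open>\<epsilon>\<close> can tend to 0. The outcome contradicts the strict
    lower bound for a function whose quotient equals the infimum.\<close>
  have "yamabe_factor (real DIM('a)) (kap0 DIM('a)) * sph_Lambda (1/2) TYPE('a) powr ((real DIM('a) - 1) / real DIM('a))
      / kap0 DIM('a) powr ((real DIM('a) - 2) / real DIM('a)) \<le> sobolev_const TYPE('a)"
    by (rule field_le_epsilon) (simp only: pos_divide_le_eq[OF k] sph_Q_upper[OF assms])
  then show False using lower unfolding pos_divide_le_eq[OF k] by simp
qed

end
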